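(* Let $K$ be an arbitrary field and let $\mathscr{R}^{\Lambda}_{\alpha}$ be a cyclotomic KLR algebra over $K$ of arbitrary type, i.e. attached to an arbitrary symmetrizable Cartan datum, arbitrary polynomials $(Q_{i,j}(u,v))_{i,j\in I}$ as in the context, $\Lambda\in P^+$ and $\alpha\in Q_n^+$. Put $d_{\Lambda,\alpha}:=2(\alpha,\Lambda)-(\alpha,\alpha)$. With $Z^\Lambda(\nu)$, $e(\nu)^{(-)}$ and $\mathcal{R}^\Lambda(\nu)$ as defined in the context: 1) $\bigl(\mathrm{Tr}(\mathscr{R}^\Lambda_\alpha)\bigr)_{d_{\Lambda,\alpha}}$ is the $K$-span of the elements $Z^\Lambda(\nu)+[\mathscr{R}^\Lambda_\alpha,\mathscr{R}^\Lambda_\alpha]$, where $\nu\in I^\alpha$ runs over the piecewise dominant sequences with respect to $\Lambda$; 2) $\bigl(\mathrm{Tr}(\mathscr{R}^\Lambda_\alpha)\bigr)_{0}$ is the $K$-span of the elements $e(\nu)^{(-)}+[\mathscr{R}^\Lambda_\alpha,\mathscr{R}^\Lambda_\alpha]$, where $\nu\in I^\alpha$ runs over the piecewise dominant sequences with respect to $\Lambda$; 3) $\mathrm{Tr}(\mathscr{R}^\Lambda_\alpha)$ is the $K$-span of the elements $a+[\mathscr{R}^\Lambda_\alpha,\mathscr{R}^\Lambda_\alpha]$, where $a\in\mathcal{R}^\Lambda(\nu)$ and $\nu\in I^\alpha$ runs over the piecewise dominant sequences with respect to $\Lambda$.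
   Context: Cartan datum. $I$ is an index set and $A=(a_{ij})_{i,j\in I}$ is a symmetrizable Cartan matrix: an integral matrix with $a_{ii}=2$, $a_{ij}\le 0$ for $i\neq j$, $a_{ij}=0\Leftrightarrow a_{ji}=0$, and there is a diagonal matrix $D=\mathrm{diag}(d_i\in\mathbb{Z}_{>0}\mid i\in I)$ with $DA$ symmetric. $P$ is a free abelian group of finite rank (weight lattice), $P^\vee=\mathrm{Hom}(P,\mathbb{Z})$, $\langle-,-\rangle:P^\vee\times P\to\mathbb{Z}$ is the natural pairing, $\Pi=\{\alpha_i\mid i\in I\}\subset P$ (simple roots) is linearly independent, $\Pi^\vee=\{h_i\mid i\in I\}\subset P^\vee$ (simple coroots), $\langle h_i,\alpha_j\rangle=a_{ij}$, and for each $i\in I$ there is $\Lambda_i\in P$ with $\langle h_j,\Lambda_i\rangle=\delta_{ij}$ for all $j\in I$. $P^+=\{\Lambda\in P\mid\langle h_i,\Lambda\rangle\geq 0\ \forall i\in I\}$, $Q^+=\sum_{i\in I}\mathbb{Z}_{\ge 0}\alpha_i$, and $Q_n^+$ is the set of $\alpha=\sum_i k_i\alpha_i\in Q^+$ with $\sum_i k_i=n$. With $\mathfrak{h}=\mathbb{Q}\otimes_{\mathbb{Z}}P^\vee$, $(-,-)$ is a symmetric bilinear form on $\mathfrak{h}^*$ with $(\alpha_i,\alpha_j)=d_ia_{ij}$ and $\langle h_i,\Lambda\rangle=2(\alpha_i,\Lambda)/(\alpha_i,\alpha_i)$ for $\Lambda\in\mathfrak{h}^*$, $i\in I$. Polynomials.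 $Q_{i,j}(u,v)\in K[u,v]$ $(i,j\in I)$ satisfy $Q_{i,j}(u,v)=Q_{j,i}(v,u)$, $Q_{i,i}=0$, and for $i\neq j$, $Q_{i,j}(u,v)=\sum_{k,q\ge 0}c_{i,j,k,q}u^kv^q$ with $c_{i,j,-a_{ij},0}\in K^\times$ and $c_{i,j,k,q}\neq 0$ only if $2(\alpha_i,\alpha_j)=-(\alpha_i,\alpha_i)k-(\alpha_j,\alpha_j)q$. KLR algebra. For $\alpha\in Q_n^+$ let $I^\alpha=\{\nu=(\nu_1,\dots,\nu_n)\in I^n\mid\sum_j\alpha_{\nu_j}=\alpha\}$; the symmetric group $\mathfrak{S}_n$, with $s_i=(i,i+1)$, acts on it by place permutation. $\mathscr{R}_\alpha$ is the associative $K$-algebra with generators $e(\nu)$ ($\nu\in I^\alpha$), $x_k$ ($1\le k\le n$), $\tau_l$ ($1\le l\le n-1$) and relations: $e(\nu)e(\nu')=\delta_{\nu,\nu'}e(\nu)$; $\sum_\nu e(\nu)=1$; $x_kx_l=x_lx_k$; $x_ke(\nu)=e(\nu)x_k$; $\tau_le(\nu)=e(s_l(\nu))\tau_l$; $\tau_k\tau_l=\tau_l\tau_k$ if $|k-l|>1$; $\tau_k^2e(\nu)=Q_{\nu_k,\nu_{k+1}}(x_k,x_{k+1})e(\nu)$; $(\tau_kx_l-x_{s_k(l)}\tau_k)e(\nu)$ equals $-e(\nu)$ if $l=k$, $\nu_k=\nu_{k+1}$, equals $e(\nu)$ if $l=k+1$, $\nu_k=\nu_{k+1}$, and $0$ otherwise;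 $(\tau_{k+1}\tau_k\tau_{k+1}-\tau_k\tau_{k+1}\tau_k)e(\nu)$ equals $\frac{Q_{\nu_k,\nu_{k+1}}(x_k,x_{k+1})-Q_{\nu_{k+2},\nu_{k+1}}(x_{k+2},x_{k+1})}{x_k-x_{k+2}}e(\nu)$ if $\nu_k=\nu_{k+2}$ and $0$ otherwise. It is $\mathbb{Z}$-graded by $\deg e(\nu)=0$, $\deg x_ke(\nu)=(\alpha_{\nu_k},\alpha_{\nu_k})$, $\deg\tau_le(\nu)=-(\alpha_{\nu_l},\alpha_{\nu_{l+1}})$. Cyclotomic KLR algebra. For $\Lambda\in P^+$, $\mathscr{R}^{\Lambda}_\alpha$ is the quotient of $\mathscr{R}_\alpha$ by the two-sided ideal generated by $\sum_{\nu\in I^\alpha}x_1^{\langle h_{\nu_1},\Lambda\rangle}e(\nu)$; it inherits the $\mathbb{Z}$-grading. $[\mathscr{R}^{\Lambda}_\alpha,\mathscr{R}^{\Lambda}_\alpha]$ is the $K$-span of all commutators $ab-ba$, and the cocenter $\mathrm{Tr}(\mathscr{R}^{\Lambda}_\alpha):=\mathscr{R}^{\Lambda}_\alpha/[\mathscr{R}^{\Lambda}_\alpha,\mathscr{R}^{\Lambda}_\alpha]$ has the induced $\mathbb{Z}$-grading; a subscript $d$ denotes the degree $d$ component. Elements $e_{[u,v]}$. For $1\le u\le v\le n$ put $e_{[u,v]}:=\tau_{w[u,v]}\,x_{u+1}x_{u+2}^2\cdots x_v^{v-u}$ if $u<v$ and $e_{[u,u]}:=1$, where $\tau_{w[u,v]}:=(\tau_u\tau_{u+1}\cdots\tau_{v-1})(\tau_u\tau_{u+1}\cdots\tau_{v-2})\cdots(\tau_u\tau_{u+1})\tau_u$.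 When $\nu_u=\nu_{u+1}=\cdots=\nu_v$, $e_{[u,v]}e(\nu)$ is regarded as an element of $\mathscr{R}^\Lambda_\alpha$. Piecewise dominant sequences. Each $\nu\in I^\alpha$ is written uniquely as $\nu=(\nu^1,\dots,\nu^1,\nu^2,\dots,\nu^2,\dots,\nu^m,\dots,\nu^m)$ with $\nu^t$ repeated $b_t\ge 1$ times, $\sum_t b_t=n$, and $\nu^t\ne\nu^{t+1}$ for $1\le t<m$. Put $c_0=0$, $c_t=b_1+\cdots+b_t$ and $\ell_t=\ell_t(\nu):=\langle h_{\nu^t},\Lambda-\sum_{s=1}^{c_{t-1}}\alpha_{\nu_s}\rangle$ for $1\le t\le m$. The sequence $\nu$ is piecewise dominant with respect to $\Lambda$ if $\ell_t\ge b_t$ for all $1\le t\le m$. The elements and sets in the claim. Let $\nu\in I^\alpha$ be piecewise dominant with respect to $\Lambda$. For $1\le t\le m$ define: - $Z^\Lambda(\nu)_t:=x_{c_{t-1}+1}^{\ell_t-1}x_{c_{t-1}+2}^{\ell_t-3}\cdots x_{c_t}^{\ell_t-2b_t+1}e(\nu)$ if $\ell_t\ge 2b_t-1$; $Z^\Lambda(\nu)_t:=x_{c_{t-1}+1}^{\ell_t-1}x_{c_{t-1}+2}^{\ell_t-3}\cdots x_{\ell_t+2c_{t-1}-c_t}^{2b_t-\ell_t+1}\,e_{[\ell_t+2c_{t-1}-c_t+1,\,c_t]}e(\nu)$ if $b_t<\ell_t<2b_t-1$; $Z^\Lambda(\nu)_t:=e_{[c_{t-1}+1,\,c_t]}e(\nu)$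 if $\ell_t=b_t$; - $\mathcal{R}^\Lambda(\nu)_t$ is the set of all elements $\prod_{j=1}^d e_{[a_j,a_{j+1}-1]}x_{a_{j+1}-1}^{l_j}e(\nu)$ with $d\ge 1$, $c_{t-1}+1=a_1<a_2<\cdots<a_d<a_{d+1}=c_t+1$ and integers $0\le l_j<\ell_t$ for $1\le j\le d$. Finally $Z^\Lambda(\nu):=\prod_{t=1}^m Z^\Lambda(\nu)_t$, $\mathcal{R}^\Lambda(\nu):=\prod_{t=1}^m\mathcal{R}^\Lambda(\nu)_t$ (the set of all products of one element from each factor), and $e(\nu)^{(-)}:=\prod_{t=1}^m e_{[c_{t-1}+1,\,c_t]}e(\nu)$. *)

theory Defs
  imports
    "HOL-Library.Poly_Mapping"
    "HOL-Computational_Algebra.Polynomial"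
    "HOL-Combinatorics.Permutations"
    "HOL-Algebra.QuotRing"
    "HOL-Algebra.Module"
begin

section \<open>Cartan datum and polynomials\<close>

text \<open>
  The weight lattice \<open>P\<close> is the whole type \<open>'p\<close>, with \<open>zscale\<close> its structure of
  \<open>\<int>\<close>-module. Elements of \<open>P\<^sup>\<or> = Hom(P, \<int>)\<close> are functions \<open>'p \<Rightarrow> int\<close>, so the natural
  pairing is function application. In \<open>Qpol i j :: 'k poly poly\<close> the inner variable is \<open>u\<close> and
  the outer one is \<open>v\<close>.
\<close>

record (overloaded) ('i, 'p, 'k) klr_datum =
  idx    :: "'i set"
  cartan :: "'i \<Rightarrow> 'i \<Rightarrow> int"
  symm   :: "'i \<Rightarrow> int"
  zscale :: "int \<Rightarrow> 'p \<Rightarrow> 'p"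
  sroot  :: "'i \<Rightarrow> 'p"
  coroot :: "'i \<Rightarrow> 'p \<Rightarrow> int"
  form   :: "(('p \<Rightarrow> int) \<Rightarrow> rat) \<Rightarrow> (('p \<Rightarrow> int) \<Rightarrow> rat) \<Rightarrow> rat"
  Qpol   :: "'i \<Rightarrow> 'i \<Rightarrow> 'k::zero poly poly"

definition symmetrizable_cartan :: "'i set \<Rightarrow> ('i \<Rightarrow> 'i \<Rightarrow> int) \<Rightarrow> ('i \<Rightarrow> int) \<Rightarrow> bool" where
  "symmetrizable_cartan I a d \<longleftrightarrow>
     (\<forall>i\<in>I. a i i = 2) \<and>
     (\<forall>i\<in>I. \<forall>j\<in>I. i \<noteq> j \<longrightarrow> a i j \<le> 0) \<and>
     (\<forall>i\<in>I. \<forall>j\<in>I. a i j = 0 \<longleftrightarrow> a j i = 0) \<and>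
     (\<forall>i\<in>I. d i > 0) \<and>
     (\<forall>i\<in>I. \<forall>j\<in>I. d i * a i j = d j * a j i)"

definition free_of_finite_rank :: "(int \<Rightarrow> 'p::ab_group_add \<Rightarrow> 'p) \<Rightarrow> bool" where
  "free_of_finite_rank zs \<longleftrightarrow> Modules.module zs \<and>
     (\<exists>B. finite B \<and> \<not> Modules.module.dependent zs B \<and> Modules.module.span zs B = UNIV)"

definition Pvee :: "('i, 'p::ab_group_add, 'k::zero) klr_datum \<Rightarrow> ('p \<Rightarrow> int) set" where
  "Pvee D = {f. Modules.module_hom (zscale D) (*) f}"

text \<open>
  With \<open>\<hh> = \<rat> \<otimes> P\<^sup>\<or>\<close>, a \<open>\<rat>\<close>-linear functional on \<open>\<hh>\<close> is the same thing as an additive map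
  \<open>P\<^sup>\<or> \<rightarrow> \<rat>\<close>; this is how elements of \<open>\<hh>\<^sup>*\<close> are represented (set to \<open>0\<close> off \<open>P\<^sup>\<or>\<close>).
  The lattice \<open>P\<close> sits inside \<open>\<hh>\<^sup>*\<close> by evaluation.
\<close>

definition hstar :: "('i, 'p::ab_group_add, 'k::zero) klr_datum \<Rightarrow> (('p \<Rightarrow> int) \<Rightarrow> rat) set" where
  "hstar D = {\<phi>. (\<forall>f\<in>Pvee D. \<forall>g\<in>Pvee D. \<phi> (\<lambda>x. f x + g x) = \<phi> f + \<phi> g) \<and>
                 (\<forall>f. f \<notin> Pvee D \<longrightarrow> \<phi> f = 0)}"

definition emb :: "('i, 'p::ab_group_add, 'k::zero) klr_datum \<Rightarrow> 'p \<Rightarrow> ('p \<Rightarrow> int) \<Rightarrow> rat" where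
  "emb D x = (\<lambda>f. if f \<in> Pvee D then of_int (f x) else 0)"

definition pform :: "('i, 'p::ab_group_add, 'k::zero) klr_datum \<Rightarrow> 'p \<Rightarrow> 'p \<Rightarrow> rat" where
  "pform D x y = form D (emb D x) (emb D y)"

definition symmetric_bilinear :: "('i, 'p::ab_group_add, 'k::zero) klr_datum \<Rightarrow> bool" where
  "symmetric_bilinear D \<longleftrightarrow>
     (\<forall>\<phi>\<in>hstar D. \<forall>\<psi>\<in>hstar D. form D \<phi> \<psi> = form D \<psi> \<phi>) \<and>
     (\<forall>\<phi>\<in>hstar D. \<forall>\<chi>\<in>hstar D. \<forall>\<psi>\<in>hstar D.
        form D (\<lambda>f. \<phi> f + \<chi> f) \<psi> = form D \<phi> \<psi> + form D \<chi> \<psi>) \<and>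
     (\<forall>c. \<forall>\<phi>\<in>hstar D. \<forall>\<psi>\<in>hstar D. form D (\<lambda>f. c * \<phi> f) \<psi> = c * form D \<phi> \<psi>)"

abbreviation Qcoeff :: "('i, 'p, 'k::zero) klr_datum \<Rightarrow> 'i \<Rightarrow> 'i \<Rightarrow> nat \<Rightarrow> nat \<Rightarrow> 'k" where
  "Qcoeff D i j k q \<equiv> coeff (coeff (Qpol D i j) q) k"

definition klr_datum :: "('i, 'p::ab_group_add, 'k::field) klr_datum \<Rightarrow> bool" where
  "klr_datum D \<longleftrightarrow>
     symmetrizable_cartan (idx D) (cartan D) (symm D) \<and>
     free_of_finite_rank (zscale D) \<and>
     inj_on (sroot D) (idx D) \<and>
     \<not> Modules.module.dependent (zscale D) (sroot D ` idx D) \<and>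
     (\<forall>i\<in>idx D. coroot D i \<in> Pvee D) \<and>
     (\<forall>i\<in>idx D. \<forall>j\<in>idx D. coroot D i (sroot D j) = cartan D i j) \<and>
     (\<forall>i\<in>idx D. \<exists>\<Lambda>. \<forall>j\<in>idx D. coroot D j \<Lambda> = (if i = j then 1 else 0)) \<and>
     symmetric_bilinear D \<and>
     (\<forall>i\<in>idx D. \<forall>j\<in>idx D. pform D (sroot D i) (sroot D j) = of_int (symm D i * cartan D i j)) \<and>
     (\<forall>i\<in>idx D. \<forall>\<phi>\<in>hstar D.
        \<phi> (coroot D i) = 2 * form D (emb D (sroot D i)) \<phi> / pform D (sroot D i) (sroot D i)) \<and>
     (\<forall>i\<in>idx D. \<forall>j\<in>idx D. \<forall>k q. Qcoeff D i j k q = Qcoeff D j i q k) \<and>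
     (\<forall>i\<in>idx D. Qpol D i i = 0) \<and>
     (\<forall>i\<in>idx D. \<forall>j\<in>idx D. i \<noteq> j \<longrightarrow>
        Qcoeff D i j (nat (- cartan D i j)) 0 \<noteq> 0 \<and>
        (\<forall>k q. Qcoeff D i j k q \<noteq> 0 \<longrightarrow>
           2 * pform D (sroot D i) (sroot D j) =
             - pform D (sroot D i) (sroot D i) * of_nat k
             - pform D (sroot D j) (sroot D j) * of_nat q))"

definition Pplus :: "('i, 'p, 'k::zero) klr_datum \<Rightarrow> 'p set" where
  "Pplus D = {\<Lambda>. \<forall>i\<in>idx D. coroot D i \<Lambda> \<ge> 0}"

text \<open>
  For a \<^const>\<open>klr_datum\<close> the index set is automatically finite, since the simple roots are
  distinct and independent in a module of finite rank.
\<close>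

definition Qplus :: "('i, 'p::ab_group_add, 'k::zero) klr_datum \<Rightarrow> nat \<Rightarrow> 'p set" where
  "Qplus D n = {\<Sum>i\<in>idx D. zscale D (int (k i)) (sroot D i) | k. (\<Sum>i\<in>idx D. k i) = n}"

text \<open>A sequence \<open>(\<nu>\<^sub>1, \<dots>, \<nu>\<^sub>n)\<close> is a list; its \<open>k\<close>-th entry is \<open>\<nu> ! (k - 1)\<close>.\<close>

definition Iseq :: "('i, 'p::ab_group_add, 'k::zero) klr_datum \<Rightarrow> nat \<Rightarrow> 'p \<Rightarrow> 'i list set" where
  "Iseq D n \<alpha> = {\<nu>. length \<nu> = n \<and> set \<nu> \<subseteq> idx D \<and> (\<Sum>i\<leftarrow>\<nu>. sroot D i) = \<alpha>}"

abbreviation entry :: "'i list \<Rightarrow> nat \<Rightarrow> 'i" where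
  "entry \<nu> k \<equiv> \<nu> ! (k - 1)"

definition swap_at :: "nat \<Rightarrow> 'i list \<Rightarrow> 'i list" where
  "swap_at l \<nu> = permute_list (transpose (l - 1) l) \<nu>"


section \<open>Algebras over a field: free algebras, quotients, spans, cocenters\<close>

text \<open>
  The free algebra is the monoid algebra of the free monoid, i.e. finitely supported functions
  on words with convolution product. Lists are wrapped because \<^typ>\<open>'a list\<close> has no
  \<^class>\<open>monoid_add\<close> instance.
\<close>

datatype 'a free_monoid = Word (letters: "'a list")

instantiation free_monoid :: (type) monoid_add
begin

definition zero_free_monoid :: "'a free_monoid" where
  "zero_free_monoid = Word []"

definition plus_free_monoid :: "'a free_monoid \<Rightarrow> 'a free_monoid \<Rightarrow> 'a free_monoid" where
  "plus_free_monoid u v = Word (letters u @ letters v)"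

instance
  by standard (simp_all add: zero_free_monoid_def plus_free_monoid_def)

end

type_synonym ('g, 'k) free_alg = "'g free_monoid \<Rightarrow>\<^sub>0 'k"

definition scal :: "'k::field \<Rightarrow> ('g, 'k) free_alg" where
  "scal c = Poly_Mapping.single 0 c"

definition gen :: "'g \<Rightarrow> ('g, 'k::field) free_alg" where
  "gen g = Poly_Mapping.single (Word [g]) 1"

text \<open>
  Algebras over the field \<open>'k\<close> are \<^typ>\<open>('k, 'a) module\<close> records, which carry both a ring
  structure and a scalar multiplication.
\<close>

definition free_algebra_on :: "'g set \<Rightarrow> ('k::field, ('g, 'k) free_alg) module" where
  "free_algebra_on G =
     \<lparr>carrier = {f. \<forall>w\<in>Poly_Mapping.keys f. set (letters w) \<subseteq> G},
      mult = (*), one = 1, zero = 0, add = (+), smult = (\<lambda>c f. scal c * f)\<rparr>"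

definition qclass :: "('k, 'a) module \<Rightarrow> 'a set \<Rightarrow> 'a \<Rightarrow> 'a set" where
  "qclass A N x = N +>\<^bsub>A\<^esub> x"

text \<open>
  \<^term>\<open>A Quot N\<close> together with the induced scalar action. If \<open>N\<close> is only a subspace and not
  an ideal, this is the quotient vector space, and its multiplication is meaningless.
\<close>

definition quot :: "('k, 'a) module \<Rightarrow> 'a set \<Rightarrow> ('k, 'a set) module" where
  "quot A N = ring.extend (A Quot N) (module.fields (\<lambda>c X. \<Union>x\<in>X. N +>\<^bsub>A\<^esub> (c \<odot>\<^bsub>A\<^esub> x)))"

inductive_set kspan :: "('k, 'a) module \<Rightarrow> 'a set \<Rightarrow> 'a set"
  for A :: "('k, 'a) module" and S :: "'a set" where
  zero: "\<zero>\<^bsub>A\<^esub> \<in> kspan A S"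
| base: "x \<in> S \<Longrightarrow> x \<in> kspan A S"
| add: "x \<in> kspan A S \<Longrightarrow> y \<in> kspan A S \<Longrightarrow> x \<oplus>\<^bsub>A\<^esub> y \<in> kspan A S"
| smult: "x \<in> kspan A S \<Longrightarrow> c \<odot>\<^bsub>A\<^esub> x \<in> kspan A S"

definition commutator_space :: "('k, 'a) module \<Rightarrow> 'a set" where
  "commutator_space A =
     kspan A {a \<otimes>\<^bsub>A\<^esub> b \<ominus>\<^bsub>A\<^esub> b \<otimes>\<^bsub>A\<^esub> a | a b. a \<in> carrier A \<and> b \<in> carrier A}"

definition cocenter :: "('k, 'a) module \<Rightarrow> ('k, 'a set) module" where
  "cocenter A = quot A (commutator_space A)"

definition trace_class :: "('k, 'a) module \<Rightarrow> 'a \<Rightarrow> 'a set" where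
  "trace_class A x = qclass A (commutator_space A) x"

lemma free_algebra_on_simps:
  "f \<in> carrier (free_algebra_on G) \<longleftrightarrow> (\<forall>w\<in>Poly_Mapping.keys f. set (letters w) \<subseteq> G)"
  "f \<otimes>\<^bsub>free_algebra_on G\<^esub> g = f * g" "\<one>\<^bsub>free_algebra_on G\<^esub> = 1"
  "f \<oplus>\<^bsub>free_algebra_on G\<^esub> g = f + g" "\<zero>\<^bsub>free_algebra_on G\<^esub> = 0"
  "c \<odot>\<^bsub>free_algebra_on G\<^esub> f = scal c * f"
  by (simp_all add: free_algebra_on_def)

lemma free_algebra_on_closed:
  fixes f g :: "('g, 'k::field) free_alg"
  shows "f \<in> carrier (free_algebra_on G) \<Longrightarrow> g \<in> carrier (free_algebra_on G) \<Longrightarrow>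
           f + g \<in> carrier (free_algebra_on G)"
    and "f \<in> carrier (free_algebra_on G) \<Longrightarrow> g \<in> carrier (free_algebra_on G) \<Longrightarrow>
           f * g \<in> carrier (free_algebra_on G)"
    and "f \<in> carrier (free_algebra_on G) \<Longrightarrow> - f \<in> carrier (free_algebra_on G)"
    and "(0 :: ('g, 'k) free_alg) \<in> carrier (free_algebra_on G)"
    and "(1 :: ('g, 'k) free_alg) \<in> carrier (free_algebra_on G)"
proof -
  assume fg: "f \<in> carrier (free_algebra_on G)" "g \<in> carrier (free_algebra_on G)"
  show "f + g \<in> carrier (free_algebra_on G)"
    using fg Poly_Mapping.keys_add[of f g] unfolding free_algebra_on_simps by fast
  show "f * g \<in> carrier (free_algebra_on G)"
    unfolding free_algebra_on_simps
  proof
    fix w assume "w \<in> Poly_Mapping.keys (f * g)"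
    then obtain u v where "w = u + v" "u \<in> Poly_Mapping.keys f" "v \<in> Poly_Mapping.keys g"
      using Poly_Mapping.keys_mult[of f g] by fast
    then show "set (letters w) \<subseteq> G"
      using fg unfolding free_algebra_on_simps plus_free_monoid_def by simp
  qed
qed (simp_all add: free_algebra_on_simps zero_free_monoid_def flip: Poly_Mapping.single_one)

lemma ring_free_algebra_on: "ring (free_algebra_on G :: ('k::field, ('g, 'k) free_alg) module)"
proof (rule ringI)
  let ?A = "free_algebra_on G :: ('k, ('g, 'k) free_alg) module"
  show "abelian_group ?A"
  proof (rule abelian_groupI)
    fix f assume "f \<in> carrier ?A"
    then show "\<exists>g\<in>carrier ?A. g \<oplus>\<^bsub>?A\<^esub> f = \<zero>\<^bsub>?A\<^esub>"
      by (intro bexI[of _ "- f"] free_algebra_on_closed(3)) (simp_all add: free_algebra_on_simps(2-))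
  qed (simp_all only: free_algebra_on_closed free_algebra_on_simps(2-) add.assoc add.commute add.left_commute
      add_0_left add_0_right)
  show "Group.monoid ?A"
    by (rule monoidI)
      (simp_all only: free_algebra_on_closed free_algebra_on_simps(2-) mult.assoc mult_1_left mult_1_right)
qed (simp_all only: free_algebra_on_simps(2-) distrib_left distrib_right)


section \<open>KLR algebras and their cyclotomic quotients\<close>

datatype 'i klr_gen = GE "'i list" | GX nat | GT nat

type_synonym ('i, 'k) klr_free = "('i klr_gen, 'k) free_alg"

abbreviation eg :: "'i list \<Rightarrow> ('i, 'k::field) klr_free" where "eg \<nu> \<equiv> gen (GE \<nu>)"
abbreviation xg :: "nat \<Rightarrow> ('i, 'k::field) klr_free" where "xg k \<equiv> gen (GX k)"
abbreviation \<tau>g :: "nat \<Rightarrow> ('i, 'k::field) klr_free" where "\<tau>g l \<equiv> gen (GT l)"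

definition klr_gens :: "('i, 'p::ab_group_add, 'k::field) klr_datum \<Rightarrow> nat \<Rightarrow> 'p \<Rightarrow> 'i klr_gen set" where
  "klr_gens D n \<alpha> = GE ` Iseq D n \<alpha> \<union> GX ` {1..n} \<union> GT ` {l. 1 \<le> l \<and> l < n}"

definition Qeval :: "'k::field poly poly \<Rightarrow> ('i, 'k) klr_free \<Rightarrow> ('i, 'k) klr_free \<Rightarrow> ('i, 'k) klr_free" where
  "Qeval p u v = (\<Sum>q\<le>degree p. \<Sum>k\<le>degree (coeff p q). scal (coeff (coeff p q) k) * (u ^ k * v ^ q))"

text \<open>
  The polynomial \<open>(p(u, v) - p(w, v)) / (u - w)\<close>, obtained from
  \<open>(u\<^sup>k - w\<^sup>k) / (u - w) = \<Sum>\<^sub>a\<^sub><\<^sub>k u\<^sup>a w\<^sup>k\<^sup>-\<^sup>1\<^sup>-\<^sup>a\<close>. The variables commute modulo the defining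
  relations, so the order of the factors does not matter.
\<close>

definition Qdivdiff :: "'k::field poly poly \<Rightarrow> ('i, 'k) klr_free \<Rightarrow> ('i, 'k) klr_free \<Rightarrow> ('i, 'k) klr_free
    \<Rightarrow> ('i, 'k) klr_free" where
  "Qdivdiff p u w v = (\<Sum>q\<le>degree p. \<Sum>k\<le>degree (coeff p q).
     scal (coeff (coeff p q) k) * ((\<Sum>a<k. u ^ a * w ^ (k - 1 - a)) * v ^ q))"

text \<open>Each relation \<open>f = g\<close> is recorded as the element \<open>f - g\<close> of the free algebra.\<close>

definition klr_relations ::
  "('i, 'p::ab_group_add, 'k::field) klr_datum \<Rightarrow> nat \<Rightarrow> 'p \<Rightarrow> ('i, 'k) klr_free set" where
  "klr_relations D n \<alpha> =
     {eg \<nu> * eg \<nu>' - (if \<nu> = \<nu>' then eg \<nu> else 0) | \<nu> \<nu>'. \<nu> \<in> Iseq D n \<alpha> \<and> \<nu>' \<in> Iseq D n \<alpha>} \<union>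
     {(\<Sum>\<nu>\<in>Iseq D n \<alpha>. eg \<nu>) - 1} \<union>
     {xg k * xg l - xg l * xg k | k l. k \<in> {1..n} \<and> l \<in> {1..n}} \<union>
     {xg k * eg \<nu> - eg \<nu> * xg k | k \<nu>. k \<in> {1..n} \<and> \<nu> \<in> Iseq D n \<alpha>} \<union>
     {\<tau>g l * eg \<nu> - eg (swap_at l \<nu>) * \<tau>g l | l \<nu>. 1 \<le> l \<and> l < n \<and> \<nu> \<in> Iseq D n \<alpha>} \<union>
     {\<tau>g k * \<tau>g l - \<tau>g l * \<tau>g k | k l. 1 \<le> k \<and> k < n \<and> 1 \<le> l \<and> l < n \<and> \<bar>int k - int l\<bar> > 1} \<union>
     {\<tau>g k ^ 2 * eg \<nu> - Qeval (Qpol D (entry \<nu> k) (entry \<nu> (k + 1))) (xg k) (xg (k + 1)) * eg \<nu> | k \<nu>.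
        1 \<le> k \<and> k < n \<and> \<nu> \<in> Iseq D n \<alpha>} \<union>
     {(\<tau>g k * xg l - xg (transpose k (k + 1) l) * \<tau>g k) * eg \<nu> -
        (if l = k \<and> entry \<nu> k = entry \<nu> (k + 1) then - eg \<nu>
         else if l = k + 1 \<and> entry \<nu> k = entry \<nu> (k + 1) then eg \<nu> else 0) | k l \<nu>.
        1 \<le> k \<and> k < n \<and> l \<in> {1..n} \<and> \<nu> \<in> Iseq D n \<alpha>} \<union>
     {(\<tau>g (k + 1) * \<tau>g k * \<tau>g (k + 1) - \<tau>g k * \<tau>g (k + 1) * \<tau>g k) * eg \<nu> -
        (if entry \<nu> k = entry \<nu> (k + 2)
         then Qdivdiff (Qpol D (entry \<nu> k) (entry \<nu> (k + 1))) (xg k) (xg (k + 2)) (xg (k + 1)) * eg \<nu>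
         else 0) | k \<nu>.
        1 \<le> k \<and> k + 1 < n \<and> \<nu> \<in> Iseq D n \<alpha>}"

definition klr_ideal ::
  "('i, 'p::ab_group_add, 'k::field) klr_datum \<Rightarrow> nat \<Rightarrow> 'p \<Rightarrow> ('i, 'k) klr_free set" where
  "klr_ideal D n \<alpha> = Idl\<^bsub>free_algebra_on (klr_gens D n \<alpha>)\<^esub> (klr_relations D n \<alpha>)"

definition klr ::
  "('i, 'p::ab_group_add, 'k::field) klr_datum \<Rightarrow> nat \<Rightarrow> 'p \<Rightarrow> ('k, ('i, 'k) klr_free set) module" where
  "klr D n \<alpha> = quot (free_algebra_on (klr_gens D n \<alpha>)) (klr_ideal D n \<alpha>)"

definition klr_class ::
  "('i, 'p::ab_group_add, 'k::field) klr_datum \<Rightarrow> nat \<Rightarrow> 'p \<Rightarrow> ('i, 'k) klr_free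
    \<Rightarrow> ('i, 'k) klr_free set" where
  "klr_class D n \<alpha> f = qclass (free_algebra_on (klr_gens D n \<alpha>)) (klr_ideal D n \<alpha>) f"

text \<open>For \<open>n = 0\<close> there is no \<open>x\<^sub>1\<close> and the cyclotomic quotient is the KLR algebra itself.\<close>

definition cyc_ideal ::
  "('i, 'p::ab_group_add, 'k::field) klr_datum \<Rightarrow> nat \<Rightarrow> 'p \<Rightarrow> 'p \<Rightarrow> ('i, 'k) klr_free set set" where
  "cyc_ideal D n \<alpha> \<Lambda> = Idl\<^bsub>klr D n \<alpha>\<^esub>
     (if n = 0 then {}
      else {klr_class D n \<alpha> (\<Sum>\<nu>\<in>Iseq D n \<alpha>. xg 1 ^ nat (coroot D (entry \<nu> 1) \<Lambda>) * eg \<nu>)})"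

definition cyc_klr ::
  "('i, 'p::ab_group_add, 'k::field) klr_datum \<Rightarrow> nat \<Rightarrow> 'p \<Rightarrow> 'p
    \<Rightarrow> ('k, ('i, 'k) klr_free set set) module" where
  "cyc_klr D n \<alpha> \<Lambda> = quot (klr D n \<alpha>) (cyc_ideal D n \<alpha> \<Lambda>)"

text \<open>The element of the cyclotomic KLR algebra represented by an expression in the generators.\<close>

definition cyc_class ::
  "('i, 'p::ab_group_add, 'k::field) klr_datum \<Rightarrow> nat \<Rightarrow> 'p \<Rightarrow> 'p \<Rightarrow> ('i, 'k) klr_free
    \<Rightarrow> ('i, 'k) klr_free set set" where
  "cyc_class D n \<alpha> \<Lambda> f = qclass (klr D n \<alpha>) (cyc_ideal D n \<alpha> \<Lambda>) (klr_class D n \<alpha> f)"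


section \<open>Gradings\<close>

text \<open>
  Products of the homogeneous generators \<open>e(\<nu>)\<close>, \<open>x\<^sub>k e(\<nu>)\<close>, \<open>\<tau>\<^sub>l e(\<nu>)\<close>, paired with their degree.
  Degrees are values of the rational bilinear form, hence of type \<^typ>\<open>rat\<close>; they are integers
  because \<open>(\<alpha>\<^sub>i, \<alpha>\<^sub>j) = d\<^sub>i a\<^sub>i\<^sub>j\<close>, so components of non-integral degree vanish.
\<close>

inductive_set hom_monomials ::
  "('i, 'p::ab_group_add, 'k::field) klr_datum \<Rightarrow> nat \<Rightarrow> 'p \<Rightarrow> (('i, 'k) klr_free \<times> rat) set"
  for D :: "('i, 'p, 'k) klr_datum" and n :: nat and \<alpha> :: 'p where
  one: "(1, 0) \<in> hom_monomials D n \<alpha>"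
| e: "(f, r) \<in> hom_monomials D n \<alpha> \<Longrightarrow> \<nu> \<in> Iseq D n \<alpha> \<Longrightarrow> (eg \<nu> * f, r) \<in> hom_monomials D n \<alpha>"
| x: "(f, r) \<in> hom_monomials D n \<alpha> \<Longrightarrow> \<nu> \<in> Iseq D n \<alpha> \<Longrightarrow> 1 \<le> k \<Longrightarrow> k \<le> n \<Longrightarrow>
       (xg k * eg \<nu> * f, pform D (sroot D (entry \<nu> k)) (sroot D (entry \<nu> k)) + r)
         \<in> hom_monomials D n \<alpha>"
| \<tau>: "(f, r) \<in> hom_monomials D n \<alpha> \<Longrightarrow> \<nu> \<in> Iseq D n \<alpha> \<Longrightarrow> 1 \<le> l \<Longrightarrow> l < n \<Longrightarrow>
       (\<tau>g l * eg \<nu> * f, - pform D (sroot D (entry \<nu> l)) (sroot D (entry \<nu> (l + 1))) + r)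
         \<in> hom_monomials D n \<alpha>"

definition klr_component ::
  "('i, 'p::ab_group_add, 'k::field) klr_datum \<Rightarrow> nat \<Rightarrow> 'p \<Rightarrow> rat \<Rightarrow> ('i, 'k) klr_free set set" where
  "klr_component D n \<alpha> r = kspan (klr D n \<alpha>) {klr_class D n \<alpha> f | f. (f, r) \<in> hom_monomials D n \<alpha>}"

definition cyc_component ::
  "('i, 'p::ab_group_add, 'k::field) klr_datum \<Rightarrow> nat \<Rightarrow> 'p \<Rightarrow> 'p \<Rightarrow> rat
    \<Rightarrow> ('i, 'k) klr_free set set set" where
  "cyc_component D n \<alpha> \<Lambda> r = qclass (klr D n \<alpha>) (cyc_ideal D n \<alpha> \<Lambda>) ` klr_component D n \<alpha> r"

definition Tr_component ::
  "('i, 'p::ab_group_add, 'k::field) klr_datum \<Rightarrow> nat \<Rightarrow> 'p \<Rightarrow> 'p \<Rightarrow> rat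
    \<Rightarrow> ('i, 'k) klr_free set set set set" where
  "Tr_component D n \<alpha> \<Lambda> r = trace_class (cyc_klr D n \<alpha> \<Lambda>) ` cyc_component D n \<alpha> \<Lambda> r"

definition d_top :: "('i, 'p::ab_group_add, 'k::zero) klr_datum \<Rightarrow> 'p \<Rightarrow> 'p \<Rightarrow> rat" where
  "d_top D \<Lambda> \<alpha> = 2 * pform D \<alpha> \<Lambda> - pform D \<alpha> \<alpha>"


section \<open>Piecewise dominant sequences and the spanning elements\<close>

function runs :: "'i list \<Rightarrow> ('i \<times> nat) list" where
  "runs [] = []"
| "runs (i # \<nu>) = (i, Suc (length (takeWhile (\<lambda>j. j = i) \<nu>))) # runs (dropWhile (\<lambda>j. j = i) \<nu>)"
  by pat_completeness auto
termination
  by (relation "measure length") (auto simp: length_dropWhile_le less_Suc_eq_le)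

lemma concat_runs: "concat (map (\<lambda>(i, b). replicate b i) (runs \<nu>)) = \<nu>"
proof (induction \<nu> rule: runs.induct)
  case (2 i \<nu>)
  have "replicate (length (takeWhile (\<lambda>j. j = i) \<nu>)) i = takeWhile (\<lambda>j. j = i) \<nu>"
    by (rule replicate_length_same) (auto dest: set_takeWhileD)
  then show ?case using 2 by simp
qed simp

lemma runs_pos: "(i, b) \<in> set (runs \<nu>) \<Longrightarrow> b \<ge> 1"
  by (induction \<nu> rule: runs.induct) auto

lemma runs_adjacent: "Suc t < length (runs \<nu>) \<Longrightarrow> fst (runs \<nu> ! t) \<noteq> fst (runs \<nu> ! Suc t)"
proof (induction \<nu> arbitrary: t rule: runs.induct)
  case (2 i \<nu>)
  show ?case
  proof (cases t)
    case 0
    then show ?thesis using 2(2) hd_dropWhile[of "\<lambda>j. j = i" \<nu>]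
      by (cases "dropWhile (\<lambda>j. j = i) \<nu>") auto
  next
    case (Suc s)
    then show ?thesis using 2 by simp
  qed
qed simp

definition nblocks :: "'i list \<Rightarrow> nat" where
  "nblocks \<nu> = length (runs \<nu>)"

definition block_val :: "'i list \<Rightarrow> nat \<Rightarrow> 'i" where
  "block_val \<nu> t = fst (runs \<nu> ! (t - 1))"

definition block_len :: "'i list \<Rightarrow> nat \<Rightarrow> nat" where
  "block_len \<nu> t = snd (runs \<nu> ! (t - 1))"

definition block_end :: "'i list \<Rightarrow> nat \<Rightarrow> nat" where
  "block_end \<nu> t = (\<Sum>s=1..t. block_len \<nu> s)"

definition ell :: "('i, 'p::ab_group_add, 'k::zero) klr_datum \<Rightarrow> 'p \<Rightarrow> 'i list \<Rightarrow> nat \<Rightarrow> int" where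
  "ell D \<Lambda> \<nu> t =
     coroot D (block_val \<nu> t) (\<Lambda> - (\<Sum>s=1..block_end \<nu> (t - 1). sroot D (entry \<nu> s)))"

definition piecewise_dominant ::
  "('i, 'p::ab_group_add, 'k::zero) klr_datum \<Rightarrow> 'p \<Rightarrow> 'i list \<Rightarrow> bool" where
  "piecewise_dominant D \<Lambda> \<nu> \<longleftrightarrow> (\<forall>t\<in>{1..nblocks \<nu>}. ell D \<Lambda> \<nu> t \<ge> int (block_len \<nu> t))"

text \<open>
  The elements below are given as expressions in the generators, to be mapped to the
  cyclotomic algebra by \<^const>\<open>cyc_class\<close>. Products are ordered, hence taken over lists.
\<close>

definition \<tau>w :: "nat \<Rightarrow> nat \<Rightarrow> ('i, 'k::field) klr_free" where
  "\<tau>w u v = prod_list (map (\<lambda>j. prod_list (map \<tau>g [u..<j])) (rev [u + 1..<v + 1]))"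

definition e_int :: "nat \<Rightarrow> nat \<Rightarrow> ('i, 'k::field) klr_free" where
  "e_int u v = (if u < v then \<tau>w u v * prod_list (map (\<lambda>j. xg j ^ (j - u)) [u + 1..<v + 1]) else 1)"

text \<open>\<open>x\<^bsub>c+1\<^esub>\<^bsup>l-1\<^esup> x\<^bsub>c+2\<^esub>\<^bsup>l-3\<^esup> \<cdots> x\<^bsub>c+p\<^esub>\<^bsup>l-2p+1\<^esup>\<close>\<close>

definition stairs :: "nat \<Rightarrow> int \<Rightarrow> nat \<Rightarrow> ('i, 'k::field) klr_free" where
  "stairs c l p = prod_list (map (\<lambda>j. xg (c + j) ^ nat (l - 2 * int j + 1)) [1..<p + 1])"

text \<open>
  In the middle case the \<open>x\<close>-indices run up to \<open>l + 2 c\<^sub>t\<^sub>-\<^sub>1 - c\<^sub>t = c\<^sub>t\<^sub>-\<^sub>1 + (l - b)\<close>.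
\<close>

definition Z_block ::
  "('i, 'p::ab_group_add, 'k::field) klr_datum \<Rightarrow> 'p \<Rightarrow> 'i list \<Rightarrow> nat \<Rightarrow> ('i, 'k) klr_free" where
  "Z_block D \<Lambda> \<nu> t =
     (let l = ell D \<Lambda> \<nu> t; b = block_len \<nu> t; c = block_end \<nu> (t - 1); c' = block_end \<nu> t in
      if l \<ge> 2 * int b - 1 then stairs c l b * eg \<nu>
      else if l > int b then
        stairs c l (nat (l - int b)) * e_int (nat (l + 2 * int c - int c') + 1) c' * eg \<nu>
      else e_int (c + 1) c' * eg \<nu>)"

definition Z_elt ::
  "('i, 'p::ab_group_add, 'k::field) klr_datum \<Rightarrow> 'p \<Rightarrow> 'i list \<Rightarrow> ('i, 'k) klr_free" where
  "Z_elt D \<Lambda> \<nu> = prod_list (map (Z_block D \<Lambda> \<nu>) [1..<nblocks \<nu> + 1])"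

definition e_minus :: "'i list \<Rightarrow> ('i, 'k::field) klr_free" where
  "e_minus \<nu> =
     prod_list (map (\<lambda>t. e_int (block_end \<nu> (t - 1) + 1) (block_end \<nu> t)) [1..<nblocks \<nu> + 1]) * eg \<nu>"

definition R_block ::
  "('i, 'p::ab_group_add, 'k::field) klr_datum \<Rightarrow> 'p \<Rightarrow> 'i list \<Rightarrow> nat \<Rightarrow> ('i, 'k) klr_free set" where
  "R_block D \<Lambda> \<nu> t =
     {prod_list (map (\<lambda>j. e_int (a j) (a (j + 1) - 1) * xg (a (j + 1) - 1) ^ l j) [1..<d + 1]) * eg \<nu>
      | d a l. d \<ge> 1 \<and> a 1 = block_end \<nu> (t - 1) + 1 \<and> a (d + 1) = block_end \<nu> t + 1 \<and>
               (\<forall>j\<in>{1..d}. a j < a (j + 1)) \<and> (\<forall>j\<in>{1..d}. int (l j) < ell D \<Lambda> \<nu> t)}"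

definition R_set ::
  "('i, 'p::ab_group_add, 'k::field) klr_datum \<Rightarrow> 'p \<Rightarrow> 'i list \<Rightarrow> ('i, 'k) klr_free set" where
  "R_set D \<Lambda> \<nu> =
     {prod_list (map r [1..<nblocks \<nu> + 1]) | r. \<forall>t\<in>{1..nblocks \<nu>}. r t \<in> R_block D \<Lambda> \<nu> t}"

end

theory Submission
  imports Defs
begin

text \<open>
  Let \<open>A\<^sub>m\<close> be spanned by the words in \<open>x\<^sub>k\<close> (\<open>k \<le> m\<close>) and \<open>\<tau>\<^sub>l\<close> (\<open>l < m\<close>). For a sequence \<open>\<theta>\<close> of length \<open>m\<close>
  and a letter \<open>i\<close> put \<open>\<ell> = \<langle>h\<^sub>i, \<Lambda> - \<Sum>\<alpha>\<^bsub>\<theta>\<^sub>j\<^esub>\<rangle>\<close>. By induction on \<open>\<theta>\<close> there are \<open>s\<^sub>k \<in> A\<^sub>m\<close>, zero for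
  \<open>k > \<ell>\<close> and with \<open>s\<^sub>\<ell>\<close> a nonzero scalar, such that \<open>\<Sum>s\<^sub>k x\<^bsub>m+1\<^esub>\<^bsup>k\<^esup> e(\<theta>i\<rho>)\<close> lies in
  \<open>A\<^sub>m \<tau>\<^sub>m A\<^sub>m\<close>; for \<open>\<theta>\<close> empty this is the cyclotomic relation. So a power \<open>x\<^bsub>m+1\<^esub>\<^bsup>N\<^esup>\<close> with \<open>N \<ge> \<ell>\<close>
  can be lowered at the cost of elements of \<open>A\<^sub>m \<tau>\<^sub>m A\<^sub>m\<close>. In the cocenter an element of \<open>A\<^sub>m \<tau>\<^sub>m A\<^sub>m\<close> can be
  rotated to one of \<open>A\<^sub>m \<tau>\<^sub>m\<close>, and expanding \<open>A\<^sub>m\<close> in turn over \<open>A\<^bsub>m-1\<^esub>\<close> collects a cycle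
  \<open>x\<^sub>a\<^bsup>N\<^esup> \<tau>\<^sub>a \<cdots> \<tau>\<^sub>m\<close>, which vanishes in the cocenter unless it runs through equal letters. In the nilHecke
  algebra \<open>x\<^sub>u\<^bsup>N\<^esup> \<tau>\<^sub>u \<cdots> \<tau>\<^bsub>v-1\<^esub>\<close> agrees up to sign with \<open>e\<^bsub>[u,v]\<^esub> x\<^sub>v\<^bsup>N-(v-u)\<^esup>\<close> modulo commutators. Hence
  the cocenter is spanned by products of blocks \<open>e\<^bsub>[u,v]\<^esub> x\<^sub>v\<^bsup>l\<^esup>\<close> on \<open>k\<close> equal letters with
  \<open>l + k \<le> \<ell>\<close>, which is part 3.

  Appending \<open>k\<close> letters \<open>i\<close> raises \<open>2(\<alpha>,\<Lambda>) - (\<alpha>,\<alpha>)\<close> by \<open>k (\<ell> - k) (\<alpha>\<^sub>i,\<alpha>\<^sub>i)\<close>, while a block has degree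
  \<open>l (\<alpha>\<^sub>i,\<alpha>\<^sub>i)\<close>. So the top degree is reached only if each block has \<open>l = \<ell> - k\<close> and either \<open>k = 1\<close> or
  \<open>l = 0\<close>, and this forces \<open>Z\<^sup>\<Lambda>(\<nu>)\<close>. In degree 0 all \<open>l\<close> vanish, and adjacent blocks on the same letter
  merge because the degree 0 part of the nilHecke algebra is spanned by \<open>e\<^bsub>[u,v]\<^esub>\<close> modulo commutators.
\<close>

section \<open>The nilHecke algebra\<close>

text \<open>The algebra of the statement consists of cosets of cosets, while the computations want a
  ring type. They are therefore done in the locale \<open>klr_rel\<close>, and the quotient is
  realised by endomorphisms of the free algebra, with \<open>act\<close> as the passage. This
  realisation does not satisfy \<Sum> e(\<nu>) = 1: the constant term of the left side is 0. So
  \<open>klr_rel\<close> does not contain that relation, and an element is cut into its pieces f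
  e(\<nu>) in the cyclotomic algebra before it is handed over. The obstacle in the mathematics is
  that \<Lambda> gives a relation for x_1 only. To carry it from strand to strand one cannot keep
  just the polynomial relation for x_{m+1}: the next letter also asks for the values of the tensor
  at the powers of x_m. Both together form one Laurent series, and each new letter acts on it by a
  single multiplication, which shifts coefficients from the negative part into the next relation.
  The bound on blocks comes from lowering x^s until s < \<ell>: a cycle of k letters turns x^s into
  x^l with l = s - (k - 1), hence l + k \<le> \<ell>.\<close>

lemma comm_times:
  fixes t a b :: "'a::semigroup_mult"
  shows "t * a = a * t \<Longrightarrow> t * b = b * t \<Longrightarrow> t * (a * b) = (a * b) * t"
  by (metis mult.assoc)

lemma comm_add:
  fixes t a b :: "'a::ring"
  shows "t * a = a * t \<Longrightarrow> t * b = b * t \<Longrightarrow> t * (a + b) = (a + b) * t"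
  by (simp add: distrib_left distrib_right)

lemma comm_diff:
  fixes t a b :: "'a::ring"
  shows "t * a = a * t \<Longrightarrow> t * b = b * t \<Longrightarrow> t * (a - b) = (a - b) * t"
  by (simp add: left_diff_distrib right_diff_distrib)

lemma comm_power:
  fixes t a :: "'a::monoid_mult"
  shows "t * a = a * t \<Longrightarrow> t * a ^ p = a ^ p * t"
  by (metis power_commuting_commutes)

text \<open>\<open>f\<close> is the unit of a corner of the ambient ring, in use an idempotent
  e(\<nu>), so it stands where the nilHecke relations have 1, and products below end in
  \<open>f\<close> to stay in the corner. The strands are u, ..., v and the crossings u, ..., v -
  1.\<close>

locale nilhecke =
  fixes X T :: "nat \<Rightarrow> 'a::ring_1" and f :: 'a and u v :: nat
  assumes f_idem: "f * f = f"
    and f_X: "f * X j = X j" and X_f: "X j * f = X j"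
    and f_T: "u \<le> j \<Longrightarrow> j < v \<Longrightarrow> f * T j = T j"
    and T_f: "u \<le> j \<Longrightarrow> j < v \<Longrightarrow> T j * f = T j"
    and X_X: "X i * X j = X j * X i"
    and T_X_far: "u \<le> j \<Longrightarrow> j < v \<Longrightarrow> k \<noteq> j \<Longrightarrow> k \<noteq> Suc j \<Longrightarrow> T j * X k = X k * T j"
    and T_X_Suc: "u \<le> j \<Longrightarrow> j < v \<Longrightarrow> T j * X (Suc j) = X j * T j + f"
    and X_Suc_T: "u \<le> j \<Longrightarrow> j < v \<Longrightarrow> X (Suc j) * T j = T j * X j + f"
    and T_T: "u \<le> j \<Longrightarrow> j < v \<Longrightarrow> T j * T j = 0"
    and T_far: "u \<le> i \<Longrightarrow> i < v \<Longrightarrow> u \<le> j \<Longrightarrow> j < v \<Longrightarrow> Suc i < j \<or> Suc j < i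
      \<Longrightarrow> T i * T j = T j * T i"
    and T_braid: "u \<le> j \<Longrightarrow> Suc j < v \<Longrightarrow> T j * T (Suc j) * T j = T (Suc j) * T j * T (Suc j)"
begin

lemma f_Xpow: "f * X j ^ p = X j ^ p * f"
  by (rule comm_power) (simp add: f_X X_f)

section \<open>Words for the longest permutation\<close>

definition "up a b = prod_list (map T [a..<b]) * f"
definition "dn a b = prod_list (map T (rev [a..<b])) * f"

lemma up_self [simp]: "b \<le> a \<Longrightarrow> up a b = f"
  by (simp add: up_def)

lemma dn_self [simp]: "b \<le> a \<Longrightarrow> dn a b = f"
  by (simp add: dn_def)

lemma up_rec: "a < b \<Longrightarrow> up a b = T a * up (Suc a) b"
  by (simp add: up_def upt_rec[of a] mult.assoc)

lemma dn_rec: "u \<le> a \<Longrightarrow> a < b \<Longrightarrow> b \<le> v \<Longrightarrow> dn a b = dn (Suc a) b * T a"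
  by (simp add: dn_def upt_rec[of a] mult.assoc f_T T_f)

lemma f_up: "u \<le> a \<Longrightarrow> b \<le> v \<Longrightarrow> f * up a b = up a b"
  by (cases "a < b") (simp_all add: up_rec f_T f_idem flip: mult.assoc)

lemma T_up_far:
  "u \<le> a \<Longrightarrow> b \<le> v \<Longrightarrow> u \<le> j \<Longrightarrow> j < v \<Longrightarrow> Suc j < a \<or> b < j \<Longrightarrow> T j * up a b = up a b * T j"
proof (induction "b - a" arbitrary: a)
  case 0
  then show ?case by (simp add: f_T T_f)
next
  case (Suc d)
  then have a: "a < b" by simp
  have IH: "T j * up (Suc a) b = up (Suc a) b * T j" by (rule Suc.hyps(1)) (use Suc in auto)
  have "T j * T a = T a * T j" using Suc a by (intro T_far) auto
  then have "T j * up a b = T a * (T j * up (Suc a) b)"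
    using a by (simp add: up_rec flip: mult.assoc)
  then show ?case using a IH by (simp add: up_rec mult.assoc)
qed

lemma T_dn_far:
  "u \<le> a \<Longrightarrow> b \<le> v \<Longrightarrow> u \<le> j \<Longrightarrow> j < v \<Longrightarrow> Suc j < a \<or> b < j \<Longrightarrow> T j * dn a b = dn a b * T j"
proof (induction "b - a" arbitrary: a)
  case 0
  then show ?case by (simp add: f_T T_f)
next
  case (Suc d)
  then have a: "a < b" by simp
  have IH: "T j * dn (Suc a) b = dn (Suc a) b * T j" by (rule Suc.hyps(1)) (use Suc in auto)
  have "T j * T a = T a * T j" using Suc a by (intro T_far) auto
  moreover have "T j * dn a b = (T j * dn (Suc a) b) * T a"
    using a Suc by (simp add: dn_rec mult.assoc)
  ultimately show ?case using a IH Suc by (simp add: dn_rec mult.assoc)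
qed

text \<open>Conjugation by the cycle s_a ... s_{b-1} shifts the index of a simple reflection by one.
  The braid relation is used once, where the two indices meet.\<close>

lemma T_up_shift:
  "u \<le> a \<Longrightarrow> b \<le> v \<Longrightarrow> a \<le> j \<Longrightarrow> Suc j < b \<Longrightarrow> T (Suc j) * up a b = up a b * T j"
proof (induction "j - a" arbitrary: a)
  case 0
  then have a: "a = j" "up a b = T j * T (Suc j) * up (Suc (Suc j)) b"
    by (simp_all add: up_rec mult.assoc)
  have c: "T j * up (Suc (Suc j)) b = up (Suc (Suc j)) b * T j"
    using 0 by (intro T_up_far) auto
  have br: "T (Suc j) * T j * T (Suc j) = T j * T (Suc j) * T j" using 0 by (simp add: T_braid)
  have "T (Suc j) * up a b = (T (Suc j) * T j * T (Suc j)) * up (Suc (Suc j)) b"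
    using a by (simp add: mult.assoc)
  also have "\<dots> = T j * T (Suc j) * (T j * up (Suc (Suc j)) b)" using br by (simp add: mult.assoc)
  also have "\<dots> = up a b * T j" using a c by (simp add: mult.assoc)
  finally show ?case .
next
  case (Suc d)
  then have a: "a < j" and IH: "T (Suc j) * up (Suc a) b = up (Suc a) b * T j" by simp_all
  have "T (Suc j) * T a = T a * T (Suc j)" using Suc a by (intro T_far) auto
  then have "T (Suc j) * up a b = T a * (T (Suc j) * up (Suc a) b)"
    using a Suc.prems by (simp add: up_rec flip: mult.assoc)
  then show ?case using a Suc.prems IH by (simp add: up_rec mult.assoc)
qed

text \<open>The word of the longest permutation of the strands a, ..., b, built by adding strands at
  the top as in \<open>\<tau>w\<close>.\<close>

fun tw :: "nat \<Rightarrow> nat \<Rightarrow> 'a" where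
  "tw a 0 = f"
| "tw a (Suc b) = (if a \<le> b then up a (Suc b) * tw a b else f)"

lemma tw_self [simp]: "b \<le> a \<Longrightarrow> tw a b = f"
  by (cases b) simp_all

lemma f_tw: "u \<le> a \<Longrightarrow> b \<le> v \<Longrightarrow> f * tw a b = tw a b"
  by (cases b) (simp_all add: f_idem f_up flip: mult.assoc)

lemma tw_f: "tw a b * f = tw a b"
  by (induction b) (simp_all add: f_idem mult.assoc)

text \<open>Each factor \<open>up\<close> that T_j crosses lowers j by one, until T_a meets a
  leading T_a and the square vanishes.\<close>

lemma T_tw: "u \<le> a \<Longrightarrow> b \<le> v \<Longrightarrow> a \<le> j \<Longrightarrow> j < b \<Longrightarrow> T j * tw a b = 0"
proof (induction b arbitrary: j)
  case (Suc b)
  then have tw: "tw a (Suc b) = up a (Suc b) * tw a b" by simp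
  show ?case
  proof (cases "j = a")
    case True
    then show ?thesis using Suc.prems
      by (simp add: tw up_rec T_T flip: mult.assoc)
  next
    case False
    then obtain i where i: "j = Suc i" "a \<le> i" "i < b" using Suc.prems by (cases j) auto
    have "T j * up a (Suc b) = up a (Suc b) * T i"
      unfolding i using Suc.prems i by (intro T_up_shift) auto
    then have "T j * tw a (Suc b) = up a (Suc b) * (T i * tw a b)"
      unfolding tw by (simp only: mult.assoc[symmetric])
    then show ?thesis using Suc i by simp
  qed
qed simp

text \<open>Both sides are reduced words of the transposition of a and b.\<close>

lemma palindrome:
  "u \<le> a \<Longrightarrow> a < b \<Longrightarrow> b \<le> v \<Longrightarrow> up a b * dn a (b - 1) = dn a b * up (Suc a) b"
proof (induction "b - a" arbitrary: a)
  case (Suc d)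
  show ?case
  proof (cases "Suc a = b")
    case True
    then show ?thesis using Suc.prems
      by (simp add: up_rec dn_rec f_T T_f mult.assoc f_idem del: upt_Suc flip: True)
  next
    case False
    then have a: "Suc a < b" using Suc.prems by simp
    have IH: "up (Suc a) b * dn (Suc a) (b - 1) = dn (Suc a) b * up (Suc (Suc a)) b"
      using Suc a by simp
    have c1: "T a * dn (Suc (Suc a)) b = dn (Suc (Suc a)) b * T a"
      using Suc.prems a by (intro T_dn_far) auto
    have c2: "T a * up (Suc (Suc a)) b = up (Suc (Suc a)) b * T a"
      using Suc.prems a by (intro T_up_far) auto
    have br: "T a * T (Suc a) * T a = T (Suc a) * T a * T (Suc a)"
      using Suc.prems a by (intro T_braid) auto
    have "dn a (b - 1) = dn (Suc a) (b - 1) * T a" using Suc.prems a by (intro dn_rec) auto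
    then have "up a b * dn a (b - 1) = T a * (up (Suc a) b * dn (Suc a) (b - 1)) * T a"
      using Suc.prems a by (simp only: up_rec[of a] mult.assoc)
    also have "\<dots> = (T a * dn (Suc (Suc a)) b) * T (Suc a) * (up (Suc (Suc a)) b * T a)"
      using IH Suc.prems a by (simp add: dn_rec[of "Suc a" b] mult.assoc)
    also have "\<dots> = dn (Suc (Suc a)) b * (T a * T (Suc a) * T a) * up (Suc (Suc a)) b"
      unfolding c1 c2[symmetric] by (simp add: mult.assoc)
    also have "\<dots> = dn a b * up (Suc a) b"
      unfolding br using Suc.prems a by (simp add: dn_rec[of a b] dn_rec[of "Suc a" b] up_rec[of "Suc a"] mult.assoc)
    finally show ?thesis .
  qed
qed simp

text \<open>A second reduced word of the longest permutation, which splits off the bottom strand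
  instead of the top one. The inductions that raise the lower end a depend on it.\<close>

lemma tw_dn: "u \<le> a \<Longrightarrow> a < b \<Longrightarrow> b \<le> v \<Longrightarrow> tw a b = dn a b * tw (Suc a) b"
proof (induction b)
  case (Suc b)
  show ?case
  proof (cases "a = b")
    case True
    then show ?thesis using Suc.prems by (simp add: up_rec dn_rec f_T T_f mult.assoc f_idem)
  next
    case False
    then have a: "a < b" using Suc.prems by simp
    have "tw a (Suc b) = up a (Suc b) * dn a b * tw (Suc a) b"
      using Suc a by (simp add: mult.assoc)
    also have "\<dots> = dn a (Suc b) * up (Suc a) (Suc b) * tw (Suc a) b"
      using palindrome[of a "Suc b"] Suc.prems a by simp
    finally show ?thesis using a by (simp add: mult.assoc)
  qed
qed simp

text \<open>The word is shortened at the top by definition or at the bottom by \<open>tw_dn\<close>,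
  keeping j inside, until a = j = b - 1 and T_j squares to 0.\<close>

lemma tw_T: "u \<le> a \<Longrightarrow> b \<le> v \<Longrightarrow> a \<le> j \<Longrightarrow> j < b \<Longrightarrow> tw a b * T j = 0"
proof (induction "b - a" arbitrary: a b rule: less_induct)
  case less
  show ?case
  proof (cases "Suc j < b")
    case True
    then obtain b' where b: "b = Suc b'" "a \<le> b'" "j < b'" using less.prems by (cases b) auto
    then have "tw a b' * T j = 0" using less by (intro less.hyps) auto
    then show ?thesis using b by (simp add: mult.assoc)
  next
    case False
    then have b: "b = Suc j" using less.prems by simp
    show ?thesis
    proof (cases "a = j")
      case True
      then show ?thesis using less.prems b by (simp add: up_rec f_T T_f mult.assoc T_T)
    next
      case False
      then have "tw (Suc a) b * T j = 0" using less.prems b by (intro less.hyps) auto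
      then show ?thesis using less.prems tw_dn[of a b] by (simp add: mult.assoc)
    qed
  qed
qed

section \<open>Monomials and symmetric polynomials\<close>

definition "mn h a c = prod_list (map (\<lambda>j. X j ^ h j) [a..<c]) * f"

lemma mn_self [simp]: "c \<le> a \<Longrightarrow> mn h a c = f"
  by (simp add: mn_def)

lemma mn_f: "mn h a c * f = mn h a c"
  by (simp add: mn_def mult.assoc f_idem)

lemma mn_rec: "a < c \<Longrightarrow> mn h a c = X a ^ h a * mn h (Suc a) c"
  by (simp add: mn_def upt_rec[of a] mult.assoc)

lemma Xpow_comm: "X i ^ p * X j ^ q = X j ^ q * X i ^ p"
proof -
  have "X i * X j ^ q = X j ^ q * X i" by (metis X_X power_commuting_commutes)
  then show ?thesis by (metis power_commuting_commutes)
qed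

lemma X_mn: "X k ^ p * mn h a c = mn h a c * X k ^ p"
proof (induction "c - a" arbitrary: a)
  case 0
  then show ?case by (simp add: f_Xpow)
next
  case (Suc d)
  then have a: "a < c" and "X k ^ p * mn h (Suc a) c = mn h (Suc a) c * X k ^ p" by simp_all
  then show ?case unfolding mn_rec[OF a] by (intro comm_times Xpow_comm)
qed

lemma f_mn: "f * mn h a c = mn h a c"
proof (induction "c - a" arbitrary: a)
  case (Suc d)
  then have a: "a < c" and IH: "f * mn h (Suc a) c = mn h (Suc a) c" by simp_all
  have "f * mn h a c = (f * X a ^ h a) * mn h (Suc a) c" by (simp only: mn_rec[OF a] mult.assoc)
  also have "\<dots> = X a ^ h a * (f * mn h (Suc a) c)" by (simp only: f_Xpow mult.assoc)
  finally show ?case by (simp only: IH mn_rec[OF a])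
qed (simp add: f_idem)

text \<open>Used to isolate the two variables touched by a crossing: an exponent function is zeroed
  at s and s + 1 and then restored by two such updates.\<close>

lemma mn_add: "a \<le> k \<Longrightarrow> k < c \<Longrightarrow> mn (h(k := h k + p)) a c = mn h a c * X k ^ p"
proof (induction "c - a" arbitrary: a)
  case (Suc d)
  then have a: "a < c" by simp
  show ?case
  proof (cases "a = k")
    case True
    have "mn (h(k := h k + p)) (Suc a) c = mn h (Suc a) c"
      unfolding mn_def using True by (intro arg_cong2[of _ _ _ _ "(*)"] arg_cong[of _ _ prod_list] map_cong) auto
    then have "mn (h(k := h k + p)) a c = X k ^ h k * (X k ^ p * mn h (Suc a) c)"
      unfolding mn_rec[OF a] using True by (simp add: power_add mult.assoc)
    also have "X k ^ p * mn h (Suc a) c = mn h (Suc a) c * X k ^ p" by (rule X_mn)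
    finally show ?thesis unfolding mn_rec[OF a] using True by (simp add: mult.assoc)
  next
    case False
    then show ?thesis using Suc a by (simp add: mn_rec[of a] mult.assoc)
  qed
qed simp

lemma mn_cong: "(\<And>j. a \<le> j \<Longrightarrow> j < c \<Longrightarrow> h j = h' j) \<Longrightarrow> mn h a c = mn h' a c"
  unfolding mn_def by (intro arg_cong2[of _ _ _ _ "(*)"] arg_cong[of _ _ prod_list] map_cong) auto

lemma T_Xpow_far: "u \<le> j \<Longrightarrow> j < v \<Longrightarrow> k \<noteq> j \<Longrightarrow> k \<noteq> Suc j \<Longrightarrow> T j * X k ^ p = X k ^ p * T j"
  by (intro comm_power T_X_far)

lemma T_mn_far:
  "u \<le> j \<Longrightarrow> j < v \<Longrightarrow> (\<And>k. a \<le> k \<Longrightarrow> k < c \<Longrightarrow> h k = 0 \<or> (k \<noteq> j \<and> k \<noteq> Suc j))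
    \<Longrightarrow> T j * mn h a c = mn h a c * T j"
proof (induction "c - a" arbitrary: a)
  case 0
  then show ?case by (simp add: f_T T_f)
next
  case (Suc d)
  then have a: "a < c" and IH: "T j * mn h (Suc a) c = mn h (Suc a) c * T j" by simp_all
  have "T j * X a ^ h a = X a ^ h a * T j"
    using Suc.prems(3)[of a] a Suc.prems T_Xpow_far[of j a] by (cases "h a = 0") auto
  then show ?case unfolding mn_rec[OF a] using IH by (rule comm_times)
qed

lemma T_sum_comm: "u \<le> j \<Longrightarrow> j < v \<Longrightarrow> T j * (X j + X (Suc j)) = (X j + X (Suc j)) * T j"
  by (simp add: distrib_left distrib_right T_X_Suc X_Suc_T)

lemma T_prod_comm:
  assumes "u \<le> j" "j < v"
  shows "T j * (X j * X (Suc j)) = (X j * X (Suc j)) * T j"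
proof -
  have "T j * X j = X (Suc j) * T j - f" using X_Suc_T[OF assms] by simp
  then have "T j * (X j * X (Suc j)) = X (Suc j) * (T j * X (Suc j)) - f * X (Suc j)"
    by (simp add: left_diff_distrib flip: mult.assoc)
  also have "\<dots> = X (Suc j) * X j * T j"
    using assms by (simp add: T_X_Suc distrib_left f_X X_f mult.assoc)
  finally show ?thesis by (simp add: X_X)
qed

text \<open>Newton's recursion p_d = (X_j + X_{j+1}) p_{d-1} - X_j X_{j+1} p_{d-2} reduces power
  sums to the two elementary symmetric polynomials.\<close>

lemma T_psum_comm:
  assumes "u \<le> j" "j < v"
  shows "T j * (X j ^ d * f + X (Suc j) ^ d * f) = (X j ^ d * f + X (Suc j) ^ d * f) * T j"
proof (induction d rule: less_induct)
  case (less d)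
  show ?case
  proof (cases d)
    case 0
    then show ?thesis using assms by (simp add: f_T T_f distrib_left distrib_right)
  next
    case (Suc d')
    show ?thesis
    proof (cases d')
      case 0
      then show ?thesis using Suc T_sum_comm[OF assms] by (simp add: X_f)
    next
      case (Suc e)
      define s where "s = X j + X (Suc j)"
      define p where "p = X j * X (Suc j)"
      define P where "P k = X j ^ k * f + X (Suc j) ^ k * f" for k
      have "P d = s * P d' - p * P e"
      proof -
        have "X (Suc j) * X j ^ Suc e = X j * X (Suc j) * X j ^ e"
             "X j * X (Suc j) ^ Suc e = X j * X (Suc j) * X (Suc j) ^ e"
          using X_X[of "Suc j" j] by (simp_all flip: mult.assoc)
        then have "X (Suc j) * (X j ^ Suc e * f) = X j * X (Suc j) * X j ^ e * f"
             "X j * (X (Suc j) ^ Suc e * f) = X j * X (Suc j) * X (Suc j) ^ e * f"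
          by (simp_all only: mult.assoc[symmetric])
        then show ?thesis using \<open>d = Suc d'\<close> Suc
          by (simp add: P_def s_def p_def distrib_left distrib_right mult.assoc)
      qed
      moreover have "T j * P d' = P d' * T j" "T j * P e = P e * T j"
        unfolding P_def using less[of d'] less[of e] \<open>d = Suc d'\<close> Suc by simp_all
      moreover have "T j * s = s * T j" "T j * p = p * T j"
        unfolding s_def p_def using T_sum_comm T_prod_comm assms by simp_all
      ultimately have "T j * P d = P d * T j"
        by (simp only:) (intro comm_diff comm_times)
      then show ?thesis by (simp add: P_def)
    qed
  qed
qed

lemma Xprod_pow: "(X i * X j) ^ p = X i ^ p * X j ^ p"
proof (induction p)
  case (Suc p)
  have "(X i * X j) ^ Suc p = X i * (X j * X i ^ p) * X j ^ p" by (simp add: Suc mult.assoc)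
  also have "X j * X i ^ p = X i ^ p * X j" using Xpow_comm[of j 1 i p] by simp
  finally show ?case by (simp add: mult.assoc)
qed simp

text \<open>The sum is a power of X_j X_{j+1} times a power sum.\<close>

lemma T_monosym_comm:
  assumes "u \<le> j" "j < v"
  shows "T j * (X j ^ p * X (Suc j) ^ q * f + X j ^ q * X (Suc j) ^ p * f)
       = (X j ^ p * X (Suc j) ^ q * f + X j ^ q * X (Suc j) ^ p * f) * T j"
proof -
  have le: "T j * (X j ^ p * X (Suc j) ^ q * f + X j ^ q * X (Suc j) ^ p * f)
       = (X j ^ p * X (Suc j) ^ q * f + X j ^ q * X (Suc j) ^ p * f) * T j" if "p \<le> q" for p q
  proof -
    obtain d where q: "q = p + d" using \<open>p \<le> q\<close> le_Suc_ex by blast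
    define m where "m = (X j * X (Suc j)) ^ p"
    have m: "m = X j ^ p * X (Suc j) ^ p" by (simp add: m_def Xprod_pow)
    have "T j * m = m * T j" unfolding m_def
      by (rule comm_power[OF T_prod_comm[OF assms]])
    moreover have "X j ^ p * X (Suc j) ^ q * f + X j ^ q * X (Suc j) ^ p * f
      = m * (X j ^ d * f + X (Suc j) ^ d * f)"
      unfolding m q power_add distrib_left
      using Xpow_comm[of "Suc j" p j d] by (simp add: mult.assoc) (simp flip: mult.assoc)
    ultimately show ?thesis using T_psum_comm[OF assms, of d] by (simp only:) (rule comm_times)
  qed
  show ?thesis
    using le[of p q] le[of q p] by (cases "p \<le> q") (auto simp: add.commute)
qed

section \<open>The staircase idempotent\<close>

definition "eb a b = tw a b * mn (\<lambda>j. j - a) a (Suc b)"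

lemma eb_self [simp]: "eb b b = f"
  by (simp add: eb_def mn_rec f_idem)

lemma tw_comm_T:
  assumes "u \<le> a" "b \<le> v" "a \<le> j" "j < b" "T j * g = g * T j"
  shows "tw a b * g * T j = 0"
proof -
  have "tw a b * g * T j = tw a b * T j * g" using assms(5) by (simp add: mult.assoc)
  then show ?thesis using tw_T[OF assms(1-4)] by simp
qed

text \<open>T_j acts from the right as a divided difference, for which g is a constant. The term in
  which T_j has moved to the left dies against \<open>tw\<close>.\<close>

lemma tw_X_T:
  assumes "u \<le> a" "b \<le> v" "a \<le> j" "j < b" "T j * g = g * T j" "g * f = g"
  shows "tw a b * (g * X (Suc j)) * T j = tw a b * g"
proof -
  have "tw a b * (g * X (Suc j)) * T j = tw a b * g * (X (Suc j) * T j)" by (simp add: mult.assoc)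
  also have "X (Suc j) * T j = T j * X j + f" using assms by (intro X_Suc_T) auto
  also have "tw a b * g * (T j * X j + f) = tw a b * g * T j * X j + tw a b * (g * f)"
    by (simp add: distrib_left mult.assoc)
  finally show ?thesis using assms tw_comm_T[OF assms(1-5)] by simp
qed

text \<open>The crossings T_{b-1}, ..., T_s act one after the other as divided differences and lower
  the exponents of X_b, ..., X_{s+1} by one each.\<close>

lemma tw_rho_dn:
  assumes "u \<le> a" "b \<le> v" "a \<le> s" "s \<le> b"
  shows "tw a b * mn (\<lambda>j. j - a) a (Suc b) * dn s b
       = tw a b * mn (\<lambda>j. if j \<le> s then j - a else j - a - 1) a (Suc b)"
  using assms(3,4)
proof (induction "b - s" arbitrary: s)
  case 0
  have "mn (\<lambda>j. if j \<le> b then j - a else j - a - 1) a (Suc b) = mn (\<lambda>j. j - a) a (Suc b)"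
    by (rule mn_cong) auto
  with 0 show ?case by (simp add: mult.assoc mn_f)
next
  case (Suc d)
  define h where "h t = (\<lambda>j. if j \<le> t then j - a else j - a - 1)" for t
  have s: "s < b" using Suc by simp
  have IH: "tw a b * mn (\<lambda>j. j - a) a (Suc b) * dn (Suc s) b = tw a b * mn (h (Suc s)) a (Suc b)"
    unfolding h_def using Suc s by (intro Suc.hyps(1)) auto
  have hh: "h (Suc s) = (h s)(Suc s := h s (Suc s) + 1)"
    using Suc.prems by (auto simp: h_def fun_eq_iff)
  have eq: "mn (h (Suc s)) a (Suc b) = mn (h s) a (Suc b) * X (Suc s)"
    unfolding hh using mn_add[of a "Suc s" "Suc b" "h s" 1] Suc.prems s by simp
  \<comment> \<open>Once the extra factor X_{s+1} is taken out, X_s and X_{s+1} both have exponent s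
    - a, so the rest is symmetric in them.\<close>
  have comm: "T s * mn (h s) a (Suc b) = mn (h s) a (Suc b) * T s"
  proof -
    define r where "r = (h s)(s := 0, Suc s := 0)"
    have "h s = (r(s := r s + (s - a)))(Suc s := (r(s := r s + (s - a))) (Suc s) + (s - a))"
      by (auto simp: r_def h_def fun_eq_iff)
    then have "mn (h s) a (Suc b) = mn r a (Suc b) * X s ^ (s - a) * X (Suc s) ^ (s - a)"
      using mn_add[of a "Suc s" "Suc b" "r(s := r s + (s - a))" "s - a"]
            mn_add[of a "s" "Suc b" "r" "s - a"] Suc.prems s
      by simp
    also have "\<dots> = mn r a (Suc b) * (X s ^ (s - a) * X (Suc s) ^ (s - a))" by (simp add: mult.assoc)
    also have "X s ^ (s - a) * X (Suc s) ^ (s - a) = (X s * X (Suc s)) ^ (s - a)"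
      by (simp add: Xprod_pow)
    finally have eq: "mn (h s) a (Suc b) = mn r a (Suc b) * (X s * X (Suc s)) ^ (s - a)" .
    have "T s * (X s * X (Suc s)) ^ (s - a) = (X s * X (Suc s)) ^ (s - a) * T s"
      using assms Suc.prems s by (intro comm_power T_prod_comm) auto
    moreover have "T s * mn r a (Suc b) = mn r a (Suc b) * T s"
      using assms Suc.prems s by (intro T_mn_far) (auto simp: r_def)
    ultimately show ?thesis unfolding eq by (intro comm_times)
  qed
  have "dn s b = dn (Suc s) b * T s" using assms Suc.prems s by (intro dn_rec) auto
  then have "tw a b * mn (\<lambda>j. j - a) a (Suc b) * dn s b = tw a b * (mn (h s) a (Suc b) * X (Suc s)) * T s"
    using IH by (simp only: eq mult.assoc[symmetric])
  also have "\<dots> = tw a b * mn (h s) a (Suc b)"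
    using assms Suc.prems s comm by (intro tw_X_T) (auto simp: mn_f)
  finally show ?case by (simp add: h_def)
qed

lemma dn_eb:
  assumes "u \<le> a" "a < b" "b \<le> v"
  shows "tw a b * mn (\<lambda>j. j - Suc a) a (Suc b) = dn a b * eb (Suc a) b"
proof -
  have "mn (\<lambda>j. j - Suc a) a (Suc b) = mn (\<lambda>j. j - Suc a) (Suc a) (Suc b)"
    using mn_rec[of a "Suc b" "\<lambda>j. j - Suc a"] assms by simp
  then show ?thesis using tw_dn[OF assms] by (simp add: eb_def mult.assoc)
qed

text \<open>The idempotents on the strands from a and from a + 1 are intertwined by
  \<open>dn\<close>; this is what makes the rotation of a cycle possible.\<close>

lemma eb_dn: "u \<le> a \<Longrightarrow> a < b \<Longrightarrow> b \<le> v \<Longrightarrow> eb a b * dn a b = dn a b * eb (Suc a) b"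
proof -
  assume *: "u \<le> a" "a < b" "b \<le> v"
  have "mn (\<lambda>j. if j \<le> a then j - a else j - a - 1) a (Suc b) = mn (\<lambda>j. j - Suc a) a (Suc b)"
    by (rule mn_cong) auto
  then show ?thesis using tw_rho_dn[of a b a] * unfolding dn_eb[OF *, symmetric] eb_def[of a b] by simp
qed

text \<open>In terms of divided differences: the longest one sends the staircase monomial to 1. It
  makes \<open>eb\<close> idempotent.\<close>

lemma eb_tw: "u \<le> a \<Longrightarrow> a \<le> b \<Longrightarrow> b \<le> v \<Longrightarrow> eb a b * tw a b = tw a b"
proof (induction "b - a" arbitrary: a)
  case 0
  then show ?case by (simp add: f_idem)
next
  case (Suc d)
  then have a: "a < b" by simp
  have "eb a b * tw a b = dn a b * (eb (Suc a) b * tw (Suc a) b)"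
    using Suc.prems a eb_dn[of a b] by (simp add: tw_dn flip: mult.assoc)
  also have "\<dots> = tw a b" using Suc a by (simp add: tw_dn)
  finally show ?case .
qed

end

text \<open>\<open>Y\<close> is the part of a product outside the block under consideration.
  \<open>N_comm\<close> says that elements of the block may be moved around the trace with
  \<open>Y\<close> in place; \<open>S\<close> is any ring with unit \<open>f\<close> around the
  block for which this holds.\<close>

locale nilhecke_trace = nilhecke X T f u v
  for X T :: "nat \<Rightarrow> 'a::ring_1" and f :: 'a and u v :: nat +
  fixes Y :: 'a and S N :: "'a set"
  assumes uv: "u \<le> v"
    and S_f: "f \<in> S" and S_X: "u \<le> j \<Longrightarrow> j \<le> v \<Longrightarrow> X j \<in> S"
    and S_T: "u \<le> j \<Longrightarrow> j < v \<Longrightarrow> T j \<in> S"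
    and S_mult: "a \<in> S \<Longrightarrow> b \<in> S \<Longrightarrow> a * b \<in> S"
    and S_add: "a \<in> S \<Longrightarrow> b \<in> S \<Longrightarrow> a + b \<in> S"
    and S_uminus: "a \<in> S \<Longrightarrow> - a \<in> S"
    and S_unit: "a \<in> S \<Longrightarrow> f * a = a" "a \<in> S \<Longrightarrow> a * f = a"
    and N_0: "0 \<in> N" and N_add: "a \<in> N \<Longrightarrow> b \<in> N \<Longrightarrow> a + b \<in> N"
    and N_uminus: "a \<in> N \<Longrightarrow> - a \<in> N"
    and N_comm: "a \<in> S \<Longrightarrow> b \<in> S \<Longrightarrow> Y * (a * b) - Y * (b * a) \<in> N"
begin

section \<open>Cycles modulo commutators\<close>

definition eqv :: "'a \<Rightarrow> 'a \<Rightarrow> bool" (infix "\<doteq>" 50) where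
  "a \<doteq> b \<longleftrightarrow> Y * a - Y * b \<in> N"

lemma eqv_refl [simp, intro]: "a \<doteq> a" by (simp add: eqv_def N_0)

lemma eqv_trans [trans]: "a \<doteq> b \<Longrightarrow> b \<doteq> c \<Longrightarrow> a \<doteq> c"
  unfolding eqv_def using N_add[of "Y * a - Y * b" "Y * b - Y * c"] by simp

lemma eqv_sym: "a \<doteq> b \<Longrightarrow> b \<doteq> a"
  unfolding eqv_def using N_uminus[of "Y * a - Y * b"] by simp

lemma eqv_add: "a \<doteq> b \<Longrightarrow> c \<doteq> d \<Longrightarrow> a + c \<doteq> b + d"
  unfolding eqv_def using N_add[of "Y * a - Y * b" "Y * c - Y * d"]
  by (simp add: algebra_simps)

lemma eqv_uminus: "a \<doteq> b \<Longrightarrow> - a \<doteq> - b"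
  unfolding eqv_def using N_uminus[of "Y * a - Y * b"] by (simp add: algebra_simps)

lemma eqv_comm: "a \<in> S \<Longrightarrow> b \<in> S \<Longrightarrow> a * b \<doteq> b * a"
  unfolding eqv_def by (rule N_comm)

lemma S_Xpow: "u \<le> j \<Longrightarrow> j \<le> v \<Longrightarrow> a \<in> S \<Longrightarrow> X j ^ p * a \<in> S"
  by (induction p) (simp_all add: mult.assoc S_mult S_X)

lemma S_up: "u \<le> a \<Longrightarrow> b \<le> v \<Longrightarrow> up a b \<in> S"
proof (induction "b - a" arbitrary: a)
  case (Suc d)
  then show ?case using up_rec[of a b] by (simp add: S_mult S_T)
qed (simp add: S_f)

lemma S_dn: "u \<le> a \<Longrightarrow> b \<le> v \<Longrightarrow> dn a b \<in> S"
proof (induction "b - a" arbitrary: a)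
  case (Suc d)
  then show ?case using dn_rec[of a b] by (simp add: S_mult S_T)
qed (simp add: S_f)

lemma S_tw: "u \<le> a \<Longrightarrow> b \<le> v \<Longrightarrow> tw a b \<in> S"
proof (induction b)
  case (Suc b)
  then show ?case using S_up[of a "Suc b"] by (auto simp: S_f S_mult)
qed (simp add: S_f)

lemma S_mn: "u \<le> a \<Longrightarrow> c \<le> Suc v \<Longrightarrow> mn h a c \<in> S"
proof (induction "c - a" arbitrary: a)
  case (Suc d)
  then show ?case using mn_rec[of a c h] by (simp add: S_Xpow)
qed (simp add: S_f)

lemma S_eb: "u \<le> a \<Longrightarrow> b \<le> v \<Longrightarrow> eb a b \<in> S"
  unfolding eb_def by (intro S_mult S_tw S_mn) auto

lemma dn_comm:
  "u \<le> a \<Longrightarrow> b \<le> v \<Longrightarrow> P \<in> S \<Longrightarrow> (\<And>j. a \<le> j \<Longrightarrow> j < b \<Longrightarrow> P * T j = T j * P) \<Longrightarrow> P * dn a b = dn a b * P"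
proof (induction "b - a" arbitrary: a)
  case (Suc d)
  then have "P * dn (Suc a) b = dn (Suc a) b * P" "P * T a = T a * P" by simp_all
  then show ?case using Suc dn_rec[of a b] by (simp add: comm_times)
qed (simp add: S_unit)

text \<open>One step: \<open>dn (Suc a) b\<close> commutes with P, travels around the trace, and
  turns the idempotent of the upper strands into a shorter product of the same shape, while T_a
  joins P. At the end only the cycle is left. P is not asked to commute with T_a, since the next P
  ends in the previous crossing.\<close>

lemma rotate:
  "u \<le> a \<Longrightarrow> a \<le> b \<Longrightarrow> b \<le> v \<Longrightarrow> P \<in> S \<Longrightarrow> (\<And>j. a < j \<Longrightarrow> j < b \<Longrightarrow> P * T j = T j * P) \<Longrightarrow>
    P * (tw a b * mn (\<lambda>j. j - Suc a) a (Suc b)) \<doteq> P * up a b"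
proof (induction "b - a" arbitrary: a P)
  case 0
  then show ?case by (simp add: mn_rec f_idem)
next
  case (Suc d)
  then have a: "a < b" by simp
  have c: "P * dn (Suc a) b = dn (Suc a) b * P"
    by (rule dn_comm) (use Suc.prems a in auto)
  have S1: "dn (Suc a) b \<in> S" "P * T a \<in> S" "eb (Suc a) b \<in> S"
    using Suc.prems a by (auto intro!: S_dn S_mult S_T S_eb)
  \<comment> \<open>With one strand left both sides are \<open>f\<close>, a case outside the range
    of \<open>eb_dn\<close>.\<close>
  have F: "eb (Suc a) b * dn (Suc a) b
      = tw (Suc a) b * mn (\<lambda>j. j - Suc (Suc a)) (Suc a) (Suc b)"
  proof (cases "Suc a = b")
    case False
    then show ?thesis using Suc.prems a eb_dn[of "Suc a" b] dn_eb[of "Suc a" b] by simp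
  qed (auto simp: mn_rec f_idem)
  have "P * (tw a b * mn (\<lambda>j. j - Suc a) a (Suc b)) = P * dn (Suc a) b * (T a * eb (Suc a) b)"
    using Suc.prems a by (simp add: dn_eb dn_rec[of a b] mult.assoc)
  also have "\<dots> = dn (Suc a) b * (P * T a * eb (Suc a) b)" by (simp only: c mult.assoc)
  also have "\<dots> \<doteq> (P * T a * eb (Suc a) b) * dn (Suc a) b"
    by (intro eqv_comm S_mult S1)
  also have "\<dots> = P * T a * (tw (Suc a) b * mn (\<lambda>j. j - Suc (Suc a)) (Suc a) (Suc b))"
    by (simp only: F mult.assoc)
  also have "\<dots> \<doteq> P * T a * up (Suc a) b"
  proof (rule Suc.hyps(1))
    fix j assume j: "Suc a < j" "j < b"
    then have "P * T j = T j * P" "T a * T j = T j * T a"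
      using Suc.prems by (auto intro!: T_far)
    then show "P * T a * T j = T j * (P * T a)" by (simp add: comm_times)
  qed (use Suc a S1 in auto)
  also have "\<dots> = P * up a b" using a by (simp only: up_rec mult.assoc)
  finally show ?case .
qed

text \<open>Insert f = T_j X_{j+1} - X_j T_j on the right. In the first term T_j commutes past g to
  \<open>tw\<close>; in the second it is rotated to the other side of \<open>tw\<close>. Both give
  0.\<close>

lemma tw_sym_zero:
  assumes "u \<le> j" "j < v" "g \<in> S" "T j * g = g * T j"
  shows "tw u v * g \<doteq> 0"
proof -
  have "f = T j * X (Suc j) - X j * T j" using T_X_Suc[of j] assms by simp
  then have "tw u v * g = tw u v * g * (T j * X (Suc j) - X j * T j)"
    using S_unit(2)[OF S_mult[OF S_tw[of u v] assms(3)]] by simp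
  also have "\<dots> = tw u v * g * T j * X (Suc j) - (tw u v * g * X j) * T j"
    by (simp only: right_diff_distrib mult.assoc)
  also have "tw u v * g * T j = 0" using assms by (intro tw_comm_T) auto
  also have "0 * X (Suc j) - tw u v * g * X j * T j = - ((tw u v * g * X j) * T j)" by simp
  also have "\<dots> \<doteq> - (T j * (tw u v * g * X j))"
    using assms by (intro eqv_uminus eqv_comm S_mult S_tw S_X S_T) auto
  also have "\<dots> = 0" using T_tw[of u v j] assms by (simp flip: mult.assoc)
  finally show ?thesis .
qed

lemma bubble_zero:
  assumes "u \<le> s" "s < v" "h s = h (Suc s)"
  shows "tw u v * mn h u (Suc v) \<doteq> 0"
proof (rule tw_sym_zero)
  define r where "r = h(s := 0, Suc s := 0)"
  have "h = (r(s := r s + h s))(Suc s := (r(s := r s + h s)) (Suc s) + h s)"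
    using assms by (auto simp: r_def fun_eq_iff)
  then have "mn h u (Suc v) = mn r u (Suc v) * X s ^ h s * X (Suc s) ^ h s"
    using mn_add[of u "Suc s" "Suc v" "r(s := r s + h s)" "h s"]
          mn_add[of u "s" "Suc v" "r" "h s"] assms by simp
  then have eq: "mn h u (Suc v) = mn r u (Suc v) * (X s * X (Suc s)) ^ h s"
    by (simp add: Xprod_pow mult.assoc)
  show "T s * mn h u (Suc v) = mn h u (Suc v) * T s"
    unfolding eq using assms
    by (intro comm_times comm_power T_prod_comm T_mn_far) (auto simp: r_def)
qed (use assms in \<open>auto intro: S_mn\<close>)

text \<open>Together with \<open>bubble_zero\<close>: modulo commutators, \<open>tw\<close> times a
  monomial is alternating in the exponents.\<close>

lemma bubble_swap:
  assumes "u \<le> s" "s < v" "h' = h(s := h (Suc s), Suc s := h s)"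
  shows "tw u v * mn h u (Suc v) \<doteq> - (tw u v * mn h' u (Suc v))"
proof -
  define r where "r = h(s := 0, Suc s := 0)"
  have split: "mn g u (Suc v) = mn r u (Suc v) * (X s ^ g s * X (Suc s) ^ g (Suc s) * f)"
    if "\<And>j. j \<noteq> s \<Longrightarrow> j \<noteq> Suc s \<Longrightarrow> g j = h j" for g
  proof -
    have "g = (r(s := r s + g s))(Suc s := (r(s := r s + g s)) (Suc s) + g (Suc s))"
      using that by (auto simp: r_def fun_eq_iff)
    then have "mn g u (Suc v) = mn r u (Suc v) * X s ^ g s * X (Suc s) ^ g (Suc s)"
      using mn_add[of u "Suc s" "Suc v" "r(s := r s + g s)" "g (Suc s)"]
          mn_add[of u "s" "Suc v" "r" "g s"] assms by simp
    then have "mn g u (Suc v) * f = mn r u (Suc v) * (X s ^ g s * X (Suc s) ^ g (Suc s) * f)"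
      by (simp only: mult.assoc)
    then show ?thesis by (simp add: mn_f)
  qed
  have "mn h u (Suc v) + mn h' u (Suc v)
      = mn r u (Suc v) * (X s ^ h s * X (Suc s) ^ h (Suc s) * f + X s ^ h (Suc s) * X (Suc s) ^ h s * f)"
    using split[of h] split[of h'] assms by (simp add: distrib_left)
  moreover have "T s * mn r u (Suc v) = mn r u (Suc v) * T s"
    using assms by (intro T_mn_far) (auto simp: r_def)
  ultimately have "T s * (mn h u (Suc v) + mn h' u (Suc v)) = (mn h u (Suc v) + mn h' u (Suc v)) * T s"
    using T_monosym_comm[OF assms(1,2)] by (simp only:) (rule comm_times)
  then have "tw u v * (mn h u (Suc v) + mn h' u (Suc v)) \<doteq> 0"
    using assms by (intro tw_sym_zero[of s] S_add S_mn) auto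
  then have "tw u v * (mn h u (Suc v) + mn h' u (Suc v)) - tw u v * mn h' u (Suc v) \<doteq> 0 - tw u v * mn h' u (Suc v)"
    unfolding diff_conv_add_uminus by (intro eqv_add) auto
  then show ?thesis by (simp add: distrib_left)
qed

text \<open>The staircase 0, 1, ..., v - u - 1 with a foreign exponent p inserted at position
  s.\<close>

definition bub :: "nat \<Rightarrow> nat \<Rightarrow> nat \<Rightarrow> nat" where
  "bub p s j = (if j < s then j - u else if j = s then p else j - Suc u)"

lemma bubble_chain:
  assumes "u \<le> s" "s \<le> v"
  shows "tw u v * mn (bub p u) u (Suc v) \<doteq> (- 1) ^ (s - u) * (tw u v * mn (bub p s) u (Suc v))"
  using assms
proof (induction s rule: dec_induct)
  case (step s)
  have "bub p (Suc s) = (bub p s)(s := bub p s (Suc s), Suc s := bub p s s)"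
    using step by (auto simp: bub_def fun_eq_iff)
  then have sw: "tw u v * mn (bub p s) u (Suc v) \<doteq> - (tw u v * mn (bub p (Suc s)) u (Suc v))"
    using step by (intro bubble_swap[of s]) auto
  have sgn: "(- 1) ^ k * a \<doteq> (- 1) ^ k * b" if "a \<doteq> b" for k :: nat and a b
    using that eqv_uminus[OF that] by (cases "even k") auto
  show ?case using eqv_trans[OF step.IH sgn[OF sw, of "s - u"]] step by (simp add: Suc_diff_le)
qed simp

text \<open>By \<open>rotate\<close> the cycle becomes \<open>tw\<close> times a shifted staircase
  whose first exponent is 0, and the factor X_u^p replaces it by p. Moving p upwards costs one sign
  per place. If p < v - u, then at position u + p it has an equal neighbour and the element
  vanishes; otherwise it reaches the top and exceeds the staircase exponent v - u by p - (v -
  u).\<close>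

lemma cycle_conv:
  shows "p < v - u \<Longrightarrow> X u ^ p * up u v \<doteq> 0"
    and "v - u \<le> p \<Longrightarrow> X u ^ p * up u v \<doteq> (- 1) ^ (v - u) * (eb u v * X v ^ (p - (v - u)))"
proof -
  have Sx: "X u ^ p * f \<in> S" using uv by (intro S_Xpow S_f) auto
  have "X u ^ p * f * (tw u v * mn (\<lambda>j. j - Suc u) u (Suc v)) \<doteq> X u ^ p * f * up u v"
  proof (rule rotate)
    fix j assume "u < j" "j < v"
    then have "T j * (X u ^ p * f) = X u ^ p * f * T j"
      by (intro comm_times T_Xpow_far) (auto simp: f_T T_f)
    then show "X u ^ p * f * T j = T j * (X u ^ p * f)" by simp
  qed (use uv Sx in auto)
  then have "X u ^ p * f * up u v \<doteq> X u ^ p * f * (tw u v * mn (\<lambda>j. j - Suc u) u (Suc v))"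
    by (rule eqv_sym)
  also have "\<dots> \<doteq> (tw u v * mn (\<lambda>j. j - Suc u) u (Suc v)) * (X u ^ p * f)"
    by (intro eqv_comm S_mult S_tw S_mn Sx) auto
  also have "\<dots> = tw u v * (mn (\<lambda>j. j - Suc u) u (Suc v) * X u ^ p)"
    by (metis X_mn mn_f mult.assoc)
  also have "mn (\<lambda>j. j - Suc u) u (Suc v) * X u ^ p = mn (bub p u) u (Suc v)"
  proof -
    have "bub p u = (\<lambda>j. j - Suc u)(u := (u - Suc u) + p)" by (auto simp: bub_def fun_eq_iff)
    then show ?thesis using mn_add[of u u "Suc v" "\<lambda>j. j - Suc u" p] uv by simp
  qed
  finally have 1: "X u ^ p * up u v \<doteq> tw u v * mn (bub p u) u (Suc v)"
    using f_up[of u v] by (simp add: mult.assoc)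
  show "X u ^ p * up u v \<doteq> 0" if "p < v - u"
  proof -
    have "tw u v * mn (bub p (u + p)) u (Suc v) \<doteq> 0"
      by (rule bubble_zero[of "u + p"]) (use that in \<open>auto simp: bub_def\<close>)
    then have "(- 1) ^ p * (tw u v * mn (bub p (u + p)) u (Suc v)) \<doteq> 0"
      using eqv_uminus[of _ 0] by (cases "even p") simp_all
    moreover have "tw u v * mn (bub p u) u (Suc v) \<doteq> (- 1) ^ p * (tw u v * mn (bub p (u + p)) u (Suc v))"
      using bubble_chain[of "u + p" p] that by simp
    ultimately show ?thesis using eqv_trans[OF 1] eqv_trans by blast
  qed
  show "X u ^ p * up u v \<doteq> (- 1) ^ (v - u) * (eb u v * X v ^ (p - (v - u)))" if "v - u \<le> p"
  proof -
    have "mn (bub p v) u (Suc v) = mn ((\<lambda>j. j - u)(v := (v - u) + (p - (v - u)))) u (Suc v)"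
      using that by (intro mn_cong) (auto simp: bub_def)
    also have "\<dots> = mn (\<lambda>j. j - u) u (Suc v) * X v ^ (p - (v - u))"
      using mn_add[of u v "Suc v" "\<lambda>j. j - u" "p - (v - u)"] uv by (simp only:)
    finally have "mn (bub p v) u (Suc v) = mn (\<lambda>j. j - u) u (Suc v) * X v ^ (p - (v - u))" .
    then show ?thesis using eqv_trans[OF 1 bubble_chain[of v p]] uv by (simp add: eb_def mult.assoc)
  qed
qed

section \<open>The degree zero part modulo commutators\<close>

inductive G :: "int \<Rightarrow> 'a \<Rightarrow> bool" where
  Gf: "G 0 f"
| G0: "G d 0"
| GX: "G d y \<Longrightarrow> u \<le> j \<Longrightarrow> j \<le> v \<Longrightarrow> G (d + 1) (X j * y)"
| GT: "G d y \<Longrightarrow> u \<le> j \<Longrightarrow> j < v \<Longrightarrow> G (d - 1) (T j * y)"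
| Gadd: "G d y \<Longrightarrow> G d z \<Longrightarrow> G d (y + z)"
| Guminus: "G d y \<Longrightarrow> G d (- y)"

text \<open>\<open>G\<close> and \<open>Pol\<close> carry the grading deg X = 1, deg T = -1, that
  is, the KLR grading in units of (\<alpha>_i, \<alpha>_i). Integer combinations suffice here, as
  the nilHecke relations have integer coefficients.\<close>

inductive Pol :: "int \<Rightarrow> 'a \<Rightarrow> bool" where
  Pf: "Pol 0 f"
| P0: "Pol d 0"
| PX: "Pol d y \<Longrightarrow> u \<le> j \<Longrightarrow> j \<le> v \<Longrightarrow> Pol (d + 1) (X j * y)"
| Padd: "Pol d y \<Longrightarrow> Pol d z \<Longrightarrow> Pol d (y + z)"
| Puminus: "Pol d y \<Longrightarrow> Pol d (- y)"

lemma Pol_G: "Pol d y \<Longrightarrow> G d y"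
  by (induction rule: Pol.induct) (auto intro: G.intros)

lemma S_0: "0 \<in> S" using S_add[OF S_f S_uminus[OF S_f]] by simp

lemma G_S: "G d y \<Longrightarrow> y \<in> S"
  by (induction rule: G.induct) (auto intro: S_f S_0 S_X S_T S_mult S_add S_uminus)

lemma G_mult: "G a y \<Longrightarrow> G b z \<Longrightarrow> G (a + b) (y * z)"
proof (induction rule: G.induct)
  case Gf
  then show ?case using S_unit[OF G_S[OF Gf]] by simp
next
  case (GX d y j)
  then have "G (d + b + 1) (X j * (y * z))" by (intro G.GX) auto
  then show ?case by (simp add: mult.assoc algebra_simps)
next
  case (GT d y j)
  then have "G (d + b - 1) (T j * (y * z))" by (intro G.GT) auto
  then show ?case by (simp add: mult.assoc algebra_simps)
qed (auto simp: distrib_right intro: G.intros)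

text \<open>A product with X_j in degree 0 comes from degree -1, where only 0 lives.\<close>

lemma Pol_low: "Pol d y \<Longrightarrow> (d < 0 \<longrightarrow> y = 0) \<and> (d = 0 \<longrightarrow> (\<exists>c. y = of_int c * f))"
proof (induction rule: Pol.induct)
  case Pf
  show ?case by (auto intro!: exI[of _ 1])
next
  case (P0 d)
  show ?case by (auto intro!: exI[of _ 0])
next
  case (PX d y j)
  then show ?case by (auto intro!: exI[of _ 0])
next
  case (Padd d y z)
  then show ?case by (auto intro: exI[of _ "_ + _"] simp: distrib_right)
next
  case (Puminus d y)
  then show ?case by (auto, metis mult_minus_left of_int_minus)
qed

lemma X_Pol: "Pol d g \<Longrightarrow> X j * g = g * X j"
  by (induction rule: Pol.induct) (auto intro: comm_times comm_add X_X simp: f_X X_f)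

text \<open>g1 is g with X_j and X_{j+1} exchanged and g2 is, up to sign, its divided difference;
  only their degrees are needed later.\<close>

lemma Pol_T: "Pol d g \<Longrightarrow> u \<le> j \<Longrightarrow> j < v \<Longrightarrow> \<exists>g1 g2. Pol d g1 \<and> Pol (d - 1) g2 \<and> g * T j = T j * g1 + g2"
proof (induction rule: Pol.induct)
  case Pf
  then show ?case by (intro exI[of _ f] exI[of _ 0]) (auto intro: Pol.intros simp: f_T T_f)
next
  case (P0 d)
  then show ?case by (intro exI[of _ 0]) (auto intro: Pol.intros)
next
  case (PX d y k)
  then obtain g1 g2 where g: "Pol d g1" "Pol (d - 1) g2" "y * T j = T j * g1 + g2" by auto
  have "Pol (d - 1 + 1) (X k * g2)" using g PX by (intro Pol.PX) auto
  then have P2: "Pol d (X k * g2)" by simp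
  have fg1: "f * g1 = g1" using S_unit[OF G_S[OF Pol_G[OF g(1)]]] by simp
  have eq: "X k * y * T j = X k * T j * g1 + X k * g2" by (simp add: mult.assoc g(3) distrib_left)
  consider "k = j" | "k = Suc j" | "k \<noteq> j" "k \<noteq> Suc j" by blast
  then show ?case
  proof cases
    case 1
    have "X k * T j = T j * X (Suc j) - f" using 1 T_X_Suc[of j] PX by simp
    then have "X k * y * T j = T j * (X (Suc j) * g1) + (- g1 + X k * g2)"
      unfolding eq by (simp add: left_diff_distrib fg1 mult.assoc)
    moreover have "Pol (d + 1) (X (Suc j) * g1)" "Pol (d + 1 - 1) (- g1 + X k * g2)"
      using PX g Padd[OF Puminus[OF g(1)] P2] by (auto intro: Pol.PX)
    ultimately show ?thesis by blast
  next
    case 2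
    then have "X k * y * T j = T j * (X j * g1) + (g1 + X k * g2)"
      unfolding eq using X_Suc_T[of j] PX by (simp add: distrib_right fg1 mult.assoc)
    moreover have "Pol (d + 1) (X j * g1)" "Pol (d + 1 - 1) (g1 + X k * g2)"
      using PX g P2 by (auto intro!: Pol.intros)
    ultimately show ?thesis by blast
  next
    case 3
    then have "X k * y * T j = T j * (X k * g1) + X k * g2"
      unfolding eq using T_X_far[of j k] PX by (simp add: mult.assoc[symmetric])
    moreover have "Pol (d + 1) (X k * g1)" "Pol (d + 1 - 1) (X k * g2)"
      using PX g P2 by (auto intro!: Pol.intros)
    ultimately show ?thesis by blast
  qed
next
  case (Padd d y z)
  then obtain g1 g2 h1 h2 where "Pol d g1" "Pol (d - 1) g2" "y * T j = T j * g1 + g2"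
    "Pol d h1" "Pol (d - 1) h2" "z * T j = T j * h1 + h2" by auto
  then show ?case
    by (intro exI[of _ "g1 + h1"] exI[of _ "g2 + h2"]) (auto intro: Pol.Padd simp: algebra_simps)
next
  case (Puminus d y)
  then obtain g1 g2 where "Pol d g1" "Pol (d - 1) g2" "y * T j = T j * g1 + g2" by auto
  then show ?case
    by (intro exI[of _ "- g1"] exI[of _ "- g2"]) (auto intro: Pol.Puminus simp: algebra_simps)
qed

text \<open>Every crossing, moved to the left past the polynomial, is killed by \<open>tw\<close>,
  so \<open>tw\<close> times the algebra is \<open>tw\<close> times polynomials.\<close>

lemma tw_Pol_G:
  "G d y \<Longrightarrow> Pol a g \<Longrightarrow> \<exists>g'. Pol (a + d) g' \<and> tw u v * g * y = tw u v * g'"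
proof (induction arbitrary: a g rule: G.induct)
  case Gf
  then show ?case using S_unit(2)[OF G_S[OF Pol_G[OF Gf]]] by (intro exI[of _ g]) (simp add: mult.assoc)
next
  case (G0 d)
  then show ?case by (intro exI[of _ 0]) (auto intro: Pol.intros)
next
  case (GX d y j)
  then have "Pol (a + 1) (X j * g)" by (intro Pol.PX)
  from GX.IH[OF this] obtain g' where "Pol (a + 1 + d) g'" "tw u v * (X j * g) * y = tw u v * g'" by auto
  then show ?case using X_Pol[OF GX.prems, of j]
    by (intro exI[of _ g']) (simp add: mult.assoc add.assoc add.commute[of 1])
next
  case (GT d y j)
  from Pol_T[OF GT.prems GT.hyps(2,3)] obtain g1 g2 where
    g: "Pol a g1" "Pol (a - 1) g2" "g * T j = T j * g1 + g2" by auto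
  from GT.IH[OF g(2)] obtain g' where g': "Pol (a - 1 + d) g'" "tw u v * g2 * y = tw u v * g'" by auto
  have "tw u v * g * (T j * y) = tw u v * (g * T j) * y" by (simp only: mult.assoc)
  also have "\<dots> = tw u v * T j * g1 * y + tw u v * g2 * y"
    by (simp only: g(3) distrib_left distrib_right mult.assoc)
  also have "tw u v * T j = 0" using GT by (intro tw_T) auto
  finally show ?case using g' by (intro exI[of _ g']) (simp add: algebra_simps)
next
  case (Gadd d y z)
  from Gadd.IH(1)[OF Gadd.prems] Gadd.IH(2)[OF Gadd.prems]
  obtain g1 g2 where "Pol (a + d) g1" "tw u v * g * y = tw u v * g1"
    "Pol (a + d) g2" "tw u v * g * z = tw u v * g2" by blast
  then show ?case by (intro exI[of _ "g1 + g2"]) (auto intro: Pol.Padd simp: distrib_left)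
next
  case (Guminus d y)
  from Guminus.IH[OF Guminus.prems]
  obtain g1 where "Pol (a + d) g1" "tw u v * g * y = tw u v * g1" by blast
  then show ?case by (intro exI[of _ "- g1"]) (auto intro: Pol.Puminus)
qed

text \<open>The length of the longest permutation of d + 1 strands, which is minus the degree of its
  word.\<close>

definition tri :: "nat \<Rightarrow> int" where "tri d = (\<Sum>i\<le>d. int i)"

lemma G_up: "u \<le> a \<Longrightarrow> b \<le> v \<Longrightarrow> a \<le> b \<Longrightarrow> G (- int (b - a)) (up a b)"
proof (induction "b - a" arbitrary: a)
  case (Suc d)
  then have "G (- int (b - Suc a) - 1) (T a * up (Suc a) b)" by (intro GT Suc.hyps(1)) auto
  moreover have "- int (b - Suc a) - 1 = - int (b - a)" using Suc by auto
  ultimately show ?case using Suc up_rec[of a b] by simp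
qed (simp add: Gf)

lemma G_tw: "u \<le> a \<Longrightarrow> b \<le> v \<Longrightarrow> a \<le> b \<Longrightarrow> G (- tri (b - a)) (tw a b)"
proof (induction b)
  case (Suc b)
  show ?case
  proof (cases "a = Suc b")
    case False
    then have a: "a \<le> b" using Suc by simp
    then have "G (- int (Suc b - a) + - tri (b - a)) (up a (Suc b) * tw a b)"
      using Suc by (intro G_mult G_up) auto
    then show ?thesis using a by (simp add: tri_def Suc_diff_le)
  qed (simp add: tri_def Gf)
qed (use Gf in \<open>auto simp: tri_def\<close>)

lemma Pol_Xpow: "Pol d g \<Longrightarrow> u \<le> j \<Longrightarrow> j \<le> v \<Longrightarrow> Pol (d + int p) (X j ^ p * g)"
proof (induction p)
  case (Suc p)
  then have "Pol (d + int p + 1) (X j * (X j ^ p * g))" by (intro PX) auto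
  then show ?case by (simp add: mult.assoc algebra_simps)
qed simp

lemma Pol_mn: "u \<le> a \<Longrightarrow> c \<le> Suc v \<Longrightarrow> Pol (\<Sum>j\<in>{a..<c}. int (h j)) (mn h a c)"
proof (induction "c - a" arbitrary: a)
  case (Suc d)
  then have "Pol ((\<Sum>j\<in>{Suc a..<c}. int (h j)) + int (h a)) (X a ^ h a * mn h (Suc a) c)"
    by (intro Pol_Xpow) auto
  moreover have "(\<Sum>j\<in>{a..<c}. int (h j)) = int (h a) + (\<Sum>j\<in>{Suc a..<c}. int (h j))"
    using Suc by (intro sum.atLeast_Suc_lessThan) simp
  ultimately show ?case using Suc mn_rec[of a c h] by (simp add: add.commute)
qed (simp add: Pf)

lemma of_int_comm: "of_int c * (a::'a) = a * of_int c"
  by (rule mult_of_int_commute)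

text \<open>Replace the first \<open>tw\<close> by tw x^\<rho> tw, x^\<rho> being the staircase
  monomial, and rotate. Then tw g tw appears, which is \<open>tw\<close> times a polynomial of
  degree 0, hence an integer multiple of \<open>tw\<close>.\<close>

lemma tw_top: "Pol (tri (v - u)) g \<Longrightarrow> \<exists>c. tw u v * g \<doteq> of_int c * eb u v"
proof -
  assume g: "Pol (tri (v - u)) g"
  from tw_Pol_G[OF G_tw[of u v] g] obtain g' where
    "Pol 0 g'" and g': "tw u v * g * tw u v = tw u v * g'" using uv by auto
  then obtain c where c: "g' = of_int c * f" using Pol_low by blast
  let ?r = "mn (\<lambda>j. j - u) u (Suc v)"
  have S: "tw u v \<in> S" "?r \<in> S" "g \<in> S" using uv S_tw S_mn G_S[OF Pol_G[OF g]] by auto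
  have "tw u v * g = tw u v * (?r * tw u v * g)" using arg_cong[OF eb_tw[of u v], of "\<lambda>y. y * g"] uv by (simp add: eb_def mult.assoc)
  also have "\<dots> \<doteq> (?r * tw u v * g) * tw u v" by (intro eqv_comm S_mult S)
  also have "\<dots> = ?r * (tw u v * (of_int c * f))" using g' c by (simp add: mult.assoc)
  also have "\<dots> = (of_int c * ?r) * tw u v"
  proof -
    have "tw u v * (of_int c * f) = of_int c * tw u v"
      using of_int_comm[of c "tw u v"] tw_f[of u v] by (metis mult.assoc)
    then show ?thesis using of_int_comm[of c ?r] by (metis mult.assoc)
  qed
  also have "\<dots> \<doteq> tw u v * (of_int c * ?r)"
  proof (rule eqv_comm[OF _ S(1)])
    show "of_int c * ?r \<in> S"
    proof (induction c)
      case (nonneg n)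
      then show ?case by (induction n) (auto simp: distrib_right S_0 intro: S_add S)
    next
      case (neg n)
      have "of_nat n * ?r \<in> S" for n by (induction n) (auto simp: distrib_right S_0 intro: S_add S)
      from S_uminus[OF this[of "Suc n"]] show ?case by (simp add: algebra_simps)
    qed
  qed
  also have "\<dots> = of_int c * eb u v"
    using of_int_comm[of c "tw u v"] by (simp add: eb_def flip: mult.assoc)
  finally show ?thesis by blast
qed

text \<open>The two-sided ideal of \<open>tw u b\<close>, where d counts only the degrees of the
  cofactors.\<close>

inductive Id :: "nat \<Rightarrow> int \<Rightarrow> 'a \<Rightarrow> bool" for b where
  Itw: "G c p \<Longrightarrow> G d q \<Longrightarrow> Id b (c + d) (p * tw u b * q)"
| Iadd: "Id b d y \<Longrightarrow> Id b d z \<Longrightarrow> Id b d (y + z)"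
| Iuminus: "Id b d y \<Longrightarrow> Id b d (- y)"

lemma Id_mult: "Id b d y \<Longrightarrow> G c p \<Longrightarrow> G e q \<Longrightarrow> Id b (c + d + e) (p * y * q)"
proof (induction rule: Id.induct)
  case (Itw c' p' d q')
  then have "Id b ((c + c') + (d + e)) ((p * p') * tw u b * (q' * q))" by (intro Id.Itw G_mult)
  then show ?case by (simp add: mult.assoc algebra_simps)
qed (auto simp: distrib_left distrib_right intro: Id.intros)

text \<open>Passing X_j through \<open>up j b * tw u (b - 1)\<close> turns it into X_b and leaves as
  error the same product without the crossing j. So each crossing of the top cycle can be removed at
  the price of one degree in the cofactors.\<close>

lemma Id_step:
  assumes "u < b" "b \<le> v" "u \<le> j" "j \<le> b"
  shows "Id b (int (j - u)) (up j b * tw u (b - 1))"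
  using assms(3,4)
proof (induction j rule: dec_induct)
  case base
  have "up u b * tw u (b - 1) = tw u b" using assms by (cases b) auto
  moreover have "Id b (0 + 0) (f * tw u b * f)" by (intro Itw Gf)
  ultimately show ?case using f_tw[of u b] tw_f[of u b] assms by simp
next
  case (step j)
  have key: "X j * (up j b * tw u (b - 1)) = up j b * tw u (b - 1) * X b - up (Suc j) b * tw u (b - 1)"
    if "u \<le> j" "j < b" for j
    using that
  proof (induction "b - Suc j" arbitrary: j)
    case 0
    then have b: "b = Suc j" by simp
    have Xj: "X j * T j = T j * X (Suc j) - f" using T_X_Suc[of j] 0 b assms by simp
    have c: "X b * tw u j = tw u j * X b"
    proof -
      have "X b * tw u c = tw u c * X b" if "c < b" for c using that
      proof (induction c)
        case (Suc c)
        have "X b * up u' (Suc c) = up u' (Suc c) * X b" if "u \<le> u'" for u' using that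
        proof (induction "Suc c - u'" arbitrary: u')
          case (Suc d)
          then have "X b * T u' = T u' * X b" using T_X_far[of u' b] \<open>Suc c < b\<close> assms by simp
          then show ?case using Suc up_rec[of u' "Suc c"] by (simp add: comm_times)
        qed (simp add: f_X X_f)
        then show ?case using Suc by (simp add: comm_times f_X X_f)
      qed (simp add: f_X X_f)
      then show ?thesis using b by simp
    qed
    have "X j * (up j b * tw u (b - 1)) = (T j * X (Suc j) - f) * (f * tw u j)"
      using b by (simp add: up_rec flip: Xj mult.assoc)
    also have "\<dots> = T j * (X b * tw u j) - tw u j"
      using 0 b assms f_tw[of u j] by (simp add: left_diff_distrib mult.assoc)
    also have "\<dots> = up j b * tw u (b - 1) * X b - up (Suc j) b * tw u (b - 1)"
      using b 0 assms f_tw[of u j] T_f[of j] c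
      by (simp add: up_rec mult.assoc)
    finally show ?case .
  next
    case (Suc d)
    have IH: "X (Suc j) * (up (Suc j) b * tw u (b - 1))
      = up (Suc j) b * tw u (b - 1) * X b - up (Suc (Suc j)) b * tw u (b - 1)"
      using Suc by (intro Suc.hyps(1)) auto
    have Xj: "X j * T j = T j * X (Suc j) - f" using T_X_Suc[of j] Suc assms by simp
    have "T j * up (Suc (Suc j)) b = up (Suc (Suc j)) b * T j"
      using Suc assms by (intro T_up_far) auto
    \<comment> \<open>T_j commutes past the rest of the cycle and is killed by
      \<open>tw u (b - 1)\<close>, so the induction hypothesis contributes no second error
      term.\<close>
    then have z: "T j * (up (Suc (Suc j)) b * tw u (b - 1)) = 0"
    proof -
      assume c: "T j * up (Suc (Suc j)) b = up (Suc (Suc j)) b * T j"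
      have "T j * tw u (b - 1) = 0" using Suc assms by (intro T_tw) auto
      then have "up (Suc (Suc j)) b * T j * tw u (b - 1) = 0" by (simp add: mult.assoc)
      then show ?thesis by (simp only: c mult.assoc[symmetric])
    qed
    have "X j * (up j b * tw u (b - 1)) = (T j * X (Suc j) - f) * (up (Suc j) b * tw u (b - 1))"
      using Suc by (simp add: up_rec[of j] flip: Xj mult.assoc)
    also have "\<dots> = T j * (X (Suc j) * (up (Suc j) b * tw u (b - 1))) - up (Suc j) b * tw u (b - 1)"
      using f_up[of "Suc j" b] Suc assms by (simp add: left_diff_distrib mult.assoc flip: mult.assoc[of f])
    also have "\<dots> = T j * up (Suc j) b * tw u (b - 1) * X b - up (Suc j) b * tw u (b - 1)"
      unfolding IH by (simp add: right_diff_distrib z mult.assoc del: One_nat_def)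
    finally show ?case using Suc by (simp add: up_rec[of j])
  qed
  have "G (0 + 1) (X j * f)" "G (0 + 1) (X b * f)"
    by (rule GX[OF Gf]; use step assms in linarith)+
  then have GX1: "G 1 (X j)" "G 1 (X b)" by (simp_all add: X_f)
  let ?Y = "up j b * tw u (b - 1)"
  have IH: "Id b (int (j - u)) ?Y" using step by simp
  have Yf: "f * ?Y = ?Y" "?Y * f = ?Y"
    using f_up[of j b] tw_f[of u "b - 1"] step assms by (simp_all add: mult.assoc flip: mult.assoc[of f])
  have "Id b (0 + int (j - u) + 1) (f * ?Y * X b)" "Id b (1 + int (j - u) + 0) (X j * ?Y * f)"
    using IH GX1 by (intro Id_mult Gf; simp)+
  then have "Id b (int (j - u) + 1) (?Y * X b)" "Id b (int (j - u) + 1) (X j * ?Y)"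
    unfolding Yf(1) mult.assoc[of "X j" ?Y f] Yf(2) by (simp_all only: add_0_left add_0_right add.commute)
  then have "Id b (int (j - u) + 1) (?Y * X b + - (X j * ?Y))" by (intro Iadd Iuminus)
  moreover have "int (j - u) + 1 = int (Suc j - u)" using step by simp
  ultimately have "Id b (int (Suc j - u)) (?Y * X b + - (X j * ?Y))" by (simp only:)
  then show ?case using key[of j] step by simp
qed

text \<open>For b = u this puts the unit \<open>f\<close> into the ideal of the longest word, as in
  a matrix algebra, with cofactors of total degree \<open>tri (v - u)\<close>.\<close>

lemma Id_tw: "u \<le> b \<Longrightarrow> b \<le> v \<Longrightarrow> Id v (tri (v - u) - tri (b - u)) (tw u b)"
proof (induction "v - b" arbitrary: b)
  case 0
  then have "Id v (0 + 0) (f * tw u v * f)" by (intro Itw Gf)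
  then show ?case using 0 f_tw[of u v] tw_f[of u v] by simp
next
  case (Suc d)
  have tr: "Id v (e + d) y" if "Id (Suc b) d y" "Id v e (tw u (Suc b))" for y d e
    using that
  proof (induction rule: Id.induct)
    case (Itw c p d q)
    then have "Id v (c + e + d) (p * tw u (Suc b) * q)" by (intro Id_mult)
    then show ?case by (simp add: algebra_simps)
  qed (auto intro: Id.intros)
  have "Id (Suc b) (int (Suc b - u)) (up (Suc b) (Suc b) * tw u (Suc b - 1))"
    using Suc by (intro Id_step) auto
  then have "Id (Suc b) (int (Suc b - u)) (tw u b)" using f_tw[of u b] Suc by simp
  from tr[OF this Suc.hyps(1)[of "Suc b"]] Suc
  have "Id v (tri (v - u) - tri (Suc b - u) + int (Suc b - u)) (tw u b)" by simp
  then show ?case using Suc by (simp add: tri_def Suc_diff_le)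
qed

text \<open>Expand the unit behind w into terms p tw q by \<open>Id_tw\<close> and rotate w p to the
  end. By \<open>tw_Pol_G\<close> the rest is \<open>tw\<close> times a polynomial of degree
  \<open>tri (v - u)\<close>, so \<open>tw_top\<close> applies.\<close>

lemma degree_zero:
  assumes "G 0 w"
  shows "\<exists>c. w \<doteq> of_int c * eb u v"
proof -
  have "\<exists>c. w * y \<doteq> of_int c * eb u v" if "Id v d y" "G e w" "d + e = tri (v - u)" for d e y w
    using that
  proof (induction arbitrary: w e rule: Id.induct)
    case (Itw c p d q)
    then have "G (d + e + c) (q * w * p)" by (intro G_mult)
    then have "G (tri (v - u)) (q * w * p)" using Itw by (simp add: algebra_simps)
    from tw_Pol_G[OF this Pf] obtain g' where
      g': "Pol (tri (v - u)) g'" "tw u v * f * (q * w * p) = tw u v * g'" by auto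
    have S: "w \<in> S" "p \<in> S" "q \<in> S" "tw u v \<in> S" using Itw G_S S_tw[of u v] by auto
    have "w * (p * tw u v * q) = (w * p) * (tw u v * q)" by (simp add: mult.assoc)
    also have "\<dots> \<doteq> (tw u v * q) * (w * p)" by (intro eqv_comm S_mult S)
    also have "\<dots> = tw u v * g'" using g'(2) by (simp add: tw_f mult.assoc flip: mult.assoc[of _ f])
    finally show ?case using tw_top[OF g'(1)] eqv_trans by blast
  next
    case (Iadd d y z)
    from Iadd.IH(1)[OF Iadd.prems] Iadd.IH(2)[OF Iadd.prems]
    obtain c1 c2 where "w * y \<doteq> of_int c1 * eb u v" "w * z \<doteq> of_int c2 * eb u v" by blast
    from eqv_add[OF this] show ?case
      by (intro exI[of _ "c1 + c2"]) (simp add: distrib_left distrib_right)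
  next
    case (Iuminus d y)
    from Iuminus.IH[OF Iuminus.prems]
    obtain c1 where "w * y \<doteq> of_int c1 * eb u v" by blast
    from eqv_uminus[OF this] show ?case by (intro exI[of _ "- c1"]) simp
  qed
  from this[OF Id_tw[of u] assms] uv S_unit(2)[OF G_S[OF assms]] show ?thesis
    by (simp add: tri_def)
qed

end

section \<open>Algebras satisfying the KLR relations\<close>

text \<open>Sequences are split as \<open>\<theta> @ i # j # \<rho>\<close>, so a position is the
  length of a prefix and no indexing occurs. \<open>Alg\<close> is the algebra proper inside the
  type; commutators are taken of its elements only. The sums in \<open>t_t\<close> and
  \<open>braid_eq\<close> run over the box of exponents that homogeneity permits.\<close>

locale klr_rel =
  fixes sc :: "'k::field \<Rightarrow> 'a::ring_1" and e :: "'i list \<Rightarrow> 'a" and x t :: "nat \<Rightarrow> 'a"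
    and n :: nat and I :: "'i set" and cf :: "'i \<Rightarrow> 'i \<Rightarrow> nat \<Rightarrow> nat \<Rightarrow> 'k"
    and ca :: "'i \<Rightarrow> 'i \<Rightarrow> int" and dg :: "'i \<Rightarrow> 'i \<Rightarrow> rat" and L :: "'i \<Rightarrow> nat"
    and Alg :: "'a set"
  assumes sc_add: "sc (c + d) = sc c + sc d"
    and sc_mult: "sc (c * d) = sc c * sc d"
    and sc_1: "sc 1 = 1"
    and sc_comm: "sc c * y = y * sc c"
    and e_idem: "e \<nu> * e \<nu> = e \<nu>"
    and e_orth: "\<nu> \<noteq> \<mu> \<Longrightarrow> e \<nu> * e \<mu> = 0"
    and x_e: "x k * e \<nu> = e \<nu> * x k"
    and x_x: "x k * x l = x l * x k"
    and t_x_far: "l \<noteq> k \<Longrightarrow> l \<noteq> Suc k \<Longrightarrow> t k * x l = x l * t k"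
    and t_t_far: "Suc k < l \<Longrightarrow> t k * t l = t l * t k"
    and t_e: "length \<theta> + 2 + length \<rho> = n \<Longrightarrow>
      t (Suc (length \<theta>)) * e (\<theta> @ i # j # \<rho>) = e (\<theta> @ j # i # \<rho>) * t (Suc (length \<theta>))"
    and t_x_neq: "length \<theta> + 2 + length \<rho> = n \<Longrightarrow> i \<noteq> j \<Longrightarrow> k = Suc (length \<theta>) \<Longrightarrow>
      t k * x k * e (\<theta> @ i # j # \<rho>) = x (Suc k) * t k * e (\<theta> @ i # j # \<rho>)"
    and t_xS_neq: "length \<theta> + 2 + length \<rho> = n \<Longrightarrow> i \<noteq> j \<Longrightarrow> k = Suc (length \<theta>) \<Longrightarrow>
      t k * x (Suc k) * e (\<theta> @ i # j # \<rho>) = x k * t k * e (\<theta> @ i # j # \<rho>)"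
    and t_x_eq: "length \<theta> + 2 + length \<rho> = n \<Longrightarrow> k = Suc (length \<theta>) \<Longrightarrow>
      t k * x k * e (\<theta> @ i # i # \<rho>) = x (Suc k) * t k * e (\<theta> @ i # i # \<rho>) - e (\<theta> @ i # i # \<rho>)"
    and t_xS_eq: "length \<theta> + 2 + length \<rho> = n \<Longrightarrow> k = Suc (length \<theta>) \<Longrightarrow>
      t k * x (Suc k) * e (\<theta> @ i # i # \<rho>) = x k * t k * e (\<theta> @ i # i # \<rho>) + e (\<theta> @ i # i # \<rho>)"
    and t_t: "length \<theta> + 2 + length \<rho> = n \<Longrightarrow> k = Suc (length \<theta>) \<Longrightarrow>
      t k * t k * e (\<theta> @ i # j # \<rho>) =
        (\<Sum>a\<le>nat (- ca i j). \<Sum>b\<le>nat (- ca j i). sc (cf i j a b) * (x k ^ a * x (Suc k) ^ b))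
          * e (\<theta> @ i # j # \<rho>)"
    and braid_eq: "length \<theta> + 3 + length \<rho> = n \<Longrightarrow> k = Suc (length \<theta>) \<Longrightarrow>
      (t (Suc k) * t k * t (Suc k) - t k * t (Suc k) * t k) * e (\<theta> @ i # j # i # \<rho>) =
        (\<Sum>a\<le>nat (- ca i j). \<Sum>b\<le>nat (- ca j i). sc (cf i j a b) *
          ((\<Sum>c<a. x k ^ c * x (Suc (Suc k)) ^ (a - 1 - c)) * x (Suc k) ^ b)) * e (\<theta> @ i # j # i # \<rho>)"
    and braid_neq: "length \<theta> + 3 + length \<rho> = n \<Longrightarrow> k = Suc (length \<theta>) \<Longrightarrow> i \<noteq> i' \<Longrightarrow>
      (t (Suc k) * t k * t (Suc k) - t k * t (Suc k) * t k) * e (\<theta> @ i # j # i' # \<rho>) = 0"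
    and cyclotomic: "Suc (length \<rho>) = n \<Longrightarrow> x 1 ^ L i * e (i # \<rho>) = 0"
    and e_I: "\<not> set \<nu> \<subseteq> I \<Longrightarrow> e \<nu> = 0"
    and cf_sym: "i \<in> I \<Longrightarrow> j \<in> I \<Longrightarrow> cf i j a b = cf j i b a"
    and cf_diag: "i \<in> I \<Longrightarrow> cf i i a b = 0"
    and cf_lead: "i \<in> I \<Longrightarrow> j \<in> I \<Longrightarrow> i \<noteq> j \<Longrightarrow> cf i j (nat (- ca i j)) 0 \<noteq> 0"
    and cf_hom: "i \<in> I \<Longrightarrow> j \<in> I \<Longrightarrow> cf i j a b \<noteq> 0 \<Longrightarrow>
      2 * dg i j = - dg i i * of_nat a - dg j j * of_nat b"
    and ca_diag: "i \<in> I \<Longrightarrow> ca i i = 2"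
    and ca_le: "i \<in> I \<Longrightarrow> j \<in> I \<Longrightarrow> i \<noteq> j \<Longrightarrow> ca i j \<le> 0"
    and dg_pos: "i \<in> I \<Longrightarrow> dg i i > 0"
    and dg_sym: "dg i j = dg j i"
    and dg_ca: "i \<in> I \<Longrightarrow> j \<in> I \<Longrightarrow> dg i i * of_int (ca i j) = 2 * dg i j"
    and Alg_1: "1 \<in> Alg" and Alg_e: "e \<nu> \<in> Alg" and Alg_x: "x k \<in> Alg" and Alg_t: "t k \<in> Alg"
    and Alg_mult: "y \<in> Alg \<Longrightarrow> z \<in> Alg \<Longrightarrow> y * z \<in> Alg"
    and Alg_add: "y \<in> Alg \<Longrightarrow> z \<in> Alg \<Longrightarrow> y + z \<in> Alg"
    and Alg_sc: "y \<in> Alg \<Longrightarrow> sc c * y \<in> Alg"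
begin

section \<open>Polynomials in two neighbouring variables\<close>

lemma sc_0: "sc 0 = 0"
  using sc_add[of 0 0] by simp

lemma sc_uminus: "sc (- c) = - sc c"
  using sc_add[of c "- c"] by (simp add: sc_0 eq_neg_iff_add_eq_0 add.commute)

lemma uminus_sc: "- y = sc (- 1) * y"
  by (simp add: sc_uminus sc_1)

lemma x_pow_e: "x k ^ p * e \<nu> = e \<nu> * x k ^ p"
  using comm_power[of "e \<nu>" "x k" p] x_e by simp

lemma x_pow_x: "x k ^ p * x l = x l * x k ^ p"
  using comm_power[of "x l" "x k" p] x_x by simp

lemma x_pow_pow: "x k ^ p * x l ^ q = x l ^ q * x k ^ p"
  using comm_power[of "x k ^ p" "x l" q] x_pow_x by simp

lemma t_pow_far: "l \<noteq> k \<Longrightarrow> l \<noteq> Suc k \<Longrightarrow> t k * x l ^ p = x l ^ p * t k"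
  by (intro comm_power t_x_far)

text \<open>The complete homogeneous polynomial of degree p - 1, which is the divided difference of
  the p-th power.\<close>

definition hs :: "nat \<Rightarrow> nat \<Rightarrow> 'a" where
  "hs k p = (\<Sum>a<p. x k ^ a * x (Suc k) ^ (p - 1 - a))"

lemma hs_Suc: "hs k (Suc p) = hs k p * x (Suc k) + x k ^ p"
proof -
  have "hs k p * x (Suc k) = (\<Sum>a<p. x k ^ a * x (Suc k) ^ (p - a))"
    unfolding hs_def sum_distrib_right
  proof (rule sum.cong)
    fix a assume "a \<in> {..<p}"
    then have "p - a = Suc (p - 1 - a)" by auto
    then show "x k ^ a * x (Suc k) ^ (p - 1 - a) * x (Suc k) = x k ^ a * x (Suc k) ^ (p - a)"
      by (simp only: power_Suc2 mult.assoc)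
  qed simp
  then show ?thesis by (simp add: hs_def)
qed

lemma hs_comm: "hs k p * x l = x l * hs k p"
  unfolding hs_def sum_distrib_left sum_distrib_right
  by (intro sum.cong refl) (metis comm_times x_pow_x)

lemma hs_Suc': "hs k (Suc p) = x k * hs k p + x (Suc k) ^ p"
proof -
  have "hs k (Suc p) = x (Suc k) ^ p + (\<Sum>a<p. x k ^ Suc a * x (Suc k) ^ (p - 1 - a))"
    unfolding hs_def sum.lessThan_Suc_shift by simp
  then show ?thesis by (simp add: hs_def sum_distrib_left mult.assoc)
qed

context
  fixes \<theta> \<rho> :: "'i list" and k :: nat
  assumes len: "length \<theta> + 2 + length \<rho> = n" and k: "k = Suc (length \<theta>)"
begin

lemma t_ek: "t k * e (\<theta> @ i # j # \<rho>) = e (\<theta> @ j # i # \<rho>) * t k"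
  unfolding k by (rule t_e[OF len])

lemma t_xp_neq: "i \<noteq> j \<Longrightarrow> t k * x k ^ p * e (\<theta> @ i # j # \<rho>) = x (Suc k) ^ p * t k * e (\<theta> @ i # j # \<rho>)"
proof (induction p)
  case (Suc p)
  have "t k * x k ^ Suc p * e (\<theta> @ i # j # \<rho>) = (t k * x k ^ p * e (\<theta> @ i # j # \<rho>)) * x k"
    by (simp only: power_Suc2 mult.assoc x_e)
  also have "\<dots> = x (Suc k) ^ p * (t k * x k * e (\<theta> @ i # j # \<rho>))"
    using Suc by (simp add: mult.assoc x_e)
  also have "\<dots> = x (Suc k) ^ Suc p * t k * e (\<theta> @ i # j # \<rho>)"
    unfolding t_x_neq[OF len Suc.prems k] by (simp only: power_Suc2 mult.assoc)
  finally show ?case .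
qed simp

lemma t_xSp_neq: "i \<noteq> j \<Longrightarrow> t k * x (Suc k) ^ p * e (\<theta> @ i # j # \<rho>) = x k ^ p * t k * e (\<theta> @ i # j # \<rho>)"
proof (induction p)
  case (Suc p)
  have "t k * x (Suc k) ^ Suc p * e (\<theta> @ i # j # \<rho>) = (t k * x (Suc k) ^ p * e (\<theta> @ i # j # \<rho>)) * x (Suc k)"
    by (simp only: power_Suc2 mult.assoc x_e)
  also have "\<dots> = x k ^ p * (t k * x (Suc k) * e (\<theta> @ i # j # \<rho>))"
    using Suc by (simp add: mult.assoc x_e)
  also have "\<dots> = x k ^ Suc p * t k * e (\<theta> @ i # j # \<rho>)"
    unfolding t_xS_neq[OF len Suc.prems k] by (simp only: power_Suc2 mult.assoc)
  finally show ?case .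
qed simp

lemma t_xp_eq: "t k * x k ^ p * e (\<theta> @ i # i # \<rho>)
    = x (Suc k) ^ p * t k * e (\<theta> @ i # i # \<rho>) - hs k p * e (\<theta> @ i # i # \<rho>)"
proof (induction p)
  case (Suc p)
  let ?e = "e (\<theta> @ i # i # \<rho>)"
  have "t k * x k ^ Suc p * ?e = (t k * x k ^ p * ?e) * x k"
    by (simp only: power_Suc2 mult.assoc x_e)
  also have "\<dots> = x (Suc k) ^ p * (t k * x k * ?e) - hs k p * x k * ?e"
    unfolding Suc by (simp add: left_diff_distrib mult.assoc x_e)
  also have "\<dots> = x (Suc k) ^ Suc p * t k * ?e - (x k * hs k p + x (Suc k) ^ p) * ?e"
    unfolding t_x_eq[OF len k]
    by (simp add: right_diff_distrib distrib_right hs_comm mult.assoc power_Suc2 del: power_Suc)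
  finally show ?case unfolding hs_Suc' .
qed (simp add: hs_def)

lemma t_xSp_eq: "t k * x (Suc k) ^ p * e (\<theta> @ i # i # \<rho>)
    = x k ^ p * t k * e (\<theta> @ i # i # \<rho>) + hs k p * e (\<theta> @ i # i # \<rho>)"
proof (induction p)
  case (Suc p)
  let ?e = "e (\<theta> @ i # i # \<rho>)"
  have "t k * x (Suc k) ^ Suc p * ?e = (t k * x (Suc k) ^ p * ?e) * x (Suc k)"
    by (simp only: power_Suc2 mult.assoc x_e)
  also have "\<dots> = x k ^ p * (t k * x (Suc k) * ?e) + hs k p * x (Suc k) * ?e"
    unfolding Suc by (simp add: distrib_right mult.assoc x_e)
  also have "\<dots> = x k ^ Suc p * t k * ?e + (hs k p * x (Suc k) + x k ^ p) * ?e"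
    unfolding t_xS_eq[OF len k]
    by (simp add: distrib_left distrib_right mult.assoc power_Suc2 del: power_Suc)
  finally show ?case unfolding hs_Suc .
qed (simp add: hs_def)

end

text \<open>The degree is an integer because the remainder in \<open>t_bi\<close> has degree -1 for
  p = q = 0; in that degree there is only 0.\<close>

inductive bi :: "nat \<Rightarrow> int \<Rightarrow> 'a \<Rightarrow> bool" for k where
  bi_0: "bi k d 0"
| bi_base: "int (a + b) = d \<Longrightarrow> bi k d (x k ^ a * x (Suc k) ^ b)"
| bi_add: "bi k d y \<Longrightarrow> bi k d z \<Longrightarrow> bi k d (y + z)"
| bi_sc: "bi k d y \<Longrightarrow> bi k d (sc c * y)"

lemma bi_sum: "(\<And>a. a \<in> A \<Longrightarrow> bi k d (f a)) \<Longrightarrow> bi k d (\<Sum>a\<in>A. f a)"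
  by (induction A rule: infinite_finite_induct) (auto intro: bi.intros)

lemma bi_hs: "bi k (int p - 1) (hs k p)"
  unfolding hs_def by (intro bi_sum bi_base) auto

lemma bi_mult: "bi k d y \<Longrightarrow> bi k (d + int p + int q) (y * (x k ^ p * x (Suc k) ^ q))"
proof (induction rule: bi.induct)
  case (bi_base a b d)
  have "x k ^ a * x (Suc k) ^ b * (x k ^ p * x (Suc k) ^ q) = x k ^ (a + p) * x (Suc k) ^ (b + q)"
    using x_pow_pow[of "Suc k" b k p] by (simp add: power_add mult.assoc) (simp flip: mult.assoc)
  then show ?case using bi.bi_base[of "a + p" "b + q"] bi_base by (simp add: algebra_simps)
qed (auto simp: distrib_right mult.assoc intro: bi.intros)

lemma t_bi:
  assumes len: "length \<theta> + 2 + length \<rho> = n" and k: "k = Suc (length \<theta>)"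
  shows "\<exists>R. bi k (int (p + q) - 1) R \<and> (i \<noteq> j \<longrightarrow> R = 0) \<and>
    t k * (x k ^ p * x (Suc k) ^ q) * e (\<theta> @ i # j # \<rho>)
      = x k ^ q * x (Suc k) ^ p * t k * e (\<theta> @ i # j # \<rho>) + R * e (\<theta> @ i # j # \<rho>)"
proof -
  let ?e = "e (\<theta> @ i # j # \<rho>)"
  have st: "t k * (x k ^ p * x (Suc k) ^ q) * ?e = (t k * x k ^ p * ?e) * x (Suc k) ^ q"
    by (simp only: mult.assoc x_pow_e[of "Suc k"])
  show ?thesis
  proof (cases "i = j")
    case False
    have "(t k * x k ^ p * ?e) * x (Suc k) ^ q = x (Suc k) ^ p * (t k * x (Suc k) ^ q * ?e)"
      unfolding t_xp_neq[OF len k False] by (simp add: mult.assoc x_pow_e)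
    also have "\<dots> = x k ^ q * x (Suc k) ^ p * t k * ?e"
      unfolding t_xSp_neq[OF len k False] using x_pow_pow[of k q "Suc k" p] by (simp add: mult.assoc[symmetric])
    finally show ?thesis using st False by (intro exI[of _ 0]) (auto intro: bi.intros)
  next
    case True
    have "(t k * x k ^ p * ?e) * x (Suc k) ^ q
        = x (Suc k) ^ p * (t k * x (Suc k) ^ q * ?e) - hs k p * x (Suc k) ^ q * ?e"
      unfolding True t_xp_eq[OF len k] by (simp add: left_diff_distrib mult.assoc x_pow_e)
    also have "\<dots> = x k ^ q * x (Suc k) ^ p * t k * ?e
        + (x (Suc k) ^ p * hs k q - hs k p * x (Suc k) ^ q) * ?e"
      unfolding True t_xSp_eq[OF len k] using x_pow_pow[of k q "Suc k" p]
      by (simp add: mult.assoc[symmetric] distrib_left left_diff_distrib)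
    finally have eq: "t k * (x k ^ p * x (Suc k) ^ q) * ?e = x k ^ q * x (Suc k) ^ p * t k * ?e
        + (x (Suc k) ^ p * hs k q - hs k p * x (Suc k) ^ q) * ?e" using st by simp
    have c: "x (Suc k) ^ p * hs k q = hs k q * x (Suc k) ^ p"
      using comm_power[of "hs k q" "x (Suc k)" p] hs_comm by simp
    have "bi k (int q - 1 + int 0 + int p) (hs k q * (x k ^ 0 * x (Suc k) ^ p))"
         "bi k (int p - 1 + int 0 + int q) (hs k p * (x k ^ 0 * x (Suc k) ^ q))"
      by (intro bi_mult bi_hs)+
    then have "bi k (int (p + q) - 1) (hs k q * x (Suc k) ^ p)"
         "bi k (int (p + q) - 1) (hs k p * x (Suc k) ^ q)"
      by (simp_all add: algebra_simps)
    then have "bi k (int (p + q) - 1) (hs k q * x (Suc k) ^ p + sc (- 1) * (hs k p * x (Suc k) ^ q))"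
      by (intro bi_add bi_sc)
    then show ?thesis using eq True unfolding c
      by (intro exI[of _ "hs k q * x (Suc k) ^ p - hs k p * x (Suc k) ^ q"]) (simp flip: uminus_sc)
  qed
qed

text \<open>
  \<open>hm \<nu> \<mu> r y\<close>: \<open>y\<close> is a combination of words in the \<open>x\<^sub>k\<close> and \<open>\<tau>\<^sub>l\<close> alone which, applied to \<open>e(\<nu>\<rho>)\<close> for
  any tail \<open>\<rho>\<close>, is homogeneous of degree \<open>r\<close> and lands in \<open>e(\<mu>\<rho>)\<close>. The idempotents are kept out of the
  words, so that one \<open>y\<close> serves all \<open>\<rho>\<close>.
\<close>

inductive hm :: "'i list \<Rightarrow> 'i list \<Rightarrow> rat \<Rightarrow> 'a \<Rightarrow> bool" for \<nu> where
  hm_one: "hm \<nu> \<nu> 0 1"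
| hm_zero: "mset \<mu> = mset \<nu> \<Longrightarrow> hm \<nu> \<mu> r 0"
| hm_x: "hm \<nu> (\<theta> @ i # \<rho>) r y \<Longrightarrow> hm \<nu> (\<theta> @ i # \<rho>) (r + dg i i) (x (Suc (length \<theta>)) * y)"
| hm_t: "hm \<nu> (\<theta> @ i # j # \<rho>) r y \<Longrightarrow> hm \<nu> (\<theta> @ j # i # \<rho>) (r - dg i j) (t (Suc (length \<theta>)) * y)"
| hm_add: "hm \<nu> \<mu> r y \<Longrightarrow> hm \<nu> \<mu> r z \<Longrightarrow> hm \<nu> \<mu> r (y + z)"
| hm_sc: "hm \<nu> \<mu> r y \<Longrightarrow> hm \<nu> \<mu> r (sc c * y)"

section \<open>Words without idempotents\<close>

lemma hm_mset: "hm \<nu> \<mu> r y \<Longrightarrow> mset \<mu> = mset \<nu>"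
  by (induction rule: hm.induct) (auto simp: add_mset_commute)

lemma hm_length: "hm \<nu> \<mu> r y \<Longrightarrow> length \<mu> = length \<nu>"
  using hm_mset mset_eq_length by blast

lemma hm_trans: "hm \<mu> \<kappa> s z \<Longrightarrow> hm \<nu> \<mu> r y \<Longrightarrow> hm \<nu> \<kappa> (r + s) (z * y)"
proof (induction rule: hm.induct)
  case (hm_zero \<kappa> s)
  then show ?case using hm_mset by (auto intro: hm.hm_zero)
next
  case (hm_x \<theta> i \<rho> s z)
  then show ?case using hm.hm_x[of \<nu> \<theta> i \<rho> "r + s" "z * y"] by (simp add: add.assoc mult.assoc)
next
  case (hm_t \<theta> i j \<rho> s z)
  then show ?case using hm.hm_t[of \<nu> \<theta> i j \<rho> "r + s" "z * y"] by (simp add: add_diff_eq mult.assoc)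
qed (auto simp: distrib_right mult.assoc intro: hm.intros)

lemma hm_ext: "hm \<nu> \<mu> r y \<Longrightarrow> hm (\<nu> @ \<rho>) (\<mu> @ \<rho>) r y"
proof (induction rule: hm.induct)
  case (hm_x \<theta> i \<kappa> s z)
  then show ?case using hm.hm_x[of "\<nu> @ \<rho>" \<theta> i "\<kappa> @ \<rho>"] by simp
next
  case (hm_t \<theta> i j \<kappa> s z)
  then show ?case using hm.hm_t[of "\<nu> @ \<rho>" \<theta> i j "\<kappa> @ \<rho>"] by simp
qed (auto intro: hm.intros)

lemma hm_e: "hm \<nu> \<mu> r y \<Longrightarrow> length \<nu> + length \<rho> = n \<Longrightarrow> y * e (\<nu> @ \<rho>) = e (\<mu> @ \<rho>) * y"
proof (induction rule: hm.induct)
  case (hm_x \<theta> i \<kappa> s z)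
  then show ?case by (simp add: mult.assoc) (simp add: x_e flip: mult.assoc)
next
  case (hm_t \<theta> i j \<kappa> s z)
  have "length \<theta> + 2 + length (\<kappa> @ \<rho>) = n" using hm_length[OF hm_t.hyps] hm_t.prems by simp
  from t_e[OF this, of i j] hm_t show ?case by (simp add: mult.assoc) (simp flip: mult.assoc)
next
  case (hm_sc \<mu> r y c)
  then show ?case by (metis mult.assoc sc_comm)
qed (auto simp: distrib_left distrib_right)

lemma hm_commute:
  "hm \<nu> \<mu> r y \<Longrightarrow> (\<And>k. 1 \<le> k \<Longrightarrow> k \<le> length \<nu> \<Longrightarrow> z * x k = x k * z) \<Longrightarrow>
    (\<And>l. 1 \<le> l \<Longrightarrow> l < length \<nu> \<Longrightarrow> z * t l = t l * z) \<Longrightarrow> z * y = y * z"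
proof (induction rule: hm.induct)
  case (hm_x \<theta> i \<kappa> s w)
  then show ?case using hm_length[OF hm_x.hyps] by (intro comm_times) auto
next
  case (hm_t \<theta> i j \<kappa> s w)
  then show ?case using hm_length[OF hm_t.hyps] by (intro comm_times) auto
next
  case (hm_sc \<mu> r y c)
  then show ?case by (intro comm_times sc_comm[symmetric]) auto
qed (auto intro: comm_add)

lemma hm_comm_x: "hm \<nu> \<mu> r y \<Longrightarrow> length \<nu> < k \<Longrightarrow> x k * y = y * x k"
  by (erule hm_commute) (auto simp: x_x t_x_far)

lemma hm_comm_xp: "hm \<nu> \<mu> r y \<Longrightarrow> length \<nu> < k \<Longrightarrow> x k ^ p * y = y * x k ^ p"
  using comm_power[of y "x k" p] hm_comm_x by metis

lemma hm_comm_t: "hm \<nu> \<mu> r y \<Longrightarrow> length \<nu> < k \<Longrightarrow> t k * y = y * t k"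
  by (erule hm_commute) (auto simp: t_x_far t_t_far[symmetric])

lemma hm_Alg: "hm \<nu> \<mu> r y \<Longrightarrow> y \<in> Alg"
  by (induction rule: hm.induct)
    (use Alg_1 Alg_sc[of 1 0] in \<open>auto intro: Alg_x Alg_t Alg_mult Alg_add Alg_sc simp: sc_0\<close>)

lemma hm_xp: "hm \<nu> (\<theta> @ i # \<rho>) r y \<Longrightarrow> k = Suc (length \<theta>) \<Longrightarrow>
  hm \<nu> (\<theta> @ i # \<rho>) (r + of_nat p * dg i i) (x k ^ p * y)"
proof (induction p)
  case (Suc p)
  then show ?case using hm_x[of \<nu> \<theta> i \<rho> "r + of_nat p * dg i i" "x k ^ p * y"]
    by (simp add: mult.assoc algebra_simps)
qed simp

lemma hm_xp1: "k = Suc (length \<theta>) \<Longrightarrow> hm (\<theta> @ i # \<rho>) (\<theta> @ i # \<rho>) (of_nat p * dg i i) (x k ^ p)"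
  using hm_xp[OF hm_one, of k \<theta> i \<rho> p] by simp

lemma hm_t1: "k = Suc (length \<theta>) \<Longrightarrow> hm (\<theta> @ i # j # \<rho>) (\<theta> @ j # i # \<rho>) (- dg i j) (t k)"
  using hm_t[OF hm_one, of \<theta> i j \<rho>] by simp

lemma hm_sum: "mset \<mu> = mset \<nu> \<Longrightarrow> (\<And>a. a \<in> A \<Longrightarrow> hm \<nu> \<mu> r (f a)) \<Longrightarrow> hm \<nu> \<mu> r (\<Sum>a\<in>A. f a)"
  by (induction A rule: infinite_finite_induct) (auto intro: hm.intros)

section \<open>Normal forms over the words on one strand fewer\<close>

text \<open>With m the length of \<theta>: a word on m + 1 strands is a sum of words on m strands
  times powers of x_{m+1} and of terms in which a single \<tau>_m separates two words on m strands.
  This is the spanning half of a basis theorem, with degrees and end sequences recorded; i' is the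
  letter that ends up in the last place.\<close>

inductive dec :: "'i list \<Rightarrow> 'i \<Rightarrow> 'i list \<Rightarrow> 'i list \<Rightarrow> 'i \<Rightarrow> rat \<Rightarrow> 'a \<Rightarrow> bool" for \<theta> i \<rho> where
  dec_x: "hm \<theta> \<theta>' r0 y \<Longrightarrow> r = r0 + of_nat s * dg i i \<Longrightarrow>
    dec \<theta> i \<rho> \<theta>' i r (y * x (Suc (length \<theta>)) ^ s * e (\<theta> @ i # \<rho>))"
| dec_t: "hm \<theta> (\<kappa> @ [i']) r2 y2 \<Longrightarrow> hm (\<kappa> @ [i]) \<theta>' r1 y1 \<Longrightarrow>
    r = r1 + r2 + of_nat s * dg i' i' - dg i' i \<Longrightarrow>
    dec \<theta> i \<rho> \<theta>' i' r (y1 * x (Suc (length \<theta>)) ^ s * t (length \<theta>) * y2 * e (\<theta> @ i # \<rho>))"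
| dec_0: "dec \<theta> i \<rho> \<theta>' i' r 0"
| dec_add: "dec \<theta> i \<rho> \<theta>' i' r y \<Longrightarrow> dec \<theta> i \<rho> \<theta>' i' r z \<Longrightarrow> dec \<theta> i \<rho> \<theta>' i' r (y + z)"
| dec_sc: "dec \<theta> i \<rho> \<theta>' i' r y \<Longrightarrow> dec \<theta> i \<rho> \<theta>' i' r (sc c * y)"

lemma dec_sum: "(\<And>a. a \<in> A \<Longrightarrow> dec \<theta> i \<rho> \<theta>' i' r (f a)) \<Longrightarrow> dec \<theta> i \<rho> \<theta>' i' r (\<Sum>a\<in>A. f a)"
  by (induction A rule: infinite_finite_induct) (auto intro: dec.intros)

lemma sc_left: "y * (sc c * z) = sc c * (y * z)"
  by (metis mult.assoc sc_comm)

lemma dec_hm: "dec \<theta> i \<rho> \<theta>' i' r z \<Longrightarrow> hm \<theta>' \<theta>'' s y \<Longrightarrow> dec \<theta> i \<rho> \<theta>'' i' (r + s) (y * z)"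
proof (induction rule: dec.induct)
  case (dec_x \<theta>' r0 y0 r p)
  then have "hm \<theta> \<theta>'' (r0 + s) (y * y0)" by (auto intro: hm_trans)
  from dec.dec_x[OF this refl, of i \<rho> p] dec_x show ?case by (simp add: mult.assoc algebra_simps)
next
  case (dec_t \<kappa> i' r2 y2 \<theta>' r1 y1 r p)
  then have h: "hm (\<kappa> @ [i]) \<theta>'' (r1 + s) (y * y1)" by (auto intro: hm_trans)
  have "dec \<theta> i \<rho> \<theta>'' i' (r + s) ((y * y1) * x (Suc (length \<theta>)) ^ p * t (length \<theta>) * y2 * e (\<theta> @ i # \<rho>))"
    by (rule dec.dec_t[OF dec_t(1) h]) (use dec_t(3) in simp)
  then show ?case by (simp add: mult.assoc)
qed (auto simp: distrib_left sc_left intro: dec.intros)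

lemma dec_xp: "dec \<theta> i \<rho> \<theta>' i' r z \<Longrightarrow> dec \<theta> i \<rho> \<theta>' i' (r + of_nat p * dg i' i') (x (Suc (length \<theta>)) ^ p * z)"
proof (induction rule: dec.induct)
  case (dec_x \<theta>' r0 y0 r q)
  have "x (Suc (length \<theta>)) ^ p * (y0 * x (Suc (length \<theta>)) ^ q * e (\<theta> @ i # \<rho>))
    = y0 * x (Suc (length \<theta>)) ^ (p + q) * e (\<theta> @ i # \<rho>)"
    using hm_comm_xp[OF dec_x(1), of "Suc (length \<theta>)" p] by (simp add: power_add flip: mult.assoc)
  then show ?case using dec.dec_x[OF dec_x(1) refl, of i \<rho> "p + q"] dec_x by (simp add: algebra_simps)
next
  case (dec_t \<kappa> i' r2 y2 \<theta>' r1 y1 r q)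
  have "length (\<kappa> @ [i]) < Suc (length \<theta>)" using hm_length[OF dec_t(1)] by simp
  then have "x (Suc (length \<theta>)) ^ p * (y1 * x (Suc (length \<theta>)) ^ q * t (length \<theta>) * y2 * e (\<theta> @ i # \<rho>))
    = y1 * x (Suc (length \<theta>)) ^ (p + q) * t (length \<theta>) * y2 * e (\<theta> @ i # \<rho>)"
    using hm_comm_xp[OF dec_t(2), of "Suc (length \<theta>)" p] by (simp add: power_add flip: mult.assoc)
  moreover have "dec \<theta> i \<rho> \<theta>' i' (r + of_nat p * dg i' i')
      (y1 * x (Suc (length \<theta>)) ^ (p + q) * t (length \<theta>) * y2 * e (\<theta> @ i # \<rho>))"
    by (rule dec.dec_t[OF dec_t(1,2)]) (use dec_t(3) in \<open>simp add: algebra_simps\<close>)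
  ultimately show ?case by (simp only:)
qed (auto simp: distrib_left sc_left intro: dec.intros)

lemma dec_xx:
  assumes "dec \<theta> i \<rho> (\<psi> @ [j]) i' r z" "length \<theta> = Suc (length \<psi>)"
    "s = r + of_nat p * dg j j + of_nat q * dg i' i'"
  shows "dec \<theta> i \<rho> (\<psi> @ [j]) i' s (x (length \<theta>) ^ p * x (Suc (length \<theta>)) ^ q * z)"
  using dec_hm[OF dec_xp[OF assms(1), of q] hm_xp1[of "length \<theta>" \<psi> j "[]" p]] assms
  by (simp add: mult.assoc algebra_simps)

lemma dec_bi:
  assumes "bi (length \<theta>) d R" "dec \<theta> i \<rho> (\<psi> @ [j]) j r z" "length \<theta> = Suc (length \<psi>)"
  shows "dec \<theta> i \<rho> (\<psi> @ [j]) j (r + of_int d * dg j j) (R * z)"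
  using assms(1)
proof (induction rule: bi.induct)
  case (bi_base a b d)
  show ?case by (rule dec_xx[OF assms(2,3)]) (auto simp: algebra_simps simp flip: bi_base)
qed (auto simp: distrib_right mult.assoc intro: dec.intros)

lemma dec_1: "dec \<theta> i \<rho> \<theta> i 0 (e (\<theta> @ i # \<rho>))"
  using dec_x[OF hm_one, of 0 0] by simp

text \<open>What is needed of z so that \<tau>_m may be applied after any polynomial in x_m and
  x_{m+1}: its last two letters j, i' are known, and both z and \<tau>_m z have normal
  forms.\<close>

definition good where
  "good \<theta> i \<rho> \<psi> j i' r z \<longleftrightarrow> e (\<psi> @ j # i' # \<rho>) * z = z \<and> dec \<theta> i \<rho> (\<psi> @ [j]) i' r z \<and>
     dec \<theta> i \<rho> (\<psi> @ [i']) j (r - dg j i') (t (length \<theta>) * z)"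

lemma good_hm:
  assumes g: "good \<theta> i \<rho> \<psi> j i' r z" and y: "hm \<psi> \<psi>' s y"
    and len: "length \<theta> = Suc (length \<psi>)" "length \<theta> + 1 + length \<rho> = n"
  shows "good \<theta> i \<rho> \<psi>' j i' (r + s) (y * z)"
proof -
  have "e (\<psi>' @ j # i' # \<rho>) * y = y * e (\<psi> @ j # i' # \<rho>)"
    using hm_e[OF y, of "j # i' # \<rho>"] len by simp
  then have "e (\<psi>' @ j # i' # \<rho>) * (y * z) = y * z"
    using g by (simp add: good_def flip: mult.assoc) (simp add: good_def mult.assoc)
  moreover have "dec \<theta> i \<rho> (\<psi>' @ [j]) i' (r + s) (y * z)"
    using g dec_hm[OF _ hm_ext[OF y, of "[j]"]] by (simp add: good_def)
  moreover have "t (length \<theta>) * y = y * t (length \<theta>)" using hm_comm_t[OF y] len by simp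
  then have "dec \<theta> i \<rho> (\<psi>' @ [i']) j (r + s - dg j i') (t (length \<theta>) * (y * z))"
    using g dec_hm[OF _ hm_ext[OF y, of "[i']"], of \<theta> i \<rho> j "r - dg j i'" "t (length \<theta>) * z"]
    by (simp add: good_def algebra_simps flip: mult.assoc)
  ultimately show ?thesis by (simp add: good_def)
qed

text \<open>The polynomial is moved to the left of \<tau>_m. Its remainder, a divided difference,
  multiplies z itself and occurs for j = i' only.\<close>

lemma good_xx:
  assumes g: "good \<theta> i \<rho> \<psi> j i' r z" and len: "length \<theta> = Suc (length \<psi>)" "length \<theta> + 1 + length \<rho> = n"
  shows "dec \<theta> i \<rho> (\<psi> @ [i']) j (r + of_nat p * dg j j + of_nat q * dg i' i' - dg j i')
    (t (length \<theta>) * (x (length \<theta>) ^ p * x (Suc (length \<theta>)) ^ q * z))"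
proof -
  let ?m = "length \<theta>" and ?e = "e (\<psi> @ j # i' # \<rho>)"
  have len': "length \<psi> + 2 + length \<rho> = n" using len by simp
  from t_bi[OF len' len(1), of p q j i'] obtain R where R: "bi ?m (int (p + q) - 1) R"
    "j \<noteq> i' \<Longrightarrow> R = 0" "t ?m * (x ?m ^ p * x (Suc ?m) ^ q) * ?e
      = x ?m ^ q * x (Suc ?m) ^ p * t ?m * ?e + R * ?e" by blast
  have "?e * z = z" using g by (simp add: good_def)
  then have eq: "t ?m * (x ?m ^ p * x (Suc ?m) ^ q * z)
      = x ?m ^ q * x (Suc ?m) ^ p * (t ?m * z) + R * z"
    using arg_cong[OF R(3), of "\<lambda>y. y * z"] by (simp add: distrib_right mult.assoc)
  have "dec \<theta> i \<rho> (\<psi> @ [i']) j (r + of_nat p * dg j j + of_nat q * dg i' i' - dg j i')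
      (x ?m ^ q * x (Suc ?m) ^ p * (t ?m * z))"
    using g len by (intro dec_xx[of _ _ _ _ _ _ "r - dg j i'"]) (auto simp: good_def)
  moreover have "dec \<theta> i \<rho> (\<psi> @ [i']) j (r + of_nat p * dg j j + of_nat q * dg i' i' - dg j i') (R * z)"
  proof (cases "j = i'")
    case True
    then show ?thesis using dec_bi[OF R(1) _ len(1), of i \<rho> j r z] g
      by (simp add: good_def algebra_simps)
  qed (simp add: R(2) dec_0)
  ultimately show ?thesis unfolding eq by (rule dec_add)
qed

lemma good_hm_e:
  assumes y: "hm \<theta> (\<psi> @ [j]) r y" and len: "length \<theta> + 1 + length \<rho> = n"
  shows "good \<theta> i \<rho> \<psi> j i r (y * e (\<theta> @ i # \<rho>))"
proof -
  have "y * e (\<theta> @ i # \<rho>) = e (\<psi> @ j # i # \<rho>) * y"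
    using hm_e[OF y, of "i # \<rho>"] len by simp
  then have "e (\<psi> @ j # i # \<rho>) * (y * e (\<theta> @ i # \<rho>)) = y * e (\<theta> @ i # \<rho>)"
    by (simp add: e_idem flip: mult.assoc)
  moreover have "dec \<theta> i \<rho> (\<psi> @ [j]) i r (y * e (\<theta> @ i # \<rho>))"
    using dec_x[OF y refl, of i \<rho> 0] by simp
  moreover have "dec \<theta> i \<rho> (\<psi> @ [i]) j (r - dg j i) (t (length \<theta>) * (y * e (\<theta> @ i # \<rho>)))"
    using dec_t[OF y hm_one refl, of i \<rho> 0] by (simp add: mult.assoc)
  ultimately show ?thesis by (simp add: good_def)
qed

text \<open>\<tau>_m meets a term without \<tau>_m. The coefficient w has already been expanded one
  strand lower, so \<tau>_m stands next to a power of x_m or, through it, to \<tau>_{m-1}.\<close>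

lemma t_dec_x:
  assumes "dec \<psi> j0 (i # \<rho>) \<theta>0 j r w" "length \<psi> + 2 + length \<rho> = n"
  shows "dec (\<psi> @ [j0]) i \<rho> (\<theta>0 @ [i]) j (r + of_nat q * dg i i - dg j i)
    (t (Suc (length \<psi>)) * (w * x (Suc (Suc (length \<psi>))) ^ q))"
  using assms(1)
proof (induction rule: dec.induct)
  case (dec_x \<theta>0 r0 y r s)
  let ?m = "Suc (length \<psi>)" and ?e = "e (\<psi> @ j0 # i # \<rho>)"
  have "good (\<psi> @ [j0]) i \<rho> \<psi> j0 i 0 (1 * e ((\<psi> @ [j0]) @ i # \<rho>))"
    by (rule good_hm_e[OF hm_one]) (use assms in simp)
  then have "good (\<psi> @ [j0]) i \<rho> \<theta>0 j0 i r0 (y * ?e)"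
    using good_hm[of "\<psi> @ [j0]" i \<rho> \<psi> j0 i 0 ?e \<theta>0 r0 y] dec_x assms by simp
  then have "dec (\<psi> @ [j0]) i \<rho> (\<theta>0 @ [i]) j0 (r0 + of_nat s * dg j0 j0 + of_nat q * dg i i - dg j0 i)
    (t ?m * (x ?m ^ s * x (Suc ?m) ^ q * (y * ?e)))"
    using good_xx[of "\<psi> @ [j0]" i \<rho> \<theta>0 j0 i r0 "y * ?e" s q] hm_length[OF dec_x(1)] assms by simp
  moreover have "y * x ?m ^ s * ?e * x (Suc ?m) ^ q = x ?m ^ s * x (Suc ?m) ^ q * (y * ?e)"
    using hm_comm_xp[OF dec_x(1), of ?m s] hm_comm_xp[OF dec_x(1), of "Suc ?m" q]
    by (simp add: mult.assoc flip: x_pow_e) (simp flip: mult.assoc)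
  ultimately show ?case using dec_x by simp
next
  case (dec_t \<kappa> j r2 y2 \<theta>0 r1 y1 r s)
  let ?l = "length \<psi>" let ?m = "Suc ?l" and ?e = "e (\<psi> @ j0 # i # \<rho>)"
  have l: "?l = Suc (length \<kappa>)" using hm_length[OF dec_t(1)] by simp
  have "hm (\<psi> @ [j0]) ((\<kappa> @ [j0]) @ [j]) (r2 - dg j j0) (t ?l * y2)"
    using hm_t[of "\<psi> @ [j0]" \<kappa> j j0 "[]" r2 y2] hm_ext[OF dec_t(1), of "[j0]"] l by simp
  from good_hm_e[OF this, of \<rho> i]
  have "good (\<psi> @ [j0]) i \<rho> (\<kappa> @ [j0]) j i (r2 - dg j j0) (t ?l * y2 * ?e)"
    using assms by simp
  from good_hm[OF this dec_t(2)]
  have "good (\<psi> @ [j0]) i \<rho> \<theta>0 j i (r2 - dg j j0 + r1) (y1 * (t ?l * y2 * ?e))"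
    using assms l by simp
  from good_xx[OF this, of s q]
  have "dec (\<psi> @ [j0]) i \<rho> (\<theta>0 @ [i]) j (r2 - dg j j0 + r1 + of_nat s * dg j j + of_nat q * dg i i - dg j i)
    (t ?m * (x ?m ^ s * x (Suc ?m) ^ q * (y1 * (t ?l * y2 * ?e))))"
    using assms l hm_length[OF dec_t(2)] by simp
  moreover have "y1 * x ?m ^ s * t ?l * y2 * ?e * x (Suc ?m) ^ q
      = x ?m ^ s * x (Suc ?m) ^ q * (y1 * (t ?l * y2 * ?e))"
  proof -
    have c: "x ?m ^ s * y1 = y1 * x ?m ^ s" "x (Suc ?m) ^ q * y1 = y1 * x (Suc ?m) ^ q"
      "x (Suc ?m) ^ q * y2 = y2 * x (Suc ?m) ^ q" "t ?l * x (Suc ?m) ^ q = x (Suc ?m) ^ q * t ?l"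
      using hm_comm_xp[OF dec_t(2)] hm_comm_xp[OF dec_t(1)] l by (auto intro: t_pow_far)
    have "x ?m ^ s * x (Suc ?m) ^ q * (y1 * (t ?l * y2 * ?e)) = x ?m ^ s * y1 * (x (Suc ?m) ^ q * t ?l) * y2 * ?e"
      by (simp add: mult.assoc) (simp add: c flip: mult.assoc)
    also have "\<dots> = x ?m ^ s * y1 * t ?l * (x (Suc ?m) ^ q * y2) * ?e"
      by (simp only: c(4)[symmetric] mult.assoc)
    also have "\<dots> = y1 * x ?m ^ s * t ?l * y2 * (x (Suc ?m) ^ q * ?e)" by (simp only: c mult.assoc)
    finally show ?thesis by (simp only: x_pow_e mult.assoc)
  qed
  ultimately show ?case unfolding dec_t(3) by (simp only: algebra_simps)
qed (auto simp: distrib_left distrib_right mult.assoc sc_left intro: dec.intros)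

text \<open>Two \<tau>_m meet. The quadratic relation leaves a polynomial of the right degree, by
  homogeneity of Q.\<close>

lemma good_tt:
  assumes y2: "hm \<theta> (\<kappa> @ [i']) r2 y2" and len: "length \<theta> = Suc (length \<kappa>)" "length \<theta> + 1 + length \<rho> = n"
  shows "good \<theta> i \<rho> \<kappa> i i' (r2 - dg i' i) (t (length \<theta>) * y2 * e (\<theta> @ i # \<rho>))"
proof -
  let ?m = "length \<theta>" and ?e = "e (\<theta> @ i # \<rho>)"
  have len': "length \<kappa> + 2 + length \<rho> = n" using len by simp
  have y2e: "y2 * ?e = e (\<kappa> @ i' # i # \<rho>) * (y2 * ?e)"
  proof -
    have "y2 * ?e = e (\<kappa> @ i' # i # \<rho>) * y2" using hm_e[OF y2, of "i # \<rho>"] len by simp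
    then show ?thesis by (simp add: e_idem flip: mult.assoc)
  qed
  have "t ?m * y2 * ?e = t ?m * e (\<kappa> @ i' # i # \<rho>) * (y2 * ?e)"
    using y2e by (simp only: mult.assoc)
  also have "\<dots> = e (\<kappa> @ i # i' # \<rho>) * (t ?m * (y2 * ?e))"
    unfolding t_ek[OF len' len(1)] by (simp only: mult.assoc)
  finally have "t ?m * y2 * ?e = e (\<kappa> @ i # i' # \<rho>) * (t ?m * y2 * ?e)"
    by (simp add: e_idem flip: mult.assoc)
  moreover have "dec \<theta> i \<rho> (\<kappa> @ [i]) i' (r2 - dg i' i) (t ?m * y2 * ?e)"
    using dec_t[OF y2 hm_one refl, of i \<rho> 0] by simp
  moreover have "dec \<theta> i \<rho> (\<kappa> @ [i']) i (r2 - dg i' i - dg i i') (t ?m * (t ?m * y2 * ?e))"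
  proof (cases "i \<in> I \<and> i' \<in> I")
    case False
    then have "e (\<kappa> @ i' # i # \<rho>) = 0" by (intro e_I) auto
    then show ?thesis using y2e dec_0 by (simp add: mult.assoc)
  next
    case True
    let ?Q = "\<Sum>a\<le>nat (- ca i' i). \<Sum>b\<le>nat (- ca i i'). sc (cf i' i a b) * (x ?m ^ a * x (Suc ?m) ^ b)"
    have "t ?m * (t ?m * y2 * ?e) = t ?m * t ?m * e (\<kappa> @ i' # i # \<rho>) * (y2 * ?e)"
      using y2e by (simp add: mult.assoc)
    also have "\<dots> = ?Q * (y2 * ?e)"
      unfolding t_t[OF len' len(1)] using y2e by (simp add: mult.assoc)
    also have "\<dots> = (\<Sum>a\<le>nat (- ca i' i). \<Sum>b\<le>nat (- ca i i').
        sc (cf i' i a b) * (x ?m ^ a * x (Suc ?m) ^ b * (y2 * ?e)))"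
      by (simp only: sum_distrib_right mult.assoc)
    finally have eq: "t ?m * (t ?m * y2 * ?e) = \<dots>" .
    have d: "dec \<theta> i \<rho> (\<kappa> @ [i']) i r2 (y2 * ?e)" using dec_x[OF y2 refl, of i \<rho> 0] by simp
    show ?thesis unfolding eq
    proof (intro dec_sum)
      fix a b
      show "dec \<theta> i \<rho> (\<kappa> @ [i']) i (r2 - dg i' i - dg i i')
        (sc (cf i' i a b) * (x ?m ^ a * x (Suc ?m) ^ b * (y2 * ?e)))"
      proof (cases "cf i' i a b = 0")
        case False
        then have "2 * dg i' i = - dg i' i' * of_nat a - dg i i * of_nat b" using True cf_hom by blast
        then have "r2 - dg i' i - dg i i' = r2 + of_nat a * dg i' i' + of_nat b * dg i i"
          using dg_sym[of i i'] by (simp add: algebra_simps)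
        from dec_xx[OF d len(1) this] show ?thesis by (rule dec_sc)
      qed (simp add: sc_0 dec_0)
    qed
  qed
  ultimately show ?thesis by (simp add: good_def)
qed

text \<open>Here \<tau>_m \<tau>_{m-1} \<tau>_m arises. It is replaced by \<tau>_{m-1} \<tau>_m
  \<tau>_{m-1}, which is in normal form, plus the polynomial correction of the braid relation in
  three neighbouring variables.\<close>

lemma good_ttt:
  assumes Y: "hm \<theta> (\<kappa> @ [j, i']) r0 Y" and len: "length \<theta> = Suc (Suc (length \<kappa>))" "length \<theta> + 1 + length \<rho> = n"
    and l: "l = Suc (length \<kappa>)"
  shows "good \<theta> i \<rho> (\<kappa> @ [i]) j i' (r0 - dg i' i - dg j i) (t l * t (Suc l) * Y * e (\<theta> @ i # \<rho>))"
proof -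
  let ?m = "Suc l" and ?e = "e (\<theta> @ i # \<rho>)"
  have m: "length \<theta> = ?m" using len l by simp
  have len1: "length (\<kappa> @ [j]) + 2 + length \<rho> = n" "?m = Suc (length (\<kappa> @ [j]))" using len l by auto
  have len2: "length \<kappa> + 2 + length (i' # \<rho>) = n" using len l by simp
  have len3: "length \<kappa> + 3 + length \<rho> = n" using len by simp
  have Ye: "Y * ?e = e (\<kappa> @ j # i' # i # \<rho>) * (Y * ?e)"
  proof -
    have "Y * ?e = e (\<kappa> @ j # i' # i # \<rho>) * Y" using hm_e[OF Y, of "i # \<rho>"] len by simp
    then show ?thesis by (simp add: e_idem flip: mult.assoc)
  qed
  have "t ?m * e (\<kappa> @ j # i' # i # \<rho>) = e (\<kappa> @ j # i # i' # \<rho>) * t ?m"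
    using t_ek[OF len1, of i' i] by simp
  moreover have "t l * e (\<kappa> @ j # i # i' # \<rho>) = e (\<kappa> @ i # j # i' # \<rho>) * t l"
    using t_ek[OF len2 l, of j i] by simp
  ultimately have "t l * t ?m * e (\<kappa> @ j # i' # i # \<rho>) = e (\<kappa> @ i # j # i' # \<rho>) * (t l * t ?m)"
    by (simp add: mult.assoc) (simp flip: mult.assoc)
  moreover have "t l * t ?m * Y * ?e = t l * t ?m * e (\<kappa> @ j # i' # i # \<rho>) * (Y * ?e)"
    using Ye by (simp only: mult.assoc)
  ultimately have "t l * t ?m * Y * ?e = e (\<kappa> @ i # j # i' # \<rho>) * (t l * t ?m * Y * ?e)"
    by (simp add: mult.assoc)
  moreover have "dec \<theta> i \<rho> ((\<kappa> @ [i]) @ [j]) i' (r0 - dg i' i - dg j i) (t l * t ?m * Y * ?e)"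
  proof -
    have "hm \<theta> ((\<kappa> @ [j]) @ [i']) r0 Y" using Y by simp
    moreover have "hm ((\<kappa> @ [j]) @ [i]) (\<kappa> @ [i, j]) (- dg j i) (t l)" using hm_t1[OF l, of j i "[]"] by simp
    ultimately have "dec \<theta> i \<rho> (\<kappa> @ [i, j]) i' (r0 - dg i' i - dg j i)
        (t l * x (Suc (length \<theta>)) ^ 0 * t (length \<theta>) * Y * e (\<theta> @ i # \<rho>))"
      by (rule dec_t) simp
    then show ?thesis using m by simp
  qed
  moreover have "dec \<theta> i \<rho> ((\<kappa> @ [i]) @ [i']) j (r0 - dg i' i - dg j i - dg j i')
      (t ?m * (t l * t ?m * Y * ?e))"
  proof -
    let ?E = "e (\<kappa> @ j # i' # i # \<rho>)"
    let ?B = "(t ?m * t l * t ?m - t l * t ?m * t l) * ?E"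
    have "t ?m * (t l * t ?m * Y * ?e) = t l * t ?m * t l * Y * ?e + (t ?m * t l * t ?m - t l * t ?m * t l) * (Y * ?e)"
      by (simp add: left_diff_distrib mult.assoc)
    also have "(t ?m * t l * t ?m - t l * t ?m * t l) * (Y * ?e) = ?B * (Y * ?e)"
      using Ye by (simp only: mult.assoc)
    finally have eq: "t ?m * (t l * t ?m * Y * ?e) = t l * t ?m * t l * Y * ?e + ?B * (Y * ?e)" .
    have "hm \<theta> ((\<kappa> @ [i']) @ [j]) (r0 - dg j i') (t l * Y)"
      using hm_t[of \<theta> \<kappa> j i' "[]" r0 Y] Y l by simp
    moreover have "hm ((\<kappa> @ [i']) @ [i]) (\<kappa> @ [i, i']) (- dg i' i) (t l)"
      using hm_t1[OF l, of i' i "[]"] by simp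
    ultimately have "dec \<theta> i \<rho> (\<kappa> @ [i, i']) j (r0 - dg i' i - dg j i - dg j i')
        (t l * x (Suc (length \<theta>)) ^ 0 * t (length \<theta>) * (t l * Y) * e (\<theta> @ i # \<rho>))"
      by (rule dec_t) simp
    then have 1: "dec \<theta> i \<rho> (\<kappa> @ [i, i']) j (r0 - dg i' i - dg j i - dg j i') (t l * t ?m * t l * Y * ?e)"
      using m by (simp add: mult.assoc)
    have 2: "dec \<theta> i \<rho> (\<kappa> @ [i, i']) j (r0 - dg i' i - dg j i - dg j i') (?B * (Y * ?e))"
    proof (cases "j = i \<and> j \<in> I \<and> i' \<in> I")
      case False
      moreover have "?E = 0" if "j \<notin> I \<or> i' \<notin> I" using that by (intro e_I) auto
      ultimately consider "j \<noteq> i" | "?E = 0" by blast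
      then have "?B = 0"
      proof cases
        case 1
        then show ?thesis using braid_neq[OF len3 l, of j i i'] by simp
      qed simp
      then show ?thesis by (simp add: dec_0)
    next
      case True
      have B: "?B * (Y * ?e) = (\<Sum>a\<le>nat (- ca j i'). \<Sum>b\<le>nat (- ca i' j). sc (cf j i' a b) *
          ((\<Sum>c<a. x l ^ c * x (Suc ?m) ^ (a - 1 - c) * (x ?m ^ b * (Y * ?e)))))"
        using braid_eq[OF len3 l, of j i'] True Ye
        by (simp add: sum_distrib_right mult.assoc)
      have d: "dec \<theta> i \<rho> ((\<kappa> @ [j]) @ [i']) j r0 (Y * ?e)"
        using dec_x[OF Y refl, of i \<rho> 0] True by simp
      show ?thesis unfolding B
      proof (intro dec_sum)
        fix a b
        show "dec \<theta> i \<rho> (\<kappa> @ [i, i']) j (r0 - dg i' i - dg j i - dg j i')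
          (sc (cf j i' a b) * ((\<Sum>c<a. x l ^ c * x (Suc ?m) ^ (a - 1 - c) * (x ?m ^ b * (Y * ?e)))))"
        proof (cases "cf j i' a b = 0")
          case False
          then have deg: "2 * dg j i' = - dg j j * of_nat a - dg i' i' * of_nat b" using True cf_hom by blast
          show ?thesis
          proof (intro dec_sc dec_sum)
            fix c assume "c \<in> {..<a}"
            then have a: "rat_of_nat a = rat_of_nat c + rat_of_nat (a - 1 - c) + 1"
              by (simp flip: of_nat_add of_nat_Suc)
            have "dec \<theta> i \<rho> ((\<kappa> @ [j]) @ [i']) j (r0 + of_nat b * dg i' i' + of_nat (a - 1 - c) * dg j j)
              (x (length \<theta>) ^ b * x (Suc (length \<theta>)) ^ (a - 1 - c) * (Y * ?e))"
              by (rule dec_xx[OF d]) (use len in auto)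
            then have "dec \<theta> i \<rho> (\<kappa> @ [j, i']) j (r0 + of_nat b * dg i' i' + of_nat (a - 1 - c) * dg j j)
              (x (Suc ?m) ^ (a - 1 - c) * (x ?m ^ b * (Y * ?e)))"
              using m x_pow_pow[of ?m b "Suc ?m" "a - 1 - c"] by (simp flip: mult.assoc)
            from dec_hm[OF this hm_xp1[OF l, of j "[i']" c]]
            have "dec \<theta> i \<rho> (\<kappa> @ [j, i']) j (r0 + of_nat b * dg i' i' + of_nat (a - 1 - c) * dg j j + of_nat c * dg j j)
              (x l ^ c * x (Suc ?m) ^ (a - 1 - c) * (x ?m ^ b * (Y * ?e)))"
              by (simp add: mult.assoc)
            \<comment> \<open>In the correction the two outer exponents add up to a - 1, one less
              than in Q. Since Q has degree -2 (\<alpha>_j, \<alpha>_i'), and i = j, this is the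
              degree of three crossings.\<close>
            moreover have "r0 + of_nat b * dg i' i' + of_nat (a - 1 - c) * dg j j + of_nat c * dg j j
              = r0 - dg i' i - dg j i - dg j i'"
            proof -
              have "of_nat (a - 1 - c) * dg j j + of_nat c * dg j j = of_nat a * dg j j - dg j j"
                unfolding a by (simp add: algebra_simps)
              then show ?thesis using deg True dg_sym[of i' j] by (simp add: algebra_simps)
            qed
            ultimately have "dec \<theta> i \<rho> (\<kappa> @ [j, i']) j (r0 - dg i' i - dg j i - dg j i')
              (x l ^ c * x (Suc ?m) ^ (a - 1 - c) * (x ?m ^ b * (Y * ?e)))" by (simp only:)
            then show "dec \<theta> i \<rho> (\<kappa> @ [i, i']) j (r0 - dg i' i - dg j i - dg j i')
              (x l ^ c * x (Suc ?m) ^ (a - 1 - c) * (x ?m ^ b * (Y * ?e)))" using True by simp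
          qed
        qed (simp add: sc_0 dec_0)
      qed
    qed
    show ?thesis unfolding eq using dec_add[OF 1 2] by simp
  qed
  ultimately show ?thesis using m by (simp add: good_def)
qed

lemma t_dec_t:
  assumes "dec \<kappa> i (i' # \<rho>) \<theta>0 j r w" and y2: "hm \<theta> (\<kappa> @ [i']) r2 y2"
    and len: "length \<theta> = Suc (length \<kappa>)" "length \<theta> + 1 + length \<rho> = n"
  shows "dec \<theta> i \<rho> (\<theta>0 @ [i']) j (r + r2 + of_nat q * dg i' i' - dg i' i - dg j i')
    (t (length \<theta>) * (w * x (Suc (length \<theta>)) ^ q * t (length \<theta>) * y2 * e (\<theta> @ i # \<rho>)))"
  using assms(1)
proof (induction rule: dec.induct)
  case (dec_x \<theta>0 r0 y r s)
  let ?m = "length \<theta>" and ?e = "e (\<theta> @ i # \<rho>)"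
  let ?z = "t ?m * y2 * ?e"
  have g: "good \<theta> i \<rho> \<kappa> i i' (r2 - dg i' i) ?z" by (rule good_tt[OF y2 len])
  from good_xx[OF good_hm[OF g dec_x(1) len], of s q]
  have "dec \<theta> i \<rho> (\<theta>0 @ [i']) i (r2 - dg i' i + r0 + of_nat s * dg i i + of_nat q * dg i' i' - dg i i')
    (t ?m * (x ?m ^ s * x (Suc ?m) ^ q * (y * ?z)))"
    using hm_length[OF dec_x(1)] len by simp
  moreover have "y * x (Suc (length \<kappa>)) ^ s * e (\<kappa> @ i # i' # \<rho>) * x (Suc ?m) ^ q * t ?m * y2 * ?e
      = x ?m ^ s * x (Suc ?m) ^ q * (y * ?z)"
  proof -
    have c: "x ?m ^ s * y = y * x ?m ^ s" "x (Suc ?m) ^ q * y = y * x (Suc ?m) ^ q"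
      using hm_comm_xp[OF dec_x(1)] len by auto
    have "y * x (Suc (length \<kappa>)) ^ s * e (\<kappa> @ i # i' # \<rho>) * x (Suc ?m) ^ q * t ?m * y2 * ?e
      = y * x ?m ^ s * x (Suc ?m) ^ q * (e (\<kappa> @ i # i' # \<rho>) * ?z)"
      using len(1) by (simp add: mult.assoc) (simp add: x_pow_e flip: mult.assoc)
    also have "e (\<kappa> @ i # i' # \<rho>) * ?z = ?z" using g by (simp add: good_def)
    also have "y * x ?m ^ s * x (Suc ?m) ^ q * ?z = x ?m ^ s * (x (Suc ?m) ^ q * y) * ?z"
      by (simp only: c mult.assoc) (simp only: c flip: mult.assoc)
    finally show ?thesis by (simp only: mult.assoc)
  qed
  ultimately show ?case using dec_x by (simp add: algebra_simps)
next
  case (dec_t \<kappa>2 j r2' y2' \<theta>0 r1 y1 r s)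
  let ?m = "length \<theta>" and ?l = "length \<kappa>" and ?e = "e (\<theta> @ i # \<rho>)" and ?E = "e (\<kappa> @ i # i' # \<rho>)"
  have l: "?l = Suc (length \<kappa>2)" using hm_length[OF dec_t(1)] by simp
  have "hm \<theta> ((\<kappa>2 @ [j]) @ [i']) (r2 + r2') (y2' * y2)"
    using hm_trans[OF hm_ext[OF dec_t(1), of "[i']"] y2] by simp
  then have "hm \<theta> (\<kappa>2 @ [j, i']) (r2 + r2') (y2' * y2)" by simp
  from good_ttt[OF this _ len(2) l, of i]
  have g: "good \<theta> i \<rho> (\<kappa>2 @ [i]) j i' (r2 + r2' - dg i' i - dg j i) (t ?l * t ?m * (y2' * y2) * ?e)"
    using len l by simp
  from good_xx[OF good_hm[OF g dec_t(2)], of s q]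
  have "dec \<theta> i \<rho> (\<theta>0 @ [i']) j (r2 + r2' - dg i' i - dg j i + r1 + of_nat s * dg j j + of_nat q * dg i' i' - dg j i')
    (t ?m * (x ?m ^ s * x (Suc ?m) ^ q * (y1 * (t ?l * t ?m * (y2' * y2) * ?e))))"
    using hm_length[OF dec_t(2)] len l by simp
  moreover have "y1 * x (Suc ?l) ^ s * t ?l * y2' * ?E * x (Suc ?m) ^ q * t ?m * y2 * ?e
      = x ?m ^ s * x (Suc ?m) ^ q * (y1 * (t ?l * t ?m * (y2' * y2) * ?e))"
  proof -
    have c: "x ?m ^ s * y1 = y1 * x ?m ^ s" "x (Suc ?m) ^ q * y1 = y1 * x (Suc ?m) ^ q"
      "x (Suc ?m) ^ q * y2' = y2' * x (Suc ?m) ^ q" "t ?l * x (Suc ?m) ^ q = x (Suc ?m) ^ q * t ?l"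
      "t ?m * y2' = y2' * t ?m"
      using hm_comm_xp[OF dec_t(2)] hm_comm_xp[OF dec_t(1)] hm_comm_t[OF dec_t(1)] l len
      by (auto intro: t_pow_far)
    have E: "?E * (t ?m * y2 * ?e) = t ?m * y2 * ?e"
      using good_tt[OF y2 len] by (simp add: good_def)
    have "y1 * x (Suc ?l) ^ s * t ?l * y2' * ?E * x (Suc ?m) ^ q * t ?m * y2 * ?e
      = y1 * x ?m ^ s * t ?l * y2' * (x (Suc ?m) ^ q * (?E * (t ?m * y2 * ?e)))"
      using len(1) by (simp only: mult.assoc flip: x_pow_e)
    also have "\<dots> = y1 * x ?m ^ s * (t ?l * x (Suc ?m) ^ q) * (y2' * t ?m) * y2 * ?e"
    proof -
      have "y2' * (x (Suc ?m) ^ q * z) = x (Suc ?m) ^ q * (y2' * z)" for z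
        using c(3) by (simp flip: mult.assoc)
      then show ?thesis unfolding E by (simp only: mult.assoc)
    qed
    also have "\<dots> = (x ?m ^ s * (x (Suc ?m) ^ q * y1)) * t ?l * t ?m * y2' * y2 * ?e"
      unfolding c(4) c(5)[symmetric] c(2) by (simp only: c(1) mult.assoc[symmetric])
    finally show ?thesis by (simp only: mult.assoc)
  qed
  ultimately show ?case unfolding dec_t(3) by (simp only: algebra_simps)
qed (auto simp: distrib_left distrib_right mult.assoc sc_left intro: dec.intros)

text \<open>Only the last crossing \<tau>_m can disturb a normal form. The left coefficient it meets
  is a word on m strands, so the induction hypothesis expands that coefficient and
  \<open>t_dec_x\<close> or \<open>t_dec_t\<close> applies.\<close>

lemma hm_dec:
  "hm (\<theta> @ [i]) (\<theta>' @ [i']) r y \<Longrightarrow> length \<theta> + 1 + length \<rho> = n \<Longrightarrow> dec \<theta> i \<rho> \<theta>' i' r (y * e (\<theta> @ i # \<rho>))"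
proof (induction "length \<theta>" arbitrary: \<theta> i \<rho> \<theta>' i' r y rule: less_induct)
  case less
  have t_dec: "dec \<theta> i \<rho> (\<psi> @ [i']) j (r - dg j i') (t (length \<theta>) * z)"
    if dz: "dec \<theta> i \<rho> (\<psi> @ [j]) i' r z" and lz: "length \<theta> = Suc (length \<psi>)" for \<psi> j i' r z
  proof -
    obtain \<theta>1 j0 where \<theta>: "\<theta> = \<theta>1 @ [j0]" using lz by (cases \<theta> rule: rev_cases) auto
    have "\<And>\<theta>'. dec \<theta> i \<rho> \<theta>' i' r z \<Longrightarrow> \<theta>' = \<psi> @ [j] \<Longrightarrow> dec \<theta> i \<rho> (\<psi> @ [i']) j (r - dg j i') (t (length \<theta>) * z)"
    \<comment> \<open>The end sequence is freed and recovered by an equation, so that the rule can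
      be applied to a composite end sequence.\<close>
    proof (erule dec.induct[where P = "\<lambda>\<theta>' i' r z. \<theta>' = \<psi> @ [j] \<longrightarrow> dec \<theta> i \<rho> (\<psi> @ [i']) j (r - dg j i') (t (length \<theta>) * z)", THEN mp])
      fix \<theta>' r0 y and r :: rat and s
      assume y: "hm \<theta> \<theta>' r0 y" "r = r0 + of_nat s * dg i i"
      show "\<theta>' = \<psi> @ [j] \<longrightarrow> dec \<theta> i \<rho> (\<psi> @ [i]) j (r - dg j i)
        (t (length \<theta>) * (y * x (Suc (length \<theta>)) ^ s * e (\<theta> @ i # \<rho>)))"
      proof
        assume \<theta>': "\<theta>' = \<psi> @ [j]"
        have "dec \<theta>1 j0 (i # \<rho>) \<psi> j r0 (y * e (\<theta>1 @ j0 # i # \<rho>))"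
          using less.hyps[of \<theta>1 j0 \<psi> j r0 y "i # \<rho>"] y \<theta> \<theta>' less.prems by simp
        from t_dec_x[OF this, of s] show "dec \<theta> i \<rho> (\<psi> @ [i]) j (r - dg j i)
          (t (length \<theta>) * (y * x (Suc (length \<theta>)) ^ s * e (\<theta> @ i # \<rho>)))"
          using y \<theta> less.prems by (simp add: mult.assoc x_pow_e)
      qed
    next
      fix \<kappa> i' r2 y2 \<theta>' r1 y1 and r :: rat and s
      assume y2: "hm \<theta> (\<kappa> @ [i']) r2 y2" and y1: "hm (\<kappa> @ [i]) \<theta>' r1 y1"
        and r: "r = r1 + r2 + of_nat s * dg i' i' - dg i' i"
      show "\<theta>' = \<psi> @ [j] \<longrightarrow> dec \<theta> i \<rho> (\<psi> @ [i']) j (r - dg j i')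
        (t (length \<theta>) * (y1 * x (Suc (length \<theta>)) ^ s * t (length \<theta>) * y2 * e (\<theta> @ i # \<rho>)))"
      proof
        assume \<theta>': "\<theta>' = \<psi> @ [j]"
        have l: "length \<theta> = Suc (length \<kappa>)" using hm_length[OF y2] by simp
        have d: "dec \<kappa> i (i' # \<rho>) \<psi> j r1 (y1 * e (\<kappa> @ i # i' # \<rho>))"
          using less.hyps[of \<kappa> i \<psi> j r1 y1 "i' # \<rho>"] y1 \<theta>' l less.prems by simp
        have "e (\<kappa> @ i # i' # \<rho>) * (x (Suc (length \<theta>)) ^ s * (t (length \<theta>) * y2 * e (\<theta> @ i # \<rho>)))
          = x (Suc (length \<theta>)) ^ s * (e (\<kappa> @ i # i' # \<rho>) * (t (length \<theta>) * y2 * e (\<theta> @ i # \<rho>)))"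
          by (simp only: x_pow_e[symmetric] mult.assoc[symmetric])
        also have "\<dots> = x (Suc (length \<theta>)) ^ s * (t (length \<theta>) * y2 * e (\<theta> @ i # \<rho>))"
          using good_tt[OF y2 l, of \<rho> i] less.prems by (simp add: good_def)
        finally have E: "e (\<kappa> @ i # i' # \<rho>) * (x (Suc (length \<theta>)) ^ s * (t (length \<theta>) * y2 * e (\<theta> @ i # \<rho>)))
          = x (Suc (length \<theta>)) ^ s * (t (length \<theta>) * y2 * e (\<theta> @ i # \<rho>))" .
        from t_dec_t[OF d y2 l, of s] less.prems r
        have "dec \<theta> i \<rho> (\<psi> @ [i']) j (r - dg j i') (t (length \<theta>) *
          (y1 * (e (\<kappa> @ i # i' # \<rho>) * (x (Suc (length \<theta>)) ^ s * (t (length \<theta>) * y2 * e (\<theta> @ i # \<rho>))))))"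
          by (simp add: mult.assoc)
        then show "dec \<theta> i \<rho> (\<psi> @ [i']) j (r - dg j i')
          (t (length \<theta>) * (y1 * x (Suc (length \<theta>)) ^ s * t (length \<theta>) * y2 * e (\<theta> @ i # \<rho>)))"
          unfolding E by (simp add: mult.assoc)
      qed
    qed (auto simp: distrib_left sc_left intro: dec.intros)
    then show ?thesis using dz by blast
  qed
  have "\<And>\<mu>. hm (\<theta> @ [i]) \<mu> r y \<Longrightarrow> \<forall>\<theta>' i'. \<mu> = \<theta>' @ [i'] \<longrightarrow> dec \<theta> i \<rho> \<theta>' i' r (y * e (\<theta> @ i # \<rho>))"
  proof (erule hm.induct; intro allI impI)
    fix \<theta>' i' assume "\<theta> @ [i] = \<theta>' @ [i']"
    then show "dec \<theta> i \<rho> \<theta>' i' 0 (1 * e (\<theta> @ i # \<rho>))" using dec_1 by simp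
  next
    fix \<psi> j \<kappa> r y \<theta>' i'
    assume h: "hm (\<theta> @ [i]) (\<psi> @ j # \<kappa>) r y"
      and IH: "\<forall>\<theta>' i'. \<psi> @ j # \<kappa> = \<theta>' @ [i'] \<longrightarrow> dec \<theta> i \<rho> \<theta>' i' r (y * e (\<theta> @ i # \<rho>))"
      and eq: "\<psi> @ j # \<kappa> = \<theta>' @ [i']"
    have d: "dec \<theta> i \<rho> \<theta>' i' r (y * e (\<theta> @ i # \<rho>))" using IH eq by blast
    show "dec \<theta> i \<rho> \<theta>' i' (r + dg j j) (x (Suc (length \<psi>)) * y * e (\<theta> @ i # \<rho>))"
    proof (cases \<kappa> rule: rev_cases)
      case Nil
      then have "\<theta>' = \<psi>" "i' = j" using eq by auto
      then show ?thesis using dec_xp[OF d, of 1] hm_length[OF h] Nil by (simp add: mult.assoc)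
    next
      case (snoc \<kappa>' i0)
      then have \<theta>': "\<theta>' = \<psi> @ j # \<kappa>'" using eq by simp
      show ?thesis using dec_hm[OF d, of \<theta>' "dg j j" "x (Suc (length \<psi>))"]
          hm_xp1[of "Suc (length \<psi>)" \<psi> j \<kappa>' 1] \<theta>' by (simp add: mult.assoc)
    qed
  next
    fix \<psi> j1 j2 \<kappa> r y \<theta>' i'
    assume h: "hm (\<theta> @ [i]) (\<psi> @ j1 # j2 # \<kappa>) r y"
      and IH: "\<forall>\<theta>' i'. \<psi> @ j1 # j2 # \<kappa> = \<theta>' @ [i'] \<longrightarrow> dec \<theta> i \<rho> \<theta>' i' r (y * e (\<theta> @ i # \<rho>))"
      and eq: "\<psi> @ j2 # j1 # \<kappa> = \<theta>' @ [i']"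
    show "dec \<theta> i \<rho> \<theta>' i' (r - dg j1 j2) (t (Suc (length \<psi>)) * y * e (\<theta> @ i # \<rho>))"
    proof (cases \<kappa> rule: rev_cases)
      case Nil
      then have eqs: "\<theta>' = \<psi> @ [j2]" "i' = j1" using eq by auto
      have "dec \<theta> i \<rho> (\<psi> @ [j1]) j2 r (y * e (\<theta> @ i # \<rho>))" using IH Nil by simp
      from t_dec[OF this] show ?thesis using hm_length[OF h] Nil eqs by (simp add: mult.assoc)
    next
      case (snoc \<kappa>' i0)
      then have \<theta>': "\<theta>' = \<psi> @ j2 # j1 # \<kappa>'" "i' = i0" using eq by auto
      have d: "dec \<theta> i \<rho> (\<psi> @ j1 # j2 # \<kappa>') i0 r (y * e (\<theta> @ i # \<rho>))" using IH snoc by simp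
      show ?thesis using dec_hm[OF d hm_t1[OF refl]] \<theta>' by (simp add: mult.assoc)
    qed
  qed (auto simp: distrib_right mult.assoc intro: dec.intros)
  then show ?case using less.prems by blast
qed

end

section \<open>Lowering powers of the last variable\<close>

lemma sum_lessThan_split:
  fixes f :: "nat \<Rightarrow> 'b::comm_monoid_add"
  shows "(\<Sum>p<d + N. f p) = (\<Sum>p<d. f p) + (\<Sum>p<N. f (d + p))"
  by (induction N) (simp_all add: add.assoc)

lemma sum_lessThan_eq:
  fixes f :: "nat \<Rightarrow> 'b::comm_monoid_add"
  assumes "\<And>k. M \<le> k \<or> N \<le> k \<Longrightarrow> f k = 0"
  shows "(\<Sum>k<M. f k) = (\<Sum>k<N. f k)"
proof -
  have le: "(\<Sum>k<M. f k) = (\<Sum>k<N. f k)" if "M \<le> N" "\<And>k. M \<le> k \<Longrightarrow> f k = 0" for M N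
    using sum_lessThan_split[of f M "N - M"] that by simp
  show ?thesis
  proof (cases "M \<le> N")
    case True
    then show ?thesis by (rule le) (rule assms, simp)
  next
    case False
    then have "(\<Sum>k<N. f k) = (\<Sum>k<M. f k)" by (intro le) (auto intro: assms)
    then show ?thesis by (rule sym)
  qed
qed

context klr_rel
begin

section \<open>Tensors and their evaluation\<close>

lemma sc_of_nat: "sc (of_nat k) = of_nat k"
  by (induction k) (simp_all add: sc_0 sc_add sc_1)

text \<open>The map z \<mapsto> \<Sum> a z b stands for the tensor \<Sum> a \<otimes> b, where b
  leads from \<theta> to a sequence ending in i and a leads back. Nothing but its values is used, at
  powers of x_m, at \<tau>_m and at products of such elements.\<close>

inductive bim :: "'i list \<Rightarrow> 'i \<Rightarrow> rat \<Rightarrow> ('a \<Rightarrow> 'a) \<Rightarrow> bool" for \<theta> i r where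
  bim_0: "bim \<theta> i r (\<lambda>z. 0)"
| bim_1: "hm (\<kappa> @ [i]) \<theta> r1 a \<Longrightarrow> hm \<theta> (\<kappa> @ [i]) r2 b \<Longrightarrow> r = r1 + r2 \<Longrightarrow> bim \<theta> i r (\<lambda>z. a * z * b)"
| bim_add: "bim \<theta> i r \<Phi> \<Longrightarrow> bim \<theta> i r \<Psi> \<Longrightarrow> bim \<theta> i r (\<lambda>z. \<Phi> z + \<Psi> z)"
| bim_sc: "bim \<theta> i r \<Phi> \<Longrightarrow> bim \<theta> i r (\<lambda>z. sc c * \<Phi> z)"

lemma bim_sum: "(\<And>a. a \<in> A \<Longrightarrow> bim \<theta> i r (F a)) \<Longrightarrow> bim \<theta> i r (\<lambda>z. \<Sum>a\<in>A. F a z)"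
  by (induction A rule: infinite_finite_induct) (auto intro: bim.intros)

lemma bim_uminus: "bim \<theta> i r \<Phi> \<Longrightarrow> bim \<theta> i r (\<lambda>z. - \<Phi> z)"
  using bim_sc[of \<theta> i r \<Phi> "- 1"] by (simp flip: uminus_sc)

lemma bim_plus: "bim \<theta> i r \<Phi> \<Longrightarrow> \<Phi> (z + w) = \<Phi> z + \<Phi> w"
  by (induction rule: bim.induct) (auto simp: distrib_left distrib_right)

lemma bim_zero: "bim \<theta> i r \<Phi> \<Longrightarrow> \<Phi> 0 = 0"
  by (induction rule: bim.induct) auto

lemma bim_diff: "bim \<theta> i r \<Phi> \<Longrightarrow> \<Phi> (z - w) = \<Phi> z - \<Phi> w"
  using bim_plus[of \<theta> i r \<Phi> "z - w" w] by simp

lemma bim_scal: "bim \<theta> i r \<Phi> \<Longrightarrow> \<Phi> (sc c * z) = sc c * \<Phi> z"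
proof (induction rule: bim.induct)
  case (bim_sc \<Phi> d)
  then show ?case using sc_left by metis
qed (auto simp: distrib_left mult.assoc sc_left)

lemma bim_sum_arg: "bim \<theta> i r \<Phi> \<Longrightarrow> \<Phi> (\<Sum>a\<in>A. f a) = (\<Sum>a\<in>A. \<Phi> (f a))"
  by (induction A rule: infinite_finite_induct) (auto simp: bim_zero bim_plus)

lemma bim_comm:
  assumes "bim \<theta> i r \<Phi>"
    and x: "\<And>k. 1 \<le> k \<Longrightarrow> k \<le> length \<theta> \<Longrightarrow> y * x k = x k * y"
    and t: "\<And>l. 1 \<le> l \<Longrightarrow> l < length \<theta> \<Longrightarrow> y * t l = t l * y"
  shows "\<Phi> (y * z) = y * \<Phi> z" and "\<Phi> (z * y) = \<Phi> z * y"
proof -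
  have "\<Phi> (y * z) = y * \<Phi> z \<and> \<Phi> (z * y) = \<Phi> z * y"
    using assms(1)
  proof (induction rule: bim.induct)
    case (bim_1 \<kappa> r1 a r2 b)
    have "y * a = a * y" using bim_1(1) by (rule hm_commute) (use x t hm_length[OF bim_1(2)] in auto)
    moreover have "y * b = b * y" using bim_1(2) by (rule hm_commute) (use x t in auto)
    ultimately show ?case by (simp add: mult.assoc) (simp flip: mult.assoc)
  next
    case (bim_sc \<Phi> c)
    then show ?case by (simp add: sc_left mult.assoc)
  qed (auto simp: distrib_left distrib_right)
  then show "\<Phi> (y * z) = y * \<Phi> z" "\<Phi> (z * y) = \<Phi> z * y" by auto
qed

lemma bim_x: "bim \<theta> i r \<Phi> \<Longrightarrow> length \<theta> < k \<Longrightarrow> \<Phi> (x k ^ p * z) = x k ^ p * \<Phi> z"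
  "bim \<theta> i r \<Phi> \<Longrightarrow> length \<theta> < k \<Longrightarrow> \<Phi> (z * x k ^ p) = \<Phi> z * x k ^ p"
  by (erule bim_comm; simp add: x_pow_x t_pow_far)+

lemma bim_t: "bim \<theta> i r \<Phi> \<Longrightarrow> length \<theta> < k \<Longrightarrow> \<Phi> (t k * z) = t k * \<Phi> z"
  "bim \<theta> i r \<Phi> \<Longrightarrow> length \<theta> < k \<Longrightarrow> \<Phi> (z * t k) = \<Phi> z * t k"
  by (erule bim_comm; simp add: t_x_far t_t_far[symmetric])+

text \<open>The right factor b carries the idempotent to one with the letter i in place m, so
  relations valid at such idempotents may be applied inside \<Phi>.\<close>

lemma bim_e:
  assumes "bim \<theta> i r \<Phi>" "length \<theta> + length \<rho> = n"
    and "\<And>\<kappa> :: 'i list. length \<theta> = Suc (length \<kappa>) \<Longrightarrow> y * e (\<kappa> @ i # \<rho>) = z * e (\<kappa> @ i # \<rho>)"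
  shows "\<Phi> y * e (\<theta> @ \<rho>) = \<Phi> z * e (\<theta> @ \<rho>)"
  using assms(1)
proof (induction rule: bim.induct)
  case (bim_1 \<kappa> r1 a r2 b)
  have be: "b * e (\<theta> @ \<rho>) = e (\<kappa> @ i # \<rho>) * b" using hm_e[OF bim_1(2), of \<rho>] assms by simp
  have "a * y * b * e (\<theta> @ \<rho>) = a * (y * e (\<kappa> @ i # \<rho>)) * b" by (simp only: mult.assoc be)
  also have "\<dots> = a * (z * e (\<kappa> @ i # \<rho>)) * b" using assms(3) hm_length[OF bim_1(2)] by simp
  also have "\<dots> = a * z * b * e (\<theta> @ \<rho>)" by (simp only: mult.assoc be)
  finally show ?case .
qed (auto simp: distrib_right mult.assoc)

text \<open>How a tensor passes to one more strand: \<tau>_m on either side exchanges i with the new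
  letter j.\<close>

lemma bim_conj:
  "bim \<theta> i r \<Phi> \<Longrightarrow> r' = r - 2 * dg i j \<Longrightarrow> bim (\<theta> @ [j]) i r' (\<lambda>z. \<Phi> (t (length \<theta>) * z * t (length \<theta>)))"
proof (induction rule: bim.induct)
  case (bim_1 \<kappa> r1 a r2 b)
  let ?m = "length \<theta>"
  have m: "?m = Suc (length \<kappa>)" using hm_length[OF bim_1(2)] by simp
  have "hm ((\<kappa> @ [j]) @ [i]) (\<theta> @ [j]) (- dg j i + r1) (a * t ?m)"
    using hm_trans[OF hm_ext[OF bim_1(1), of "[j]"], of "(\<kappa> @ [j]) @ [i]" "- dg j i" "t ?m"]
      hm_t1[OF m, of j i "[]"] by simp
  moreover have "hm (\<theta> @ [j]) ((\<kappa> @ [j]) @ [i]) (r2 - dg i j) (t ?m * b)"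
    using hm_t[of "\<theta> @ [j]" \<kappa> i j "[]" r2 b] hm_ext[OF bim_1(2), of "[j]"] m by simp
  ultimately have "bim (\<theta> @ [j]) i r' (\<lambda>z. a * t ?m * z * (t ?m * b))"
    by (rule bim.bim_1) (use bim_1 dg_sym[of i j] in simp)
  then show ?case by (simp add: mult.assoc)
qed (auto intro: bim.intros)

definition ell :: "'i list \<Rightarrow> 'i \<Rightarrow> int" where
  "ell \<theta> i = int (L i) - (\<Sum>j\<leftarrow>\<theta>. ca i j)"

lemma ell_snoc: "ell (\<theta> @ [j]) i = ell \<theta> i - ca i j"
  by (simp add: ell_def)

text \<open>The polynomial part of u^a s(u) at u = x_k. The bound M may be anything beyond the
  leading exponent, by \<open>ev_eq\<close>.\<close>

definition ev :: "nat \<Rightarrow> (int \<Rightarrow> 'a) \<Rightarrow> nat \<Rightarrow> nat \<Rightarrow> 'a" where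
  "ev M s a k = (\<Sum>p<M. s (int p - int a) * x k ^ p)"

lemma ev_eq: "(\<And>p. l < p \<Longrightarrow> s p = 0) \<Longrightarrow> l + int a < int M \<Longrightarrow> l + int a < int N \<Longrightarrow> ev M s a k = ev N s a k"
  unfolding ev_def by (rule sum_lessThan_eq) auto

text \<open>
  The coefficients \<open>s k\<close> are those of a Laurent series in \<open>u\<inverse>\<close> with leading term \<open>u\<^bsup>ell\<^esup>\<close>: its
  polynomial part at \<open>u = x\<^bsub>m+1\<^esub>\<close> lies in the ideal through \<open>\<tau>\<^sub>m\<close>, and the negative part records
  the moments of the tensor \<open>\<Phi>\<close>. Heuristically the series is the product of \<open>u\<^bsup>L\<^esup>\<close> with
  \<open>Q\<^bsub>i,\<nu>\<^sub>p\<^esub>(u, x\<^sub>p)\<close> over the letters \<open>\<nu>\<^sub>p \<noteq> i\<close> and \<open>(u - x\<^sub>p)\<^bsup>-2\<^esup>\<close> over the letters \<open>\<nu>\<^sub>p = i\<close>.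
\<close>

definition bubble :: "'i list \<Rightarrow> 'i \<Rightarrow> ('a \<Rightarrow> 'a) \<Rightarrow> (int \<Rightarrow> 'a) \<Rightarrow> bool" where
  "bubble \<theta> i \<Phi> s \<longleftrightarrow>
     bim \<theta> i (of_int (ell \<theta> i + 1) * dg i i) \<Phi> \<and>
     (\<forall>k. hm \<theta> \<theta> (of_int (ell \<theta> i - k) * dg i i) (s k)) \<and>
     (\<forall>k>ell \<theta> i. s k = 0) \<and> (\<exists>c. c \<noteq> 0 \<and> s (ell \<theta> i) = sc c) \<and>
     (\<forall>\<rho> k. length \<theta> + length \<rho> = n \<longrightarrow>
        \<Phi> (x (length \<theta>) ^ k) * e (\<theta> @ \<rho>) = - s (- int k - 1) * e (\<theta> @ \<rho>)) \<and>
     (\<forall>\<rho> M. length \<theta> + 1 + length \<rho> = n \<longrightarrow> ell \<theta> i < int M \<longrightarrow>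
        \<Phi> (t (length \<theta>)) * e (\<theta> @ i # \<rho>) = ev M s 0 (Suc (length \<theta>)) * e (\<theta> @ i # \<rho>))"

text \<open>Multiplying the series by u moves one negative coefficient into the polynomial part. On
  the left, x_m \<tau>_m = \<tau>_m x_{m+1} - 1 on equal letters produces the same coefficient as a
  value of \<Phi> at a power of x_m.\<close>

lemma bubble_shift:
  assumes b: "bubble \<theta> i \<Phi> s" and len: "length \<theta> + 1 + length \<rho> = n" and M: "ell \<theta> i < int M"
  shows "\<Phi> (x (length \<theta>) ^ a * t (length \<theta>)) * e (\<theta> @ i # \<rho>)
      = ev (M + a) s a (Suc (length \<theta>)) * e (\<theta> @ i # \<rho>)"
proof (induction a)
  case 0
  then show ?case using b len M by (simp add: bubble_def)
next
  case (Suc a)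
  let ?m = "length \<theta>" and ?e = "e (\<theta> @ i # \<rho>)"
  have \<Phi>: "bim \<theta> i (of_int (ell \<theta> i + 1) * dg i i) \<Phi>" using b by (simp add: bubble_def)
  have "\<Phi> (x ?m ^ Suc a * t ?m) * ?e = \<Phi> (x ?m ^ a * t ?m * x (Suc ?m) ^ 1 - x ?m ^ a) * ?e"
  proof (rule bim_e[OF \<Phi>])
    fix \<kappa> :: "'i list" assume k: "?m = Suc (length \<kappa>)"
    have "x ?m * t ?m * e (\<kappa> @ i # i # \<rho>) = t ?m * x (Suc ?m) * e (\<kappa> @ i # i # \<rho>) - e (\<kappa> @ i # i # \<rho>)"
      using t_xS_eq[of \<kappa> \<rho> ?m i] k len by simp
    then show "x ?m ^ Suc a * t ?m * e (\<kappa> @ i # i # \<rho>) =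
        (x ?m ^ a * t ?m * x (Suc ?m) ^ 1 - x ?m ^ a) * e (\<kappa> @ i # i # \<rho>)"
      by (simp add: left_diff_distrib right_diff_distrib mult.assoc power_Suc2 del: power_Suc)
  qed (use len in simp)
  also have "\<dots> = \<Phi> (x ?m ^ a * t ?m) * x (Suc ?m) * ?e - \<Phi> (x ?m ^ a) * ?e"
    using bim_x(2)[OF \<Phi>, of "Suc ?m" _ 1] by (simp add: bim_diff[OF \<Phi>] left_diff_distrib)
  also have "\<dots> = (\<Phi> (x ?m ^ a * t ?m) * ?e) * x (Suc ?m) + s (- int a - 1) * ?e"
    using b len by (simp add: bubble_def mult.assoc x_e)
  also have "\<dots> = (ev (M + a) s a (Suc ?m) * x (Suc ?m) + s (- int a - 1)) * ?e"
    unfolding Suc by (simp add: mult.assoc x_e distrib_right)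
  also have "ev (M + a) s a (Suc ?m) * x (Suc ?m) + s (- int a - 1) = ev (M + Suc a) s (Suc a) (Suc ?m)"
  proof -
    have eqs: "int (Suc k) - int (Suc a) = int k - int a" "int 0 - int (Suc a) = - int a - 1" for k
      by simp_all
    have "ev (M + Suc a) s (Suc a) (Suc ?m)
        = s (- int a - 1) + (\<Sum>k<M + a. s (int k - int a) * x (Suc ?m) ^ Suc k)"
      by (simp only: ev_def add_Suc_right sum.lessThan_Suc_shift eqs power_0 mult_1_right)
    then show ?thesis
      by (simp add: ev_def sum_distrib_right mult.assoc power_Suc2 add.commute del: power_Suc)
  qed
  finally show ?case .
qed

text \<open>On no strands the series is u^L and the tensor is 0; that the value x_1^L vanishes is
  the cyclotomic relation.\<close>

lemma bubble_Nil: "i \<in> I \<Longrightarrow> bubble [] i (\<lambda>z. 0) (\<lambda>k. if k = int (L i) then 1 else 0)"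
proof -
  assume i: "i \<in> I"
  let ?s = "\<lambda>k. if k = int (L i) then 1 else (0 :: 'a)"
  have "ev M ?s 0 (Suc 0) * e (i # \<rho>) = 0" if "Suc (length \<rho>) = n" "int (L i) < int M" for \<rho> M
  proof -
    have "ev M ?s 0 (Suc 0) = x 1 ^ L i"
      using that by (simp add: ev_def if_distrib[of "\<lambda>y. y * _"] cong: if_cong)
    then show ?thesis using cyclotomic[OF that(1), of i] by simp
  qed
  moreover have "hm [] [] (of_int (int (L i) - k) * dg i i) (?s k)" for k
    by (cases "k = int (L i)") (auto intro: hm_zero hm_one)
  moreover have "bim [] i r (\<lambda>z. 0)" for r by (rule bim_0)
  moreover have "\<exists>c. c \<noteq> 0 \<and> ?s (int (L i)) = sc c" by (intro exI[of _ 1]) (simp add: sc_1)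
  ultimately show ?thesis unfolding bubble_def by (simp add: ell_def)
qed

text \<open>Write l for the length of \<theta> and m = l + 1. A letter j \<noteq> i in place m
  multiplies the series by Q_{i,j}(u, x_m). With the tensor conjugated by \<tau>_l, its values at
  powers of x_m come from the quadratic relation and its value at \<tau>_m from the braid
  relation.\<close>

lemma bubble_neq:
  assumes b: "bubble \<theta> i \<Phi> s" and ij: "i \<noteq> j" "i \<in> I" "j \<in> I"
  shows "\<exists>\<Phi>' s'. bubble (\<theta> @ [j]) i \<Phi>' s'"
proof -
  define p p' where "p = nat (- ca i j)" and "p' = nat (- ca j i)"
  let ?l = "length \<theta>" and ?m = "Suc (length \<theta>)"
  \<comment> \<open>The coefficient of u^q in Q_{i,j}(u, x_m).\<close>
  define Pc where "Pc q = (\<Sum>b\<le>p'. sc (cf i j q b) * x ?m ^ b)" for q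
  define s' where "s' k = (\<Sum>q\<le>p. Pc q * s (k - int q))" for k
  define \<Phi>' where "\<Phi>' z = \<Phi> (t ?l * z * t ?l)" for z
  have \<Phi>: "bim \<theta> i (of_int (ell \<theta> i + 1) * dg i i) \<Phi>" and hs: "\<And>k. hm \<theta> \<theta> (of_int (ell \<theta> i - k) * dg i i) (s k)"
    and s0: "\<And>k. ell \<theta> i < k \<Longrightarrow> s k = 0"
    and mom: "\<And>\<rho> k. ?l + length \<rho> = n \<Longrightarrow> \<Phi> (x ?l ^ k) * e (\<theta> @ \<rho>) = - s (- int k - 1) * e (\<theta> @ \<rho>)"
    and top: "\<And>\<rho> M. ?l + 1 + length \<rho> = n \<Longrightarrow> ell \<theta> i < int M \<Longrightarrow>
        \<Phi> (t ?l) * e (\<theta> @ i # \<rho>) = ev M s 0 ?m * e (\<theta> @ i # \<rho>)"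
    using b by (auto simp: bubble_def)
  obtain c where c: "c \<noteq> 0" "s (ell \<theta> i) = sc c" using b by (auto simp: bubble_def)
  have caij: "ca i j = - int p" using ca_le[OF ij(2,3,1)] by (simp add: p_def)
  have el: "ell (\<theta> @ [j]) i = ell \<theta> i + int p" by (simp add: ell_snoc caij)
  have dgp: "2 * dg i j = - of_nat p * dg i i" using dg_ca[OF ij(2,3)] caij by (simp add: mult.commute)
  \<comment> \<open>The exponent of u fixes that of x_m. For q = p it is 0, so the leading
    coefficient of the new series is again a nonzero scalar.\<close>
  have cfd: "of_nat b * dg j j = (of_nat p - of_nat q) * dg i i" if "cf i j q b \<noteq> 0" for q b
    using cf_hom[OF ij(2,3) that] dgp by (simp add: algebra_simps)
  have Pc_s: "Pc q * s k = s k * Pc q" for q k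
    unfolding Pc_def sum_distrib_left sum_distrib_right
    using hm_comm_xp[OF hs[of k], of ?m] by (simp add: mult.assoc sc_left)
  have hPc: "hm (\<theta> @ [j]) (\<theta> @ [j]) ((of_nat p - of_nat q) * dg i i) (Pc q)" for q
    unfolding Pc_def
  proof (rule hm_sum)
    fix b
    show "hm (\<theta> @ [j]) (\<theta> @ [j]) ((of_nat p - of_nat q) * dg i i) (sc (cf i j q b) * x ?m ^ b)"
    proof (cases "cf i j q b = 0")
      case False
      show ?thesis using hm_sc[OF hm_xp1[of ?m \<theta> j "[]" b]] cfd[OF False] by simp
    qed (simp add: sc_0 hm_zero)
  qed simp
  have "hm (\<theta> @ [j]) (\<theta> @ [j]) (of_int (ell (\<theta> @ [j]) i - k) * dg i i) (s' k)" for k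
    unfolding s'_def
  proof (rule hm_sum)
    fix q
    have "hm (\<theta> @ [j]) (\<theta> @ [j]) (of_int (ell \<theta> i - (k - int q)) * dg i i + (of_nat p - of_nat q) * dg i i)
      (Pc q * s (k - int q))"
      by (rule hm_trans[OF hPc hm_ext[OF hs]])
    then show "hm (\<theta> @ [j]) (\<theta> @ [j]) (of_int (ell (\<theta> @ [j]) i - k) * dg i i) (Pc q * s (k - int q))"
      by (simp add: el algebra_simps)
  qed simp
  moreover have "s' k = 0" if "ell (\<theta> @ [j]) i < k" for k
    unfolding s'_def using that by (intro sum.neutral) (auto simp: el s0)
  moreover have "s' (ell (\<theta> @ [j]) i) = sc (cf i j p 0 * c)"
  proof -
    have "s' (ell (\<theta> @ [j]) i) = (\<Sum>q\<in>{p}. Pc q * s (ell (\<theta> @ [j]) i - int q))"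
      unfolding s'_def by (rule sum.mono_neutral_right) (auto simp: el s0)
    also have "\<dots> = Pc p * sc c" by (simp add: el c)
    also have "Pc p = (\<Sum>b\<in>{0}. sc (cf i j p b) * x ?m ^ b)"
      unfolding Pc_def
    proof (rule sum.mono_neutral_right)
      have "b = 0" if "cf i j p b \<noteq> 0" for b using cfd[OF that] dg_pos[OF ij(3)] by simp
      then have "cf i j p b = 0" if "b \<noteq> 0" for b using that by blast
      then show "\<forall>b\<in>{..p'} - {0}. sc (cf i j p b) * x ?m ^ b = 0" by (simp add: sc_0)
    qed auto
    finally show ?thesis by (simp add: sc_mult)
  qed
  moreover have "cf i j p 0 * c \<noteq> 0" using cf_lead[OF ij(2,3,1)] c by (simp add: p_def)
  moreover have "bim (\<theta> @ [j]) i (of_int (ell (\<theta> @ [j]) i + 1) * dg i i) \<Phi>'"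
    unfolding \<Phi>'_def using \<Phi> by (rule bim_conj) (use dgp in \<open>simp add: el algebra_simps\<close>)
  moreover have "\<Phi>' (x ?m ^ k) * e (\<theta> @ j # \<rho>) = - s' (- int k - 1) * e (\<theta> @ j # \<rho>)"
    if len: "Suc ?l + length \<rho> = n" for \<rho> k
  proof -
    let ?e = "e (\<theta> @ j # \<rho>)"
    have "\<Phi>' (x ?m ^ k) * ?e = \<Phi> (\<Sum>a\<le>p. \<Sum>b\<le>p'. sc (cf i j a b) * (x ?m ^ b * x ?l ^ (k + a))) * ?e"
      unfolding \<Phi>'_def
    proof (rule bim_e[OF \<Phi>])
      fix \<kappa> :: "'i list" assume kl: "?l = Suc (length \<kappa>)"
      have len2: "length \<kappa> + 2 + length \<rho> = n" using kl len by simp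
      have "t ?l * x ?m ^ k * t ?l * e (\<kappa> @ i # j # \<rho>) = (t ?l * x ?m ^ k * e (\<kappa> @ j # i # \<rho>)) * t ?l"
        using t_ek[OF len2 kl, of i j] by (simp add: mult.assoc)
      also have "\<dots> = x ?l ^ k * t ?l * e (\<kappa> @ j # i # \<rho>) * t ?l"
        using t_xSp_neq[OF len2 kl, of j i k] ij by simp
      also have "\<dots> = x ?l ^ k * (t ?l * t ?l * e (\<kappa> @ i # j # \<rho>))"
        using t_ek[OF len2 kl, of i j] by (simp add: mult.assoc)
      also have "\<dots> = (\<Sum>a\<le>p. \<Sum>b\<le>p'. sc (cf i j a b) * (x ?m ^ b * x ?l ^ (k + a))) * e (\<kappa> @ i # j # \<rho>)"
      proof -
        have "x ?l ^ k * (x ?l ^ a * x ?m ^ b) = x ?m ^ b * x ?l ^ (k + a)" for a b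
          using x_pow_pow[of ?l "k + a" ?m b] by (simp add: power_add mult.assoc)
        then have "x ?l ^ k * (sc d * (x ?l ^ a * x ?m ^ b)) = sc d * (x ?m ^ b * x ?l ^ (k + a))" for a b d
          by (simp only: sc_left)
        then show ?thesis
          unfolding t_t[OF len2 kl] p_def p'_def mult.assoc[of "x ?l ^ k", symmetric] sum_distrib_left[of "x ?l ^ k"]
          by simp
      qed
      finally show "t ?l * x ?m ^ k * t ?l * e (\<kappa> @ i # j # \<rho>) = \<dots>" .
    qed (use len in simp)
    also have "\<dots> = (\<Sum>a\<le>p. \<Sum>b\<le>p'. sc (cf i j a b) * (x ?m ^ b * \<Phi> (x ?l ^ (k + a)))) * ?e"
      by (simp only: bim_sum_arg[OF \<Phi>] bim_scal[OF \<Phi>] bim_x(1)[OF \<Phi>, of ?m] lessI)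
    also have "\<dots> = (\<Sum>a\<le>p. \<Sum>b\<le>p'. sc (cf i j a b) * (x ?m ^ b * (\<Phi> (x ?l ^ (k + a)) * ?e)))"
      by (simp only: sum_distrib_right mult.assoc)
    also have "\<dots> = (\<Sum>a\<le>p. \<Sum>b\<le>p'. sc (cf i j a b) * (x ?m ^ b * (- s (- int k - 1 - int a) * ?e)))"
    proof -
      have "\<Phi> (x ?l ^ (k + a)) * ?e = - s (- int k - 1 - int a) * ?e" for a
      proof -
        have "- int (k + a) - 1 = - int k - 1 - int a" by simp
        then show ?thesis using mom[of "j # \<rho>" "k + a"] len by (simp only: list.size)
      qed
      then show ?thesis by (simp only:)
    qed
    also have "\<dots> = - s' (- int k - 1) * ?e"
      by (simp add: s'_def Pc_def sum_distrib_right mult.assoc sum_negf)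
    finally show ?thesis .
  qed
  moreover have "\<Phi>' (t ?m) * e (\<theta> @ j # i # \<rho>) = ev M' s' 0 (Suc ?m) * e (\<theta> @ j # i # \<rho>)"
    if len: "Suc ?l + 1 + length \<rho> = n" and M': "ell (\<theta> @ [j]) i < int M'" for \<rho> M'
  proof -
    let ?e = "e (\<theta> @ j # i # \<rho>)" and ?X = "x (Suc ?m)"
    define M where "M = nat (ell \<theta> i + 1)"
    have M: "ell \<theta> i < int M" by (simp add: M_def)
    have lenm: "?l + 2 + length \<rho> = n" using len by simp
    have te: "t ?m * ?e = e (\<theta> @ i # j # \<rho>) * t ?m" by (rule t_ek[OF lenm refl])
    have "\<Phi>' (t ?m) * ?e = \<Phi> (t ?m * t ?l * t ?m - (\<Sum>a\<le>p. \<Sum>b\<le>p'. sc (cf i j a b) *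
        (x ?m ^ b * (\<Sum>c<a. x ?l ^ c * ?X ^ (a - 1 - c))))) * ?e"
      unfolding \<Phi>'_def
    proof (rule bim_e[OF \<Phi>])
      fix \<kappa> :: "'i list" assume kl: "?l = Suc (length \<kappa>)"
      have len3: "length \<kappa> + 3 + length \<rho> = n" using kl len by simp
      have "(\<Sum>c<a. x ?l ^ c * ?X ^ (a - 1 - c)) * x ?m ^ b = x ?m ^ b * (\<Sum>c<a. x ?l ^ c * ?X ^ (a - 1 - c))" for a b
        unfolding sum_distrib_left sum_distrib_right
        by (intro sum.cong refl) (metis comm_times x_pow_pow)
      with braid_eq[OF len3 kl, of i j]
      show "t ?l * t ?m * t ?l * e (\<kappa> @ i # j # i # \<rho>) = (t ?m * t ?l * t ?m - (\<Sum>a\<le>p. \<Sum>b\<le>p'. sc (cf i j a b) *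
        (x ?m ^ b * (\<Sum>c<a. x ?l ^ c * ?X ^ (a - 1 - c))))) * e (\<kappa> @ i # j # i # \<rho>)"
        unfolding p_def p'_def by (simp add: left_diff_distrib algebra_simps)
    qed (use len in simp)
    also have "\<dots> = \<Phi> (t ?m * t ?l * t ?m) * ?e - (\<Sum>a\<le>p. \<Sum>b\<le>p'. sc (cf i j a b) *
        (x ?m ^ b * \<Phi> (\<Sum>c<a. x ?l ^ c * ?X ^ (a - 1 - c)))) * ?e"
      by (simp only: bim_diff[OF \<Phi>] bim_sum_arg[OF \<Phi>, of _ "{..p}"] bim_sum_arg[OF \<Phi>, of _ "{..p'}"]
          bim_scal[OF \<Phi>] bim_x(1)[OF \<Phi>, of ?m] lessI left_diff_distrib)
    \<comment> \<open>Words on l strands commute with \<tau>_m, so \<tau>_m can be taken out of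
      \<Phi> on both sides. The relation of the shorter sequence is thereby conjugated by \<tau>_m,
      which sends x_m to x_{m+1} and leaves Q.\<close>
    also have "\<Phi> (t ?m * t ?l * t ?m) * ?e = (\<Sum>q\<le>p. Pc q * (\<Sum>k<M. s (int k) * ?X ^ (k + q))) * ?e"
    proof -
      have "\<Phi> (t ?m * t ?l * t ?m) * ?e = t ?m * \<Phi> (t ?l) * t ?m * ?e"
        by (simp only: bim_t[OF \<Phi>, of ?m] lessI)
      also have "\<dots> = t ?m * (\<Phi> (t ?l) * e (\<theta> @ i # j # \<rho>)) * t ?m" by (simp only: te mult.assoc)
      also have "\<Phi> (t ?l) * e (\<theta> @ i # j # \<rho>) = ev M s 0 ?m * e (\<theta> @ i # j # \<rho>)"
        by (rule top) (use len M in auto)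
      also have "t ?m * (ev M s 0 ?m * e (\<theta> @ i # j # \<rho>)) * t ?m
          = (\<Sum>k<M. s (int k) * (t ?m * x ?m ^ k * e (\<theta> @ i # j # \<rho>)) * t ?m)"
        unfolding ev_def sum_distrib_left sum_distrib_right
        using hm_comm_t[OF hs, of ?m] by (simp add: mult.assoc) (simp flip: mult.assoc)
      also have "\<dots> = (\<Sum>k<M. s (int k) * ?X ^ k * (t ?m * t ?m * ?e))"
        unfolding t_xp_neq[OF lenm refl ij(1)] using te by (simp add: mult.assoc)
      also have "t ?m * t ?m * ?e = (\<Sum>q\<le>p. Pc q * ?X ^ q) * ?e"
      proof -
        have "t ?m * t ?m * ?e = (\<Sum>a\<le>p'. \<Sum>b\<le>p. sc (cf j i a b) * (x ?m ^ a * ?X ^ b)) * ?e"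
          unfolding p_def p'_def by (rule t_t[OF lenm refl])
        also have "(\<Sum>a\<le>p'. \<Sum>b\<le>p. sc (cf j i a b) * (x ?m ^ a * ?X ^ b)) = (\<Sum>q\<le>p. Pc q * ?X ^ q)"
          unfolding Pc_def sum_distrib_right using cf_sym[OF ij(2,3)]
          by (subst sum.swap) (simp add: mult.assoc)
        finally show ?thesis .
      qed
      also have "(\<Sum>k<M. s (int k) * ?X ^ k * ((\<Sum>q\<le>p. Pc q * ?X ^ q) * ?e))
          = (\<Sum>q\<le>p. Pc q * (\<Sum>k<M. s (int k) * ?X ^ (k + q))) * ?e"
      proof -
        have XP: "?X ^ k * Pc q = Pc q * ?X ^ k" for k q
          unfolding Pc_def sum_distrib_left sum_distrib_right
          using x_pow_pow[of ?m _ "Suc ?m" k] by (simp add: mult.assoc sc_left)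
        have "s (int k) * ?X ^ k * (Pc q * ?X ^ q) = Pc q * (s (int k) * ?X ^ (k + q))" for k q
        proof -
          have "s (int k) * ?X ^ k * (Pc q * ?X ^ q) = s (int k) * (?X ^ k * Pc q) * ?X ^ q"
            by (simp only: mult.assoc)
          also have "\<dots> = (s (int k) * Pc q) * ?X ^ k * ?X ^ q" by (simp only: XP mult.assoc)
          finally show ?thesis by (simp only: Pc_s[symmetric] power_add mult.assoc)
        qed
        then have "(\<Sum>k<M. s (int k) * ?X ^ k * (\<Sum>q\<le>p. Pc q * ?X ^ q))
            = (\<Sum>q\<le>p. Pc q * (\<Sum>k<M. s (int k) * ?X ^ (k + q)))"
          by (simp only: sum_distrib_left) (rule sum.swap)
        moreover have "(\<Sum>k<M. s (int k) * ?X ^ k * (Q * ?e)) = (\<Sum>k<M. s (int k) * ?X ^ k * Q) * ?e" for Q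
          by (subst sum_distrib_right) (simp only: mult.assoc)
        ultimately show ?thesis by (simp only:)
      qed
      finally show ?thesis .
    qed
    \<comment> \<open>The correction of the braid relation evaluates \<Phi> at powers of x_l, hence
      at the negative coefficients of the old series.\<close>
    also have "(\<Sum>a\<le>p. \<Sum>b\<le>p'. sc (cf i j a b) *
        (x ?m ^ b * \<Phi> (\<Sum>c<a. x ?l ^ c * ?X ^ (a - 1 - c)))) * ?e
        = (\<Sum>q\<le>p. Pc q * - (\<Sum>c<q. s (- int c - 1) * ?X ^ (q - 1 - c))) * ?e"
    proof -
      have "\<Phi> (\<Sum>c<a. x ?l ^ c * ?X ^ (a - 1 - c)) * ?e = - (\<Sum>c<a. s (- int c - 1) * ?X ^ (a - 1 - c)) * ?e" for a
      proof -
        have "\<Phi> (\<Sum>c<a. x ?l ^ c * ?X ^ (a - 1 - c)) * ?e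
            = (\<Sum>c<a. (\<Phi> (x ?l ^ c) * ?e) * ?X ^ (a - 1 - c))"
          by (simp add: bim_sum_arg[OF \<Phi>] bim_x(2)[OF \<Phi>] sum_distrib_right mult.assoc x_pow_e)
        also have "\<dots> = (\<Sum>c<a. (- s (- int c - 1) * ?e) * ?X ^ (a - 1 - c))"
          using mom[of "j # i # \<rho>"] len by simp
        finally show ?thesis
          by (simp add: sum_distrib_right mult.assoc x_pow_e sum_negf)
      qed
      then show ?thesis
        unfolding Pc_def sum_distrib_right by (simp add: mult.assoc)
    qed
    finally have "\<Phi>' (t ?m) * ?e = (\<Sum>q\<le>p. Pc q * ((\<Sum>k<M. s (int k) * ?X ^ (k + q))
        + (\<Sum>c<q. s (- int c - 1) * ?X ^ (q - 1 - c)))) * ?e"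
      by (simp add: distrib_left sum.distrib distrib_right sum_negf)
    also have "(\<Sum>q\<le>p. Pc q * ((\<Sum>k<M. s (int k) * ?X ^ (k + q)) + (\<Sum>c<q. s (- int c - 1) * ?X ^ (q - 1 - c))))
        = (\<Sum>q\<le>p. Pc q * (\<Sum>k<M'. s (int k - int q) * ?X ^ k))"
    proof (intro sum.cong refl arg_cong2[of _ _ _ _ "(*)"])
      \<comment> \<open>The two pieces are the nonnegative and the negative coefficients of s that
        make up the polynomial part of u^q s(u) at x_{m+1}.\<close>
      fix q assume q: "q \<in> {..p}"
      have "(\<Sum>k<M'. s (int k - int q) * ?X ^ k) = (\<Sum>k<q + M. s (int k - int q) * ?X ^ k)"
        using M' M q by (intro sum_lessThan_eq) (auto simp: s0 el)
      also have "\<dots> = (\<Sum>k<q. s (int k - int q) * ?X ^ k) + (\<Sum>k<M. s (int k) * ?X ^ (k + q))"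
        unfolding sum_lessThan_split by (simp add: add.commute)
      also have "(\<Sum>k<q. s (int k - int q) * ?X ^ k) = (\<Sum>c<q. s (- int c - 1) * ?X ^ (q - 1 - c))"
      proof -
        have "(\<Sum>k<q. s (int k - int q) * ?X ^ k) = (\<Sum>c<q. s (int (q - Suc c) - int q) * ?X ^ (q - Suc c))"
          by (rule sum.nat_diff_reindex[symmetric])
        also have "\<dots> = (\<Sum>c<q. s (- int c - 1) * ?X ^ (q - 1 - c))"
        proof (intro sum.cong refl)
          fix c assume "c \<in> {..<q}"
          then have "int (q - Suc c) - int q = - int c - 1" "q - Suc c = q - 1 - c" by auto
          then show "s (int (q - Suc c) - int q) * ?X ^ (q - Suc c) = s (- int c - 1) * ?X ^ (q - 1 - c)"
            by (simp only:)
        qed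
        finally show ?thesis .
      qed
      finally show "(\<Sum>k<M. s (int k) * ?X ^ (k + q)) + (\<Sum>c<q. s (- int c - 1) * ?X ^ (q - 1 - c))
        = (\<Sum>k<M'. s (int k - int q) * ?X ^ k)" by (simp only: add.commute)
    qed
    also have "\<dots> = ev M' s' 0 (Suc ?m)"
      unfolding ev_def s'_def sum_distrib_left sum_distrib_right
      by (subst sum.swap) (simp add: mult.assoc)
    finally show ?thesis .
  qed
  ultimately have "bubble (\<theta> @ [j]) i \<Phi>' s'"
    unfolding bubble_def by (simp only: length_append_singleton append_assoc append_Cons append_Nil) blast
  then show ?thesis by blast
qed

text \<open>Both sides are h_{p-2}(x_k, x_k, x_{k+1}), the second divided difference of the p-th
  power at a doubled point.\<close>

lemma hs_nested:
  "(\<Sum>a<p. x k ^ a * hs k (p - 1 - a)) = (\<Sum>d<p. of_nat (p - 1 - d) * (x k ^ (p - 2 - d) * x (Suc k) ^ d))"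
proof (induction p)
  case (Suc p)
  have "(\<Sum>a<Suc p. x k ^ a * hs k (Suc p - 1 - a)) = hs k p + x k * (\<Sum>a<p. x k ^ a * hs k (p - 1 - a))"
    by (simp add: sum.lessThan_Suc_shift sum_distrib_left mult.assoc del: sum.lessThan_Suc)
  also have "hs k p = (\<Sum>d<p. x k ^ (p - 1 - d) * x (Suc k) ^ d)"
  proof -
    have "hs k p = (\<Sum>d<p. x k ^ (p - Suc d) * x (Suc k) ^ (p - 1 - (p - Suc d)))"
      unfolding hs_def by (rule sum.nat_diff_reindex[symmetric])
    also have "\<dots> = (\<Sum>d<p. x k ^ (p - 1 - d) * x (Suc k) ^ d)" by (intro sum.cong) auto
    finally show ?thesis .
  qed
  also have "\<dots> + x k * (\<Sum>a<p. x k ^ a * hs k (p - 1 - a))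
      = (\<Sum>d<p. of_nat (p - d) * (x k ^ (p - 1 - d) * x (Suc k) ^ d))"
    unfolding Suc sum_distrib_left sum.distrib[symmetric]
  proof (rule sum.cong)
    fix d assume d: "d \<in> {..<p}"
    show "x k ^ (p - 1 - d) * x (Suc k) ^ d + x k * (of_nat (p - 1 - d) * (x k ^ (p - 2 - d) * x (Suc k) ^ d))
      = of_nat (p - d) * (x k ^ (p - 1 - d) * x (Suc k) ^ d)"
    proof (cases "p - 1 - d = 0")
      case True
      then have "p - d = 1" using d by auto
      then show ?thesis using True by simp
    next
      case False
      then have 1: "p - 1 - d = Suc (p - 2 - d)" "p - d = Suc (p - 1 - d)" by auto
      have "x k * (of_nat (p - 1 - d) * (x k ^ (p - 2 - d) * x (Suc k) ^ d))
        = of_nat (p - 1 - d) * (x k ^ (p - 1 - d) * x (Suc k) ^ d)"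
        unfolding 1(1) power_Suc by (metis mult.assoc mult_of_nat_commute)
      then show ?thesis unfolding 1(2) of_nat_Suc by (simp add: distrib_right)
    qed
  qed simp
  finally show ?case by simp
qed simp

text \<open>Notation as for \<open>bubble_neq\<close>. A letter i in place m divides the series by
  (u - x_m)^2. The conjugated tensor alone is not enough, for it vanishes at 1 because \<tau>_l
  squares to 0 on equal letters. \<open>\<Psi>\<close>, the divided difference of the polynomial
  part of s written as a tensor, supplies the rest.\<close>

lemma bubble_eq:
  assumes b: "bubble \<theta> i \<Phi> s" and i: "i \<in> I"
  shows "\<exists>\<Phi>' s'. bubble (\<theta> @ [i]) i \<Phi>' s'"
proof -
  let ?l = "length \<theta>" and ?m = "Suc (length \<theta>)"
  define M where "M = nat (ell \<theta> i + 1)"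
  \<comment> \<open>From (y - x_m)^{-2} = \<Sum> u x_m^{u-1} y^{-u-1}. The summand \<open>u\<close>
    = 0 is 0, and beyond the bound the coefficient of s is 0.\<close>
  define s' where "s' k = (\<Sum>u<nat (ell \<theta> i - k). of_nat u * (s (k + 1 + int u) * x ?m ^ (u - 1)))" for k
  define \<Psi> where "\<Psi> z = (\<Sum>p<M. \<Sum>a<p. s (int p) * x ?m ^ a * z * x ?m ^ (p - 1 - a))" for z
  define \<Phi>' where "\<Phi>' z = - (\<Psi> z + \<Phi> (t ?l * z * t ?l))" for z
  have M: "ell \<theta> i < int M" by (simp add: M_def)
  have \<Phi>: "bim \<theta> i (of_int (ell \<theta> i + 1) * dg i i) \<Phi>" and hs: "\<And>k. hm \<theta> \<theta> (of_int (ell \<theta> i - k) * dg i i) (s k)"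
    and s0: "\<And>k. ell \<theta> i < k \<Longrightarrow> s k = 0"
    and top: "\<And>\<rho> M. ?l + 1 + length \<rho> = n \<Longrightarrow> ell \<theta> i < int M \<Longrightarrow>
        \<Phi> (t ?l) * e (\<theta> @ i # \<rho>) = ev M s 0 ?m * e (\<theta> @ i # \<rho>)"
    using b by (auto simp: bubble_def)
  obtain c where c: "c \<noteq> 0" "s (ell \<theta> i) = sc c" using b by (auto simp: bubble_def)
  have el: "ell (\<theta> @ [i]) i = ell \<theta> i - 2" by (simp add: ell_snoc ca_diag[OF i])
  have s'_eq: "s' k = (\<Sum>u<N. of_nat u * (s (k + 1 + int u) * x ?m ^ (u - 1)))"
    if "ell \<theta> i \<le> k + int N" for k N
    unfolding s'_def by (rule sum_lessThan_eq) (use that in \<open>auto simp: s0\<close>)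
  have hx: "hm (\<theta> @ [i]) (\<theta> @ [i]) (of_nat a * dg i i) (x ?m ^ a)" for a
    using hm_xp1[of ?m \<theta> i "[]" a] by simp
  have hsx: "hm (\<theta> @ [i]) (\<theta> @ [i]) (of_nat a * dg i i + of_int (ell \<theta> i - k) * dg i i) (s k * x ?m ^ a)" for a k
    by (rule hm_trans[OF hm_ext[OF hs] hx])
  have "hm (\<theta> @ [i]) (\<theta> @ [i]) (of_int (ell (\<theta> @ [i]) i - k) * dg i i) (s' k)" for k
    unfolding s'_def
  proof (rule hm_sum)
    fix u
    show "hm (\<theta> @ [i]) (\<theta> @ [i]) (of_int (ell (\<theta> @ [i]) i - k) * dg i i)
      (of_nat u * (s (k + 1 + int u) * x ?m ^ (u - 1)))"
    proof (cases u)
      case (Suc v)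
      have "of_nat v * dg i i + of_int (ell \<theta> i - (k + 1 + int u)) * dg i i = of_int (ell (\<theta> @ [i]) i - k) * dg i i"
        by (simp add: Suc el algebra_simps)
      then show ?thesis using hm_sc[OF hsx[of v "k + 1 + int u"], of "of_nat u"]
        by (simp add: Suc sc_of_nat del: of_nat_Suc)
    qed (simp add: hm_zero)
  qed simp
  moreover have s'0: "s' k = 0" if "ell (\<theta> @ [i]) i < k" for k
    unfolding s'_def
  proof (rule sum.neutral, rule ballI)
    fix u
    show "of_nat u * (s (k + 1 + int u) * x ?m ^ (u - 1)) = 0"
      using that by (cases u) (simp_all add: el s0)
  qed
  moreover have "s' (ell (\<theta> @ [i]) i) = sc c"
    unfolding s'_def by (simp add: el c numeral_2_eq_2)
  moreover have "bim (\<theta> @ [i]) i (of_int (ell (\<theta> @ [i]) i + 1) * dg i i) \<Phi>'"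
    unfolding \<Phi>'_def \<Psi>_def
  proof (intro bim_uminus bim_add bim_sum)
    fix p a :: nat assume "a \<in> {..<p}"
    then obtain v where p: "p = Suc (a + v)" using less_imp_Suc_add by auto
    show "bim (\<theta> @ [i]) i (of_int (ell (\<theta> @ [i]) i + 1) * dg i i)
      (\<lambda>z. s (int p) * x ?m ^ a * z * x ?m ^ (p - 1 - a))"
      by (rule bim_1[OF hsx hx]) (simp add: p el algebra_simps)
  next
    show "bim (\<theta> @ [i]) i (of_int (ell (\<theta> @ [i]) i + 1) * dg i i) (\<lambda>z. \<Phi> (t ?l * z * t ?l))"
      by (rule bim_conj[OF \<Phi>]) (simp add: el algebra_simps)
  qed
  moreover have "\<Phi>' (x ?m ^ k) * e (\<theta> @ i # \<rho>) = - s' (- int k - 1) * e (\<theta> @ i # \<rho>)"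
    if len: "Suc ?l + length \<rho> = n" for \<rho> k
  proof -
    let ?e = "e (\<theta> @ i # \<rho>)"
    have lenl: "?l + 1 + length \<rho> = n" using len by simp
    have \<Psi>: "\<Psi> (x ?m ^ k) = (\<Sum>p<M. of_nat p * (s (int p) * x ?m ^ (p + k - 1)))" for k
      unfolding \<Psi>_def
    proof (intro sum.cong refl)
      fix p
      have "(\<Sum>a<p. s (int p) * x ?m ^ a * x ?m ^ k * x ?m ^ (p - 1 - a)) = (\<Sum>a<p. s (int p) * x ?m ^ (p + k - 1))"
      proof (intro sum.cong refl)
        fix a assume "a \<in> {..<p}"
        then have "a + k + (p - 1 - a) = p + k - 1" by auto
        then have "x ?m ^ a * x ?m ^ k * x ?m ^ (p - 1 - a) = x ?m ^ (p + k - 1)"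
          by (simp only: power_add[symmetric])
        then show "s (int p) * x ?m ^ a * x ?m ^ k * x ?m ^ (p - 1 - a) = s (int p) * x ?m ^ (p + k - 1)"
          by (simp only: mult.assoc)
      qed
      then show "(\<Sum>a<p. s (int p) * x ?m ^ a * x ?m ^ k * x ?m ^ (p - 1 - a)) = of_nat p * (s (int p) * x ?m ^ (p + k - 1))"
        by simp
    qed
    \<comment> \<open>Induction on k. A further factor x_m multiplies what is there by x_m, and
      \<Phi>(x_l^k \<tau>_l), known from \<open>bubble_shift\<close>, raises every integer
      coefficient by one.\<close>
    have "\<Phi>' (x ?m ^ k) * ?e = - (\<Sum>u<M + k. of_nat u * (s (int u - int k) * x ?m ^ (u - 1))) * ?e" for k
    proof (induction k)
      case 0
      have "\<Phi> (t ?l * t ?l) * ?e = \<Phi> 0 * ?e"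
      proof (rule bim_e[OF \<Phi>])
        fix \<kappa> :: "'i list" assume kl: "?l = Suc (length \<kappa>)"
        have len2: "length \<kappa> + 2 + length \<rho> = n" using kl len by simp
        show "t ?l * t ?l * e (\<kappa> @ i # i # \<rho>) = 0 * e (\<kappa> @ i # i # \<rho>)"
          using t_t[OF len2 kl, of i i] by (simp add: cf_diag[OF i] sc_0)
      qed (use len in simp)
      then show ?case using \<Psi>[of 0] by (simp add: \<Phi>'_def bim_zero[OF \<Phi>] left_diff_distrib)
    next
      case (Suc k)
      have "\<Phi> (t ?l * x ?m ^ Suc k * t ?l) * ?e = \<Phi> (x ?m ^ 1 * (t ?l * x ?m ^ k * t ?l) + x ?l ^ k * t ?l) * ?e"
      proof (rule bim_e[OF \<Phi>])
        fix \<kappa> :: "'i list" assume kl: "?l = Suc (length \<kappa>)"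
        let ?f = "e (\<kappa> @ i # i # \<rho>)"
        have len2: "length \<kappa> + 2 + length \<rho> = n" using kl len by simp
        have tt0: "t ?l * (t ?l * ?f) = 0"
          using t_t[OF len2 kl, of i i] by (simp add: cf_diag[OF i] sc_0 mult.assoc)
        have conj: "t ?l * x ?m ^ k * t ?l * ?f = hs ?l k * t ?l * ?f" for k
        proof -
          have "t ?l * x ?m ^ k * t ?l * ?f = (t ?l * x ?m ^ k * ?f) * t ?l"
            using t_ek[OF len2 kl, of i i] by (simp add: mult.assoc)
          also have "\<dots> = hs ?l k * t ?l * ?f"
          proof -
            have te: "t ?l * ?f = ?f * t ?l" by (rule t_ek[OF len2 kl])
            have "x ?l ^ k * t ?l * ?f * t ?l = x ?l ^ k * (t ?l * (t ?l * ?f))"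
            proof -
              have "t ?l * (?f * t ?l) = ?f * (t ?l * t ?l)" using te by (simp flip: mult.assoc)
              then show ?thesis by (simp only: te mult.assoc)
            qed
            moreover have "hs ?l k * ?f * t ?l = hs ?l k * t ?l * ?f" by (simp only: te mult.assoc)
            ultimately show ?thesis unfolding t_xSp_eq[OF len2 kl] by (simp add: distrib_right tt0)
          qed
          finally show ?thesis .
        qed
        have "t ?l * x ?m ^ Suc k * t ?l * ?f = (hs ?l k * x ?m + x ?l ^ k) * t ?l * ?f"
          unfolding conj hs_Suc by simp
        also have "\<dots> = x ?m * (hs ?l k * t ?l * ?f) + x ?l ^ k * t ?l * ?f"
          by (simp add: distrib_right hs_comm mult.assoc)
        also have "x ?m * (hs ?l k * t ?l * ?f) = x ?m * (t ?l * x ?m ^ k * t ?l * ?f)"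
          unfolding conj ..
        finally show "t ?l * x ?m ^ Suc k * t ?l * ?f = (x ?m ^ 1 * (t ?l * x ?m ^ k * t ?l) + x ?l ^ k * t ?l) * ?f"
          by (simp add: distrib_right mult.assoc)
      qed (use len in simp)
      also have "\<dots> = x ?m * (\<Phi> (t ?l * x ?m ^ k * t ?l) * ?e) + \<Phi> (x ?l ^ k * t ?l) * ?e"
        unfolding bim_plus[OF \<Phi>] bim_x(1)[OF \<Phi> lessI] distrib_right by (simp add: mult.assoc)
      finally have 1: "\<Phi> (t ?l * x ?m ^ Suc k * t ?l) * ?e
        = x ?m * (\<Phi> (t ?l * x ?m ^ k * t ?l) * ?e) + ev (M + k) s k ?m * ?e"
        by (simp only: bubble_shift[OF b lenl M])
      have xsx: "x ?m * (of_nat u * (s q * x ?m ^ v)) = of_nat u * (s q * x ?m ^ Suc v)" for u q v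
      proof -
        have "x ?m * (of_nat u * (s q * x ?m ^ v)) = of_nat u * (x ?m * s q * x ?m ^ v)"
          by (metis mult.assoc mult_of_nat_commute)
        then show ?thesis using hm_comm_x[OF hs, of ?m q] by (simp add: mult.assoc)
      qed
      have 2: "\<Psi> (x ?m ^ Suc k) * ?e = x ?m * (\<Psi> (x ?m ^ k) * ?e)"
      proof -
        have "\<Psi> (x ?m ^ Suc k) = x ?m * \<Psi> (x ?m ^ k)"
          unfolding \<Psi> sum_distrib_left
        proof (intro sum.cong refl)
          fix p
          show "of_nat p * (s (int p) * x ?m ^ (p + Suc k - 1)) = x ?m * (of_nat p * (s (int p) * x ?m ^ (p + k - 1)))"
            unfolding xsx by (cases p) simp_all
        qed
        then show ?thesis by (simp add: mult.assoc)
      qed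
      have "\<Phi>' (x ?m ^ Suc k) * ?e = - (\<Psi> (x ?m ^ Suc k) * ?e + \<Phi> (t ?l * x ?m ^ Suc k * t ?l) * ?e)"
        by (simp only: \<Phi>'_def distrib_right mult_minus_left)
      also have "\<dots> = x ?m * (\<Phi>' (x ?m ^ k) * ?e) - ev (M + k) s k ?m * ?e"
        unfolding 1 2 \<Phi>'_def by (simp only: distrib_right distrib_left mult_minus_left mult_minus_right) simp
      also have "\<dots> = - (x ?m * (\<Sum>u<M + k. of_nat u * (s (int u - int k) * x ?m ^ (u - 1)))
          + ev (M + k) s k ?m) * ?e"
        unfolding Suc by (simp add: distrib_right left_diff_distrib mult.assoc)
      also have "x ?m * (\<Sum>u<M + k. of_nat u * (s (int u - int k) * x ?m ^ (u - 1))) + ev (M + k) s k ?m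
        = (\<Sum>u<M + k. of_nat (Suc u) * (s (int u - int k) * x ?m ^ u))"
        unfolding ev_def sum_distrib_left sum.distrib[symmetric]
      proof (intro sum.cong refl)
        fix u
        show "x ?m * (of_nat u * (s (int u - int k) * x ?m ^ (u - 1))) + s (int u - int k) * x ?m ^ u
          = of_nat (Suc u) * (s (int u - int k) * x ?m ^ u)"
          unfolding xsx by (cases u) (simp_all add: distrib_right)
      qed
      also have "\<dots> = (\<Sum>u<M + Suc k. of_nat u * (s (int u - int (Suc k)) * x ?m ^ (u - 1)))"
        by (simp add: sum.lessThan_Suc_shift del: sum.lessThan_Suc of_nat_Suc)
          (simp add: algebra_simps)
      finally show ?case .
    qed
    moreover have "s' (- int k - 1) = (\<Sum>u<M + k. of_nat u * (s (int u - int k) * x ?m ^ (u - 1)))"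
      using s'_eq[of "- int k - 1" "M + k"] M by (simp add: algebra_simps)
    ultimately show ?thesis by simp
  qed
  moreover have "\<Phi>' (t ?m) * e (\<theta> @ i # i # \<rho>) = ev M' s' 0 (Suc ?m) * e (\<theta> @ i # i # \<rho>)"
    if len: "Suc ?l + 1 + length \<rho> = n" and M': "ell (\<theta> @ [i]) i < int M'" for \<rho> M'
  proof -
    let ?e = "e (\<theta> @ i # i # \<rho>)" and ?X = "x (Suc ?m)"
    have lenm: "?l + 2 + length \<rho> = n" using len by simp
    have te: "t ?m * ?e = ?e * t ?m" by (rule t_ek[OF lenm refl])
    have tt0: "t ?m * (t ?m * ?e) = 0"
      using t_t[OF lenm refl, of i i] by (simp add: cf_diag[OF i] sc_0 mult.assoc)
    have "\<Phi> (t ?l * t ?m * t ?l) * ?e = \<Phi> (t ?m * t ?l * t ?m) * ?e"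
    proof (rule bim_e[OF \<Phi>])
      fix \<kappa> :: "'i list" assume kl: "?l = Suc (length \<kappa>)"
      have len3: "length \<kappa> + 3 + length \<rho> = n" using kl len by simp
      from braid_eq[OF len3 kl, of i i]
      show "t ?l * t ?m * t ?l * e (\<kappa> @ i # i # i # \<rho>) = t ?m * t ?l * t ?m * e (\<kappa> @ i # i # i # \<rho>)"
        by (simp add: cf_diag[OF i] sc_0 left_diff_distrib)
    qed (use len in simp)
    also have "\<dots> = t ?m * \<Phi> (t ?l) * t ?m * ?e"
      by (simp only: bim_t[OF \<Phi>, of ?m] lessI)
    also have "\<dots> = t ?m * (\<Phi> (t ?l) * ?e) * t ?m" by (simp only: te mult.assoc)
    also have "\<Phi> (t ?l) * ?e = ev M s 0 ?m * ?e"
      by (rule top) (use len M in auto)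
    also have "t ?m * (ev M s 0 ?m * ?e) * t ?m = (\<Sum>p<M. s (int p) * (t ?m * x ?m ^ p * ?e) * t ?m)"
      unfolding ev_def sum_distrib_left sum_distrib_right
      using hm_comm_t[OF hs, of ?m] by (simp add: mult.assoc) (simp flip: mult.assoc)
    also have "\<dots> = (\<Sum>p<M. - (s (int p) * (hs ?m p * t ?m * ?e)))"
    proof (intro sum.cong refl)
      fix p
      have "(t ?m * x ?m ^ p * ?e) * t ?m = ?X ^ p * (t ?m * (t ?m * ?e)) - hs ?m p * t ?m * ?e"
      proof -
        have "t ?m * (?e * t ?m) = ?e * (t ?m * t ?m)" using te by (simp flip: mult.assoc)
        then show ?thesis unfolding t_xp_eq[OF lenm refl] by (simp add: left_diff_distrib mult.assoc te)
      qed
      then show "s (int p) * (t ?m * x ?m ^ p * ?e) * t ?m = - (s (int p) * (hs ?m p * t ?m * ?e))"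
        by (simp add: tt0 mult.assoc)
    qed
    finally have 1: "\<Phi> (t ?l * t ?m * t ?l) * ?e = - (\<Sum>p<M. s (int p) * (hs ?m p * t ?m * ?e))"
      by (simp add: sum_negf)
    have "\<Phi>' (t ?m) * ?e = (\<Sum>p<M. s (int p) * (hs ?m p * t ?m * ?e)) - \<Psi> (t ?m) * ?e"
      unfolding \<Phi>'_def using 1 by (simp add: algebra_simps)
    also have "\<Psi> (t ?m) * ?e = (\<Sum>p<M. s (int p) * (\<Sum>a<p. x ?m ^ a * (t ?m * x ?m ^ (p - 1 - a) * ?e)))"
      by (simp add: \<Psi>_def sum_distrib_right sum_distrib_left mult.assoc)
    \<comment> \<open>Term by term, x_{m+1}^{p-1-a} \<tau>_m and \<tau>_m x_m^{p-1-a} differ by a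
      divided difference, so \<tau>_m disappears.\<close>
    also have "(\<Sum>p<M. s (int p) * (hs ?m p * t ?m * ?e)) - \<dots>
      = (\<Sum>p<M. s (int p) * (\<Sum>a<p. x ?m ^ a * hs ?m (p - 1 - a)) * ?e)"
      unfolding sum_subtractf[symmetric]
    proof (intro sum.cong refl)
      fix p
      have "hs ?m p * t ?m * ?e - (\<Sum>a<p. x ?m ^ a * (t ?m * x ?m ^ (p - 1 - a) * ?e))
        = (\<Sum>a<p. x ?m ^ a * (?X ^ (p - 1 - a) * t ?m * ?e - t ?m * x ?m ^ (p - 1 - a) * ?e))"
        by (simp add: hs_def sum_distrib_right mult.assoc right_diff_distrib sum_subtractf)
      also have "\<dots> = (\<Sum>a<p. x ?m ^ a * hs ?m (p - 1 - a)) * ?e"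
        unfolding t_xp_eq[OF lenm refl] by (simp add: sum_distrib_right mult.assoc)
      finally show "s (int p) * (hs ?m p * t ?m * ?e) - s (int p) * (\<Sum>a<p. x ?m ^ a * (t ?m * x ?m ^ (p - 1 - a) * ?e))
        = s (int p) * (\<Sum>a<p. x ?m ^ a * hs ?m (p - 1 - a)) * ?e"
        by (simp add: right_diff_distrib[symmetric] mult.assoc)
    qed
    also have "\<dots> = (\<Sum>p<M. s (int p) * (\<Sum>d<M. of_nat (p - 1 - d) * (x ?m ^ (p - 2 - d) * ?X ^ d))) * ?e"
    proof -
      have "(\<Sum>d<p. of_nat (p - 1 - d) * (x ?m ^ (p - 2 - d) * ?X ^ d))
          = (\<Sum>d<M. of_nat (p - 1 - d) * (x ?m ^ (p - 2 - d) * ?X ^ d))" if "p < M" for p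
        using that by (intro sum_lessThan_eq) auto
      then show ?thesis unfolding hs_nested sum_distrib_right by (intro sum.cong) auto
    qed
    also have "(\<Sum>p<M. s (int p) * (\<Sum>d<M. of_nat (p - 1 - d) * (x ?m ^ (p - 2 - d) * ?X ^ d)))
      = (\<Sum>d<M. \<Sum>p<M. of_nat (p - 1 - d) * (s (int p) * x ?m ^ (p - 2 - d)) * ?X ^ d)"
    proof -
      have "s (int p) * (of_nat (p - 1 - d) * (x ?m ^ (p - 2 - d) * ?X ^ d))
        = of_nat (p - 1 - d) * (s (int p) * x ?m ^ (p - 2 - d)) * ?X ^ d" for p d
        by (metis mult.assoc mult_of_nat_commute)
      then show ?thesis unfolding sum_distrib_left by (subst sum.swap) simp
    qed
    also have "\<dots> = (\<Sum>d<M. s' (int d) * ?X ^ d)"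
    proof (intro sum.cong refl)
      fix d assume d: "d \<in> {..<M}"
      have "M = Suc d + (M - Suc d)" using d by auto
      then have "(\<Sum>p<M. of_nat (p - 1 - d) * (s (int p) * x ?m ^ (p - 2 - d)))
        = (\<Sum>p<Suc d + (M - Suc d). of_nat (p - 1 - d) * (s (int p) * x ?m ^ (p - 2 - d)))" by simp
      also have "\<dots> = (\<Sum>u<M - Suc d. of_nat u * (s (int d + 1 + int u) * x ?m ^ (u - 1)))"
        unfolding sum_lessThan_split by (simp add: algebra_simps)
      also have "\<dots> = s' (int d)" using M d by (intro s'_eq[symmetric]) auto
      finally show "(\<Sum>p<M. of_nat (p - 1 - d) * (s (int p) * x ?m ^ (p - 2 - d)) * ?X ^ d) = s' (int d) * ?X ^ d"
        by (simp only: sum_distrib_right[symmetric])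
    qed
    also have "\<dots> = ev M' s' 0 (Suc ?m)"
      unfolding ev_def diff_zero of_nat_0
    proof (rule sum_lessThan_eq)
      fix k assume "M \<le> k \<or> M' \<le> k"
      then have "ell (\<theta> @ [i]) i < int k" using M M' el by auto
      then have "s' (int k) = 0" by (rule s'0)
      then show "s' (int k) * ?X ^ k = 0" by simp
    qed
    finally show ?thesis .
  qed
  ultimately have "bubble (\<theta> @ [i]) i \<Phi>' s'"
    unfolding bubble_def using c(1)
    by (simp only: length_append_singleton append_assoc append_Cons append_Nil) blast
  then show ?thesis by blast
qed

lemma bubble_exists: "set \<theta> \<subseteq> I \<Longrightarrow> i \<in> I \<Longrightarrow> \<exists>\<Phi> s. bubble \<theta> i \<Phi> s"
proof (induction \<theta> rule: rev_induct)
  case Nil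
  then show ?case using bubble_Nil by blast
next
  case (snoc j \<theta>)
  then obtain \<Phi> s where "bubble \<theta> i \<Phi> s" by auto
  then show ?case using bubble_neq[of \<theta> i \<Phi> s j] bubble_eq[of \<theta> i \<Phi> s] snoc.prems
    by (cases "i = j") auto
qed

end

section \<open>Spanning the cocenter by blocks\<close>

text \<open>Stated for an arbitrary monoid, so that one expression can be read in the free algebra,
  where it is \<open>\<tau>w\<close>, and in its image under \<open>act\<close>.\<close>

definition tw_prod :: "(nat \<Rightarrow> 'a::monoid_mult) \<Rightarrow> nat \<Rightarrow> nat \<Rightarrow> 'a" where
  "tw_prod t u v = prod_list (map (\<lambda>j. prod_list (map t [u..<j])) (rev [u + 1..<v + 1]))"

definition e_prod :: "(nat \<Rightarrow> 'a::monoid_mult) \<Rightarrow> (nat \<Rightarrow> 'a) \<Rightarrow> nat \<Rightarrow> nat \<Rightarrow> 'a" where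
  "e_prod x t u v = (if u < v then tw_prod t u v * prod_list (map (\<lambda>j. x j ^ (j - u)) [u + 1..<v + 1]) else 1)"

text \<open>A triple \<open>(i, k, l)\<close> stands for \<open>e\<^bsub>[p+1, p+k]\<^esub> x\<^bsub>p+k\<^esub>\<^bsup>l\<^esup>\<close> on \<open>k\<close> adjacent letters \<open>i\<close>.\<close>

definition bseq :: "('i \<times> nat \<times> nat) list \<Rightarrow> 'i list" where
  "bseq bl = concat (map (\<lambda>(i, k, l). replicate k i) bl)"

fun belt :: "(nat \<Rightarrow> 'a::monoid_mult) \<Rightarrow> (nat \<Rightarrow> 'a) \<Rightarrow> nat \<Rightarrow> ('i \<times> nat \<times> nat) list \<Rightarrow> 'a" where
  "belt x t p [] = 1"
| "belt x t p ((i, k, l) # bl) = e_prod x t (p + 1) (p + k) * x (p + k) ^ l * belt x t (p + k) bl"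

lemma bseq_simps [simp]:
  "bseq [] = []" "bseq ((i, k, l) # bl) = replicate k i @ bseq bl" "bseq (bl @ bl') = bseq bl @ bseq bl'"
  by (simp_all add: bseq_def)

lemma belt_append: "belt x t p (bl @ bl') = belt x t p bl * belt x t (p + length (bseq bl)) bl'"
  by (induction x t p bl rule: belt.induct) (simp_all add: mult.assoc add.assoc)

lemma prod_list_comm:
  fixes w :: "'a::monoid_mult"
  shows "(\<And>y. y \<in> set ys \<Longrightarrow> w * y = y * w) \<Longrightarrow> w * prod_list ys = prod_list ys * w"
  by (induction ys) (auto intro: comm_times)

lemma tw_prod_Suc: "a \<le> b \<Longrightarrow> tw_prod t a (Suc b) = prod_list (map t [a..<Suc b]) * tw_prod t a b"
  by (simp add: tw_prod_def)

lemma tw_prod_comm: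
  "(\<And>j. u \<le> j \<Longrightarrow> j < v \<Longrightarrow> w * t j = t j * w) \<Longrightarrow> w * tw_prod t u v = tw_prod t u v * w"
  unfolding tw_prod_def by (intro prod_list_comm) (auto intro!: prod_list_comm)

lemma e_prod_comm:
  "(\<And>j. u \<le> j \<Longrightarrow> j < v \<Longrightarrow> w * t j = t j * w) \<Longrightarrow> (\<And>j. u \<le> j \<Longrightarrow> j \<le> v \<Longrightarrow> w * x j = x j * w)
    \<Longrightarrow> w * e_prod x t u v = e_prod x t u v * w"
  unfolding e_prod_def by (auto intro!: comm_times tw_prod_comm prod_list_comm comm_power)

text \<open>The idempotent at the end passes through the factors g, so that each h meets it and is
  replaced in turn.\<close>

lemma prod_list_absorb:
  fixes f :: "'a::monoid_mult"
  shows "f * f = f \<Longrightarrow> (\<And>j. j \<in> set js \<Longrightarrow> g j * f = f * g j) \<Longrightarrow> (\<And>j. j \<in> set js \<Longrightarrow> h j * f = g j * f) \<Longrightarrow>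
    prod_list (map h js) * f = prod_list (map g js) * f"
proof (induction js)
  case (Cons j js)
  have c: "prod_list (map g js) * f = f * prod_list (map g js)"
    using Cons.prems by (intro prod_list_comm[symmetric]) auto
  have IH: "prod_list (map h js) * f = prod_list (map g js) * f" using Cons by auto
  have "prod_list (map h (j # js)) * f = h j * (prod_list (map h js) * f)" by (simp add: mult.assoc)
  also have "\<dots> = h j * f * prod_list (map g js)" unfolding IH c by (simp only: mult.assoc)
  also have "h j * f = g j * f" using Cons.prems by simp
  also have "g j * f * prod_list (map g js) = prod_list (map g (j # js)) * f"
    using c by (simp add: mult.assoc)
  finally show ?case .
qed simp

context nilhecke_trace
begin

lemma Pol_mn_rho: "u \<le> a \<Longrightarrow> a \<le> b \<Longrightarrow> b \<le> v \<Longrightarrow> Pol (tri (b - a)) (mn (\<lambda>j. j - a) a (Suc b))"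
proof -
  assume "u \<le> a" "a \<le> b" "b \<le> v"
  moreover have "(\<Sum>j\<in>{a..<Suc b}. int (j - a)) = tri (b - a)"
    using sum.shift_bounds_nat_ivl[of "\<lambda>j. int (j - a)" 0 a "Suc (b - a)"] \<open>a \<le> b\<close>
    by (simp add: tri_def atLeast0LessThan lessThan_Suc_atMost)
  ultimately show ?thesis using Pol_mn[of a "Suc b" "\<lambda>j. j - a"] by simp
qed

lemma G_eb: "u \<le> a \<Longrightarrow> a \<le> b \<Longrightarrow> b \<le> v \<Longrightarrow> G 0 (eb a b)"
  using G_mult[OF G_tw[of a b] Pol_G[OF Pol_mn_rho[of a b]]] by (simp add: eb_def)

end

context klr_rel
begin

section \<open>Blocks of equal letters modulo commutators\<close>

inductive_set lsp :: "'a set \<Rightarrow> 'a set" for S where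
  lsp_0: "0 \<in> lsp S"
| lsp_base: "y \<in> S \<Longrightarrow> y \<in> lsp S"
| lsp_add: "y \<in> lsp S \<Longrightarrow> z \<in> lsp S \<Longrightarrow> y + z \<in> lsp S"
| lsp_sc: "y \<in> lsp S \<Longrightarrow> sc c * y \<in> lsp S"

lemma lsp_uminus: "y \<in> lsp S \<Longrightarrow> - y \<in> lsp S"
  using lsp_sc[of y S "- 1"] by (simp flip: uminus_sc)

lemma lsp_diff: "y \<in> lsp S \<Longrightarrow> z \<in> lsp S \<Longrightarrow> y - z \<in> lsp S"
  using lsp_add[of y S "- z"] lsp_uminus[of z S] by simp

lemma lsp_sum: "(\<And>a. a \<in> A \<Longrightarrow> f a \<in> lsp S) \<Longrightarrow> (\<Sum>a\<in>A. f a) \<in> lsp S"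
  by (induction A rule: infinite_finite_induct) (auto intro: lsp.intros)

lemma lsp_mono: "y \<in> lsp S \<Longrightarrow> S \<subseteq> lsp S' \<Longrightarrow> y \<in> lsp S'"
  by (induction rule: lsp.induct) (auto intro: lsp.intros)

definition CC :: "'a set" where "CC = {a * b - b * a | a b. a \<in> Alg \<and> b \<in> Alg}"

lemma CC_swap: "CC \<subseteq> S \<Longrightarrow> a \<in> Alg \<Longrightarrow> b \<in> Alg \<Longrightarrow> b * a \<in> lsp S \<Longrightarrow> a * b \<in> lsp S"
  using lsp_add[of "a * b - b * a" S "b * a"] lsp_base[of "a * b - b * a" S] by (auto simp: CC_def)

lemma Alg_uminus: "y \<in> Alg \<Longrightarrow> - y \<in> Alg"
  using Alg_sc[of y "- 1"] by (simp flip: uminus_sc)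

lemma Alg_pow: "y \<in> Alg \<Longrightarrow> y ^ p \<in> Alg"
  by (induction p) (auto intro: Alg_1 Alg_mult)

lemma Alg_prod_list: "set ys \<subseteq> Alg \<Longrightarrow> prod_list ys \<in> Alg"
  by (induction ys) (auto intro: Alg_1 Alg_mult)

lemma Alg_e_prod: "e_prod x t u v \<in> Alg"
  unfolding e_prod_def tw_prod_def
  by (auto intro!: Alg_1 Alg_mult Alg_prod_list Alg_pow Alg_x Alg_t)

context
  fixes \<theta> \<rho> :: "'i list" and i :: 'i and k :: nat and f :: 'a
  assumes i: "i \<in> I" and k: "k \<ge> 1" and len: "length \<theta> + k + length \<rho> = n"
    and f: "f = e (\<theta> @ replicate k i @ \<rho>)"
begin

lemma split2:
  assumes "Suc (length \<theta>) \<le> j" "j < length \<theta> + k"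
  obtains \<theta>' \<rho>' where "\<theta> @ replicate k i @ \<rho> = \<theta>' @ i # i # \<rho>'" "j = Suc (length \<theta>')"
    "length \<theta>' + 2 + length \<rho>' = n"
proof
  have "k = (j - Suc (length \<theta>)) + (2 + (length \<theta> + k - Suc j))" using assms by simp
  then have "replicate k i = replicate (j - Suc (length \<theta>)) i @ i # i # replicate (length \<theta> + k - Suc j) i"
    by (metis replicate_add replicate_Suc add_2_eq_Suc append_Cons)
  then show "\<theta> @ replicate k i @ \<rho> = (\<theta> @ replicate (j - Suc (length \<theta>)) i) @ i # i #
    (replicate (length \<theta> + k - Suc j) i @ \<rho>)" by simp
qed (use assms len in auto)

lemma split3:
  assumes "Suc (length \<theta>) \<le> j" "Suc j < length \<theta> + k"
  obtains \<theta>' \<rho>' where "\<theta> @ replicate k i @ \<rho> = \<theta>' @ i # i # i # \<rho>'" "j = Suc (length \<theta>')"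
    "length \<theta>' + 3 + length \<rho>' = n"
proof
  have "k = (j - Suc (length \<theta>)) + (Suc (2 + (length \<theta> + k - Suc (Suc j))))" using assms by simp
  then have "replicate k i = replicate (j - Suc (length \<theta>)) i @ i # i # i # replicate (length \<theta> + k - Suc (Suc j)) i"
    by (metis replicate_add replicate_Suc add_2_eq_Suc append_Cons)
  then show "\<theta> @ replicate k i @ \<rho> = (\<theta> @ replicate (j - Suc (length \<theta>)) i) @ i # i # i #
    (replicate (length \<theta> + k - Suc (Suc j)) i @ \<rho>)" by simp
qed (use assms len in auto)

lemma xf: "x j * f = f * x j"
  unfolding f by (rule x_e)

lemma tf: "Suc (length \<theta>) \<le> j \<Longrightarrow> j < length \<theta> + k \<Longrightarrow> t j * f = f * t j"
proof -
  assume "Suc (length \<theta>) \<le> j" "j < length \<theta> + k"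
  then show ?thesis using t_e unfolding f by (metis split2)
qed

lemma ff: "f * f = f"
  unfolding f by (rule e_idem)

lemma f_absorb: "a * f = f * a \<Longrightarrow> b * f = f * b \<Longrightarrow> (a * f) * (b * f) = a * b * f"
  by (metis ff mult.assoc)

text \<open>On equal letters Q vanishes, and with it the correction of the braid relation; what
  remains on the k positions is the nilHecke algebra in the corner of e(\<theta> i^k
  \<rho>).\<close>

lemma nilhecke_block: "nilhecke (\<lambda>j. x j * f) (\<lambda>j. t j * f) f (Suc (length \<theta>)) (length \<theta> + k)"
proof
  let ?u = "Suc (length \<theta>)" and ?v = "length \<theta> + k"
  show "f * f = f" by (rule ff)
  show "f * (x j * f) = x j * f" "x j * f * f = x j * f" for j
    using xf[of j] ff by (metis mult.assoc)+
  show "f * (t j * f) = t j * f" "t j * f * f = t j * f" if "?u \<le> j" "j < ?v" for j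
    using tf[OF that] ff by (metis mult.assoc)+
  show "x p * f * (x q * f) = x q * f * (x p * f)" for p q
    using f_absorb[OF xf xf] x_x by simp
  show "t j * f * (x q * f) = x q * f * (t j * f)" if "?u \<le> j" "j < ?v" "q \<noteq> j" "q \<noteq> Suc j" for j q
    using f_absorb[OF xf tf[OF that(1,2)]] f_absorb[OF tf[OF that(1,2)] xf] t_x_far[OF that(3,4)] by simp
  show "t j * f * (x (Suc j) * f) = x j * f * (t j * f) + f" if j: "?u \<le> j" "j < ?v" for j
  proof -
    from split2[OF j] obtain \<theta>' \<rho>' where "f = e (\<theta>' @ i # i # \<rho>')" "j = Suc (length \<theta>')"
      "length \<theta>' + 2 + length \<rho>' = n" using f by metis
    then show ?thesis using t_xS_eq f_absorb[OF tf[OF j] xf] f_absorb[OF xf tf[OF j]] by simp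
  qed
  show "x (Suc j) * f * (t j * f) = t j * f * (x j * f) + f" if j: "?u \<le> j" "j < ?v" for j
  proof -
    from split2[OF j] obtain \<theta>' \<rho>' where "f = e (\<theta>' @ i # i # \<rho>')" "j = Suc (length \<theta>')"
      "length \<theta>' + 2 + length \<rho>' = n" using f by metis
    then show ?thesis using t_x_eq f_absorb[OF tf[OF j] xf] f_absorb[OF xf tf[OF j]] by simp
  qed
  show "t j * f * (t j * f) = 0" if j: "?u \<le> j" "j < ?v" for j
  proof -
    from split2[OF j] obtain \<theta>' \<rho>' where "f = e (\<theta>' @ i # i # \<rho>')" "j = Suc (length \<theta>')"
      "length \<theta>' + 2 + length \<rho>' = n" using f by metis
    then show ?thesis using t_t[of \<theta>' \<rho>' j i i] f_absorb[OF tf[OF j] tf[OF j]]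
      by (simp add: cf_diag[OF i] sc_0)
  qed
  show "t p * f * (t q * f) = t q * f * (t p * f)"
    if "?u \<le> p" "p < ?v" "?u \<le> q" "q < ?v" "Suc p < q \<or> Suc q < p" for p q
    using that(5) t_t_far[of p q] t_t_far[of q p]
      f_absorb[OF tf[OF that(1,2)] tf[OF that(3,4)]] f_absorb[OF tf[OF that(3,4)] tf[OF that(1,2)]]
    by (elim disjE) simp_all
  show "t j * f * (t (Suc j) * f) * (t j * f) = t (Suc j) * f * (t j * f) * (t (Suc j) * f)"
    if j: "?u \<le> j" "Suc j < ?v" for j
  proof -
    from split3[OF j] obtain \<theta>' \<rho>' where f3: "f = e (\<theta>' @ i # i # i # \<rho>')" "j = Suc (length \<theta>')"
      "length \<theta>' + 3 + length \<rho>' = n" using f by metis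
    have c: "t j * f = f * t j" "t (Suc j) * f = f * t (Suc j)" using tf[of j] tf[of "Suc j"] j by auto
    have "t j * t (Suc j) * f = f * (t j * t (Suc j))" "t (Suc j) * t j * f = f * (t (Suc j) * t j)"
      using c by (metis mult.assoc)+
    then have "t j * f * (t (Suc j) * f) * (t j * f) = t j * t (Suc j) * t j * f"
      "t (Suc j) * f * (t j * f) * (t (Suc j) * f) = t (Suc j) * t j * t (Suc j) * f"
      using f_absorb c by simp_all
    moreover have "t (Suc j) * t j * t (Suc j) * f = t j * t (Suc j) * t j * f"
      using braid_eq[OF f3(3,2), of i i] f3(1) by (simp add: cf_diag[OF i] sc_0 left_diff_distrib)
    ultimately show ?thesis by simp
  qed
qed

interpretation nb: nilhecke "\<lambda>j. x j * f" "\<lambda>j. t j * f" f "Suc (length \<theta>)" "length \<theta> + k"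
  by (rule nilhecke_block)

lemma nb_up: "Suc (length \<theta>) \<le> a \<Longrightarrow> b \<le> length \<theta> + k \<Longrightarrow> nb.up a b = prod_list (map t [a..<b]) * f"
  unfolding nb.up_def
proof (rule prod_list_absorb[OF ff])
  fix j assume "Suc (length \<theta>) \<le> a" "b \<le> length \<theta> + k" "j \<in> set [a..<b]"
  then have j: "Suc (length \<theta>) \<le> j" "j < length \<theta> + k" by auto
  show "t j * f = f * t j" by (rule tf[OF j])
  show "t j * f * f = t j * f" by (rule nb.T_f[OF j])
qed

lemma nb_tw: "Suc (length \<theta>) \<le> a \<Longrightarrow> b \<le> length \<theta> + k \<Longrightarrow> nb.tw a b = tw_prod t a b * f"
proof (induction b)
  case (Suc b)
  show ?case
  proof (cases "a \<le> b")
    case True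
    then have "nb.tw a (Suc b) = prod_list (map t [a..<Suc b]) * (f * nb.tw a b)"
      using nb_up[of a "Suc b"] Suc.prems by (simp add: mult.assoc del: upt_Suc)
    also have "f * nb.tw a b = tw_prod t a b * f" using Suc nb.f_tw[of a b] by simp
    finally show ?thesis using tw_prod_Suc[OF True, of t] by (simp add: mult.assoc)
  qed (simp add: tw_prod_def)
qed (simp add: tw_prod_def)

lemma xf_pow: "(x j * f) ^ p * f = x j ^ p * f"
proof (induction p)
  case (Suc p)
  have "(x j * f) ^ Suc p * f = x j * (f * ((x j * f) ^ p * f))" by (simp add: mult.assoc)
  also have "\<dots> = x j * (f * x j ^ p) * f" unfolding Suc by (simp add: mult.assoc)
  also have "f * x j ^ p = x j ^ p * f" using comm_power[of f "x j" p] xf by simp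
  finally show ?case by (simp add: mult.assoc ff)
qed simp

lemma xp_f: "x j ^ p * f = f * x j ^ p"
  using comm_power[of f "x j" p] xf by simp

lemma nb_eb:
  assumes "Suc (length \<theta>) \<le> a" "a \<le> b" "b \<le> length \<theta> + k"
  shows "nb.eb a b = e_prod x t a b * f"
proof (cases "a = b")
  case False
  have "nb.mn (\<lambda>j. j - a) a (Suc b) = prod_list (map (\<lambda>j. x j ^ (j - a)) [a..<Suc b]) * f"
    unfolding nb.mn_def by (rule prod_list_absorb) (auto simp: ff xp_f xf_pow simp del: upt_Suc)
  also have "\<dots> = prod_list (map (\<lambda>j. x j ^ (j - a)) [a + 1..<b + 1]) * f"
    using assms by (simp add: upt_rec[of a] del: upt_Suc)
  finally have mn: "nb.mn (\<lambda>j. j - a) a (Suc b) = prod_list (map (\<lambda>j. x j ^ (j - a)) [a + 1..<b + 1]) * f" .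
  have "nb.eb a b = tw_prod t a b * (f * nb.mn (\<lambda>j. j - a) a (Suc b))"
    using nb_tw[of a b] assms by (simp add: nb.eb_def mult.assoc)
  then have "nb.eb a b = tw_prod t a b * (prod_list (map (\<lambda>j. x j ^ (j - a)) [a + 1..<b + 1]) * f)"
    unfolding nb.f_mn by (simp only: mn)
  then show ?thesis using assms False by (simp add: e_prod_def mult.assoc)
qed (simp add: e_prod_def)

context
  fixes Y :: 'a
  assumes Y: "Y \<in> Alg" "Y * f = f * Y"
    "\<And>j. Suc (length \<theta>) \<le> j \<Longrightarrow> j \<le> length \<theta> + k \<Longrightarrow> Y * x j = x j * Y"
    "\<And>j. Suc (length \<theta>) \<le> j \<Longrightarrow> j < length \<theta> + k \<Longrightarrow> Y * t j = t j * Y"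
begin

text \<open>Restricting \<open>S\<close> to elements that commute with Y makes Y(ab) - Y(ba) the
  commutator of Ya and b.\<close>

lemma nilhecke_trace_block:
  "nilhecke_trace (\<lambda>j. x j * f) (\<lambda>j. t j * f) f (Suc (length \<theta>)) (length \<theta> + k) Y
    {s \<in> Alg. f * s = s \<and> s * f = s \<and> Y * s = s * Y} (lsp CC)"
proof unfold_locales
  let ?S = "{s \<in> Alg. f * s = s \<and> s * f = s \<and> Y * s = s * Y}"
  have fA: "f \<in> Alg" unfolding f by (rule Alg_e)
  show "Suc (length \<theta>) \<le> length \<theta> + k" using k by simp
  show "f \<in> ?S" using fA ff Y by simp
  show "x j * f \<in> ?S" if "Suc (length \<theta>) \<le> j" "j \<le> length \<theta> + k" for j
  proof -
    have "Y * (x j * f) = (x j * f) * Y" using Y(3)[OF that] Y(2) by (rule comm_times)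
    then show ?thesis using Alg_mult[OF Alg_x fA] nb.f_X nb.X_f by simp
  qed
  show "t j * f \<in> ?S" if j: "Suc (length \<theta>) \<le> j" "j < length \<theta> + k" for j
  proof -
    have "Y * (t j * f) = (t j * f) * Y" using Y(4)[OF j] Y(2) by (rule comm_times)
    then show ?thesis using Alg_mult[OF Alg_t fA] nb.f_T[OF j] nb.T_f[OF j] by simp
  qed
  show "a * b \<in> ?S" if "a \<in> ?S" "b \<in> ?S" for a b
  proof -
    have "Y * (a * b) = (a * b) * Y" using that by (intro comm_times) auto
    moreover have "f * (a * b) = a * b" using that by (simp flip: mult.assoc)
    moreover have "a * b * f = a * b" using that by (simp add: mult.assoc)
    ultimately show ?thesis using that Alg_mult by auto
  qed
  show "a + b \<in> ?S" if "a \<in> ?S" "b \<in> ?S" for a b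
    using that Alg_add by (auto simp: distrib_left distrib_right)
  show "- a \<in> ?S" if "a \<in> ?S" for a using that Alg_uminus by auto
  show "f * a = a" "a * f = a" if "a \<in> ?S" for a using that by auto
  show "0 \<in> lsp CC" by (rule lsp_0)
  show "a + b \<in> lsp CC" if "a \<in> lsp CC" "b \<in> lsp CC" for a b using that by (rule lsp_add)
  show "- a \<in> lsp CC" if "a \<in> lsp CC" for a using that by (rule lsp_uminus)
  show "Y * (a * b) - Y * (b * a) \<in> lsp CC" if "a \<in> ?S" "b \<in> ?S" for a b
  proof -
    have "Y * (b * a) = b * (Y * a)" using that mult.assoc[of Y b a] mult.assoc[of b Y a] by auto
    then have "Y * (a * b) - Y * (b * a) = (Y * a) * b - b * (Y * a)" by (simp add: mult.assoc)
    also have "\<dots> \<in> CC"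
    proof -
      have "Y * a \<in> Alg" "b \<in> Alg" using that Y Alg_mult by auto
      then show ?thesis unfolding CC_def by blast
    qed
    finally show ?thesis by (rule lsp_base)
  qed
qed

interpretation nt: nilhecke_trace "\<lambda>j. x j * f" "\<lambda>j. t j * f" f "Suc (length \<theta>)" "length \<theta> + k" Y
    "{s \<in> Alg. f * s = s \<and> s * f = s \<and> Y * s = s * Y}" "lsp CC"
  by (rule nilhecke_trace_block)

lemma cycle_block:
  defines "C \<equiv> prod_list (map t [Suc (length \<theta>)..<length \<theta> + k])"
  shows "p < k - 1 \<Longrightarrow> Y * x (Suc (length \<theta>)) ^ p * C * f \<in> lsp CC"
    and "k - 1 \<le> p \<Longrightarrow> Y * x (Suc (length \<theta>)) ^ p * C * f
      - sc ((- 1) ^ (k - 1)) * (Y * e_prod x t (Suc (length \<theta>)) (length \<theta> + k) * x (length \<theta> + k) ^ (p - (k - 1)) * f)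
      \<in> lsp CC"
proof -
  let ?u = "Suc (length \<theta>)" and ?v = "length \<theta> + k"
  have vu: "?v - ?u = k - 1" by simp
  have Cf: "C * f = f * C"
    unfolding C_def by (rule prod_list_comm[symmetric]) (auto simp: tf)
  have "(x ?u * f) ^ p * nb.up ?u ?v = (x ?u * f) ^ p * f * C"
    using nb_up[of ?u ?v] Cf by (simp add: C_def mult.assoc)
  also have "\<dots> = x ?u ^ p * C * f" using Cf by (simp add: xf_pow mult.assoc)
  finally have 1: "(x ?u * f) ^ p * nb.up ?u ?v = x ?u ^ p * C * f" .
  show "Y * x ?u ^ p * C * f \<in> lsp CC" if "p < k - 1"
    using nt.cycle_conv(1)[of p] that 1 by (simp add: nt.eqv_def mult.assoc)
  have 2: "nb.eb ?u ?v * (x ?v * f) ^ q = e_prod x t ?u ?v * x ?v ^ q * f" for q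
  proof -
    have "nb.eb ?u ?v * (x ?v * f) ^ q = e_prod x t ?u ?v * (f * (x ?v * f) ^ q)"
      using nb_eb[of ?u ?v] k by (simp add: mult.assoc)
    also have "f * (x ?v * f) ^ q = (x ?v * f) ^ q * f"
      by (rule nb.f_Xpow)
    finally show ?thesis by (simp add: xf_pow mult.assoc)
  qed
  have sg: "sc ((- 1) ^ q) = (- 1) ^ q" for q by (induction q) (simp_all add: sc_1 sc_mult sc_uminus)
  show "Y * x ?u ^ p * C * f
      - sc ((- 1) ^ (k - 1)) * (Y * e_prod x t ?u ?v * x ?v ^ (p - (k - 1)) * f) \<in> lsp CC"
    if "k - 1 \<le> p"
    using nt.cycle_conv(2)[of p] that 1 2 unfolding nt.eqv_def vu sg
    by (simp add: mult.assoc) (metis (no_types, opaque_lifting) sg sc_left)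
qed

text \<open>Each e_[a,b] has degree 0 in the nilHecke algebra of the block, so
  \<open>degree_zero\<close> reduces any product of them to a multiple of the one on the whole
  block.\<close>

lemma merge_block:
  assumes "\<And>w. w \<in> set ws \<Longrightarrow> \<exists>a b. w = e_prod x t a b \<and> Suc (length \<theta>) \<le> a \<and> a \<le> b \<and> b \<le> length \<theta> + k"
  shows "\<exists>c. Y * prod_list ws * f - sc c * (Y * e_prod x t (Suc (length \<theta>)) (length \<theta> + k) * f) \<in> lsp CC"
proof -
  let ?u = "Suc (length \<theta>)" and ?v = "length \<theta> + k"
  have "nt.G 0 (prod_list ws * f)"
    using assms
  proof (induction ws)
    case (Cons w ws)
    from Cons.prems[of w] obtain a b where w: "w = e_prod x t a b" "?u \<le> a" "a \<le> b" "b \<le> ?v"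
      by auto
    have IH: "nt.G 0 (prod_list ws * f)" using Cons.prems by (intro Cons.IH) simp
    have "nt.G (0 + 0) (nb.eb a b * (prod_list ws * f))"
      by (rule nt.G_mult[OF nt.G_eb[OF w(2-4)] IH])
    moreover have "f * (prod_list ws * f) = prod_list ws * f" by (rule nt.S_unit(1)[OF nt.G_S[OF IH]])
    ultimately show ?case using nb_eb[OF w(2-4)] w(1) by (simp add: mult.assoc)
  qed (simp add: nt.Gf)
  from nt.degree_zero[OF this] obtain c where
    "Y * (prod_list ws * f) - Y * (of_int c * nb.eb ?u ?v) \<in> lsp CC" by (auto simp: nt.eqv_def)
  moreover have "of_int c = sc (of_int c)"
    by (cases c rule: int_cases2) (simp_all add: sc_of_nat sc_uminus)
  ultimately show ?thesis using nb_eb[of ?u ?v] k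
    by (intro exI[of _ "of_int c"]) (simp add: mult.assoc sc_left)
qed

end

end

section \<open>Collecting cycles into blocks\<close>

fun valid :: "'i list \<Rightarrow> ('i \<times> nat \<times> nat) list \<Rightarrow> bool" where
  "valid \<theta> [] \<longleftrightarrow> True"
| "valid \<theta> ((i, k, l) # bl) \<longleftrightarrow> i \<in> I \<and> k \<ge> 1 \<and> int l + int k \<le> ell \<theta> i \<and> valid (\<theta> @ replicate k i) bl"

definition bdeg :: "('i \<times> nat \<times> nat) list \<Rightarrow> rat" where
  "bdeg bl = (\<Sum>(i, k, l)\<leftarrow>bl. of_nat l * dg i i)"

lemma valid_append: "valid \<theta> (bl @ bl') \<longleftrightarrow> valid \<theta> bl \<and> valid (\<theta> @ bseq bl) bl'"
  by (induction \<theta> bl rule: valid.induct) auto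

lemma ell_mset: "mset \<theta> = mset \<theta>' \<Longrightarrow> ell \<theta> i = ell \<theta>' i"
  unfolding ell_def by (metis mset_map sum_mset_sum_list)

lemma hm_Nil: "hm [] \<mu> r y \<Longrightarrow> \<mu> = [] \<and> (r \<noteq> 0 \<longrightarrow> y = 0) \<and> (\<exists>c. y = sc c)"
proof (induction rule: hm.induct)
  case hm_one
  then show ?case using sc_1 by (auto intro!: exI[of _ 1])
next
  case (hm_zero \<mu> r)
  then show ?case using sc_0 by (auto intro!: exI[of _ 0])
next
  case (hm_add \<mu> r y z)
  then show ?case by (auto, metis sc_add)
next
  case (hm_sc \<mu> r y c)
  then show ?case by (auto, metis sc_mult)
qed auto

text \<open>z is what has been collected on the strands after m. It must commute with everything on
  the first m strands to be carried along when words there are rotated.\<close>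

definition tail :: "nat \<Rightarrow> 'i list \<Rightarrow> 'a \<Rightarrow> bool" where
  "tail m \<rho> z \<longleftrightarrow> z \<in> Alg \<and> (\<forall>j. 1 \<le> j \<longrightarrow> j \<le> m \<longrightarrow> z * x j = x j * z) \<and>
     (\<forall>j. 1 \<le> j \<longrightarrow> j < m \<longrightarrow> z * t j = t j * z) \<and>
     (\<forall>\<nu>. length \<nu> = m \<longrightarrow> z * e (\<nu> @ \<rho>) = e (\<nu> @ \<rho>) * z)"

definition cyc :: "nat \<Rightarrow> nat \<Rightarrow> 'a" where
  "cyc a m = prod_list (map t [a..<m])"

lemma cyc_rec: "a < m \<Longrightarrow> cyc a m = t a * cyc (Suc a) m"
  by (simp add: cyc_def upt_rec[of a])

lemma cyc_self: "cyc m m = 1"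
  by (simp add: cyc_def)

lemma cyc_Alg: "cyc a m \<in> Alg"
  unfolding cyc_def by (auto intro!: Alg_prod_list Alg_t)

lemma cyc_comm: "(\<And>j. a \<le> j \<Longrightarrow> j < m \<Longrightarrow> w * t j = t j * w) \<Longrightarrow> w * cyc a m = cyc a m * w"
  unfolding cyc_def by (rule prod_list_comm) auto

lemma cyc_e:
  assumes "length \<theta> + k + length \<rho> = n"
  shows "cyc (Suc (length \<theta>)) (length \<theta> + k) * e (\<theta> @ replicate k i @ \<rho>)
    = e (\<theta> @ replicate k i @ \<rho>) * cyc (Suc (length \<theta>)) (length \<theta> + k)"
proof (rule cyc_comm[symmetric])
  fix j assume j: "Suc (length \<theta>) \<le> j" "j < length \<theta> + k"
  have "k = (j - Suc (length \<theta>)) + (2 + (length \<theta> + k - Suc j))" using j by simp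
  then have "replicate k i = replicate (j - Suc (length \<theta>)) i @ i # i # replicate (length \<theta> + k - Suc j) i"
    by (metis replicate_add replicate_Suc add_2_eq_Suc append_Cons)
  then have eq: "\<theta> @ replicate k i @ \<rho> = (\<theta> @ replicate (j - Suc (length \<theta>)) i) @ i # i #
    (replicate (length \<theta> + k - Suc j) i @ \<rho>)" by simp
  show "e (\<theta> @ replicate k i @ \<rho>) * t j = t j * e (\<theta> @ replicate k i @ \<rho>)"
    unfolding eq using t_ek[of "\<theta> @ replicate (j - Suc (length \<theta>)) i" "replicate (length \<theta> + k - Suc j) i @ \<rho>" j i i]
      j assms by simp
qed

context
  fixes m :: nat and \<rho> :: "'i list" and z :: 'a and r :: rat and M :: "'i multiset" and Nn :: "'a set"
  assumes mn: "m + length \<rho> = n" and z: "tail m \<rho> z" and Nn: "CC \<subseteq> Nn"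
    and H: "\<And>\<theta> i k s y r'. length \<theta> + k = m \<Longrightarrow> k \<ge> 1 \<Longrightarrow> mset (\<theta> @ replicate k i) = M \<Longrightarrow>
      hm \<theta> \<theta> r' y \<Longrightarrow> r = r' + (of_nat s - of_nat (k - 1)) * dg i i \<Longrightarrow> int s < ell \<theta> i \<Longrightarrow>
      set \<theta> \<subseteq> I \<Longrightarrow> i \<in> I \<Longrightarrow>
      y * x (Suc (length \<theta>)) ^ s * cyc (Suc (length \<theta>)) m * z * e (\<theta> @ replicate k i @ \<rho>) \<in> lsp Nn"
begin

definition E where "E \<theta> k i = e (\<theta> @ replicate k i @ \<rho>)"

text \<open>\<open>Q1\<close> and \<open>Q2\<close> are the two induction statements for a cycle
  through k letters i after the prefix \<theta>. In \<open>Q1\<close> the coefficient y uses the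
  strands of \<theta> only and a power of the first variable of the cycle is explicit; in
  \<open>Q2\<close> the coefficient may also use the first strand of the cycle. The hypothesis
  \<open>H\<close> of the context is \<open>Q1\<close> for exponents below \<open>ell\<close>. The k
  - 1 crossings of the cycle account for the degree shift.\<close>

definition Q1 where "Q1 \<theta> i k \<longleftrightarrow> (\<forall>y s r'. hm \<theta> \<theta> r' y \<longrightarrow> r = r' + (of_nat s - of_nat (k - 1)) * dg i i \<longrightarrow>
   y * x (Suc (length \<theta>)) ^ s * cyc (Suc (length \<theta>)) m * z * E \<theta> k i \<in> lsp Nn)"

definition Q2 where "Q2 \<theta> i k \<longleftrightarrow> (\<forall>y r'. hm (\<theta> @ [i]) (\<theta> @ [i]) r' y \<longrightarrow> r = r' - of_nat (k - 1) * dg i i \<longrightarrow>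
   y * cyc (Suc (length \<theta>)) m * z * E \<theta> k i \<in> lsp Nn)"

lemma Q1D: "Q1 \<theta> i k \<Longrightarrow> hm \<theta> \<theta> r' y \<Longrightarrow> r = r' + (of_nat s - of_nat (k - 1)) * dg i i \<Longrightarrow>
    y * x (Suc (length \<theta>)) ^ s * cyc (Suc (length \<theta>)) m * z * E \<theta> k i \<in> lsp Nn"
  unfolding Q1_def by blast

lemma Q2D: "Q2 \<theta> i k \<Longrightarrow> hm (\<theta> @ [i]) (\<theta> @ [i]) r' y \<Longrightarrow> r = r' - of_nat (k - 1) * dg i i \<Longrightarrow>
    y * cyc (Suc (length \<theta>)) m * z * E \<theta> k i \<in> lsp Nn"
  unfolding Q2_def by blast

lemma cz_E: "length \<theta> + k = m \<Longrightarrow> cyc (Suc (length \<theta>)) m * z * E \<theta> k i = E \<theta> k i * (cyc (Suc (length \<theta>)) m * z)"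
proof -
  assume m: "length \<theta> + k = m"
  then have "z * E \<theta> k i = E \<theta> k i * z" using z unfolding tail_def E_def
    by (metis append.assoc length_append length_replicate)
  moreover have "cyc (Suc (length \<theta>)) m * E \<theta> k i = E \<theta> k i * cyc (Suc (length \<theta>)) m"
    unfolding E_def using cyc_e[of \<theta> k \<rho> i] m mn by simp
  ultimately show ?thesis by (simp add: mult.assoc) (simp flip: mult.assoc)
qed

lemma hm_cz: "length \<theta> + k = m \<Longrightarrow> length \<nu> \<le> length \<theta> \<Longrightarrow> hm \<nu> \<mu> r' y \<Longrightarrow>
  y * (cyc (Suc (length \<theta>)) m * z) = cyc (Suc (length \<theta>)) m * z * y"
proof (rule comm_times)
  assume a: "length \<theta> + k = m" "length \<nu> \<le> length \<theta>" "hm \<nu> \<mu> r' y"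
  show "y * cyc (Suc (length \<theta>)) m = cyc (Suc (length \<theta>)) m * y"
    by (rule cyc_comm) (use hm_comm_t[OF a(3)] a in auto)
  show "y * z = z * y"
    using hm_commute[OF a(3), of z] z a by (simp add: tail_def)
qed

lemma x_cz: "length \<theta> + k = m \<Longrightarrow> 1 \<le> j \<Longrightarrow> j \<le> length \<theta> \<Longrightarrow>
  x j ^ s * (cyc (Suc (length \<theta>)) m * z) = cyc (Suc (length \<theta>)) m * z * x j ^ s"
proof (rule comm_times)
  assume a: "length \<theta> + k = m" "1 \<le> j" "j \<le> length \<theta>"
  show "x j ^ s * cyc (Suc (length \<theta>)) m = cyc (Suc (length \<theta>)) m * x j ^ s"
    by (rule cyc_comm) (use a in \<open>auto simp: t_pow_far\<close>)
  have "z * x j = x j * z" using z a by (simp add: tail_def)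
  then show "x j ^ s * z = z * x j ^ s" using comm_power[of z "x j" s] by simp
qed

lemma cz_Alg: "cyc a m * z * E \<theta> k i \<in> Alg"
  using z unfolding E_def tail_def by (intro Alg_mult cyc_Alg Alg_e) auto

lemma E_zero: "\<not> (set \<theta> \<subseteq> I \<and> i \<in> I) \<Longrightarrow> k \<ge> 1 \<Longrightarrow> E \<theta> k i = 0"
  unfolding E_def by (intro e_I) (cases k, auto)

lemma E_Suc: "E \<theta> (Suc k) i = e (\<theta> @ i # replicate k i @ \<rho>)" "E (\<kappa> @ [i]) k i = E \<kappa> (Suc k) i"
  by (simp_all add: E_def)

text \<open>If s \<ge> \<ell>, the bubble of \<theta> expresses x^s by lower powers, covered by the
  inner induction, and by \<Phi>(x^A \<tau>). In the latter the crossing extends the cycle by one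
  letter i to the left, the right factor of the tensor is rotated to the front, and
  \<open>Q2\<close> for the shortened prefix applies.\<close>

lemma Q1_step:
  assumes len: "length \<theta> + k = m" "k \<ge> 1" and M: "mset (\<theta> @ replicate k i) = M"
    and Q2: "\<And>\<kappa>. length \<theta> = Suc (length \<kappa>) \<Longrightarrow> mset (\<kappa> @ [i]) = mset \<theta> \<Longrightarrow> Q2 \<kappa> i (Suc k)"
  shows "Q1 \<theta> i k"
proof (cases "set \<theta> \<subseteq> I \<and> i \<in> I")
  case False
  then show ?thesis using E_zero[of \<theta> i k] len by (simp add: Q1_def lsp_0)
next
  case True
  let ?l = "length \<theta>" and ?a = "Suc (length \<theta>)"
  let ?cz = "cyc ?a m * z" and ?E = "E \<theta> k i"
  have "y * x ?a ^ s * ?cz * ?E \<in> lsp Nn"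
    if "hm \<theta> \<theta> r' y" "r = r' + (of_nat s - of_nat (k - 1)) * dg i i" for y s r'
    using that
  proof (induction s arbitrary: y r' rule: less_induct)
    case (less s)
    show ?case
    proof (cases "int s < ell \<theta> i")
      case lt: True
      then show ?thesis using H[OF len M less.prems lt] True by (simp add: E_def mult.assoc)
    next
      case False
      \<comment> \<open>The surplus over \<ell>: after multiplication by u^A the leading term of the
        bubble relation is x^s.\<close>
      define A where "A = nat (int s - ell \<theta> i)"
      have A: "int A = int s - ell \<theta> i" using False by (simp add: A_def)
      obtain \<Phi> c' where b: "bubble \<theta> i \<Phi> c'" using bubble_exists True by blast
      have \<Phi>: "bim \<theta> i (of_int (ell \<theta> i + 1) * dg i i) \<Phi>"
        and hs: "\<And>k. hm \<theta> \<theta> (of_int (ell \<theta> i - k) * dg i i) (c' k)"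
        and s0: "\<And>k. ell \<theta> i < k \<Longrightarrow> c' k = 0" using b by (auto simp: bubble_def)
      obtain c where c: "c \<noteq> 0" "c' (ell \<theta> i) = sc c" using b by (auto simp: bubble_def)
      have E: "?E = e (\<theta> @ i # replicate (k - 1) i @ \<rho>)" using len(2) E_Suc(1)[of \<theta> "k - 1" i] by simp
      let ?N = "nat (ell \<theta> i + 1)"
      have "\<Phi> (x ?l ^ A * t ?l) * ?E = ev (?N + A) c' A ?a * ?E"
        unfolding E by (rule bubble_shift[OF b]) (use len mn in auto)
      also have "ev (?N + A) c' A ?a = ev (Suc s) c' A ?a"
        by (rule ev_eq[of "ell \<theta> i"]) (use A s0 in auto)
      also have "ev (Suc s) c' A ?a = ev s c' A ?a + sc c * x ?a ^ s"
        using c A by (simp add: ev_def)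
      finally have "sc c * x ?a ^ s * ?E = \<Phi> (x ?l ^ A * t ?l) * ?E - ev s c' A ?a * ?E"
        by (simp add: distrib_right)
      then have "sc (inverse c) * (sc c * x ?a ^ s * ?E) = sc (inverse c) * (\<Phi> (x ?l ^ A * t ?l) * ?E - ev s c' A ?a * ?E)"
        by simp
      moreover have "sc (inverse c) * sc c = 1" using c sc_1 by (simp flip: sc_mult)
      ultimately have xs: "x ?a ^ s * ?E = sc (inverse c) * (\<Phi> (x ?l ^ A * t ?l) * ?E - ev s c' A ?a * ?E)"
        by (simp flip: mult.assoc)
      have "y * x ?a ^ s * ?cz * ?E = y * (x ?a ^ s * ?E) * ?cz"
        using cz_E[OF len(1), of i] by (simp only: mult.assoc)
      also have "\<dots> = sc (inverse c) * (y * \<Phi> (x ?l ^ A * t ?l) * ?E * ?cz - y * ev s c' A ?a * ?E * ?cz)"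
        unfolding xs sc_left by (simp add: right_diff_distrib left_diff_distrib mult.assoc)
      finally have eq: "y * x ?a ^ s * ?cz * ?E
          = sc (inverse c) * (y * \<Phi> (x ?l ^ A * t ?l) * ?E * ?cz - y * ev s c' A ?a * ?E * ?cz)" .
      have 1: "y * ev s c' A ?a * ?E * ?cz \<in> lsp Nn"
      proof -
        have "y * ev s c' A ?a * ?E * ?cz = (\<Sum>p<s. y * c' (int p - int A) * x ?a ^ p * ?cz * ?E)"
          using cz_E[OF len(1), of i] by (simp add: ev_def sum_distrib_left sum_distrib_right mult.assoc)
        also have "\<dots> \<in> lsp Nn"
        proof (rule lsp_sum)
          fix p assume p: "p \<in> {..<s}"
          show "y * c' (int p - int A) * x ?a ^ p * ?cz * ?E \<in> lsp Nn"
          proof (rule less.IH[of p])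
            show "hm \<theta> \<theta> (of_int (ell \<theta> i - (int p - int A)) * dg i i + r') (y * c' (int p - int A))"
              by (rule hm_trans[OF less.prems(1) hs])
            have "of_int (ell \<theta> i - (int p - int A)) = rat_of_nat s - of_nat p"
              using A by simp
            then show "r = of_int (ell \<theta> i - (int p - int A)) * dg i i + r' + (of_nat p - of_nat (k - 1)) * dg i i"
              using less.prems(2) by (simp only:) (simp add: algebra_simps)
          qed (use p in simp)
        qed
        finally show ?thesis .
      qed
      have 2: "y * \<Phi> (x ?l ^ A * t ?l) * ?E * ?cz \<in> lsp Nn"
        using \<Phi>
      proof (induction rule: bim.induct)
        case bim_0
        then show ?case by (simp add: lsp_0)
      next
        case (bim_1 \<kappa> r1 a0 r2 b0)
        have l: "?l = Suc (length \<kappa>)" using hm_length[OF bim_1(2)] by simp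
        have m: "length \<kappa> + Suc k = m" using l len by simp
        let ?E' = "E \<kappa> (Suc k) i"
        have bE: "b0 * ?E = ?E' * b0"
          using hm_e[OF bim_1(2), of "replicate k i @ \<rho>"] len mn E_Suc(2)[of \<kappa> i k] by (simp add: E_def)
        have "y * (a0 * (x ?l ^ A * t ?l) * b0) * ?E * ?cz = y * a0 * x ?l ^ A * t ?l * (?E' * b0) * ?cz"
          by (simp only: bE[symmetric] mult.assoc)
        also have "\<dots> = y * a0 * x ?l ^ A * t ?l * ?E' * (b0 * ?cz)" by (simp only: mult.assoc)
        also have "b0 * ?cz = ?cz * b0" by (rule hm_cz[OF len(1) _ bim_1(2)]) simp
        also have "y * a0 * x ?l ^ A * t ?l * ?E' * (?cz * b0) = y * a0 * x ?l ^ A * (t ?l * ?E' * ?cz) * b0"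
          by (simp only: mult.assoc)
        also have "t ?l * ?E' * ?cz = cyc (Suc (length \<kappa>)) m * z * ?E'"
        proof -
          have "t ?l * ?E' = ?E' * t ?l"
            using t_ek[of \<kappa> "replicate (k - 1) i @ \<rho>" ?l i i] l len mn
            by (cases k) (auto simp: E_def)
          moreover have "cyc (Suc (length \<kappa>)) m = t ?l * cyc ?a m" using cyc_rec[of ?l m] l len by simp
          ultimately show ?thesis using cz_E[OF m, of i] by (simp add: mult.assoc)
        qed
        finally have eq: "y * (a0 * (x ?l ^ A * t ?l) * b0) * ?E * ?cz
            = (y * a0 * x ?l ^ A * (cyc (Suc (length \<kappa>)) m * z * ?E')) * b0" .
        \<comment> \<open>b0 leads from \<theta> to \<open>\<kappa> @ [i]\<close>, so after rotation
          the coefficient is a word from \<open>\<kappa> @ [i]\<close> to itself, as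
          \<open>Q2\<close> demands.\<close>
        have "b0 * (y * a0 * x ?l ^ A * (cyc (Suc (length \<kappa>)) m * z * ?E')) \<in> lsp Nn"
        proof -
          have h1: "hm (\<kappa> @ [i]) (\<kappa> @ [i]) (of_nat A * dg i i + (r1 + r' + r2)) (b0 * (y * a0) * x ?l ^ A)"
            using hm_trans[OF hm_trans[OF bim_1(2) hm_trans[OF less.prems(1) bim_1(1)]] hm_xp1[OF l, of i "[]" A]]
            by (simp add: add.assoc add.commute)
          have d1: "r = of_nat A * dg i i + (r1 + r' + r2) - of_nat (Suc k - 1) * dg i i"
          proof -
            have rA: "rat_of_nat A = of_nat s - of_int (ell \<theta> i)" using A by (metis of_int_diff of_int_of_nat_eq)
            have "rat_of_nat (k - 1) = of_nat k - 1" using len(2) by (simp add: of_nat_diff)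
            moreover from rA have "rat_of_nat A * dg i i = of_nat s * dg i i - of_int (ell \<theta> i) * dg i i"
              by (simp only: left_diff_distrib)
            ultimately show ?thesis using less.prems(2) bim_1(3) by (simp add: algebra_simps)
          qed
          have ms: "mset (\<kappa> @ [i]) = mset \<theta>" using hm_mset[OF bim_1(2)] by simp
          show ?thesis using Q2D[OF Q2[OF l ms] h1 d1] by (simp add: mult.assoc)
        qed
        moreover have "b0 \<in> Alg" "y * a0 * x ?l ^ A * (cyc (Suc (length \<kappa>)) m * z * ?E') \<in> Alg"
          using hm_Alg[OF bim_1(1)] hm_Alg[OF bim_1(2)] hm_Alg[OF less.prems(1)]
          by (auto intro!: Alg_mult Alg_pow Alg_x cz_Alg[unfolded mult.assoc] simp: mult.assoc)
        ultimately show ?case unfolding eq using CC_swap[OF Nn] by blast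
      next
        case (bim_add \<Phi> \<Psi>)
        then show ?case by (simp add: distrib_left distrib_right lsp_add)
      next
        case (bim_sc \<Phi> c)
        have "y * (sc c * \<Phi> (x ?l ^ A * t ?l)) * ?E * ?cz = sc c * (y * \<Phi> (x ?l ^ A * t ?l) * ?E * ?cz)"
          by (simp only: sc_left mult.assoc)
        then show ?case using bim_sc lsp_sc by simp
      qed
      show ?thesis unfolding eq by (intro lsp_sc lsp_diff 1 2)
    qed
  qed
  then show ?thesis by (simp add: Q1_def mult.assoc)
qed

text \<open>Bring y into normal form over the strands of \<theta>. Terms without the last crossing
  are \<open>Q1\<close>. In the others y2 is rotated to the front and x^s is moved past the
  crossing: the main term has a cycle longer by one letter and is \<open>Q2\<close> for a shorter
  prefix, while the divided difference has lost the crossing and is \<open>Q1\<close> for a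
  rearranged prefix.\<close>

lemma Q2_step:
  assumes len: "length \<theta> + k = m" "k \<ge> 1"
    and Q1: "\<And>\<theta>'. length \<theta>' = length \<theta> \<Longrightarrow> mset \<theta>' = mset \<theta> \<Longrightarrow> Q1 \<theta>' i k"
    and Q2: "\<And>\<kappa>. length \<theta> = Suc (length \<kappa>) \<Longrightarrow> mset (\<kappa> @ [i]) = mset \<theta> \<Longrightarrow> Q2 \<kappa> i (Suc k)"
  shows "Q2 \<theta> i k"
  unfolding Q2_def
proof (intro allI impI)
  let ?l = "length \<theta>" and ?a = "Suc (length \<theta>)"
  let ?cz = "cyc ?a m * z" and ?E = "E \<theta> k i"
  fix y r' assume y: "hm (\<theta> @ [i]) (\<theta> @ [i]) r' y" and r: "r = r' - of_nat (k - 1) * dg i i"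
  have E: "?E = e (\<theta> @ i # replicate (k - 1) i @ \<rho>)" using len(2) E_Suc(1)[of \<theta> "k - 1" i] by simp
  have "dec \<theta> i (replicate (k - 1) i @ \<rho>) \<theta> i r' (y * ?E)"
    unfolding E by (rule hm_dec[OF y]) (use len mn in auto)
  then have "\<And>w. dec \<theta> i (replicate (k - 1) i @ \<rho>) \<theta> i r' w \<Longrightarrow> w * ?cz \<in> lsp Nn"
  proof -
    have "\<theta>' = \<theta> \<longrightarrow> i' = i \<longrightarrow> r'' = r' \<longrightarrow> w * ?cz \<in> lsp Nn"
      if "dec \<theta> i (replicate (k - 1) i @ \<rho>) \<theta>' i' r'' w" for \<theta>' i' r'' w
      using that
    proof (induction rule: dec.induct)
      case (dec_x \<theta>' r0 y0 r'' s)
      show ?case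
      proof (intro impI)
        assume a: "\<theta>' = \<theta>" "r'' = r'"
        have "y0 * x ?a ^ s * ?cz * ?E \<in> lsp Nn"
          using Q1[of \<theta>] dec_x a r unfolding Q1_def by (simp add: algebra_simps mult.assoc)
        then show "y0 * x ?a ^ s * e (\<theta> @ i # replicate (k - 1) i @ \<rho>) * ?cz \<in> lsp Nn"
          unfolding E[symmetric] using cz_E[OF len(1), of i] by (simp add: mult.assoc)
      qed
    next
      case (dec_t \<kappa> i' r2 y2 \<theta>' r1 y1 r'' s)
      show ?case
      proof (intro impI)
        assume a: "\<theta>' = \<theta>" "i' = i" "r'' = r'"
        have l: "?l = Suc (length \<kappa>)" using hm_length[OF dec_t(1)] by simp
        have m: "length \<kappa> + Suc k = m" using l len by simp
        have ms: "mset (\<kappa> @ [i]) = mset \<theta>" using hm_mset[OF dec_t(1)] a by simp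
        let ?E' = "E \<kappa> (Suc k) i" and ?cz' = "cyc ?l m * z"
        have y2: "hm \<theta> (\<kappa> @ [i]) r2 y2" and y1: "hm (\<kappa> @ [i]) \<theta> r1 y1" using dec_t a by auto
        have y21: "hm (\<kappa> @ [i]) (\<kappa> @ [i]) (r1 + r2) (y2 * y1)" by (rule hm_trans[OF y2 y1])
        have yE: "y2 * ?E = ?E' * y2"
          using hm_e[OF y2, of "replicate k i @ \<rho>"] len mn E_Suc(2)[of \<kappa> i k] by (simp add: E_def)
        have lenk: "length \<kappa> + 2 + length (replicate (k - 1) i @ \<rho>) = n" using m mn len by simp
        have E': "?E' = e (\<kappa> @ i # i # (replicate (k - 1) i @ \<rho>))"
          using len(2) by (cases k) (auto simp: E_def)
        have tE: "t ?l * ?E' = ?E' * t ?l" unfolding E' by (rule t_ek[OF lenk l])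
        have cz': "?cz' = t ?l * ?cz" using cyc_rec[of ?l m] l len by (simp add: mult.assoc)
        have cE: "?cz * ?E' = ?E' * ?cz"
          using cz_E[of "\<kappa> @ [i]" k i] l len E_Suc(2)[of \<kappa> i k] by simp
        have "y1 * x ?a ^ s * t ?l * y2 * ?E * ?cz = y1 * x ?a ^ s * t ?l * ?E' * (y2 * ?cz)"
          using yE by (simp only: mult.assoc)
        also have "y2 * ?cz = ?cz * y2" by (rule hm_cz[OF len(1) _ y2]) simp
        finally have eq: "y1 * x ?a ^ s * t ?l * y2 * ?E * ?cz = (y1 * (x ?a ^ s * t ?l * ?E') * ?cz) * y2"
          by (simp only: mult.assoc)
        have "x ?a ^ s * t ?l * ?E' = t ?l * x ?l ^ s * ?E' + hs ?l s * ?E'"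
          unfolding E' t_xp_eq[OF lenk l] by simp
        then have "y2 * (y1 * (x ?a ^ s * t ?l * ?E') * ?cz)
          = y2 * y1 * t ?l * x ?l ^ s * (?E' * ?cz) + y2 * y1 * hs ?l s * (?E' * ?cz)"
          by (simp add: distrib_left distrib_right mult.assoc)
        also have "y2 * y1 * t ?l * x ?l ^ s * (?E' * ?cz) = (y2 * y1 * (?cz' * ?E')) * x ?l ^ s"
        proof -
          have "x ?l ^ s * (?cz * ?E') = (?cz * ?E') * x ?l ^ s"
            by (rule comm_times) (use x_cz[OF len(1), of ?l s] l x_pow_e in \<open>auto simp: E_def\<close>)
          then show ?thesis unfolding cE[symmetric] cz' by (simp only: mult.assoc)
        qed
        also have "y2 * y1 * hs ?l s * (?E' * ?cz) = (\<Sum>c<s. y2 * y1 * x ?l ^ c * x ?a ^ (s - 1 - c) * ?cz * ?E')"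
          unfolding cE[symmetric] hs_def using l by (simp add: sum_distrib_left sum_distrib_right mult.assoc)
        finally have eq2: "y2 * (y1 * (x ?a ^ s * t ?l * ?E') * ?cz) = (y2 * y1 * (?cz' * ?E')) * x ?l ^ s
            + (\<Sum>c<s. y2 * y1 * x ?l ^ c * x ?a ^ (s - 1 - c) * ?cz * ?E')" .
        have degk: "rat_of_nat (k - 1) = of_nat k - 1" using len(2) by (simp add: of_nat_diff)
        \<comment> \<open>The power has come out on the right of the cycle; rotated to the front it
          is part of the coefficient.\<close>
        have A: "x ?l ^ s * (y2 * y1 * (?cz' * ?E')) \<in> lsp Nn"
        proof -
          have h1: "hm (\<kappa> @ [i]) (\<kappa> @ [i]) (r1 + r2 + of_nat s * dg i i) (x ?l ^ s * (y2 * y1))"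
            using hm_trans[OF hm_xp1[OF l, of i "[]" s] y21] by simp
          have d1: "r = r1 + r2 + of_nat s * dg i i - of_nat (Suc k - 1) * dg i i"
            using r dec_t(3) a degk by (simp add: algebra_simps)
          show ?thesis using Q2D[OF Q2[OF l ms] h1 d1] l by (simp add: mult.assoc)
        qed
        have B: "y2 * y1 * x ?l ^ c * x ?a ^ (s - 1 - c) * ?cz * ?E' \<in> lsp Nn" if c: "c < s" for c
        proof -
          have "hm (\<kappa> @ [i]) (\<kappa> @ [i]) (of_nat c * dg i i + (r1 + r2)) (y2 * y1 * x ?l ^ c)"
            using hm_trans[OF y21 hm_xp1[OF l, of i "[]" c]] by simp
          moreover obtain v where v: "s = Suc (c + v)" using less_imp_Suc_add[OF c] by auto
          moreover have "r = of_nat c * dg i i + (r1 + r2) + (of_nat (s - 1 - c) - of_nat (k - 1)) * dg i i"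
            using r dec_t(3) a v by (simp add: algebra_simps)
          ultimately have "y2 * y1 * x ?l ^ c * x (Suc (length (\<kappa> @ [i]))) ^ (s - 1 - c)
              * cyc (Suc (length (\<kappa> @ [i]))) m * z * E (\<kappa> @ [i]) k i \<in> lsp Nn"
            using Q1[of "\<kappa> @ [i]"] ms l by (intro Q1D[where r' = "of_nat c * dg i i + (r1 + r2)"]) auto
          then show ?thesis using l unfolding E_Suc(2) by (simp add: mult.assoc)
        qed
        have "(y2 * y1 * (?cz' * ?E')) * x ?l ^ s \<in> lsp Nn"
          by (rule CC_swap[OF Nn _ _ A])
            (use hm_Alg[OF y1] hm_Alg[OF y2] in \<open>auto intro!: Alg_mult Alg_pow Alg_x cz_Alg[unfolded mult.assoc] simp: mult.assoc\<close>)
        then have "y2 * (y1 * (x ?a ^ s * t ?l * ?E') * ?cz) \<in> lsp Nn"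
          unfolding eq2 using B by (intro lsp_add lsp_sum) auto
        moreover have "y1 * (x ?a ^ s * t ?l * ?E') * ?cz \<in> Alg" "y2 \<in> Alg"
          using hm_Alg[OF y1] hm_Alg[OF y2] z
          by (auto intro!: Alg_mult Alg_pow Alg_x Alg_t cyc_Alg simp: E_def Alg_e tail_def)
        ultimately show "y1 * x ?a ^ s * t ?l * y2 * e (\<theta> @ i # replicate (k - 1) i @ \<rho>) * ?cz \<in> lsp Nn"
          unfolding E[symmetric] eq using CC_swap[OF Nn] by blast
      qed
    qed (auto simp: lsp_0 distrib_right mult.assoc intro: lsp_add lsp_sc)
    then show "\<And>w. dec \<theta> i (replicate (k - 1) i @ \<rho>) \<theta> i r' w \<Longrightarrow> w * ?cz \<in> lsp Nn" by blast
  qed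
  then have "y * ?E * ?cz \<in> lsp Nn"
    using \<open>dec \<theta> i (replicate (k - 1) i @ \<rho>) \<theta> i r' (y * ?E)\<close> by blast
  then show "y * cyc ?a m * z * ?E \<in> lsp Nn" using cz_E[OF len(1), of i] by (simp add: mult.assoc)
qed

text \<open>The induction starts with the empty prefix, where the cycle fills all m strands. Each
  step refers to prefixes shorter by one letter or to rearrangements of the same prefix, which is
  why just the multiset of letters is fixed.\<close>

lemma Q12:
  "length \<theta> + k = m \<Longrightarrow> k \<ge> 1 \<Longrightarrow> mset (\<theta> @ replicate k i) = M \<Longrightarrow> Q1 \<theta> i k \<and> Q2 \<theta> i k"
proof (induction "length \<theta>" arbitrary: \<theta> k)
  case 0
  have "Q1 \<theta> i k" by (rule Q1_step) (use 0 in auto)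
  moreover have "Q2 \<theta> i k" by (rule Q2_step) (use 0 \<open>Q1 \<theta> i k\<close> in auto)
  ultimately show ?case by simp
next
  case (Suc l)
  have Q2: "Q2 \<kappa> i (Suc k)" if "Suc l = Suc (length \<kappa>)" "mset (\<kappa> @ [i]) = mset \<theta>" for \<kappa>
  proof -
    have "mset (\<kappa> @ replicate (Suc k) i) = mset (\<kappa> @ [i]) + mset (replicate k i)" by simp
    also have "\<dots> = M" unfolding that(2) using Suc.prems(3) by simp
    finally show ?thesis using Suc.hyps(1)[of \<kappa> "Suc k"] Suc that by simp
  qed
  have Q1: "Q1 \<theta>' i k" if "length \<theta>' = length \<theta>" "mset \<theta>' = mset \<theta>" for \<theta>'
    by (rule Q1_step) (use Suc that Q2 in auto)
  have "Q2 \<theta> i k" by (rule Q2_step) (use Suc Q1 Q2 in auto)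
  then show ?case using Q1 by blast
qed

text \<open>An arbitrary word is the case k = 1 of \<open>Q2\<close>, where the cycle has no
  crossing.\<close>

lemma hm_reduce:
  assumes "hm \<nu> \<nu> r y" "length \<nu> = m" "\<nu> \<noteq> []" "mset \<nu> = M"
  shows "y * z * e (\<nu> @ \<rho>) \<in> lsp Nn"
proof -
  obtain \<theta> i where \<nu>: "\<nu> = \<theta> @ [i]" using assms(3) by (cases \<nu> rule: rev_cases) auto
  have "Q2 \<theta> i 1" using Q12[of \<theta> 1 i] assms \<nu> by simp
  then show ?thesis using assms \<nu> unfolding Q2_def by (auto simp: cyc_self E_def)
qed

end

text \<open>The last cycle becomes a block by \<open>cycle_block\<close> and joins z, and the
  coefficient in front of it is a word on fewer strands; so blocks are found from right to left. The
  induction hypothesis may rearrange the prefix, but \<open>ell\<close> depends on the multiset of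
  letters only, so the bound for the new block survives.\<close>

theorem span_blocks:
  "length \<nu> + length \<rho> = n \<Longrightarrow> tail (length \<nu>) \<rho> z \<Longrightarrow> hm \<nu> \<nu> r y \<Longrightarrow>
    y * z * e (\<nu> @ \<rho>) \<in> lsp (CC \<union> {belt x t 0 bl * z * e (bseq bl @ \<rho>) | bl.
      valid [] bl \<and> mset (bseq bl) = mset \<nu> \<and> bdeg bl = r})"
proof (induction "length \<nu>" arbitrary: \<nu> \<rho> z r y rule: less_induct)
  case less
  define B where "B \<nu> \<rho> z r = {belt x t 0 bl * z * e (bseq bl @ \<rho>) | bl.
      valid [] bl \<and> mset (bseq bl) = mset \<nu> \<and> bdeg bl = r}" for \<nu> \<rho> z r
  let ?N = "CC \<union> B \<nu> \<rho> z r"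
  show ?case
  proof (cases "\<nu> = []")
    case True
    obtain c where c: "y = sc c" "r \<noteq> 0 \<longrightarrow> y = 0" using hm_Nil[of "[]" r y] less.prems True by auto
    show ?thesis
    proof (cases "r = 0")
      case r0: True
      have "belt x t 0 [] * z * e (bseq [] @ \<rho>) \<in> B \<nu> \<rho> z r"
        unfolding B_def using True r0 by (intro CollectI exI[of _ "[]"]) (simp add: bdeg_def)
      then have "z * e \<rho> \<in> lsp ?N" by (intro lsp_base) simp
      from lsp_sc[OF this, of c] show ?thesis using True c by (simp add: mult.assoc B_def)
    qed (use c lsp_0 in simp)
  next
    case False
    have "y * z * e (\<nu> @ \<rho>) \<in> lsp ?N"
    proof (rule hm_reduce[where m = "length \<nu>" and M = "mset \<nu>" and r = r])
      fix \<theta> i k s y r'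
      assume m: "length \<theta> + k = length \<nu>" and k: "k \<ge> 1" and M: "mset (\<theta> @ replicate k i) = mset \<nu>"
        and y: "hm \<theta> \<theta> r' y" and r: "r = r' + (of_nat s - of_nat (k - 1)) * dg i i"
        and s: "int s < ell \<theta> i" and \<theta>I: "set \<theta> \<subseteq> I" and i: "i \<in> I"
      let ?a = "Suc (length \<theta>)" and ?m = "length \<nu>" and ?E = "e (\<theta> @ replicate k i @ \<rho>)"
      have len: "length \<theta> + k + length \<rho> = n" using m less.prems by simp
      have zA: "z \<in> Alg" and zx: "\<And>j. 1 \<le> j \<Longrightarrow> j \<le> ?m \<Longrightarrow> z * x j = x j * z"
        and zt: "\<And>j. 1 \<le> j \<Longrightarrow> j < ?m \<Longrightarrow> z * t j = t j * z"
        and ze: "\<And>\<nu>'. length \<nu>' = ?m \<Longrightarrow> z * e (\<nu>' @ \<rho>) = e (\<nu>' @ \<rho>) * z"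
        using less.prems(2) by (auto simp: tail_def)
      have zE: "z * ?E = ?E * z" using ze[of "\<theta> @ replicate k i"] m by simp
      have yE: "y * ?E = ?E * y" using hm_e[OF y, of "replicate k i @ \<rho>"] len by simp
      have tE: "t j * ?E = ?E * t j" if "?a \<le> j" "j < length \<theta> + k" for j
        using tf[OF i k len refl that] .
      have Y: "y * z \<in> Alg" "y * z * ?E = ?E * (y * z)"
        "\<And>j. ?a \<le> j \<Longrightarrow> j \<le> length \<theta> + k \<Longrightarrow> y * z * x j = x j * (y * z)"
        "\<And>j. ?a \<le> j \<Longrightarrow> j < length \<theta> + k \<Longrightarrow> y * z * t j = t j * (y * z)"
      proof -
        show "y * z \<in> Alg" using hm_Alg[OF y] zA by (rule Alg_mult)
        show "y * z * ?E = ?E * (y * z)" using comm_times[OF yE[symmetric] zE[symmetric]] by simp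
        show "y * z * x j = x j * (y * z)" if "?a \<le> j" "j \<le> length \<theta> + k" for j
          using comm_times[of "x j" y z] hm_comm_x[OF y, of j] zx[of j] that m by simp
        show "y * z * t j = t j * (y * z)" if "?a \<le> j" "j < length \<theta> + k" for j
          using comm_times[of "t j" y z] hm_comm_t[OF y, of j] zt[of j] that m by simp
      qed
      have cy: "cyc ?a ?m = prod_list (map t [?a..<length \<theta> + k])" using m by (simp add: cyc_def)
      have zc: "z * cyc ?a ?m = cyc ?a ?m * z" by (rule cyc_comm) (use zt in auto)
      have lhs: "y * x ?a ^ s * cyc ?a ?m * z * ?E = y * z * x ?a ^ s * prod_list (map t [?a..<length \<theta> + k]) * ?E"
      proof -
        have "z * x ?a = x ?a * z" using zx[of ?a] m k by simp
        then have "z * x ?a ^ s = x ?a ^ s * z" by (rule comm_power)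
        then have "z * (x ?a ^ s * cyc ?a ?m) = (x ?a ^ s * cyc ?a ?m) * z" using zc by (rule comm_times)
        then show ?thesis unfolding cy[symmetric] by (simp add: mult.assoc)
      qed
      have CCN: "w \<in> lsp ?N" if "w \<in> lsp CC" for w
        using that by (rule lsp_mono) (auto intro: lsp_base)
      show "y * x ?a ^ s * cyc ?a ?m * z * ?E \<in> lsp ?N"
      proof (cases "s < k - 1")
        case True
        then show ?thesis unfolding lhs using cycle_block(1)[OF i k len refl Y True] CCN by blast
      next
        case False
        define l where "l = s - (k - 1)"
        let ?z' = "e_prod x t ?a (length \<theta> + k) * x (length \<theta> + k) ^ l * z" and ?\<rho>' = "replicate k i @ \<rho>"
        have ks: "k - 1 \<le> s" using False by simp
        have "length \<theta> < ?m" using m k by simp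
        moreover have "length \<theta> + length ?\<rho>' = n" using len by simp
        moreover have "tail (length \<theta>) ?\<rho>' ?z'"
          unfolding tail_def
        proof (intro conjI allI impI)
          show "?z' \<in> Alg" using zA by (intro Alg_mult Alg_e_prod Alg_pow Alg_x)
          fix j assume j: "1 \<le> j" "j \<le> length \<theta>"
          have "x j * e_prod x t ?a (length \<theta> + k) = e_prod x t ?a (length \<theta> + k) * x j"
            by (rule e_prod_comm) (use j in \<open>auto simp: x_x t_x_far\<close>)
          moreover have "x j * z = z * x j" using zx[of j] j m by simp
          ultimately have "x j * ?z' = ?z' * x j" by (intro comm_times comm_power x_x)
          then show "?z' * x j = x j * ?z'" by simp
        next
          fix j assume j: "1 \<le> j" "j < length \<theta>"
          have "t j * e_prod x t ?a (length \<theta> + k) = e_prod x t ?a (length \<theta> + k) * t j"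
            by (rule e_prod_comm) (use j in \<open>auto simp: t_x_far t_t_far\<close>)
          moreover have "t j * z = z * t j" using zt[of j] j m by simp
          moreover have "t j * x (length \<theta> + k) = x (length \<theta> + k) * t j" using j k by (intro t_x_far) auto
          ultimately have "t j * ?z' = ?z' * t j" by (intro comm_times comm_power)
          then show "?z' * t j = t j * ?z'" by simp
        next
          fix \<nu>' :: "'i list" assume l\<nu>: "length \<nu>' = length \<theta>"
          let ?E' = "e (\<nu>' @ ?\<rho>')"
          have "?E' * e_prod x t ?a (length \<theta> + k) = e_prod x t ?a (length \<theta> + k) * ?E'"
          proof (rule e_prod_comm)
            have len': "length \<nu>' + k + length \<rho> = n" using l\<nu> len by simp
            show "?E' * t j = t j * ?E'" if "?a \<le> j" "j < length \<theta> + k" for j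
              using tf[OF i k len' refl, of j] that l\<nu> by simp
          qed (simp add: x_e)
          moreover have "?E' * z = z * ?E'" using ze[of "\<nu>' @ replicate k i"] m l\<nu> by simp
          ultimately have "?E' * ?z' = ?z' * ?E'" by (intro comm_times comm_power) (simp_all add: x_e)
          then show "?z' * ?E' = ?E' * ?z'" by simp
        qed
        ultimately have IH: "y * ?z' * e (\<theta> @ ?\<rho>') \<in> lsp (CC \<union> B \<theta> ?\<rho>' ?z' r')"
          unfolding B_def using y by (intro less.hyps)
        have "B \<theta> ?\<rho>' ?z' r' \<subseteq> B \<nu> \<rho> z r"
        proof
          fix w assume "w \<in> B \<theta> ?\<rho>' ?z' r'"
          then obtain bl where bl: "w = belt x t 0 bl * ?z' * e (bseq bl @ ?\<rho>')" "valid [] bl"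
            "mset (bseq bl) = mset \<theta>" "bdeg bl = r'" unfolding B_def by auto
          have ln: "length (bseq bl) = length \<theta>" using bl(3) mset_eq_length by blast
          have "valid [] (bl @ [(i, k, l)])"
            using bl(2) i k s ks ell_mset[OF bl(3), of i] by (simp add: valid_append l_def)
          moreover have "mset (bseq (bl @ [(i, k, l)])) = mset \<nu>" using bl(3) M by simp
          moreover have "bdeg (bl @ [(i, k, l)]) = r"
          proof -
            have "rat_of_nat l = of_nat s - of_nat (k - 1)" unfolding l_def using ks by (rule of_nat_diff)
            then show ?thesis using bl(4) r by (simp add: bdeg_def)
          qed
          moreover have "w = belt x t 0 (bl @ [(i, k, l)]) * z * e (bseq (bl @ [(i, k, l)]) @ \<rho>)"
            using bl(1) ln by (simp add: belt_append mult.assoc)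
          ultimately show "w \<in> B \<nu> \<rho> z r" unfolding B_def by blast
        qed
        then have "y * ?z' * ?E \<in> lsp ?N"
          using IH by (intro lsp_mono[OF IH]) (auto intro: lsp_base)
        moreover have "y * ?z' * ?E = y * z * e_prod x t ?a (length \<theta> + k) * x (length \<theta> + k) ^ l * ?E"
        proof -
          have "z * e_prod x t ?a (length \<theta> + k) = e_prod x t ?a (length \<theta> + k) * z"
            by (rule e_prod_comm) (use zx zt m in auto)
          moreover have "z * x (length \<theta> + k) ^ l = x (length \<theta> + k) ^ l * z"
            using zx[of "length \<theta> + k"] m k by (intro comm_power) auto
          ultimately have "z * (e_prod x t ?a (length \<theta> + k) * x (length \<theta> + k) ^ l)
            = (e_prod x t ?a (length \<theta> + k) * x (length \<theta> + k) ^ l) * z" by (rule comm_times)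
          then show ?thesis by (simp add: mult.assoc)
        qed
        ultimately have "sc ((- 1) ^ (k - 1)) * (y * z * e_prod x t ?a (length \<theta> + k) * x (length \<theta> + k) ^ l * ?E) \<in> lsp ?N"
          using lsp_sc by simp
        from lsp_add[OF CCN[OF cycle_block(2)[OF i k len refl Y ks]] this]
        show ?thesis unfolding lhs l_def by simp
      qed
    qed (use less.prems False in auto)
    then show ?thesis by (simp only: B_def)
  qed
qed

end

section \<open>Quotients of free algebras\<close>

lemma quot_simps:
  "carrier (quot A N) = a_rcosets\<^bsub>A\<^esub> N" "mult (quot A N) = rcoset_mult A N"
  "one (quot A N) = N +>\<^bsub>A\<^esub> \<one>\<^bsub>A\<^esub>" "zero (quot A N) = N" "add (quot A N) = set_add A"
  "smult (quot A N) c X = (\<Union>x\<in>X. N +>\<^bsub>A\<^esub> (c \<odot>\<^bsub>A\<^esub> x))"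
  by (simp_all add: quot_def ring.defs module.defs FactRing_def)

lemma ring_quot:
  assumes "ideal N A"
  shows "ring (quot A N)"
proof -
  interpret ideal N A by (rule assms)
  show ?thesis
  proof (rule ringI)
    show "abelian_group (quot A N)"
    proof -
      have z: "\<zero>\<^bsub>quot A N\<^esub> = N +>\<^bsub>A\<^esub> \<zero>\<^bsub>A\<^esub>"
        by (simp add: quot_simps a_coset_add_zero a_subset)
      have c: "X \<in> carrier (quot A N) \<longleftrightarrow> (\<exists>x\<in>carrier A. X = N +>\<^bsub>A\<^esub> x)" for X
        by (auto simp: quot_simps A_RCOSETS_defs a_r_coset_def)
      have p: "x \<in> carrier A \<Longrightarrow> y \<in> carrier A \<Longrightarrow>
          (N +>\<^bsub>A\<^esub> x) \<oplus>\<^bsub>quot A N\<^esub> (N +>\<^bsub>A\<^esub> y) = N +>\<^bsub>A\<^esub> (x \<oplus>\<^bsub>A\<^esub> y)" for x y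
        by (simp add: quot_simps a_rcos_sum)
      have inv: "\<exists>Y\<in>carrier (quot A N). Y \<oplus>\<^bsub>quot A N\<^esub> X = \<zero>\<^bsub>quot A N\<^esub>"
        if "X \<in> carrier (quot A N)" for X
      proof -
        from that obtain x where x: "x \<in> carrier A" "X = N +>\<^bsub>A\<^esub> x" using c by auto
        then show ?thesis by (intro bexI[of _ "N +>\<^bsub>A\<^esub> (\<ominus>\<^bsub>A\<^esub> x)"]) (auto simp: p z c l_neg)
      qed
      show ?thesis
        by (rule abelian_groupI; (fact inv)?) (auto simp: c p z a_ac)
    qed
    show "Group.monoid (quot A N)"
      by (rule monoidI)
        (auto simp add: quot_simps A_RCOSETS_defs a_r_coset_def[symmetric] rcoset_mult_add m_assoc)
  qed (auto simp: quot_simps A_RCOSETS_defs a_r_coset_def[symmetric] rcoset_mult_add a_rcos_sum l_distr r_distr)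
qed

text \<open>The part of the module axioms used by linear quotients. It passes to
  \<open>quot A N\<close> by \<open>lmod_quot\<close>, so the free algebra, the KLR algebra and the
  cyclotomic algebra can be treated alike.\<close>

definition lmod :: "('k, 'a) module \<Rightarrow> bool" where
  "lmod A \<longleftrightarrow> abelian_group A \<and> (\<forall>c. \<forall>x\<in>carrier A. c \<odot>\<^bsub>A\<^esub> x \<in> carrier A) \<and>
     (\<forall>c. \<forall>x\<in>carrier A. \<forall>y\<in>carrier A. c \<odot>\<^bsub>A\<^esub> (x \<oplus>\<^bsub>A\<^esub> y) = c \<odot>\<^bsub>A\<^esub> x \<oplus>\<^bsub>A\<^esub> c \<odot>\<^bsub>A\<^esub> y)"

definition lsub :: "('k, 'a) module \<Rightarrow> 'a set \<Rightarrow> bool" where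
  "lsub A N \<longleftrightarrow> additive_subgroup N A \<and> (\<forall>c. \<forall>x\<in>N. c \<odot>\<^bsub>A\<^esub> x \<in> N)"

lemma kspan_closed: "lmod A \<Longrightarrow> S \<subseteq> carrier A \<Longrightarrow> x \<in> kspan A S \<Longrightarrow> x \<in> carrier A"
  by (erule kspan.induct)
    (auto simp: lmod_def abelian_group_def abelian_monoid.zero_closed abelian_monoid.a_closed)

context
  fixes A :: "('k, 'a) module" and N :: "'a set"
  assumes A: "lmod A" and N: "lsub A N"
begin

interpretation G: abelian_group A using A by (simp add: lmod_def)

interpretation H: abelian_subgroup N A
  using N G.abelian_group_axioms by (auto simp: lsub_def intro: abelian_subgroupI3)

lemma qclass_add: "x \<in> carrier A \<Longrightarrow> y \<in> carrier A \<Longrightarrow>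
    qclass A N (x \<oplus>\<^bsub>A\<^esub> y) = qclass A N x \<oplus>\<^bsub>quot A N\<^esub> qclass A N y"
  by (simp add: qclass_def quot_simps H.a_rcos_sum)

lemma qclass_zero: "qclass A N \<zero>\<^bsub>A\<^esub> = \<zero>\<^bsub>quot A N\<^esub>"
  by (simp add: qclass_def quot_simps G.a_coset_add_zero H.a_subset)

lemma qclass_carrier: "carrier (quot A N) = qclass A N ` carrier A"
  by (auto simp: quot_simps A_RCOSETS_defs qclass_def a_r_coset_def)

lemma qclass_eq: "x \<in> carrier A \<Longrightarrow> y \<in> carrier A \<Longrightarrow> qclass A N x = qclass A N y \<longleftrightarrow> x \<ominus>\<^bsub>A\<^esub> y \<in> N"
proof
  assume xy: "x \<in> carrier A" "y \<in> carrier A"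
  show "x \<ominus>\<^bsub>A\<^esub> y \<in> N" if "qclass A N x = qclass A N y"
  proof -
    have "x \<in> N +>\<^bsub>A\<^esub> y" using that H.a_rcos_self[OF xy(1)] by (simp add: qclass_def)
    then show ?thesis using H.a_rcos_module_imp[OF xy(2)] by (simp add: G.minus_eq)
  qed
  show "qclass A N x = qclass A N y" if "x \<ominus>\<^bsub>A\<^esub> y \<in> N"
    using H.a_rcos_module_rev[OF xy(2,1)] that G.a_repr_independence[of x N y] xy H.a_subgroup
    by (simp add: qclass_def G.minus_eq)
qed

lemma smult_minus: "x \<in> carrier A \<Longrightarrow> y \<in> carrier A \<Longrightarrow> c \<odot>\<^bsub>A\<^esub> (x \<ominus>\<^bsub>A\<^esub> y) = c \<odot>\<^bsub>A\<^esub> x \<ominus>\<^bsub>A\<^esub> c \<odot>\<^bsub>A\<^esub> y"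
proof -
  assume xy: "x \<in> carrier A" "y \<in> carrier A"
  have cl: "\<And>z. z \<in> carrier A \<Longrightarrow> c \<odot>\<^bsub>A\<^esub> z \<in> carrier A" using A by (simp add: lmod_def)
  have "c \<odot>\<^bsub>A\<^esub> (x \<ominus>\<^bsub>A\<^esub> y) \<oplus>\<^bsub>A\<^esub> c \<odot>\<^bsub>A\<^esub> y = c \<odot>\<^bsub>A\<^esub> ((x \<ominus>\<^bsub>A\<^esub> y) \<oplus>\<^bsub>A\<^esub> y)"
    using A xy by (simp add: lmod_def)
  also have "(x \<ominus>\<^bsub>A\<^esub> y) \<oplus>\<^bsub>A\<^esub> y = x" using xy by (simp add: G.minus_eq G.a_assoc G.l_neg)
  finally have eq: "c \<odot>\<^bsub>A\<^esub> x = c \<odot>\<^bsub>A\<^esub> (x \<ominus>\<^bsub>A\<^esub> y) \<oplus>\<^bsub>A\<^esub> c \<odot>\<^bsub>A\<^esub> y" by simp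
  show ?thesis unfolding eq using xy cl by (simp add: G.minus_eq G.a_assoc G.r_neg)
qed

text \<open>All representatives of a coset give the same scaled coset, so the union in
  \<open>quot\<close> runs over a single value.\<close>

lemma qclass_smult: "x \<in> carrier A \<Longrightarrow> c \<odot>\<^bsub>quot A N\<^esub> qclass A N x = qclass A N (c \<odot>\<^bsub>A\<^esub> x)"
proof -
  assume x: "x \<in> carrier A"
  have cl: "\<And>z. z \<in> carrier A \<Longrightarrow> c \<odot>\<^bsub>A\<^esub> z \<in> carrier A" using A by (simp add: lmod_def)
  have "N +>\<^bsub>A\<^esub> (c \<odot>\<^bsub>A\<^esub> y) = N +>\<^bsub>A\<^esub> (c \<odot>\<^bsub>A\<^esub> x)" if y: "y \<in> N +>\<^bsub>A\<^esub> x" for y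
  proof -
    have yA: "y \<in> carrier A" using y x H.a_subset by (auto simp: a_r_coset_def r_coset_def)
    have "y \<ominus>\<^bsub>A\<^esub> x \<in> N" using H.a_rcos_module_imp[OF x y] by (simp add: G.minus_eq)
    then have "c \<odot>\<^bsub>A\<^esub> (y \<ominus>\<^bsub>A\<^esub> x) \<in> N" using N by (simp add: lsub_def)
    then have "c \<odot>\<^bsub>A\<^esub> y \<ominus>\<^bsub>A\<^esub> c \<odot>\<^bsub>A\<^esub> x \<in> N" using smult_minus yA x by simp
    then show ?thesis using qclass_eq cl yA x by (simp add: qclass_def)
  qed
  then have "(\<Union>y\<in>N +>\<^bsub>A\<^esub> x. N +>\<^bsub>A\<^esub> (c \<odot>\<^bsub>A\<^esub> y)) = (\<Union>y\<in>N +>\<^bsub>A\<^esub> x. N +>\<^bsub>A\<^esub> (c \<odot>\<^bsub>A\<^esub> x))"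
    by (intro SUP_cong refl)
  also have "\<dots> = N +>\<^bsub>A\<^esub> (c \<odot>\<^bsub>A\<^esub> x)" using H.a_rcos_self[OF x] by (subst UN_constant) auto
  finally show ?thesis by (simp only: qclass_def quot_simps)
qed

text \<open>Three applications, one for each quotient, turn a statement about spans in the cocenter
  into one about spans in the free algebra.\<close>

lemma kspan_quot:
  assumes S: "S \<subseteq> carrier A"
  shows "kspan (quot A N) (qclass A N ` S) = qclass A N ` kspan A S"
proof (intro equalityI subsetI)
  fix X assume "X \<in> kspan (quot A N) (qclass A N ` S)"
  then show "X \<in> qclass A N ` kspan A S"
  proof (induction rule: kspan.induct)
    case zero
    show ?case using qclass_zero kspan.zero by (metis image_eqI)
  next
    case (base X)
    then show ?case by (auto intro: kspan.base)
  next
    case (add X Y)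
    then obtain x y where "X = qclass A N x" "Y = qclass A N y" "x \<in> kspan A S" "y \<in> kspan A S" by auto
    then show ?case using qclass_add kspan_closed[OF A S] kspan.add[of x A S y] by (metis image_eqI)
  next
    case (smult X c)
    then obtain x where "X = qclass A N x" "x \<in> kspan A S" by auto
    then show ?case using qclass_smult kspan_closed[OF A S] kspan.smult[of x A S c] by (metis image_eqI)
  qed
next
  fix X assume "X \<in> qclass A N ` kspan A S"
  then obtain x where X: "X = qclass A N x" and "x \<in> kspan A S" by auto
  from this(2) have "qclass A N x \<in> kspan (quot A N) (qclass A N ` S)"
  proof (induction rule: kspan.induct)
    case (add x y)
    then show ?case using qclass_add kspan_closed[OF A S] by (simp add: kspan.add)
  next
    case (smult x c)
    then show ?case using qclass_smult[of x c] kspan_closed[OF A S] by (metis kspan.smult)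
  qed (auto simp: qclass_zero intro: kspan.intros)
  then show "X \<in> kspan (quot A N) (qclass A N ` S)" using X by simp
qed

lemma lmod_quot: "abelian_group (quot A N) \<Longrightarrow> lmod (quot A N)"
  unfolding lmod_def qclass_carrier
proof (intro conjI allI ballI; (elim imageE)?)
  fix c X x assume "X = qclass A N x" "x \<in> carrier A"
  then show "c \<odot>\<^bsub>quot A N\<^esub> X \<in> qclass A N ` carrier A"
    using A by (auto simp: qclass_smult lmod_def)
next
  fix c X Y x y assume "X = qclass A N x" "x \<in> carrier A" "Y = qclass A N y" "y \<in> carrier A"
  then show "c \<odot>\<^bsub>quot A N\<^esub> (X \<oplus>\<^bsub>quot A N\<^esub> Y) = c \<odot>\<^bsub>quot A N\<^esub> X \<oplus>\<^bsub>quot A N\<^esub> c \<odot>\<^bsub>quot A N\<^esub> Y"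
    using A by (simp add: qclass_smult lmod_def flip: qclass_add)
qed

end

text \<open>\<open>kspan\<close> has no rule for negatives; they come from scalar multiples.\<close>

lemma lsub_kspan:
  assumes A: "lmod A" and S: "S \<subseteq> carrier A" and neg: "\<And>x. x \<in> carrier A \<Longrightarrow> \<exists>c. \<ominus>\<^bsub>A\<^esub> x = c \<odot>\<^bsub>A\<^esub> x"
  shows "lsub A (kspan A S)"
proof -
  interpret G: abelian_group A using A by (simp add: lmod_def)
  have "subgroup (kspan A S) (add_monoid A)"
  proof (rule G.add.subgroupI)
    show "kspan A S \<subseteq> carrier A" using kspan_closed[OF A S] by blast
    show "kspan A S \<noteq> {}" using kspan.zero by blast
    show "\<ominus>\<^bsub>A\<^esub> x \<in> kspan A S" if "x \<in> kspan A S" for x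
      using neg[OF kspan_closed[OF A S that]] that by (auto intro: kspan.smult)
    show "x \<oplus>\<^bsub>A\<^esub> y \<in> kspan A S" if "x \<in> kspan A S" "y \<in> kspan A S" for x y
      using that by (rule kspan.add)
  qed
  then show ?thesis by (auto simp: lsub_def additive_subgroup_def intro: kspan.smult)
qed

lemma qclass_mult: "ideal N A \<Longrightarrow> x \<in> carrier A \<Longrightarrow> y \<in> carrier A \<Longrightarrow>
    qclass A N (x \<otimes>\<^bsub>A\<^esub> y) = qclass A N x \<otimes>\<^bsub>quot A N\<^esub> qclass A N y"
  by (simp add: qclass_def quot_simps ideal.rcoset_mult_add)

section \<open>A quotient of the free algebra inside a ring type\<close>

lemma poly_mapping_add_induct [case_names zero single add]:
  assumes "P 0" "\<And>k v. P (Poly_Mapping.single k v)" "\<And>f g. P f \<Longrightarrow> P g \<Longrightarrow> P (f + g)"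
  shows "P (f :: 'a \<Rightarrow>\<^sub>0 'b::comm_monoid_add)"
proof (induction f rule: Poly_Mapping.update_induct)
  case (update f k v)
  have "Poly_Mapping.update k v f = f + Poly_Mapping.single k v"
    using update by (intro poly_mapping_eqI)
      (auto simp: lookup_update lookup_add lookup_single in_keys_iff when_def)
  then show ?case using update assms by simp
qed (use assms in simp)

lemma scal_add: "scal (c + d) = scal c + (scal d :: ('g, 'k::field) free_alg)"
  by (simp add: scal_def single_add)

lemma scal_mult: "scal (c * d) = scal c * (scal d :: ('g, 'k::field) free_alg)"
  by (simp add: scal_def mult_single)

lemma scal_1: "scal 1 = (1 :: ('g, 'k::field) free_alg)"
  by (simp add: scal_def)

lemma scal_0: "scal 0 = (0 :: ('g, 'k::field) free_alg)"
  by (simp add: scal_def)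

lemma scal_comm: "scal c * f = f * (scal c :: ('g, 'k::field) free_alg)"
  by (induction f rule: poly_mapping_add_induct)
    (simp_all add: scal_def mult_single mult.commute distrib_left distrib_right)

lemma scal_left: "f * (scal c * g) = scal c * (f * (g :: ('g, 'k::field) free_alg))"
  by (metis mult.assoc scal_comm)

text \<open>Restriction of the support. It is multiplicative if a product lies in W exactly when
  both factors do; this is used for the words in the given generators and for the empty word
  alone.\<close>

definition rst :: "'a set \<Rightarrow> ('a \<Rightarrow>\<^sub>0 'b::zero) \<Rightarrow> ('a \<Rightarrow>\<^sub>0 'b)" where
  "rst W f = Poly_Mapping.mapp (\<lambda>k v. if k \<in> W then v else 0) f"

lemma lookup_rst: "Poly_Mapping.lookup (rst W f) k = (if k \<in> W then Poly_Mapping.lookup f k else 0)"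
  by (simp add: rst_def lookup_mapp when_def in_keys_iff)

lemma rst_add: "rst W (f + g) = rst W f + rst W (g :: 'a \<Rightarrow>\<^sub>0 'b::comm_monoid_add)"
  by (rule poly_mapping_eqI) (simp add: lookup_rst lookup_add)

lemma rst_single: "rst W (Poly_Mapping.single k v) = (if k \<in> W then Poly_Mapping.single k v else 0)"
  by (rule poly_mapping_eqI) (auto simp: lookup_rst lookup_single when_def)

lemma rst_0: "rst W 0 = 0"
  by (rule poly_mapping_eqI) (simp add: lookup_rst)

lemma rst_mult:
  assumes W: "\<And>u v. u + v \<in> W \<longleftrightarrow> u \<in> W \<and> v \<in> W"
  shows "rst W (f * g) = rst W f * rst W (g :: 'a::monoid_add \<Rightarrow>\<^sub>0 'b::semiring_0)"
proof (induction f rule: poly_mapping_add_induct)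
  case (single k v)
  show ?case
    by (induction g rule: poly_mapping_add_induct)
      (auto simp: rst_0 rst_single rst_add mult_single distrib_left W)
qed (simp_all add: rst_0 rst_add distrib_right)

text \<open>A type cannot depend on the ideal to be divided out. The linear endomorphisms of the
  free algebra form a fixed ring, in which every such quotient can act.\<close>

typedef (overloaded) ('g, 'k) lend = "{F :: ('g, 'k::field) free_alg \<Rightarrow> ('g, 'k) free_alg.
    (\<forall>u v. F (u + v) = F u + F v) \<and> (\<forall>c u. F (scal c * u) = scal c * F u)}"
  by (rule exI[of _ "\<lambda>x. x"]) simp

lemma Rep_lend_add: "Rep_lend F (u + v) = Rep_lend F u + Rep_lend F v"
  and Rep_lend_scal: "Rep_lend F (scal c * u) = scal c * Rep_lend F u"
  using Rep_lend[of F] by auto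

instantiation lend :: (type, field) ring_1
begin

definition "zero_lend = Abs_lend (\<lambda>u. 0)"
definition "one_lend = Abs_lend (\<lambda>u. u)"
definition "plus_lend F G = Abs_lend (\<lambda>u. Rep_lend F u + Rep_lend G u)"
definition "minus_lend F G = Abs_lend (\<lambda>u. Rep_lend F u - Rep_lend G u)"
definition "uminus_lend F = Abs_lend (\<lambda>u. - Rep_lend F u)"
definition "times_lend F G = Abs_lend (\<lambda>u. Rep_lend F (Rep_lend G u))"

lemma Rep_lend_simps:
  "Rep_lend 0 = (\<lambda>u. 0)" "Rep_lend 1 = (\<lambda>u. u)"
  "Rep_lend (F + G) = (\<lambda>u. Rep_lend F u + Rep_lend G u)"
  "Rep_lend (F - G) = (\<lambda>u. Rep_lend F u - Rep_lend G u)"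
  "Rep_lend (- F) = (\<lambda>u. - Rep_lend F u)"
  "Rep_lend (F * G) = (\<lambda>u. Rep_lend F (Rep_lend G u))"
  unfolding zero_lend_def one_lend_def plus_lend_def minus_lend_def uminus_lend_def times_lend_def
  by (subst Abs_lend_inverse; simp add: Rep_lend_add Rep_lend_scal algebra_simps)+

instance
proof
  have "(\<lambda>u. 0) \<noteq> (\<lambda>u :: ('a, 'b) free_alg. u)" by (metis zero_neq_one)
  then show "(0 :: ('a, 'b) lend) \<noteq> 1" by (metis Rep_lend_simps(1,2))
qed (auto simp: Rep_lend_inject[symmetric] Rep_lend_simps Rep_lend_add fun_eq_iff algebra_simps)

end

text \<open>
  Realises the quotient of the free algebra by an ideal \<open>J\<close> inside a single type: \<open>J\<close> has a linear
  complement, and an element acts on it by left multiplication followed by projection. On \<open>J\<close> itself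
  it acts through the augmentation \<open>\<epsilon>\<close>, which makes the map unital.
\<close>

locale free_ideal =
  fixes J :: "('g, 'k::field) free_alg set"
  assumes J_add: "f \<in> J \<Longrightarrow> g \<in> J \<Longrightarrow> f + g \<in> J"
    and J_left: "f \<in> J \<Longrightarrow> g * f \<in> J" and J_right: "f \<in> J \<Longrightarrow> f * g \<in> J"
    and J_0: "0 \<in> J"
begin

text \<open>The inclusion of J has a linear left inverse g, and f - g f is a projection with kernel
  J.\<close>

lemma projection_exists:
  "\<exists>p. (\<forall>f g. p (f + g) = p f + p g) \<and> (\<forall>c f. p (scal c * f) = scal c * p f) \<and>
    (\<forall>f. p f = 0 \<longleftrightarrow> f \<in> J) \<and> (\<forall>f. f - p f \<in> J)"
proof -
  interpret V: vector_space "\<lambda>c (f :: ('g, 'k) free_alg). scal c * f"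
    by unfold_locales (simp_all add: distrib_left distrib_right scal_add scal_mult scal_1 mult.assoc)
  interpret VV: vector_space_pair "\<lambda>c (f :: ('g, 'k) free_alg). scal c * f" "\<lambda>c (f :: ('g, 'k) free_alg). scal c * f" ..
  have "V.subspace J" unfolding V.subspace_def using J_0 J_add J_left by auto
  moreover have "Vector_Spaces.linear (\<lambda>c (f :: ('g, 'k) free_alg). scal c * f) (\<lambda>c f. scal c * f) (\<lambda>x. x)"
    by (rule V.linear_ident)
  ultimately obtain g where g: "g ` UNIV \<subseteq> J" "Vector_Spaces.linear (\<lambda>c (f :: ('g, 'k) free_alg). scal c * f) (\<lambda>c f. scal c * f) g"
    "\<forall>v\<in>J. g v = v" using VV.linear_exists_left_inverse_on[of "\<lambda>x. x" J] by (auto simp: inj_on_def)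
  interpret g: Vector_Spaces.linear "\<lambda>c (f :: ('g, 'k) free_alg). scal c * f" "\<lambda>c f. scal c * f" g by (rule g(2))
  show ?thesis
  proof (intro exI[of _ "\<lambda>f. f - g f"] conjI allI)
    fix f
    show "f - g f = 0 \<longleftrightarrow> f \<in> J" using g by auto
    show "f - (f - g f) \<in> J" using g by auto
  qed (simp_all add: g.add g.scale right_diff_distrib)
qed

definition proj where
  "proj = (SOME p. (\<forall>f g. p (f + g) = p f + p g) \<and> (\<forall>c f. p (scal c * f) = scal c * p f) \<and>
    (\<forall>f. p f = 0 \<longleftrightarrow> f \<in> J) \<and> (\<forall>f. f - p f \<in> J))"

lemma proj_add: "proj (f + g) = proj f + proj g" and proj_scal: "proj (scal c * f) = scal c * proj f"
  and proj_0: "proj f = 0 \<longleftrightarrow> f \<in> J" and proj_diff: "f - proj f \<in> J"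
  using someI_ex[OF projection_exists] unfolding proj_def[symmetric] by blast+

lemma proj_cong: "f - g \<in> J \<Longrightarrow> proj f = proj g"
  using proj_add[of "f - g" g] proj_0[of "f - g"] by simp

lemma proj_proj: "proj (proj f) = proj f"
proof -
  have "proj f - f \<in> J" using J_left[OF proj_diff, of "- 1" f] by simp
  then show ?thesis by (rule proj_cong)
qed

definition act :: "('g, 'k) free_alg \<Rightarrow> ('g, 'k) lend" where
  "act f = Abs_lend (\<lambda>w. proj (f * proj w) + scal (Poly_Mapping.lookup f 0) * (w - proj w))"

lemma Rep_act: "Rep_lend (act f) w = proj (f * proj w) + scal (Poly_Mapping.lookup f 0) * (w - proj w)"
  unfolding act_def
proof (subst Abs_lend_inverse)
  have 1: "f * proj (u + v) = f * proj u + f * proj v" "f * (scal c * proj u) = scal c * (f * proj u)" for u v c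
    by (simp_all add: proj_add distrib_left scal_left)
  have 2: "scal a * ((u + v) - (proj u + proj v)) = scal a * (u - proj u) + scal a * (v - proj v)" for u v a
    by (simp add: distrib_left right_diff_distrib)
  have 3: "scal a * (scal c * u - scal c * proj u) = scal c * (scal a * (u - proj u))" for u a c
    by (metis right_diff_distrib scal_left)
  show "(\<lambda>w. proj (f * proj w) + scal (Poly_Mapping.lookup f 0) * (w - proj w)) \<in> {F. (\<forall>u v. F (u + v) = F u + F v) \<and>
      (\<forall>c u. F (scal c * u) = scal c * F u)}"
    unfolding mem_Collect_eq proj_add proj_scal 1 2 3 by (simp add: proj_add proj_scal distrib_left add_ac)
qed simp

lemma act_add: "act (f + g) = act f + act g"
  by (simp add: Rep_lend_inject[symmetric] Rep_lend_simps Rep_act fun_eq_iff lookup_add scal_add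
      distrib_right proj_add)

text \<open>The empty word is a product of empty words only, so the constant term is a restriction
  to which \<open>rst_mult\<close> applies.\<close>

lemma lookup_mult_0: "Poly_Mapping.lookup (f * g) 0 = Poly_Mapping.lookup f 0 * Poly_Mapping.lookup (g :: ('g, 'k) free_alg) 0"
proof -
  have W: "u + v \<in> {0} \<longleftrightarrow> u \<in> {0} \<and> v \<in> {0}" for u v :: "'g free_monoid"
    by (cases u; cases v) (auto simp: plus_free_monoid_def zero_free_monoid_def)
  have r: "rst {0} h = Poly_Mapping.single 0 (Poly_Mapping.lookup h 0)" for h :: "('g, 'k) free_alg"
    by (rule poly_mapping_eqI) (auto simp: lookup_rst lookup_single when_def)
  have "(Poly_Mapping.single 0 (Poly_Mapping.lookup (f * g) 0) :: ('g, 'k) free_alg)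
      = Poly_Mapping.single 0 (Poly_Mapping.lookup f 0 * Poly_Mapping.lookup g 0)"
    using rst_mult[OF W, of f g] by (simp add: r mult_single)
  from arg_cong[OF this, of "\<lambda>h. Poly_Mapping.lookup h 0"] show ?thesis by simp
qed

lemma proj_diff_proj: "proj (w - proj w) = 0"
  using proj_0 proj_diff by blast

lemma act_mult: "act (f * g) = act f * act g"
proof -
  have "Rep_lend (act (f * g)) w = Rep_lend (act f) (Rep_lend (act g) w)" for w
  proof -
    let ?u = "Rep_lend (act g) w"
    have pu: "proj ?u = proj (g * proj w)"
      by (simp add: Rep_act proj_add proj_scal proj_proj proj_diff_proj)
    have "f * (g * proj w) - f * proj (g * proj w) \<in> J"
      using J_left[OF proj_diff, of f "g * proj w"] by (simp add: right_diff_distrib)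
    then have "proj (f * g * proj w) = proj (f * proj ?u)" unfolding pu mult.assoc by (rule proj_cong)
    moreover have "?u - proj ?u = scal (Poly_Mapping.lookup g 0) * (w - proj w)"
      unfolding pu by (simp add: Rep_act)
    ultimately show ?thesis
      by (simp add: Rep_act[of "f * g"] Rep_act[of f ?u] lookup_mult_0 scal_mult mult.assoc)
  qed
  then show ?thesis by (simp add: Rep_lend_inject[symmetric] Rep_lend_simps fun_eq_iff)
qed

lemma act_1: "act 1 = 1"
  by (simp add: Rep_lend_inject[symmetric] Rep_lend_simps Rep_act fun_eq_iff proj_proj scal_1)

text \<open>On J an element acts by its constant term, which must vanish as well. Of the defining
  relations only \<Sum> e(\<nu>) = 1 has a nonzero constant term.\<close>

lemma act_eq_0: "f \<in> J \<Longrightarrow> Poly_Mapping.lookup f 0 = 0 \<Longrightarrow> act f = 0"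
  using J_right[of f] proj_0
  by (auto simp add: Rep_lend_inject[symmetric] Rep_lend_simps Rep_act fun_eq_iff scal_0)

text \<open>Evaluate at 1: its projection differs from 1 by an element of J.\<close>

lemma act_0_imp: "act f = 0 \<Longrightarrow> f \<in> J"
proof -
  assume "act f = 0"
  then have "proj (f * proj 1) + scal (Poly_Mapping.lookup f 0) * (1 - proj 1) = 0"
    using Rep_act[of f 1] by (simp add: Rep_lend_simps)
  then have "proj (proj (f * proj 1) + scal (Poly_Mapping.lookup f 0) * (1 - proj 1)) = proj 0" by simp
  then have "proj (f * proj 1) = 0"
    using proj_0[of 0] J_0 by (simp add: proj_add proj_scal proj_proj proj_diff_proj)
  then have "f * proj 1 \<in> J" using proj_0 by blast
  moreover have "f * (1 - proj 1) \<in> J" by (rule J_left[OF proj_diff])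
  ultimately have "f * proj 1 + f * (1 - proj 1) \<in> J" by (rule J_add)
  then show "f \<in> J" by (simp add: right_diff_distrib)
qed

lemma act_scal: "act (scal c) * y = y * act (scal c)"
proof -
  have "Rep_lend (act (scal c)) w = scal c * w" for w
    by (simp add: Rep_act proj_scal proj_proj right_diff_distrib) (simp add: scal_def)
  then show ?thesis
    by (simp add: Rep_lend_inject[symmetric] Rep_lend_simps fun_eq_iff Rep_lend_scal)
qed

end

section \<open>The cyclotomic KLR algebra\<close>

lemma sum_eq_support:
  fixes f :: "'a \<Rightarrow> 'b::comm_monoid_add"
  assumes "finite S" "finite T" "\<And>k. f k \<noteq> 0 \<Longrightarrow> k \<in> S \<and> k \<in> T"
  shows "sum f S = sum f T"
proof -
  have "sum f S = sum f (S \<inter> T)" using assms by (intro sum.mono_neutral_right) auto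
  also have "\<dots> = sum f T" using assms by (intro sum.mono_neutral_left) auto
  finally show ?thesis .
qed

text \<open>Translates place permutations into the split form of sequences used by
  \<open>klr_rel\<close>.\<close>

lemma swap_at_append: "swap_at (Suc (length \<theta>)) (\<theta> @ i # j # \<rho>) = \<theta> @ j # i # \<rho>"
proof (rule nth_equalityI)
  show "length (swap_at (Suc (length \<theta>)) (\<theta> @ i # j # \<rho>)) = length (\<theta> @ j # i # \<rho>)"
    by (simp add: swap_at_def)
  fix p assume "p < length (swap_at (Suc (length \<theta>)) (\<theta> @ i # j # \<rho>))"
  then have p: "p < length \<theta> + Suc (Suc (length \<rho>))" by (simp add: swap_at_def)
  then have "swap_at (Suc (length \<theta>)) (\<theta> @ i # j # \<rho>) ! p
      = (\<theta> @ i # j # \<rho>) ! transpose (length \<theta>) (Suc (length \<theta>)) p"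
    unfolding swap_at_def by (subst permute_list_nth) (auto intro!: permutes_swap_id)
  also have "\<dots> = (\<theta> @ j # i # \<rho>) ! p"
    using p by (auto simp: transpose_def nth_append nth_Cons')
  finally show "swap_at (Suc (length \<theta>)) (\<theta> @ i # j # \<rho>) ! p = (\<theta> @ j # i # \<rho>) ! p" .
qed

lemma Iseq_mset: "mset \<mu> = mset \<nu> \<Longrightarrow> \<mu> \<in> Iseq D n \<alpha> \<longleftrightarrow> \<nu> \<in> Iseq D n \<alpha>"
proof -
  assume a: "mset \<mu> = mset \<nu>"
  then have "length \<mu> = length \<nu>" "set \<mu> = set \<nu>" by (metis mset_eq_length, metis mset_eq_setD)
  moreover have "(\<Sum>i\<leftarrow>\<mu>. sroot D i) = (\<Sum>i\<leftarrow>\<nu>. sroot D i)"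
    using a by (metis mset_map sum_mset_sum_list)
  ultimately show ?thesis by (simp add: Iseq_def)
qed

lemma swap_at_Iseq: "\<nu> \<in> Iseq D n \<alpha> \<Longrightarrow> 1 \<le> l \<Longrightarrow> l < n \<Longrightarrow> swap_at l \<nu> \<in> Iseq D n \<alpha>"
proof -
  assume a: "\<nu> \<in> Iseq D n \<alpha>" "1 \<le> l" "l < n"
  have "mset (swap_at l \<nu>) = mset \<nu>"
    unfolding swap_at_def by (rule mset_permute_list) (use a in \<open>auto intro!: permutes_swap_id simp: Iseq_def\<close>)
  then show ?thesis using Iseq_mset a by blast
qed

section \<open>From expressions to the cocenter\<close>

locale cyc_setup =
  fixes D :: "('i, 'p::ab_group_add, 'k::field) klr_datum" and n :: nat and \<alpha> \<Lambda> :: 'p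
  assumes D: "klr_datum D" and \<Lambda>: "\<Lambda> \<in> Pplus D"
begin

abbreviation G where "G \<equiv> klr_gens D n \<alpha>"
abbreviation FA :: "('k, ('i, 'k) klr_free) module" where "FA \<equiv> free_algebra_on G"
abbreviation C :: "('i, 'k) klr_free set" where "C \<equiv> carrier FA"
abbreviation IS where "IS \<equiv> Iseq D n \<alpha>"
abbreviation KA where "KA \<equiv> klr D n \<alpha>"
abbreviation A where "A \<equiv> cyc_klr D n \<alpha> \<Lambda>"
abbreviation \<kappa> where "\<kappa> \<equiv> cyc_class D n \<alpha> \<Lambda>"

text \<open>By independence of the simple roots \<alpha> determines how often each letter occurs, so
  all sequences are rearrangements of one of them.\<close>

lemma finite_IS: "finite IS"
proof (cases "IS = {}")
  case False
  then obtain \<nu>0 where \<nu>0: "\<nu>0 \<in> IS" by auto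
  have "IS \<subseteq> {\<nu>. mset \<nu> = mset \<nu>0}"
  proof (intro subsetI CollectI)
    fix \<nu> assume \<nu>: "\<nu> \<in> IS"
    have mod: "Modules.module (zscale D)" and inj: "inj_on (sroot D) (idx D)"
      and indep: "\<not> Modules.module.dependent (zscale D) (sroot D ` idx D)"
      using D by (auto simp: klr_datum_def free_of_finite_rank_def)
    interpret M: Modules.module "zscale D" by (rule mod)
    let ?T = "set \<nu> \<union> set \<nu>0"
    have T: "?T \<subseteq> idx D" using \<nu> \<nu>0 by (auto simp: Iseq_def)
    have s: "(\<Sum>i\<leftarrow>\<mu>. sroot D i) = (\<Sum>i\<in>?T. zscale D (int (count (mset \<mu>) i)) (sroot D i))"
      if "set \<mu> \<subseteq> ?T" for \<mu>
    proof -
      have z: "zscale D (int k) v = (\<Sum>j<k. v)" for k v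
        by (induction k) (simp_all add: M.scale_left_distrib add.commute)
      have "(\<Sum>i\<leftarrow>\<mu>. sroot D i) = (\<Sum>i\<in>?T. (\<Sum>j<count (mset \<mu>) i. sroot D i))"
        using that
      proof (induction \<mu>)
        case (Cons a \<mu>)
        have "(\<Sum>i\<in>?T. (\<Sum>j<count (mset (a # \<mu>)) i. sroot D i))
          = (\<Sum>i\<in>?T. (if i = a then sroot D i else 0) + (\<Sum>j<count (mset \<mu>) i. sroot D i))"
          by (intro sum.cong) auto
        also have "\<dots> = sroot D a + (\<Sum>i\<leftarrow>\<mu>. sroot D i)"
          using Cons by (simp add: sum.distrib sum.delta)
        finally show ?case by simp
      qed simp
      then show ?thesis by (simp only: z)
    qed
    have "(\<Sum>i\<in>?T. zscale D (int (count (mset \<nu>) i)) (sroot D i))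
        = (\<Sum>i\<in>?T. zscale D (int (count (mset \<nu>0) i)) (sroot D i))"
      using s[of \<nu>] s[of \<nu>0] \<nu> \<nu>0 by (simp add: Iseq_def)
    then have "(\<Sum>i\<in>?T. zscale D (int (count (mset \<nu>) i) - int (count (mset \<nu>0) i)) (sroot D i)) = 0"
      by (simp add: M.scale_left_diff_distrib sum_subtractf)
    moreover have "inj_on (sroot D) ?T" using inj T by (rule inj_on_subset)
    \<comment> \<open>The relation is reindexed by roots instead of letters, the form in which
      independence is stated.\<close>
    ultimately have *: "(\<Sum>v\<in>sroot D ` ?T. zscale D ((\<lambda>i. int (count (mset \<nu>) i) - int (count (mset \<nu>0) i))
        (the_inv_into ?T (sroot D) v)) v) = 0"
      by (simp add: sum.reindex the_inv_into_f_f)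
    have fin: "finite (sroot D ` ?T)" "sroot D ` ?T \<subseteq> sroot D ` idx D" using T by auto
    have "\<forall>v\<in>sroot D ` ?T. (\<lambda>i. int (count (mset \<nu>) i) - int (count (mset \<nu>0) i))
        (the_inv_into ?T (sroot D) v) = 0"
      by (intro ballI) (rule M.independentD[OF indep fin *])
    then have "count (mset \<nu>) i = count (mset \<nu>0) i" if "i \<in> ?T" for i
      using that \<open>inj_on (sroot D) ?T\<close> by (auto simp: the_inv_into_f_f)
    moreover have "count (mset \<nu>) i = count (mset \<nu>0) i" if "i \<notin> ?T" for i
      using that by (metis UnCI count_mset_0_iff)
    ultimately show "mset \<nu> = mset \<nu>0" by (intro multiset_eqI) blast
  qed
  moreover have "finite {\<nu>. mset \<nu> = mset \<nu>0}" by (rule mset_eq_finite)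
  ultimately show ?thesis by (rule finite_subset)
qed simp

lemma C_iff: "f \<in> C \<longleftrightarrow> (\<forall>w\<in>Poly_Mapping.keys f. set (letters w) \<subseteq> G)"
  by (rule free_algebra_on_simps)

lemma C_add: "f \<in> C \<Longrightarrow> g \<in> C \<Longrightarrow> f + g \<in> C" and C_mult: "f \<in> C \<Longrightarrow> g \<in> C \<Longrightarrow> f * g \<in> C"
  and C_uminus: "f \<in> C \<Longrightarrow> - f \<in> C" and C_0: "0 \<in> C" and C_1: "1 \<in> C"
  by (rule free_algebra_on_closed; assumption)+

lemma C_diff: "f \<in> C \<Longrightarrow> g \<in> C \<Longrightarrow> f - g \<in> C"
  using C_add[of f "- g"] C_uminus[of g] by simp

lemma C_sum: "(\<And>i. i \<in> S \<Longrightarrow> f i \<in> C) \<Longrightarrow> sum f S \<in> C"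
  by (induction S rule: infinite_finite_induct) (auto intro: C_add C_0)

lemma C_pow: "f \<in> C \<Longrightarrow> f ^ p \<in> C"
  by (induction p) (auto intro: C_mult C_1)

lemma C_prod_list: "set fs \<subseteq> C \<Longrightarrow> prod_list fs \<in> C"
  by (induction fs) (auto intro: C_mult C_1)

lemma C_scal: "scal c \<in> C"
  by (simp add: C_iff scal_def zero_free_monoid_def)

lemma C_gen: "g \<in> G \<Longrightarrow> gen g \<in> C"
  by (simp add: C_iff gen_def)

lemma C_eg: "\<nu> \<in> IS \<Longrightarrow> eg \<nu> \<in> C" and C_xg: "1 \<le> k \<Longrightarrow> k \<le> n \<Longrightarrow> xg k \<in> C"
  and C_tg: "1 \<le> l \<Longrightarrow> l < n \<Longrightarrow> \<tau>g l \<in> C"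
  by (rule C_gen; simp add: klr_gens_def)+

lemma C_Qeval: "u \<in> C \<Longrightarrow> v \<in> C \<Longrightarrow> Qeval p u v \<in> C"
  unfolding Qeval_def by (intro C_sum C_mult C_scal C_pow)

lemma C_Qdivdiff: "u \<in> C \<Longrightarrow> w \<in> C \<Longrightarrow> v \<in> C \<Longrightarrow> Qdivdiff p u w v \<in> C"
  unfolding Qdivdiff_def by (intro C_sum C_mult C_scal C_pow)

lemma relations_C: "klr_relations D n \<alpha> \<subseteq> C"
  unfolding klr_relations_def
proof (intro Un_least; safe)
  show "eg \<nu> * eg \<nu>' - (if \<nu> = \<nu>' then eg \<nu> else 0) \<in> C" if "\<nu> \<in> IS" "\<nu>' \<in> IS" for \<nu> \<nu>'
    using that by (auto intro!: C_diff C_mult C_eg C_0)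
  show "(\<Sum>\<nu>\<in>IS. eg \<nu>) - 1 \<in> C" by (intro C_diff C_sum C_eg C_1)
  show "xg k * xg l - xg l * xg k \<in> C" if "k \<in> {1..n}" "l \<in> {1..n}" for k l
    using that by (intro C_diff C_mult C_xg) auto
  show "xg k * eg \<nu> - eg \<nu> * xg k \<in> C" if "k \<in> {1..n}" "\<nu> \<in> IS" for k \<nu>
    using that by (intro C_diff C_mult C_xg C_eg) auto
  show "\<tau>g l * eg \<nu> - eg (swap_at l \<nu>) * \<tau>g l \<in> C" if "1 \<le> l" "l < n" "\<nu> \<in> IS" for l \<nu>
    using that by (intro C_diff C_mult C_tg C_eg swap_at_Iseq) auto
  show "\<tau>g k * \<tau>g l - \<tau>g l * \<tau>g k \<in> C" if "1 \<le> k" "k < n" "1 \<le> l" "l < n" for k l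
    using that by (intro C_diff C_mult C_tg) auto
  show "\<tau>g k ^ 2 * eg \<nu> - Qeval (Qpol D (entry \<nu> k) (entry \<nu> (k + 1))) (xg k) (xg (k + 1)) * eg \<nu> \<in> C"
    if "1 \<le> k" "k < n" "\<nu> \<in> IS" for k \<nu>
    using that by (intro C_diff C_mult C_tg C_eg C_pow C_Qeval C_xg) auto
  show "(\<tau>g k * xg l - xg (transpose k (k + 1) l) * \<tau>g k) * eg \<nu> -
        (if l = k \<and> entry \<nu> k = entry \<nu> (k + 1) then - eg \<nu>
         else if l = k + 1 \<and> entry \<nu> k = entry \<nu> (k + 1) then eg \<nu> else 0) \<in> C"
    if "1 \<le> k" "k < n" "l \<in> {1..n}" "\<nu> \<in> IS" for k l \<nu>
  proof -
    have "1 \<le> transpose k (k + 1) l \<and> transpose k (k + 1) l \<le> n" using that by (auto simp: transpose_def)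
    then have "(\<tau>g k * xg l - xg (transpose k (k + 1) l) * \<tau>g k) * eg \<nu> \<in> C"
      using that by (intro C_diff C_mult C_tg C_eg C_xg) auto
    moreover have "(if l = k \<and> entry \<nu> k = entry \<nu> (k + 1) then - eg \<nu>
         else if l = k + 1 \<and> entry \<nu> k = entry \<nu> (k + 1) then eg \<nu> else 0) \<in> C"
      using that C_eg C_uminus C_0 by (simp only: split: if_split) blast
    ultimately show ?thesis by (rule C_diff)
  qed
  show "(\<tau>g (k + 1) * \<tau>g k * \<tau>g (k + 1) - \<tau>g k * \<tau>g (k + 1) * \<tau>g k) * eg \<nu> -
        (if entry \<nu> k = entry \<nu> (k + 2)
         then Qdivdiff (Qpol D (entry \<nu> k) (entry \<nu> (k + 1))) (xg k) (xg (k + 2)) (xg (k + 1)) * eg \<nu>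
         else 0) \<in> C" if "1 \<le> k" "k + 1 < n" "\<nu> \<in> IS" for k \<nu>
    using that by (auto intro!: C_diff C_mult C_tg C_eg C_xg C_0 C_Qdivdiff)
qed

lemma ring_FA: "ring FA" by (rule ring_free_algebra_on)

lemma lmod_FA: "lmod FA"
  unfolding lmod_def
  using ring.is_abelian_group[OF ring_FA] C_mult[OF C_scal]
  by (simp add: free_algebra_on_simps(2-) distrib_left)

lemma ideal_klr: "ideal (klr_ideal D n \<alpha>) FA"
  unfolding klr_ideal_def by (rule ring.genideal_ideal[OF ring_FA relations_C])

lemma lsub_klr: "lsub FA (klr_ideal D n \<alpha>)"
  unfolding lsub_def using ideal.axioms(1)[OF ideal_klr] ideal.I_l_closed[OF ideal_klr _ C_scal]
  by (simp add: free_algebra_on_simps(2-))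

lemma ring_KA: "ring KA"
  unfolding klr_def by (rule ring_quot[OF ideal_klr])

lemma lmod_KA: "lmod KA"
  using lmod_quot[OF lmod_FA lsub_klr] ring.is_abelian_group[OF ring_KA] by (simp add: klr_def)

abbreviation klr_cl where "klr_cl \<equiv> klr_class D n \<alpha>"

lemma klr_cl_carrier: "carrier KA = klr_cl ` C"
  using qclass_carrier[OF lmod_FA lsub_klr] by (simp add: klr_def klr_class_def[abs_def])

lemma klr_cl_mult: "f \<in> C \<Longrightarrow> g \<in> C \<Longrightarrow> klr_cl (f * g) = klr_cl f \<otimes>\<^bsub>KA\<^esub> klr_cl g"
  using qclass_mult[OF ideal_klr, of f g] by (simp add: klr_def klr_class_def free_algebra_on_simps(2-))

lemma klr_cl_add: "f \<in> C \<Longrightarrow> g \<in> C \<Longrightarrow> klr_cl (f + g) = klr_cl f \<oplus>\<^bsub>KA\<^esub> klr_cl g"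
  using qclass_add[OF lmod_FA lsub_klr, of f g] by (simp add: klr_def klr_class_def free_algebra_on_simps(2-))

lemma klr_cl_smult: "f \<in> C \<Longrightarrow> klr_cl (scal c * f) = c \<odot>\<^bsub>KA\<^esub> klr_cl f"
  using qclass_smult[OF lmod_FA lsub_klr, of f c] by (simp add: klr_def klr_class_def free_algebra_on_simps(2-))

lemma klr_cl_0: "klr_cl 0 = \<zero>\<^bsub>KA\<^esub>"
  using qclass_zero[OF lmod_FA lsub_klr] by (simp add: klr_def klr_class_def free_algebra_on_simps(2-))

definition cgens where
  "cgens = (if n = 0 then {} else {klr_cl (\<Sum>\<nu>\<in>IS. xg 1 ^ nat (coroot D (entry \<nu> 1) \<Lambda>) * eg \<nu>)})"

lemma cgens_carrier: "cgens \<subseteq> carrier KA"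
  unfolding cgens_def klr_cl_carrier by (auto intro!: imageI C_sum C_mult C_pow C_xg C_eg)

lemma ideal_cyc: "ideal (cyc_ideal D n \<alpha> \<Lambda>) KA"
  using ring.genideal_ideal[OF ring_KA cgens_carrier] by (simp add: cyc_ideal_def cgens_def)

text \<open>Scalars act as multiplication by elements of the algebra, so a ring ideal is a
  subspace.\<close>

lemma lsub_cyc: "lsub KA (cyc_ideal D n \<alpha> \<Lambda>)"
  unfolding lsub_def
proof (intro conjI allI ballI)
  show "additive_subgroup (cyc_ideal D n \<alpha> \<Lambda>) KA" using ideal_cyc by (rule ideal.axioms)
  fix c X assume X: "X \<in> cyc_ideal D n \<alpha> \<Lambda>"
  then have "X \<in> carrier KA" using ideal.Icarr[OF ideal_cyc] by blast
  then obtain f where f: "f \<in> C" "X = klr_cl f" using klr_cl_carrier by auto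
  then have "c \<odot>\<^bsub>KA\<^esub> X = klr_cl (scal c) \<otimes>\<^bsub>KA\<^esub> X" using C_scal by (simp add: klr_cl_mult flip: klr_cl_smult)
  moreover have "klr_cl (scal c) \<in> carrier KA" using C_scal klr_cl_carrier by blast
  ultimately show "c \<odot>\<^bsub>KA\<^esub> X \<in> cyc_ideal D n \<alpha> \<Lambda>" using ideal.I_l_closed[OF ideal_cyc X] by simp
qed

lemma ring_A: "ring A"
  unfolding cyc_klr_def by (rule ring_quot[OF ideal_cyc])

lemma lmod_A: "lmod A"
  using lmod_quot[OF lmod_KA lsub_cyc] ring.is_abelian_group[OF ring_A] by (simp add: cyc_klr_def)

lemma \<kappa>_carrier: "carrier A = \<kappa> ` C"
  using qclass_carrier[OF lmod_KA lsub_cyc] klr_cl_carrier by (auto simp: cyc_klr_def cyc_class_def)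

lemma klr_cl_C: "f \<in> C \<Longrightarrow> klr_cl f \<in> carrier KA" and \<kappa>_C: "f \<in> C \<Longrightarrow> \<kappa> f \<in> carrier A"
  using klr_cl_carrier \<kappa>_carrier by auto

lemma \<kappa>_mult: "f \<in> C \<Longrightarrow> g \<in> C \<Longrightarrow> \<kappa> (f * g) = \<kappa> f \<otimes>\<^bsub>A\<^esub> \<kappa> g"
  using qclass_mult[OF ideal_cyc, of "klr_cl f" "klr_cl g"] klr_cl_C by (simp add: cyc_klr_def cyc_class_def klr_cl_mult)

lemma \<kappa>_add: "f \<in> C \<Longrightarrow> g \<in> C \<Longrightarrow> \<kappa> (f + g) = \<kappa> f \<oplus>\<^bsub>A\<^esub> \<kappa> g"
  using qclass_add[OF lmod_KA lsub_cyc, of "klr_cl f" "klr_cl g"] klr_cl_C by (simp add: cyc_klr_def cyc_class_def klr_cl_add)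

lemma \<kappa>_smult: "f \<in> C \<Longrightarrow> \<kappa> (scal c * f) = c \<odot>\<^bsub>A\<^esub> \<kappa> f"
  using qclass_smult[OF lmod_KA lsub_cyc, of "klr_cl f" c] klr_cl_C by (simp add: cyc_klr_def cyc_class_def klr_cl_smult)

lemma \<kappa>_0: "\<kappa> 0 = \<zero>\<^bsub>A\<^esub>"
  using qclass_zero[OF lmod_KA lsub_cyc] by (simp add: cyc_klr_def cyc_class_def klr_cl_0)

lemma \<kappa>_uminus: "f \<in> C \<Longrightarrow> \<kappa> (- f) = \<ominus>\<^bsub>A\<^esub> \<kappa> f"
proof -
  assume f: "f \<in> C"
  interpret R: ring A by (rule ring_A)
  have "\<kappa> (- f) \<oplus>\<^bsub>A\<^esub> \<kappa> f = \<zero>\<^bsub>A\<^esub>"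
    using \<kappa>_add[OF C_uminus[OF f] f] by (simp add: \<kappa>_0)
  then show ?thesis using f C_uminus \<kappa>_C R.minus_equality by metis
qed

lemma \<kappa>_eq: "f \<in> C \<Longrightarrow> g \<in> C \<Longrightarrow> \<kappa> (f - g) = \<zero>\<^bsub>A\<^esub> \<Longrightarrow> \<kappa> f = \<kappa> g"
proof -
  assume a: "f \<in> C" "g \<in> C" "\<kappa> (f - g) = \<zero>\<^bsub>A\<^esub>"
  interpret R: ring A by (rule ring_A)
  have "\<kappa> f = \<kappa> (f - g) \<oplus>\<^bsub>A\<^esub> \<kappa> g" using \<kappa>_add[of "f - g" g] a C_diff by simp
  then show ?thesis using a \<kappa>_C by simp
qed

lemma \<kappa>_relation: "r \<in> klr_relations D n \<alpha> \<Longrightarrow> \<kappa> r = \<zero>\<^bsub>A\<^esub>"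
proof -
  assume r: "r \<in> klr_relations D n \<alpha>"
  then have "r \<in> klr_ideal D n \<alpha>"
    unfolding klr_ideal_def using ring.genideal_self[OF ring_FA relations_C] by blast
  moreover interpret R: ring FA by (rule ring_FA)
  have "r \<ominus>\<^bsub>FA\<^esub> \<zero>\<^bsub>FA\<^esub> = r" using r relations_C by (auto simp: R.minus_eq)
  ultimately have "klr_cl r = klr_cl 0"
    using qclass_eq[OF lmod_FA lsub_klr, of r 0] r relations_C C_0
    by (auto simp: klr_class_def free_algebra_on_simps(5))
  then show ?thesis using \<kappa>_0 by (simp add: cyc_class_def)
qed

lemma \<kappa>_cyclotomic: "n \<noteq> 0 \<Longrightarrow> \<kappa> (\<Sum>\<nu>\<in>IS. xg 1 ^ nat (coroot D (entry \<nu> 1) \<Lambda>) * eg \<nu>) = \<zero>\<^bsub>A\<^esub>"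
proof -
  assume n: "n \<noteq> 0"
  let ?f = "\<Sum>\<nu>\<in>IS. xg 1 ^ nat (coroot D (entry \<nu> 1) \<Lambda>) * eg \<nu>"
  have c: "klr_cl ?f \<in> carrier KA" using cgens_carrier n by (simp add: cgens_def)
  have "klr_cl ?f \<in> cyc_ideal D n \<alpha> \<Lambda>"
    using ring.genideal_self[OF ring_KA cgens_carrier] n by (auto simp: cyc_ideal_def cgens_def)
  moreover interpret R: ring KA by (rule ring_KA)
  have "klr_cl ?f \<ominus>\<^bsub>KA\<^esub> \<zero>\<^bsub>KA\<^esub> = klr_cl ?f" using c by (simp add: R.minus_eq)
  ultimately have "qclass KA (cyc_ideal D n \<alpha> \<Lambda>) (klr_cl ?f) = qclass KA (cyc_ideal D n \<alpha> \<Lambda>) \<zero>\<^bsub>KA\<^esub>"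
    using qclass_eq[OF lmod_KA lsub_cyc c] by simp
  then show ?thesis using \<kappa>_0 by (simp add: cyc_class_def klr_cl_0)
qed

definition comms where "comms = {a \<otimes>\<^bsub>A\<^esub> b \<ominus>\<^bsub>A\<^esub> b \<otimes>\<^bsub>A\<^esub> a | a b. a \<in> carrier A \<and> b \<in> carrier A}"

lemma lsub_comm: "lsub A (commutator_space A)"
proof -
  interpret R: ring A by (rule ring_A)
  have "lsub A (kspan A comms)"
  proof (rule lsub_kspan[OF lmod_A])
    show "comms \<subseteq> carrier A" unfolding comms_def by auto
    fix X assume "X \<in> carrier A"
    then obtain f where f: "f \<in> C" "X = \<kappa> f" using \<kappa>_carrier by auto
    have "scal (- 1) * f + scal 1 * f = 0" by (simp add: scal_0 flip: scal_add distrib_right)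
    then have "scal (- 1) * f = - f" by (simp add: scal_1 eq_neg_iff_add_eq_0)
    then have "\<ominus>\<^bsub>A\<^esub> X = (- 1) \<odot>\<^bsub>A\<^esub> X" using f \<kappa>_uminus \<kappa>_smult[of f "- 1"] by simp
    then show "\<exists>c. \<ominus>\<^bsub>A\<^esub> X = c \<odot>\<^bsub>A\<^esub> X" by blast
  qed
  then show ?thesis by (simp add: commutator_space_def comms_def)
qed

definition q where "q f = trace_class A (\<kappa> f)"

lemma q_eq: "\<kappa> f = \<kappa> g \<Longrightarrow> q f = q g"
  by (simp add: q_def)

lemma q_add: "f \<in> C \<Longrightarrow> g \<in> C \<Longrightarrow> q (f + g) = q f \<oplus>\<^bsub>cocenter A\<^esub> q g"
  using qclass_add[OF lmod_A lsub_comm, of "\<kappa> f" "\<kappa> g"] \<kappa>_C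
  by (simp add: q_def trace_class_def cocenter_def \<kappa>_add)

lemma q_smult: "f \<in> C \<Longrightarrow> q (scal c * f) = c \<odot>\<^bsub>cocenter A\<^esub> q f"
  using qclass_smult[OF lmod_A lsub_comm, of "\<kappa> f" c] \<kappa>_C
  by (simp add: q_def trace_class_def cocenter_def \<kappa>_smult)

lemma q_comm: "f \<in> C \<Longrightarrow> g \<in> C \<Longrightarrow> q (f * g) = q (g * f)"
proof -
  assume f: "f \<in> C" and g: "g \<in> C"
  have "\<kappa> f \<otimes>\<^bsub>A\<^esub> \<kappa> g \<ominus>\<^bsub>A\<^esub> \<kappa> g \<otimes>\<^bsub>A\<^esub> \<kappa> f \<in> commutator_space A"
    unfolding commutator_space_def using \<kappa>_C f g by (intro kspan.base) blast
  moreover have "\<kappa> (f * g) \<in> carrier A" "\<kappa> (g * f) \<in> carrier A" using f g by (auto intro!: \<kappa>_C C_mult)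
  ultimately have "qclass A (commutator_space A) (\<kappa> (f * g)) = qclass A (commutator_space A) (\<kappa> (g * f))"
    using qclass_eq[OF lmod_A lsub_comm, of "\<kappa> (f * g)" "\<kappa> (g * f)"] f g by (simp add: \<kappa>_mult)
  then show ?thesis by (simp add: q_def trace_class_def)
qed

lemma q_carrier: "carrier (cocenter A) = q ` C"
  using qclass_carrier[OF lmod_A lsub_comm] \<kappa>_carrier by (auto simp: q_def trace_class_def cocenter_def)

lemma kspan_image:
  assumes "S \<subseteq> C"
  shows "kspan KA (klr_cl ` S) = klr_cl ` kspan FA S" and "kspan A (\<kappa> ` S) = \<kappa> ` kspan FA S"
    and "kspan (cocenter A) (q ` S) = q ` kspan FA S"
proof -
  show 1: "kspan KA (klr_cl ` S) = klr_cl ` kspan FA S"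
    using kspan_quot[OF lmod_FA lsub_klr assms] by (simp add: klr_def klr_class_def[abs_def])
  have "klr_cl ` S \<subseteq> carrier KA" using assms klr_cl_C by auto
  from kspan_quot[OF lmod_KA lsub_cyc this] 1
  show 2: "kspan A (\<kappa> ` S) = \<kappa> ` kspan FA S"
    by (simp add: cyc_klr_def cyc_class_def[abs_def] image_image)
  have "\<kappa> ` S \<subseteq> carrier A" using assms \<kappa>_C by auto
  from kspan_quot[OF lmod_A lsub_comm this] 2
  show "kspan (cocenter A) (q ` S) = q ` kspan FA S"
    by (simp add: cocenter_def q_def[abs_def] trace_class_def image_image)
qed

lemma kspan_C: "S \<subseteq> C \<Longrightarrow> f \<in> kspan FA S \<Longrightarrow> f \<in> C"
  by (rule kspan_closed[OF lmod_FA])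

definition monomials :: "rat \<Rightarrow> ('i, 'k) klr_free set" where "monomials r = {f. (f, r) \<in> hom_monomials D n \<alpha>}"

lemma monomials_C: "monomials r \<subseteq> C"
proof
  fix f assume "f \<in> monomials r"
  then have "(f, r) \<in> hom_monomials D n \<alpha>" by (simp add: monomials_def)
  then show "f \<in> C"
    by (induction f r rule: hom_monomials.induct) (auto intro!: C_1 C_mult C_eg C_xg C_tg)
qed

lemma Tr_component_eq: "Tr_component D n \<alpha> \<Lambda> r = q ` kspan FA (monomials r)"
proof -
  have "{klr_cl f | f. (f, r) \<in> hom_monomials D n \<alpha>} = klr_cl ` monomials r" by (auto simp: monomials_def)
  then show ?thesis
    using kspan_image(1)[OF monomials_C, of r]
    by (simp add: Tr_component_def cyc_component_def klr_component_def image_image q_def[abs_def] cyc_class_def)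
qed

end

text \<open>\<open>Qeval\<close> and \<open>Qdivdiff\<close> sum up to the degrees of the polynomial
  at hand, \<open>klr_rel\<close> over a fixed box; both ranges contain all nonzero
  coefficients.\<close>

lemma poly_sum_box:
  fixes F :: "nat \<Rightarrow> nat \<Rightarrow> 'b::comm_monoid_add"
  assumes box: "\<And>k q. coeff (coeff p q) k \<noteq> 0 \<Longrightarrow> k \<le> M \<and> q \<le> N"
    and F: "\<And>k q. coeff (coeff p q) k = 0 \<Longrightarrow> F k q = 0"
  shows "(\<Sum>q\<le>degree p. \<Sum>k\<le>degree (coeff p q). F k q) = (\<Sum>k\<le>M. \<Sum>q\<le>N. F k q)"
proof -
  have "(\<Sum>k\<le>degree (coeff p q). F k q) = (\<Sum>k\<le>M. F k q)" for q
    by (intro sum_eq_support) (use box F le_degree in force)+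
  then have "(\<Sum>q\<le>degree p. \<Sum>k\<le>degree (coeff p q). F k q) = (\<Sum>q\<le>degree p. \<Sum>k\<le>M. F k q)" by simp
  also have "\<dots> = (\<Sum>k\<le>M. \<Sum>q\<le>degree p. F k q)" by (rule sum.swap)
  also have "\<dots> = (\<Sum>k\<le>M. \<Sum>q\<le>N. F k q)"
  proof (rule sum.cong[OF refl], rule sum_eq_support)
    fix k q assume "F k q \<noteq> 0"
    then have c: "coeff (coeff p q) k \<noteq> 0" using F by blast
    then have "coeff p q \<noteq> 0" by auto
    then show "q \<in> {..degree p} \<and> q \<in> {..N}" using box[OF c] le_degree by auto
  qed auto
  finally show ?thesis .
qed

lemma lookup_gen_0: "Poly_Mapping.lookup (gen g :: ('g, 'k::field) free_alg) 0 = 0"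
  by (simp add: gen_def lookup_single zero_free_monoid_def)

context cyc_setup
begin

section \<open>Consequences of the axioms of the datum\<close>

lemma datum:
  shows cartan_diag: "i \<in> idx D \<Longrightarrow> cartan D i i = 2"
    and cartan_le: "i \<in> idx D \<Longrightarrow> j \<in> idx D \<Longrightarrow> i \<noteq> j \<Longrightarrow> cartan D i j \<le> 0"
    and symm_pos: "i \<in> idx D \<Longrightarrow> symm D i > 0"
    and coroot_root: "i \<in> idx D \<Longrightarrow> j \<in> idx D \<Longrightarrow> coroot D i (sroot D j) = cartan D i j"
    and coroot_Pvee: "i \<in> idx D \<Longrightarrow> coroot D i \<in> Pvee D"
    and bilin: "symmetric_bilinear D"
    and pform_root: "i \<in> idx D \<Longrightarrow> j \<in> idx D \<Longrightarrow>
      pform D (sroot D i) (sroot D j) = of_int (symm D i * cartan D i j)"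
    and coroot_form: "i \<in> idx D \<Longrightarrow> \<phi> \<in> hstar D \<Longrightarrow>
      \<phi> (coroot D i) = 2 * form D (emb D (sroot D i)) \<phi> / pform D (sroot D i) (sroot D i)"
    and Q_sym: "i \<in> idx D \<Longrightarrow> j \<in> idx D \<Longrightarrow> Qcoeff D i j k r = Qcoeff D j i r k"
    and Q_diag: "i \<in> idx D \<Longrightarrow> Qpol D i i = 0"
    and Q_lead: "i \<in> idx D \<Longrightarrow> j \<in> idx D \<Longrightarrow> i \<noteq> j \<Longrightarrow> Qcoeff D i j (nat (- cartan D i j)) 0 \<noteq> 0"
    and Q_hom: "i \<in> idx D \<Longrightarrow> j \<in> idx D \<Longrightarrow> i \<noteq> j \<Longrightarrow> Qcoeff D i j k r \<noteq> 0 \<Longrightarrow>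
      2 * pform D (sroot D i) (sroot D j) =
        - pform D (sroot D i) (sroot D i) * of_nat k - pform D (sroot D j) (sroot D j) * of_nat r"
  using D unfolding klr_datum_def symmetrizable_cartan_def by (-, (elim conjE, simp)+)

abbreviation dg where "dg i j \<equiv> pform D (sroot D i) (sroot D j)"

lemma emb_hstar: "emb D y \<in> hstar D"
proof -
  have "Modules.module (zscale D)" using D by (simp add: klr_datum_def free_of_finite_rank_def)
  then have "(\<lambda>x. f x + g x) \<in> Pvee D" if "f \<in> Pvee D" "g \<in> Pvee D" for f g
    using that by (auto simp: Pvee_def module_hom_iff algebra_simps)
  then show ?thesis by (auto simp: hstar_def emb_def)
qed

lemma emb_add: "emb D (y + z) = (\<lambda>f. emb D y f + emb D z f)"
  by (auto simp: emb_def Pvee_def module_hom_iff fun_eq_iff)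

lemma pform_sym: "pform D y z = pform D z y"
  using bilin emb_hstar by (simp add: symmetric_bilinear_def pform_def)

lemma pform_add_left: "pform D (y + y') z = pform D y z + pform D y' z"
  using bilin emb_hstar by (simp add: symmetric_bilinear_def pform_def emb_add)

lemma pform_add_right: "pform D z (y + y') = pform D z y + pform D z y'"
  using pform_add_left pform_sym by metis

lemma pform_0: "pform D 0 z = 0"
  using pform_add_left[of 0 0 z] by simp

lemma dg_pos: "i \<in> idx D \<Longrightarrow> dg i i > 0"
  using pform_root symm_pos cartan_diag by simp

lemma dg_cartan: "i \<in> idx D \<Longrightarrow> j \<in> idx D \<Longrightarrow> dg i i * of_int (cartan D i j) = 2 * dg i j"
  using pform_root cartan_diag by simp

lemma coroot_pform: "i \<in> idx D \<Longrightarrow> 2 * pform D (sroot D i) y = of_int (coroot D i y) * dg i i"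
  using coroot_form[OF _ emb_hstar, of i y] dg_pos[of i] coroot_Pvee[of i]
  by (simp add: emb_def pform_def field_simps)

text \<open>Homogeneity and 2 (\<alpha>_i, \<alpha>_j) = a_ij (\<alpha>_i, \<alpha>_i) give
  (\<alpha>_i, \<alpha>_i)(-a_ij - k) = (\<alpha>_j, \<alpha>_j) r \<ge> 0. The bound for r is the
  same argument for Q_{j,i}.\<close>

lemma Q_box:
  assumes i: "i \<in> idx D" and j: "j \<in> idx D" and c: "Qcoeff D i j k r \<noteq> 0"
  shows "k \<le> nat (- cartan D i j) \<and> r \<le> nat (- cartan D j i)"
proof -
  have ij: "i \<noteq> j" using Q_diag i c by auto
  have bound: "k \<le> nat (- cartan D i j)"
    if i: "i \<in> idx D" and j: "j \<in> idx D" and c: "Qcoeff D i j k r \<noteq> 0" and ij: "i \<noteq> j" for i j k r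
  proof -
    have "dg i i * (of_int (- cartan D i j) - of_nat k) = dg j j * of_nat r"
      using Q_hom[OF i j ij c] dg_cartan[OF i j] by (simp add: algebra_simps)
    moreover have "dg j j * of_nat r \<ge> 0" using dg_pos[OF j] by simp
    ultimately have "of_int (- cartan D i j) - rat_of_nat k \<ge> 0"
      using dg_pos[OF i] by (metis mult_less_0_iff not_less order_less_not_sym)
    then have "rat_of_int (int k) \<le> of_int (- cartan D i j)" by simp
    then have "int k \<le> - cartan D i j" by (simp only: of_int_le_iff)
    then show ?thesis by simp
  qed
  have c': "Qcoeff D j i r k \<noteq> 0" using Q_sym[OF i j] c by simp
  show ?thesis using bound[OF i j c ij] bound[OF j i c'] ij by auto
qed

text \<open>An ideal in the free algebra on all conceivable generators, since a type class knows no
  carrier: words with a foreign letter are discarded first, so foreign generators become 0.\<close>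

definition J where "J = {f. \<kappa> (rst {w. set (letters w) \<subseteq> G} f) = \<zero>\<^bsub>A\<^esub>}"

abbreviation rG :: "('i, 'k) klr_free \<Rightarrow> ('i, 'k) klr_free" where "rG \<equiv> rst {w. set (letters w) \<subseteq> G}"

lemma rG_C: "rG f \<in> C"
  unfolding C_iff by (auto simp: in_keys_iff lookup_rst split: if_splits)

lemma rG_id: "f \<in> C \<Longrightarrow> rG f = f"
  by (rule poly_mapping_eqI) (auto simp: lookup_rst C_iff in_keys_iff)

lemma rG_mult: "rG (f * g) = rG f * rG g"
  by (rule rst_mult) (simp add: plus_free_monoid_def)

sublocale FI: free_ideal J
proof
  interpret R: ring A by (rule ring_A)
  fix f g
  show "f + g \<in> J" if "f \<in> J" "g \<in> J" using that \<kappa>_add[OF rG_C rG_C, of f g] by (simp add: J_def rst_add)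
  show "g * f \<in> J" if "f \<in> J" using that \<kappa>_mult[OF rG_C rG_C, of g f] \<kappa>_C[OF rG_C, of g] by (simp add: J_def rG_mult)
  show "f * g \<in> J" if "f \<in> J" using that \<kappa>_mult[OF rG_C rG_C, of f g] \<kappa>_C[OF rG_C, of g] by (simp add: J_def rG_mult)
  show "0 \<in> J" by (simp add: J_def rst_0 \<kappa>_0)
qed

abbreviation act where "act \<equiv> FI.act"
abbreviation aug :: "('i, 'k) klr_free \<Rightarrow> 'k" where "aug f \<equiv> Poly_Mapping.lookup f 0"

lemma act_0: "act 0 = 0"
  using FI.act_add[of 0 0] by simp

lemma act_uminus: "act (- f) = - act f"
  using FI.act_add[of f "- f"] by (simp add: act_0 eq_neg_iff_add_eq_0 add.commute)

lemma act_diff: "act (f - g) = act f - act g"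
  using FI.act_add[of f "- g"] by (simp add: act_uminus)

lemma act_sum: "act (sum f S) = (\<Sum>a\<in>S. act (f a))"
  by (induction S rule: infinite_finite_induct) (simp_all add: act_0 FI.act_add)

lemma act_pow: "act (f ^ p) = act f ^ p"
  by (induction p) (simp_all add: FI.act_1 FI.act_mult)

lemma act_prod_list: "act (prod_list fs) = prod_list (map act fs)"
  by (induction fs) (simp_all add: FI.act_1 FI.act_mult)

lemmas act_hom = FI.act_1 FI.act_mult FI.act_add act_0 act_uminus act_diff act_sum act_pow act_prod_list

lemma aug_mult: "aug (f * g) = aug f * aug g"
  by (rule FI.lookup_mult_0)

lemma aug_diff: "aug (f - g) = aug f - aug g"
  by (simp add: lookup_minus)

lemma act_\<kappa>: "f \<in> C \<Longrightarrow> \<kappa> f = \<zero>\<^bsub>A\<^esub> \<Longrightarrow> aug f = 0 \<Longrightarrow> act f = 0"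
  by (rule FI.act_eq_0) (simp_all add: J_def rG_id)

text \<open>The way back: equality in the realisation implies equality in the cyclotomic algebra,
  whatever the constant terms are.\<close>

lemma act_eq_\<kappa>: "f \<in> C \<Longrightarrow> g \<in> C \<Longrightarrow> act f = act g \<Longrightarrow> \<kappa> f = \<kappa> g"
proof -
  assume a: "f \<in> C" "g \<in> C" "act f = act g"
  then have "f - g \<in> J" using FI.act_0_imp[of "f - g"] by (simp add: act_diff)
  then show ?thesis using a C_diff by (intro \<kappa>_eq) (simp_all add: J_def rG_id)
qed

lemma act_rel: "r \<in> klr_relations D n \<alpha> \<Longrightarrow> aug r = 0 \<Longrightarrow> act r = 0"
  using relations_C \<kappa>_relation by (intro act_\<kappa>) auto

section \<open>The KLR relations in the realisation\<close>

definition "sc c = act (scal c)"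
definition "e \<nu> = act (eg \<nu>)"
definition "x k = act (xg k)"
definition "t l = act (\<tau>g l)"

lemma act_gen_notin: "g \<notin> G \<Longrightarrow> act (gen g) = 0"
  by (rule FI.act_eq_0) (simp_all add: J_def gen_def rst_single \<kappa>_0 lookup_single zero_free_monoid_def)

lemma e_notin: "\<nu> \<notin> IS \<Longrightarrow> e \<nu> = 0" and x_notin: "\<not> (1 \<le> k \<and> k \<le> n) \<Longrightarrow> x k = 0"
  and t_notin: "\<not> (1 \<le> l \<and> l < n) \<Longrightarrow> t l = 0"
  unfolding e_def x_def t_def by (rule act_gen_notin; auto simp: klr_gens_def)+

text \<open>Here 1 = \<Sum> e(\<nu>) is inserted, in the cyclotomic algebra, because
  \<open>act\<close> does not respect it.\<close>

lemma \<kappa>_expand: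
  assumes f: "f \<in> C"
  shows "\<kappa> f = \<kappa> (\<Sum>\<nu>\<in>IS. f * eg \<nu>)"
proof -
  interpret R: ring A by (rule ring_A)
  have c: "(\<Sum>\<nu>\<in>IS. eg \<nu>) - 1 \<in> C" by (intro C_diff C_sum C_eg C_1)
  have "(\<Sum>\<nu>\<in>IS. eg \<nu>) - 1 \<in> klr_relations D n \<alpha>" unfolding klr_relations_def by blast
  then have "\<kappa> (f * ((\<Sum>\<nu>\<in>IS. eg \<nu>) - 1)) = \<zero>\<^bsub>A\<^esub>" using \<kappa>_mult[OF f c] \<kappa>_relation \<kappa>_C[OF f] by simp
  then have "\<kappa> ((\<Sum>\<nu>\<in>IS. f * eg \<nu>) - f) = \<zero>\<^bsub>A\<^esub>" by (simp add: right_diff_distrib sum_distrib_left)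
  then show ?thesis using f by (intro \<kappa>_eq[symmetric] C_sum C_mult C_eg)
qed

lemma \<kappa>_sum_0: "(\<And>a. a \<in> S \<Longrightarrow> f a \<in> C \<and> \<kappa> (f a) = \<zero>\<^bsub>A\<^esub>) \<Longrightarrow> \<kappa> (sum f S) = \<zero>\<^bsub>A\<^esub>"
proof (induction S rule: infinite_finite_induct)
  case (insert a S)
  interpret R: ring A by (rule ring_A)
  show ?case using insert \<kappa>_add[of "f a" "sum f S"] C_sum[of S f] by simp
qed (simp_all add: \<kappa>_0)

lemma e_e: "e \<nu> * e \<mu> = (if \<nu> = \<mu> then e \<nu> else 0)"
proof (cases "\<nu> \<in> IS \<and> \<mu> \<in> IS")
  case True
  then have "eg \<nu> * eg \<mu> - (if \<nu> = \<mu> then eg \<nu> else 0) \<in> klr_relations D n \<alpha>"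
    unfolding klr_relations_def by blast
  from act_rel[OF this] show ?thesis by (auto simp: aug_mult aug_diff lookup_gen_0 act_hom e_def)
qed (auto simp: e_notin)

lemma x_e: "x k * e \<nu> = e \<nu> * x k"
proof (cases "k \<in> {1..n} \<and> \<nu> \<in> IS")
  case True
  then have "xg k * eg \<nu> - eg \<nu> * xg k \<in> klr_relations D n \<alpha>" unfolding klr_relations_def by blast
  from act_rel[OF this] show ?thesis by (simp add: aug_mult aug_diff lookup_gen_0 act_hom e_def x_def)
qed (auto simp: e_notin x_notin)

lemma x_x: "x k * x l = x l * x k"
proof (cases "k \<in> {1..n} \<and> l \<in> {1..n}")
  case True
  then have "xg k * xg l - xg l * xg k \<in> klr_relations D n \<alpha>" unfolding klr_relations_def by blast
  from act_rel[OF this] show ?thesis by (simp add: aug_mult aug_diff lookup_gen_0 act_hom x_def)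
qed (auto simp: x_notin)

lemma t_e: "1 \<le> l \<Longrightarrow> l < n \<Longrightarrow> \<nu> \<in> IS \<Longrightarrow> t l * e \<nu> = e (swap_at l \<nu>) * t l"
proof -
  assume "1 \<le> l" "l < n" "\<nu> \<in> IS"
  then have "\<tau>g l * eg \<nu> - eg (swap_at l \<nu>) * \<tau>g l \<in> klr_relations D n \<alpha>" unfolding klr_relations_def by blast
  from act_rel[OF this] show ?thesis by (simp add: aug_mult aug_diff lookup_gen_0 act_hom e_def t_def)
qed

lemma t_t_far: "Suc k < l \<Longrightarrow> t k * t l = t l * t k"
proof (cases "1 \<le> k \<and> k < n \<and> 1 \<le> l \<and> l < n")
  case True
  assume "Suc k < l"
  then have "\<bar>int k - int l\<bar> > 1" by simp
  then have "\<tau>g k * \<tau>g l - \<tau>g l * \<tau>g k \<in> klr_relations D n \<alpha>" unfolding klr_relations_def using True by blast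
  from act_rel[OF this] show ?thesis by (simp add: aug_mult aug_diff lookup_gen_0 act_hom t_def)
qed (auto simp: t_notin)

lemma tx_rel:
  assumes "1 \<le> k" "k < n" "l \<in> {1..n}" "\<nu> \<in> IS"
  shows "(\<tau>g k * xg l - xg (transpose k (k + 1) l) * \<tau>g k) * eg \<nu> -
        (if l = k \<and> entry \<nu> k = entry \<nu> (k + 1) then - eg \<nu>
         else if l = k + 1 \<and> entry \<nu> k = entry \<nu> (k + 1) then eg \<nu> else 0) \<in> klr_relations D n \<alpha>"
  using assms unfolding klr_relations_def by blast

lemma t_x:
  assumes "1 \<le> k" "k < n" "l \<in> {1..n}" "\<nu> \<in> IS"
  shows "(t k * x l - x (transpose k (k + 1) l) * t k) * e \<nu> =
        (if l = k \<and> entry \<nu> k = entry \<nu> (k + 1) then - e \<nu>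
         else if l = k + 1 \<and> entry \<nu> k = entry \<nu> (k + 1) then e \<nu> else 0)"
  using act_rel[OF tx_rel[OF assms]]
  by (simp add: aug_mult aug_diff lookup_gen_0 act_hom e_def x_def t_def split: if_splits)

text \<open>The defining relation is available only in front of an idempotent. It is summed over all
  of them in the cyclotomic algebra and then transferred, which is allowed since the commutator has
  constant term 0.\<close>

lemma t_x_far: "l \<noteq> k \<Longrightarrow> l \<noteq> Suc k \<Longrightarrow> t k * x l = x l * t k"
proof (cases "1 \<le> k \<and> k < n \<and> 1 \<le> l \<and> l \<le> n")
  case True
  assume l: "l \<noteq> k" "l \<noteq> Suc k"
  let ?f = "\<tau>g k * xg l - xg l * \<tau>g k"
  have f: "?f \<in> C" using True by (auto intro!: C_diff C_mult C_xg C_tg)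
  have "\<kappa> (?f * eg \<nu>) = \<zero>\<^bsub>A\<^esub>" if "\<nu> \<in> IS" for \<nu>
    using \<kappa>_relation[OF tx_rel[of k l \<nu>]] True l that by (simp add: transpose_def)
  then have "\<kappa> (\<Sum>\<nu>\<in>IS. ?f * eg \<nu>) = \<zero>\<^bsub>A\<^esub>" by (intro \<kappa>_sum_0) (auto intro!: C_mult f C_eg)
  then have "\<kappa> ?f = \<zero>\<^bsub>A\<^esub>" using \<kappa>_expand[OF f] by simp
  from act_\<kappa>[OF f this] show ?thesis by (simp add: aug_mult aug_diff lookup_gen_0 act_hom x_def t_def)
qed (auto simp: t_notin x_notin)

lemma act_scal_pow: "act (scal c * (xg k ^ p * xg l ^ r)) = sc c * (x k ^ p * x l ^ r)"
  by (simp add: act_hom sc_def x_def)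

lemma Iseq_idx: "\<nu> \<in> IS \<Longrightarrow> i \<in> set \<nu> \<Longrightarrow> i \<in> idx D"
  by (auto simp: Iseq_def)

lemma sc_0: "sc 0 = 0"
  by (simp add: sc_def scal_0 act_0)

lemma t_t:
  assumes "length \<theta> + 2 + length \<rho> = n" and k: "k = Suc (length \<theta>)"
  shows "t k * t k * e (\<theta> @ i # j # \<rho>) =
        (\<Sum>a\<le>nat (- cartan D i j). \<Sum>b\<le>nat (- cartan D j i). sc (Qcoeff D i j a b) * (x k ^ a * x (Suc k) ^ b))
          * e (\<theta> @ i # j # \<rho>)"
proof (cases "\<theta> @ i # j # \<rho> \<in> IS")
  case True
  let ?\<nu> = "\<theta> @ i # j # \<rho>"
  have "1 \<le> k" "k < n" using assms by auto
  then have "\<tau>g k ^ 2 * eg ?\<nu> - Qeval (Qpol D (entry ?\<nu> k) (entry ?\<nu> (k + 1))) (xg k) (xg (k + 1)) * eg ?\<nu>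
      \<in> klr_relations D n \<alpha>" unfolding klr_relations_def using True by blast
  from act_rel[OF this] have 1: "t k * t k * e ?\<nu> = act (Qeval (Qpol D i j) (xg k) (xg (Suc k))) * e ?\<nu>"
    by (simp add: aug_mult aug_diff lookup_gen_0 act_hom e_def t_def k nth_append power2_eq_square)
  have ij: "i \<in> idx D" "j \<in> idx D" using True Iseq_idx by auto
  have "act (Qeval (Qpol D i j) (xg k) (xg (Suc k))) =
      (\<Sum>b\<le>degree (Qpol D i j). \<Sum>a\<le>degree (coeff (Qpol D i j) b). sc (Qcoeff D i j a b) * (x k ^ a * x (Suc k) ^ b))"
    unfolding Qeval_def act_sum act_scal_pow ..
  also have "\<dots> = (\<Sum>a\<le>nat (- cartan D i j). \<Sum>b\<le>nat (- cartan D j i). sc (Qcoeff D i j a b) * (x k ^ a * x (Suc k) ^ b))"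
    by (rule poly_sum_box) (use Q_box[OF ij] in \<open>auto simp: sc_0\<close>)
  finally show ?thesis using 1 by simp
qed (simp add: e_notin)

lemma braid:
  assumes "length \<theta> + 3 + length \<rho> = n" and k: "k = Suc (length \<theta>)" and \<nu>: "\<theta> @ i # j # i' # \<rho> \<in> IS"
  shows "(t (Suc k) * t k * t (Suc k) - t k * t (Suc k) * t k) * e (\<theta> @ i # j # i' # \<rho>) =
    (if i = i' then (\<Sum>a\<le>nat (- cartan D i j). \<Sum>b\<le>nat (- cartan D j i). sc (Qcoeff D i j a b) *
      ((\<Sum>c<a. x k ^ c * x (Suc (Suc k)) ^ (a - 1 - c)) * x (Suc k) ^ b)) * e (\<theta> @ i # j # i' # \<rho>) else 0)"
proof -
  let ?\<nu> = "\<theta> @ i # j # i' # \<rho>"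
  have "1 \<le> k" "k + 1 < n" using assms by auto
  then have "(\<tau>g (k + 1) * \<tau>g k * \<tau>g (k + 1) - \<tau>g k * \<tau>g (k + 1) * \<tau>g k) * eg ?\<nu> -
        (if entry ?\<nu> k = entry ?\<nu> (k + 2)
         then Qdivdiff (Qpol D (entry ?\<nu> k) (entry ?\<nu> (k + 1))) (xg k) (xg (k + 2)) (xg (k + 1)) * eg ?\<nu>
         else 0) \<in> klr_relations D n \<alpha>" unfolding klr_relations_def using \<nu> by blast
  from act_rel[OF this] have 1: "(t (Suc k) * t k * t (Suc k) - t k * t (Suc k) * t k) * e ?\<nu> =
    (if i = i' then act (Qdivdiff (Qpol D i j) (xg k) (xg (Suc (Suc k))) (xg (Suc k))) * e ?\<nu> else 0)"
    by (simp add: aug_mult aug_diff lookup_gen_0 act_hom e_def t_def k nth_append split: if_splits)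
  have ij: "i \<in> idx D" "j \<in> idx D" using \<nu> Iseq_idx by auto
  have "act (Qdivdiff (Qpol D i j) (xg k) (xg (Suc (Suc k))) (xg (Suc k))) =
      (\<Sum>b\<le>degree (Qpol D i j). \<Sum>a\<le>degree (coeff (Qpol D i j) b). sc (Qcoeff D i j a b) *
      ((\<Sum>c<a. x k ^ c * x (Suc (Suc k)) ^ (a - 1 - c)) * x (Suc k) ^ b))"
    unfolding Qdivdiff_def act_hom sc_def x_def ..
  also have "\<dots> = (\<Sum>a\<le>nat (- cartan D i j). \<Sum>b\<le>nat (- cartan D j i). sc (Qcoeff D i j a b) *
      ((\<Sum>c<a. x k ^ c * x (Suc (Suc k)) ^ (a - 1 - c)) * x (Suc k) ^ b))"
    by (rule poly_sum_box) (use Q_box[OF ij] in \<open>auto simp: sc_0\<close>)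
  finally show ?thesis unfolding 1 by (simp only:)
qed

lemma cyclotomic: "Suc (length \<rho>) = n \<Longrightarrow> x 1 ^ nat (coroot D i \<Lambda>) * e (i # \<rho>) = 0"
proof (cases "i # \<rho> \<in> IS")
  case True
  assume n: "Suc (length \<rho>) = n"
  interpret R: ring A by (rule ring_A)
  let ?S = "\<Sum>\<nu>\<in>IS. xg 1 ^ nat (coroot D (entry \<nu> 1) \<Lambda>) * eg \<nu>"
  have "1 \<le> n" using n by simp
  then have S: "?S \<in> C" by (intro C_sum C_mult C_pow C_xg C_eg) auto
  have "\<kappa> (?S * eg (i # \<rho>)) = \<zero>\<^bsub>A\<^esub>"
    using \<kappa>_cyclotomic n \<kappa>_mult[OF S C_eg[OF True]] \<kappa>_C[OF C_eg[OF True]] by simp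
  then have "act (?S * eg (i # \<rho>)) = 0"
    by (intro act_\<kappa> C_mult S C_eg True) (simp_all only: aug_mult lookup_gen_0 mult_zero_right)
  then have "(\<Sum>\<nu>\<in>IS. x 1 ^ nat (coroot D (entry \<nu> 1) \<Lambda>) * (e \<nu> * e (i # \<rho>))) = 0"
    by (simp add: act_hom x_def e_def sum_distrib_right mult.assoc)
  moreover have "(\<Sum>\<nu>\<in>IS. x 1 ^ nat (coroot D (entry \<nu> 1) \<Lambda>) * (e \<nu> * e (i # \<rho>)))
      = (\<Sum>\<nu>\<in>IS. if \<nu> = i # \<rho> then x 1 ^ nat (coroot D i \<Lambda>) * e (i # \<rho>) else 0)"
    by (intro sum.cong) (auto simp: e_e)
  ultimately show ?thesis using True finite_IS by simp
qed (simp add: e_notin)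

sublocale K: klr_rel sc e x t n "idx D" "Qcoeff D" "cartan D" dg "\<lambda>i. nat (coroot D i \<Lambda>)" "act ` C"
proof
  show "sc (c + d) = sc c + sc d" "sc (c * d) = sc c * sc d" "sc 1 = 1" for c d
    by (simp_all add: sc_def scal_add scal_mult scal_1 act_hom)
  show "sc c * y = y * sc c" for c y unfolding sc_def by (rule FI.act_scal)
  show "e \<nu> * e \<nu> = e \<nu>" for \<nu> by (simp add: e_e)
  show "e \<nu> * e \<mu> = 0" if "\<nu> \<noteq> \<mu>" for \<nu> \<mu> using that by (simp add: e_e)
  fix \<theta> \<rho> :: "'i list" and i j :: 'i and k
  have sw: "\<theta> @ j # i # \<rho> \<in> IS \<longleftrightarrow> \<theta> @ i # j # \<rho> \<in> IS" by (rule Iseq_mset) simp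
  show "t (Suc (length \<theta>)) * e (\<theta> @ i # j # \<rho>) = e (\<theta> @ j # i # \<rho>) * t (Suc (length \<theta>))"
    if "length \<theta> + 2 + length \<rho> = n"
    using t_e[of "Suc (length \<theta>)" "\<theta> @ i # j # \<rho>"] that sw
    by (cases "\<theta> @ i # j # \<rho> \<in> IS") (auto simp: swap_at_append e_notin)
  {
    assume l: "length \<theta> + 2 + length \<rho> = n" and k: "k = Suc (length \<theta>)"
    have tx: "(t k * x l - x (transpose k (k + 1) l) * t k) * e (\<theta> @ i # j # \<rho>) =
        (if l = k \<and> i = j then - e (\<theta> @ i # j # \<rho>)
         else if l = k + 1 \<and> i = j then e (\<theta> @ i # j # \<rho>) else 0)" if "l \<in> {k, Suc k}" for l i j
      using t_x[of k l "\<theta> @ i # j # \<rho>"] that l k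
      using e_notin[of "\<theta> @ i # j # \<rho>"]
      by (cases "\<theta> @ i # j # \<rho> \<in> IS") (auto simp: nth_append)
    show "t k * x k * e (\<theta> @ i # j # \<rho>) = x (Suc k) * t k * e (\<theta> @ i # j # \<rho>)" if "i \<noteq> j"
      using tx[of k i j] that by (simp add: left_diff_distrib)
    show "t k * x (Suc k) * e (\<theta> @ i # j # \<rho>) = x k * t k * e (\<theta> @ i # j # \<rho>)" if "i \<noteq> j"
      using tx[of "Suc k" i j] that by (simp add: left_diff_distrib)
    show "t k * x k * e (\<theta> @ i # i # \<rho>) = x (Suc k) * t k * e (\<theta> @ i # i # \<rho>) - e (\<theta> @ i # i # \<rho>)"
      using tx[of k i i] by (simp add: left_diff_distrib algebra_simps)
    show "t k * x (Suc k) * e (\<theta> @ i # i # \<rho>) = x k * t k * e (\<theta> @ i # i # \<rho>) + e (\<theta> @ i # i # \<rho>)"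
      using tx[of "Suc k" i i] by (simp add: left_diff_distrib algebra_simps)
  }
  show "(t (Suc k) * t k * t (Suc k) - t k * t (Suc k) * t k) * e (\<theta> @ i # j # i # \<rho>) =
        (\<Sum>a\<le>nat (- cartan D i j). \<Sum>b\<le>nat (- cartan D j i). sc (Qcoeff D i j a b) *
          ((\<Sum>c<a. x k ^ c * x (Suc (Suc k)) ^ (a - 1 - c)) * x (Suc k) ^ b)) * e (\<theta> @ i # j # i # \<rho>)"
    if "length \<theta> + 3 + length \<rho> = n" "k = Suc (length \<theta>)"
    using braid[OF that, of i j i] by (cases "\<theta> @ i # j # i # \<rho> \<in> IS") (simp_all add: e_notin)
  show "(t (Suc k) * t k * t (Suc k) - t k * t (Suc k) * t k) * e (\<theta> @ i # j # i' # \<rho>) = 0"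
    if "length \<theta> + 3 + length \<rho> = n" "k = Suc (length \<theta>)" "i \<noteq> i'" for i'
    using braid[OF that(1,2), of i j i'] that(3)
    by (cases "\<theta> @ i # j # i' # \<rho> \<in> IS") (simp_all add: e_notin)
  show "e \<nu> = 0" if "\<not> set \<nu> \<subseteq> idx D" for \<nu> using that by (intro e_notin) (auto simp: Iseq_def)
  show "Qcoeff D i i a b = 0" if "i \<in> idx D" for a b using Q_diag[OF that] by simp
  show "2 * dg i j = - dg i i * of_nat a - dg j j * of_nat b"
    if "i \<in> idx D" "j \<in> idx D" "Qcoeff D i j a b \<noteq> 0" for a b
    using Q_hom[OF that(1,2) _ that(3)] Q_diag[OF that(1)] that(3) by (cases "i = j") auto
  show "e \<nu> \<in> act ` C" for \<nu>
    using C_eg C_0 act_0 e_notin[of \<nu>] unfolding e_def by (cases "\<nu> \<in> IS") (metis image_eqI)+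
  show "x k \<in> act ` C" "t k \<in> act ` C" for k
    using C_xg[of k] C_tg[of k] C_0 act_0 x_notin[of k] t_notin[of k] unfolding x_def t_def by (metis image_eqI)+
  show "1 \<in> act ` C" using C_1 FI.act_1 by (metis image_eqI)
  show "y * z \<in> act ` C" "y + z \<in> act ` C" if "y \<in> act ` C" "z \<in> act ` C" for y z
    using that C_mult C_add FI.act_mult FI.act_add by (auto, (metis image_eqI)+)
  show "sc c * y \<in> act ` C" if "y \<in> act ` C" for c y
    using that C_mult C_scal FI.act_mult unfolding sc_def by (auto, metis image_eqI)
qed (fact x_e x_x t_x_far t_t_far t_t cyclotomic Q_sym Q_lead cartan_diag cartan_le dg_pos pform_sym dg_cartan)+

end

context klr_rel
begin

section \<open>Degrees of blocks\<close>

lemma hm_block_t: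
  "length \<theta> < j \<Longrightarrow> j < length \<theta> + k \<Longrightarrow>
    hm (\<theta> @ replicate k i @ \<rho>) (\<theta> @ replicate k i @ \<rho>) (- dg i i) (t j)"
proof -
  assume j: "length \<theta> < j" "j < length \<theta> + k"
  define a b where "a = j - Suc (length \<theta>)" and "b = length \<theta> + k - Suc j"
  have "k = a + (2 + b)" using j by (simp add: a_def b_def)
  then have "\<theta> @ replicate k i @ \<rho> = (\<theta> @ replicate a i) @ i # i # (replicate b i @ \<rho>)"
    by (simp only: replicate_add) (simp add: numeral_2_eq_2)
  then show ?thesis using hm_t1[of j "\<theta> @ replicate a i" i i "replicate b i @ \<rho>"] j by (simp add: a_def)
qed

lemma hm_block_x:
  "length \<theta> < j \<Longrightarrow> j \<le> length \<theta> + k \<Longrightarrow>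
    hm (\<theta> @ replicate k i @ \<rho>) (\<theta> @ replicate k i @ \<rho>) (of_nat p * dg i i) (x j ^ p)"
proof -
  assume j: "length \<theta> < j" "j \<le> length \<theta> + k"
  define a b where "a = j - Suc (length \<theta>)" and "b = length \<theta> + k - j"
  have "k = a + (1 + b)" using j by (simp add: a_def b_def)
  then have "\<theta> @ replicate k i @ \<rho> = (\<theta> @ replicate a i) @ i # (replicate b i @ \<rho>)"
    by (simp only: replicate_add) simp
  then show ?thesis using hm_xp1[of j "\<theta> @ replicate a i" i "replicate b i @ \<rho>" p] j by (simp add: a_def)
qed

lemma hm_prod_list:
  "(\<And>j. j \<in> set js \<Longrightarrow> hm \<nu> \<nu> (r j) (g j)) \<Longrightarrow> hm \<nu> \<nu> (sum_list (map r js)) (prod_list (map g js))"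
proof (induction js)
  case (Cons j js)
  then show ?case using hm_trans[of \<nu> \<nu> "r j" "g j" \<nu> "sum_list (map r js)"] by (simp add: add.commute)
qed (simp add: hm_one)

text \<open>For each j the j - u crossings \<tau>_u, ..., \<tau>_{j-1} and the power x_j^{j-u} have
  opposite degrees.\<close>

lemma hm_e_prod:
  assumes "length \<theta> < u" "v \<le> length \<theta> + k"
  shows "hm (\<theta> @ replicate k i @ \<rho>) (\<theta> @ replicate k i @ \<rho>) 0 (e_prod x t u v)"
proof (cases "u < v")
  case True
  let ?\<nu> = "\<theta> @ replicate k i @ \<rho>" and ?js = "[u + 1..<v + 1]"
  have 1: "hm ?\<nu> ?\<nu> (of_nat (j - u) * (- dg i i)) (prod_list (map t [u..<j]))" if "j \<le> v" for j
  proof -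
    have "hm ?\<nu> ?\<nu> (sum_list (map (\<lambda>_. - dg i i) [u..<j])) (prod_list (map t [u..<j]))"
      using assms that by (intro hm_prod_list hm_block_t) auto
    then show ?thesis by (simp only: map_replicate_const sum_list_replicate length_upt)
  qed
  have 2: "hm ?\<nu> ?\<nu> (sum_list (map (\<lambda>j. of_nat (j - u) * (- dg i i)) (rev ?js))) (tw_prod t u v)"
    unfolding tw_prod_def by (intro hm_prod_list 1) auto
  have 3: "hm ?\<nu> ?\<nu> (sum_list (map (\<lambda>j. of_nat (j - u) * dg i i) ?js)) (prod_list (map (\<lambda>j. x j ^ (j - u)) ?js))"
    using assms by (intro hm_prod_list hm_block_x) auto
  have "sum_list (map (\<lambda>j. of_nat (j - u) * dg i i) ?js) + sum_list (map (\<lambda>j. of_nat (j - u) * (- dg i i)) (rev ?js)) = 0"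
    by (simp add: rev_map[symmetric] sum_list_rev flip: uminus_sum_list_map[unfolded comp_def])
  then show ?thesis using hm_trans[OF 2 3] True by (simp add: e_prod_def)
qed (simp add: e_prod_def hm_one)

lemma hm_belt:
  "(\<And>i k l. (i, k, l) \<in> set bl \<Longrightarrow> 1 \<le> k) \<Longrightarrow>
    hm (\<theta> @ bseq bl @ \<rho>) (\<theta> @ bseq bl @ \<rho>) (bdeg bl) (belt x t (length \<theta>) bl)"
proof (induction bl arbitrary: \<theta>)
  case (Cons b bl)
  obtain i k l where b: "b = (i, k, l)" by (cases b)
  then have k: "1 \<le> k" using Cons.prems by auto
  let ?\<nu> = "\<theta> @ bseq (b # bl) @ \<rho>" and ?p = "length \<theta>"
  have \<nu>: "?\<nu> = \<theta> @ replicate k i @ (bseq bl @ \<rho>)" by (simp add: b)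
  have 1: "hm ?\<nu> ?\<nu> 0 (e_prod x t (?p + 1) (?p + k))" unfolding \<nu> by (rule hm_e_prod) auto
  have 2: "hm ?\<nu> ?\<nu> (of_nat l * dg i i) (x (?p + k) ^ l)" unfolding \<nu> using k by (intro hm_block_x) auto
  have 3: "hm ?\<nu> ?\<nu> (bdeg bl) (belt x t (?p + k) bl)"
    using Cons.IH[of "\<theta> @ replicate k i"] Cons.prems unfolding \<nu> by auto
  show ?case using hm_trans[OF hm_trans[OF 1 2] 3] by (simp add: b bdeg_def add.commute)
qed (simp add: hm_one bdeg_def)

lemma valid_pos: "valid \<theta> bl \<Longrightarrow> (i, k, l) \<in> set bl \<Longrightarrow> 1 \<le> k"
  by (induction \<theta> bl rule: valid.induct) auto

end

context cyc_setup
begin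

text \<open>f lies in the span of S modulo commutators. The span is formed in the free algebra,
  which keeps cosets out of the arguments.\<close>

definition in_trace_span where "in_trace_span S f \<longleftrightarrow> f \<in> C \<and> q f \<in> q ` kspan FA S"

lemma in_trace_span_0: "in_trace_span S 0"
  unfolding in_trace_span_def using C_0 kspan.zero[of FA S] by (auto simp: free_algebra_on_simps(5))

lemma in_trace_span_add: "S \<subseteq> C \<Longrightarrow> in_trace_span S f \<Longrightarrow> in_trace_span S g \<Longrightarrow> in_trace_span S (f + g)"
proof -
  assume S: "S \<subseteq> C" and "in_trace_span S f" "in_trace_span S g"
  then obtain u v where *: "f \<in> C" "g \<in> C" "u \<in> kspan FA S" "v \<in> kspan FA S" "q f = q u" "q g = q v"
    by (auto simp: in_trace_span_def)
  then have "q (f + g) = q (u + v)" using q_add kspan_C[OF S] by metis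
  moreover have "u + v \<in> kspan FA S" using kspan.add[OF *(3,4)] by (simp add: free_algebra_on_simps(4))
  ultimately show ?thesis unfolding in_trace_span_def using *(1,2) C_add by blast
qed

lemma in_trace_span_scal: "S \<subseteq> C \<Longrightarrow> in_trace_span S f \<Longrightarrow> in_trace_span S (scal c * f)"
proof -
  assume S: "S \<subseteq> C" and "in_trace_span S f"
  then obtain u where *: "f \<in> C" "u \<in> kspan FA S" "q f = q u" by (auto simp: in_trace_span_def)
  then have "q (scal c * f) = q (scal c * u)" using q_smult kspan_C[OF S] by metis
  moreover have "scal c * u \<in> kspan FA S" using kspan.smult[OF *(2), of c] by (simp add: free_algebra_on_simps(6))
  ultimately show ?thesis unfolding in_trace_span_def using *(1) C_mult C_scal by blast
qed

lemma in_trace_span_q: "in_trace_span S f \<Longrightarrow> g \<in> C \<Longrightarrow> q g = q f \<Longrightarrow> in_trace_span S g"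
  by (simp add: in_trace_span_def)

lemma in_trace_span_sum: "S \<subseteq> C \<Longrightarrow> (\<And>a. a \<in> T \<Longrightarrow> in_trace_span S (f a)) \<Longrightarrow> in_trace_span S (sum f T)"
  by (induction T rule: infinite_finite_induct) (auto intro: in_trace_span_0 in_trace_span_add)

lemma in_trace_span_base: "S \<subseteq> C \<Longrightarrow> f \<in> S \<Longrightarrow> in_trace_span S f"
  unfolding in_trace_span_def by (auto intro: kspan.base)

lemma in_trace_span_kspan: "T \<subseteq> C \<Longrightarrow> (\<And>f. f \<in> S \<Longrightarrow> in_trace_span T f) \<Longrightarrow> f \<in> kspan FA S \<Longrightarrow> in_trace_span T f"
proof -
  assume T: "T \<subseteq> C" and S: "\<And>f. f \<in> S \<Longrightarrow> in_trace_span T f"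
  show "f \<in> kspan FA S \<Longrightarrow> in_trace_span T f"
    by (induction rule: kspan.induct)
      (auto simp: free_algebra_on_simps(4-6) intro: in_trace_span_0 in_trace_span_add[OF T] in_trace_span_scal[OF T] S)
qed

lemma span_subset: "T \<subseteq> C \<Longrightarrow> (\<And>f. f \<in> S \<Longrightarrow> in_trace_span T f) \<Longrightarrow> q ` kspan FA S \<subseteq> q ` kspan FA T"
  using in_trace_span_kspan[of T S] by (auto simp: in_trace_span_def)

text \<open>The preimage is assembled along the span and may differ from a given representative;
  \<open>in_trace_span_lsp\<close> compares the two by \<open>act_eq_\<kappa>\<close>.\<close>

lemma lift_lsp:
  assumes S: "S \<subseteq> C"
  shows "y \<in> K.lsp (K.CC \<union> act ` S) \<Longrightarrow> \<exists>f. act f = y \<and> in_trace_span S f"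
proof (induction rule: K.lsp.induct)
  case lsp_0
  show ?case using act_0 in_trace_span_0 by blast
next
  case (lsp_base y)
  show ?case
  proof (cases "y \<in> K.CC")
    case True
    then obtain f g where fg: "f \<in> C" "g \<in> C" "y = act f * act g - act g * act f" by (auto simp: K.CC_def)
    have m: "scal (- 1) * h = - h" for h :: "('i, 'k) klr_free"
    proof -
      have "scal (- 1) * h + scal 1 * h = 0" by (simp add: scal_0 flip: scal_add distrib_right)
      then show ?thesis by (simp add: scal_1 eq_neg_iff_add_eq_0)
    qed
    have "q (f * g + scal (- 1) * (g * f)) = q (g * f + scal (- 1) * (g * f))"
      using fg C_mult[OF C_scal C_mult] C_mult by (simp add: q_add q_comm[of f g])
    then have "in_trace_span S (f * g - g * f)" using fg in_trace_span_0[of S] by (intro in_trace_span_q[OF in_trace_span_0] C_diff C_mult) (simp_all add: m)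
    then show ?thesis using fg by (intro exI[of _ "f * g - g * f"]) (simp add: act_hom)
  next
    case False
    then show ?thesis using lsp_base in_trace_span_base[OF S] by auto
  qed
next
  case (lsp_add y z)
  then show ?case using in_trace_span_add[OF S] FI.act_add by metis
next
  case (lsp_sc y c)
  then show ?case using in_trace_span_scal[OF S] FI.act_mult unfolding sc_def by metis
qed

lemma in_trace_span_lsp: "S \<subseteq> C \<Longrightarrow> f \<in> C \<Longrightarrow> act f \<in> K.lsp (K.CC \<union> act ` S) \<Longrightarrow> in_trace_span S f"
proof -
  assume S: "S \<subseteq> C" and f: "f \<in> C" and l: "act f \<in> K.lsp (K.CC \<union> act ` S)"
  then obtain g where g: "act g = act f" "in_trace_span S g" using lift_lsp by blast
  then have "\<kappa> f = \<kappa> g" using f by (intro act_eq_\<kappa>) (auto simp: in_trace_span_def)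
  then show "in_trace_span S f" using in_trace_span_q[OF g(2) f] q_eq by blast
qed

lemma hom_monomial_hm:
  "(f, r) \<in> hom_monomials D n \<alpha> \<Longrightarrow> \<nu> \<in> IS \<Longrightarrow> \<exists>\<mu> y. K.hm \<nu> \<mu> r y \<and> act f * e \<nu> = y * e \<nu>"
proof (induction f r rule: hom_monomials.induct)
  case one
  show ?case using K.hm_one[of \<nu>] by (intro exI[of _ \<nu>] exI[of _ 1]) (simp add: FI.act_1)
next
  case (e f r \<nu>')
  then obtain \<mu> y where y: "K.hm \<nu> \<mu> r y" "act f * e \<nu> = y * e \<nu>" by blast
  have "y * e \<nu> = e \<mu> * y" using K.hm_e[OF y(1), of "[]"] e.prems by (simp add: Iseq_def)
  then have "act (eg \<nu>' * f) * e \<nu> = e \<nu>' * e \<mu> * y" by (simp add: FI.act_mult mult.assoc y(2) flip: e_def)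
  also have "\<dots> = (if \<nu>' = \<mu> then y else 0) * e \<nu>" using \<open>y * e \<nu> = e \<mu> * y\<close> by (simp add: e_e)
  finally have eq: "act (eg \<nu>' * f) * e \<nu> = (if \<nu>' = \<mu> then y else 0) * e \<nu>" .
  have "K.hm \<nu> \<mu> r (if \<nu>' = \<mu> then y else 0)" using y(1) K.hm_zero[OF K.hm_mset[OF y(1)]] by simp
  then show ?case using eq by blast
next
  case (x f r \<nu>' k)
  then obtain \<mu> y where y: "K.hm \<nu> \<mu> r y" "act f * e \<nu> = y * e \<nu>" by blast
  have c: "y * e \<nu> = e \<mu> * y" using K.hm_e[OF y(1), of "[]"] x.prems by (simp add: Iseq_def)
  have len: "length \<mu> = n" using K.hm_length[OF y(1)] x.prems by (simp add: Iseq_def)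
  have "act (xg k * eg \<nu>' * f) * e \<nu> = cyc_setup.x D n \<alpha> \<Lambda> k * (e \<nu>' * e \<mu>) * y"
    by (simp add: FI.act_mult mult.assoc y(2) c flip: e_def x_def)
  also have "\<dots> = (if \<nu>' = \<mu> then cyc_setup.x D n \<alpha> \<Lambda> k * y else 0) * e \<nu>" using c by (simp add: e_e mult.assoc)
  finally have eq: "act (xg k * eg \<nu>' * f) * e \<nu> = (if \<nu>' = \<mu> then cyc_setup.x D n \<alpha> \<Lambda> k * y else 0) * e \<nu>" .
  show ?case
  proof (cases "\<nu>' = \<mu>")
    case True
    define \<theta> \<rho> where "\<theta> = take (k - 1) \<mu>" and "\<rho> = drop k \<mu>"
    have \<mu>: "\<mu> = \<theta> @ entry \<mu> k # \<rho>" "k = Suc (length \<theta>)"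
      using x.hyps len id_take_nth_drop[of "k - 1" \<mu>] by (auto simp: \<theta>_def \<rho>_def)
    have "K.hm \<nu> \<mu> (r + dg (entry \<mu> k) (entry \<mu> k)) (cyc_setup.x D n \<alpha> \<Lambda> k * y)"
      using K.hm_x[of \<nu> \<theta> "entry \<mu> k" \<rho> r y] y(1) \<mu> by metis
    then show ?thesis using eq True by (auto simp: add.commute)
  next
    case False
    have "K.hm \<nu> \<nu> (dg (entry \<nu>' k) (entry \<nu>' k) + r) 0" by (rule K.hm_zero) simp
    then show ?thesis using eq False by (intro exI[of _ \<nu>] exI[of _ 0]) simp
  qed
next
  case (\<tau> f r \<nu>' l)
  then obtain \<mu> y where y: "K.hm \<nu> \<mu> r y" "act f * e \<nu> = y * e \<nu>" by blast
  have c: "y * e \<nu> = e \<mu> * y" using K.hm_e[OF y(1), of "[]"] \<tau>.prems by (simp add: Iseq_def)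
  have len: "length \<mu> = n" using K.hm_length[OF y(1)] \<tau>.prems by (simp add: Iseq_def)
  have "act (\<tau>g l * eg \<nu>' * f) * e \<nu> = t l * (e \<nu>' * e \<mu>) * y"
    by (simp add: FI.act_mult mult.assoc y(2) c flip: e_def t_def)
  also have "\<dots> = (if \<nu>' = \<mu> then t l * y else 0) * e \<nu>" using c by (simp add: e_e mult.assoc)
  finally have eq: "act (\<tau>g l * eg \<nu>' * f) * e \<nu> = (if \<nu>' = \<mu> then t l * y else 0) * e \<nu>" .
  show ?case
  proof (cases "\<nu>' = \<mu>")
    case True
    define \<theta> \<rho> where "\<theta> = take (l - 1) \<mu>" and "\<rho> = drop (Suc l) \<mu>"
    have \<mu>: "\<mu> = \<theta> @ entry \<mu> l # entry \<mu> (l + 1) # \<rho>" "l = Suc (length \<theta>)"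
      using \<tau>.hyps len id_take_nth_drop[of "l - 1" \<mu>] Cons_nth_drop_Suc[of l \<mu>]
      by (auto simp: \<theta>_def \<rho>_def)
    have "K.hm \<nu> (\<theta> @ entry \<mu> (l + 1) # entry \<mu> l # \<rho>) (r - dg (entry \<mu> l) (entry \<mu> (l + 1))) (t l * y)"
      using K.hm_t[of \<nu> \<theta> "entry \<mu> l" "entry \<mu> (l + 1)" \<rho> r y] y(1) \<mu> by metis
    then have "K.hm \<nu> (\<theta> @ entry \<mu> (l + 1) # entry \<mu> l # \<rho>)
        (- dg (entry \<nu>' l) (entry \<nu>' (l + 1)) + r) (t l * y)"
      using True by (simp add: algebra_simps)
    then show ?thesis using eq True by auto
  next
    case False
    have "K.hm \<nu> \<nu> (- dg (entry \<nu>' l) (entry \<nu>' (l + 1)) + r) 0" by (rule K.hm_zero) simp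
    then show ?thesis using eq False by (intro exI[of _ \<nu>] exI[of _ 0]) simp
  qed
qed

definition block_elts :: "rat \<Rightarrow> ('i, 'k) klr_free set" where
  "block_elts r = {belt xg \<tau>g 0 bl * eg (bseq bl) | bl. K.valid [] bl \<and> bseq bl \<in> IS \<and> K.bdeg bl = r}"

lemma e_int_eq: "e_int u v = e_prod xg \<tau>g u v"
  by (simp add: e_int_def e_prod_def \<tau>w_def tw_prod_def)

lemma act_e_prod: "act (e_prod xg \<tau>g u v) = e_prod x t u v"
  by (simp add: e_prod_def tw_prod_def act_hom comp_def rev_map flip: x_def t_def)

lemma act_belt: "act (belt xg \<tau>g p bl) = belt x t p bl"
proof (induction bl arbitrary: p)
  case (Cons b bl)
  then show ?case by (cases b) (simp add: FI.act_mult act_pow act_e_prod flip: x_def)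
qed (simp add: FI.act_1)

lemma C_e_prod: "1 \<le> u \<Longrightarrow> v \<le> n \<Longrightarrow> e_prod xg \<tau>g u v \<in> C"
  unfolding e_prod_def tw_prod_def
  by (auto intro!: C_mult C_prod_list C_1 C_pow C_xg C_tg)

lemma C_belt: "(\<And>i k l. (i, k, l) \<in> set bl \<Longrightarrow> 1 \<le> k) \<Longrightarrow> p + length (bseq bl) \<le> n \<Longrightarrow> belt xg \<tau>g p bl \<in> C"
proof (induction bl arbitrary: p)
  case (Cons b bl)
  obtain i k l where b: "b = (i, k, l)" by (cases b)
  then have k: "1 \<le> k" using Cons.prems by auto
  have "belt xg \<tau>g (p + k) bl \<in> C" using Cons.IH[of "p + k"] Cons.prems by (auto simp: b)
  moreover have "e_prod xg \<tau>g (p + 1) (p + k) \<in> C" "xg (p + k) \<in> C"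
    using Cons.prems k by (auto intro!: C_e_prod C_xg simp: b)
  ultimately show ?case by (auto simp: b intro!: C_mult C_pow)
qed (simp add: C_1)

lemma block_elts_C: "block_elts r \<subseteq> C"
proof
  fix f assume "f \<in> block_elts r"
  then obtain bl where bl: "f = belt xg \<tau>g 0 bl * eg (bseq bl)" "K.valid [] bl" "bseq bl \<in> IS"
    by (auto simp: block_elts_def)
  moreover have "length (bseq bl) = n" using bl(3) by (simp add: Iseq_def)
  ultimately show "f \<in> C" using K.valid_pos[OF bl(2)] C_belt[of bl 0] C_eg C_mult by simp
qed

text \<open>f e(\<nu>) ends in one sequence \<mu>. If \<mu> = \<nu>, \<open>span_blocks\<close>
  applies; otherwise y e(\<nu>) = e(\<mu>) y e(\<nu>) is a commutator, as e(\<nu>) e(\<mu>) =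
  0.\<close>

lemma monomials_block_elts: "f \<in> monomials r \<Longrightarrow> in_trace_span (block_elts r) f"
proof -
  assume "f \<in> monomials r"
  then have hf: "(f, r) \<in> hom_monomials D n \<alpha>" and f: "f \<in> C" using monomials_C by (auto simp: monomials_def)
  have "in_trace_span (block_elts r) (f * eg \<nu>)" if \<nu>: "\<nu> \<in> IS" for \<nu>
  proof (rule in_trace_span_lsp[OF block_elts_C])
    show "f * eg \<nu> \<in> C" by (intro C_mult f C_eg \<nu>)
    obtain \<mu> y where y: "K.hm \<nu> \<mu> r y" "act f * e \<nu> = y * e \<nu>" using hom_monomial_hm[OF hf \<nu>] by blast
    have a: "act (f * eg \<nu>) = y * e \<nu>" using y(2) by (simp add: FI.act_mult e_def)
    have ln: "length \<nu> + length [] = n" using \<nu> by (simp add: Iseq_def)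
    have c: "y * e \<nu> = e \<mu> * y" using K.hm_e[OF y(1) ln] by simp
    show "act (f * eg \<nu>) \<in> K.lsp (K.CC \<union> act ` block_elts r)"
    proof (cases "\<mu> = \<nu>")
      case True
      have "K.tail (length \<nu>) [] 1" unfolding K.tail_def using K.Alg_1 by simp
      from K.span_blocks[OF ln this y(1)[unfolded True]]
      have "y * e \<nu> \<in> K.lsp (K.CC \<union> {belt x t 0 bl * 1 * e (bseq bl @ []) |bl.
            K.valid [] bl \<and> mset (bseq bl) = mset \<nu> \<and> K.bdeg bl = r})" by simp
      moreover have "{belt x t 0 bl * 1 * e (bseq bl @ []) |bl.
            K.valid [] bl \<and> mset (bseq bl) = mset \<nu> \<and> K.bdeg bl = r} \<subseteq> act ` block_elts r"
      proof safe
        fix bl assume bl: "K.valid [] bl" "mset (bseq bl) = mset \<nu>" "r = K.bdeg bl"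
        then have "bseq bl \<in> IS" using Iseq_mset \<nu> by blast
        then have "belt xg \<tau>g 0 bl * eg (bseq bl) \<in> block_elts (K.bdeg bl)" using bl by (auto simp: block_elts_def)
        then show "belt x t 0 bl * 1 * e (bseq bl @ []) \<in> act ` block_elts (K.bdeg bl)"
          by (intro rev_image_eqI) (auto simp: FI.act_mult act_belt e_def)
      qed
      ultimately show ?thesis unfolding a by (elim K.lsp_mono) (intro subsetI K.lsp_base, blast)
    next
      case False
      have "(y * e \<nu>) * e \<mu> = 0" using False by (simp add: mult.assoc e_e)
      then have "e \<mu> * (y * e \<nu>) \<in> K.lsp K.CC"
        using K.CC_swap[OF order_refl K.Alg_e K.Alg_mult[OF K.hm_Alg[OF y(1)] K.Alg_e], of \<nu> \<mu>] K.lsp_0[of K.CC]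
        by (simp only:)
      moreover have "e \<mu> * (y * e \<nu>) = y * e \<nu>" unfolding c by (simp add: e_e flip: mult.assoc)
      ultimately show ?thesis unfolding a using K.lsp_mono[of _ K.CC "K.CC \<union> act ` block_elts r"] K.lsp_base[of _ "K.CC \<union> act ` block_elts r"] by (simp only:) blast
    qed
  qed
  then have "in_trace_span (block_elts r) (\<Sum>\<nu>\<in>IS. f * eg \<nu>)" by (intro in_trace_span_sum block_elts_C)
  then show ?thesis using in_trace_span_q f \<kappa>_expand[OF f] q_eq by metis
qed

lemma left_mult_monomials:
  assumes g: "\<And>f. f \<in> monomials r \<Longrightarrow> g * f \<in> monomials s" and f: "f \<in> kspan FA (monomials r)"
  shows "g * f \<in> kspan FA (monomials s)"
  using f
proof (induction rule: kspan.induct)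
  case zero
  show ?case using kspan.zero[of FA "monomials s"] by (simp add: free_algebra_on_simps(5))
next
  case (base f)
  then show ?case using g by (intro kspan.base)
next
  case (add f f')
  then show ?case using kspan.add[of "g * f" FA "monomials s" "g * f'"] by (simp add: free_algebra_on_simps(4) distrib_left)
next
  case (smult f c)
  then show ?case using kspan.smult[of "g * f" FA "monomials s" c] by (simp add: free_algebra_on_simps(6) scal_left)
qed

text \<open>Converse of \<open>hom_monomial_hm\<close>, with the idempotents put back. It shows that
  a block belongs to the component of its degree.\<close>

lemma hm_monomials:
  assumes \<nu>: "\<nu> \<in> IS"
  shows "K.hm \<nu> \<mu> r y \<Longrightarrow> \<exists>f\<in>kspan FA (monomials r). act f = y * e \<nu>"
proof (induction rule: K.hm.induct)
  case hm_one
  have "(eg \<nu> * 1, 0) \<in> hom_monomials D n \<alpha>" using hom_monomials.one \<nu> by (rule hom_monomials.e)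
  then have "eg \<nu> \<in> kspan FA (monomials 0)" by (intro kspan.base) (simp add: monomials_def)
  then show ?case by (auto simp: e_def)
next
  case (hm_zero \<mu> r)
  show ?case using kspan.zero[of FA "monomials r"] act_0 by (auto simp: free_algebra_on_simps(5))
next
  case (hm_x \<theta> i \<rho> r y)
  let ?\<mu> = "\<theta> @ i # \<rho>" and ?k = "Suc (length \<theta>)"
  obtain f where f: "f \<in> kspan FA (monomials r)" "act f = y * e \<nu>" using hm_x by blast
  have \<mu>: "?\<mu> \<in> IS" using Iseq_mset[OF K.hm_mset[OF hm_x.hyps]] \<nu> by blast
  have "xg ?k * eg ?\<mu> * f' \<in> monomials (r + dg i i)" if "f' \<in> monomials r" for f'
    using hom_monomials.x[of f' r D n \<alpha> ?\<mu> ?k] that \<mu> by (simp add: monomials_def Iseq_def add.commute)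
  from left_mult_monomials[OF this f(1)] have "xg ?k * eg ?\<mu> * f \<in> kspan FA (monomials (r + dg i i))" .
  moreover have "act (xg ?k * eg ?\<mu> * f) = x ?k * y * e \<nu>"
    using K.hm_e[OF hm_x.hyps, of "[]"] \<nu>
    by (simp add: FI.act_mult f(2) mult.assoc Iseq_def flip: x_def e_def) (simp add: e_e flip: mult.assoc)
  ultimately show ?case by blast
next
  case (hm_t \<theta> i j \<rho> r y)
  let ?\<mu> = "\<theta> @ i # j # \<rho>" and ?k = "Suc (length \<theta>)"
  obtain f where f: "f \<in> kspan FA (monomials r)" "act f = y * e \<nu>" using hm_t by blast
  have \<mu>: "?\<mu> \<in> IS" using Iseq_mset[OF K.hm_mset[OF hm_t.hyps]] \<nu> by blast
  have "\<tau>g ?k * eg ?\<mu> * f' \<in> monomials (r - dg i j)" if "f' \<in> monomials r" for f'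
    using hom_monomials.\<tau>[of f' r D n \<alpha> ?\<mu> ?k] that \<mu> by (simp add: monomials_def Iseq_def nth_append)
  from left_mult_monomials[OF this f(1)] have "\<tau>g ?k * eg ?\<mu> * f \<in> kspan FA (monomials (r - dg i j))" .
  moreover have "act (\<tau>g ?k * eg ?\<mu> * f) = t ?k * y * e \<nu>"
    using K.hm_e[OF hm_t.hyps, of "[]"] \<nu>
    by (simp add: FI.act_mult f(2) mult.assoc Iseq_def flip: t_def e_def) (simp add: e_e flip: mult.assoc)
  ultimately show ?case by blast
next
  case (hm_add \<mu> r y z)
  then obtain f g where "f \<in> kspan FA (monomials r)" "act f = y * e \<nu>" "g \<in> kspan FA (monomials r)" "act g = z * e \<nu>" by blast
  then show ?case using kspan.add[of f FA "monomials r" g]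
    by (intro bexI[of _ "f + g"]) (auto simp: FI.act_add distrib_right free_algebra_on_simps(4))
next
  case (hm_sc \<mu> r y c)
  then obtain f where "f \<in> kspan FA (monomials r)" "act f = y * e \<nu>" by blast
  then show ?case using kspan.smult[of f FA "monomials r" c]
    by (intro bexI[of _ "scal c * f"]) (auto simp: FI.act_mult sc_def mult.assoc free_algebra_on_simps(6))
qed

lemma block_elts_component: "f \<in> block_elts r \<Longrightarrow> in_trace_span (monomials r) f"
proof -
  assume fB: "f \<in> block_elts r"
  then obtain bl where bl: "f = belt xg \<tau>g 0 bl * eg (bseq bl)" "K.valid [] bl" "bseq bl \<in> IS" "K.bdeg bl = r"
    by (auto simp: block_elts_def)
  have "K.hm (bseq bl) (bseq bl) r (belt x t 0 bl)"
    using K.hm_belt[of bl "[]" "[]"] K.valid_pos[OF bl(2)] bl(4) by auto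
  from hm_monomials[OF bl(3) this] obtain g where g: "g \<in> kspan FA (monomials r)" "act g = act f"
    by (auto simp: bl(1) FI.act_mult act_belt e_def)
  have f: "f \<in> C" using fB block_elts_C by blast
  have "\<kappa> f = \<kappa> g" using act_eq_\<kappa>[OF f kspan_C[OF monomials_C g(1)]] g(2) by simp
  then show ?thesis unfolding in_trace_span_def using f g(1) q_eq by blast
qed

lemma Tr_component_block_elts: "Tr_component D n \<alpha> \<Lambda> r = q ` kspan FA (block_elts r)"
  unfolding Tr_component_eq
  by (intro equalityI span_subset[OF block_elts_C] span_subset[OF monomials_C] monomials_block_elts block_elts_component)

text \<open>A word becomes a sum of homogeneous monomials when \<Sum> e(\<nu>) is inserted behind
  each generator.\<close>

lemma carrier_block_elts: "f \<in> C \<Longrightarrow> in_trace_span (\<Union>r. block_elts r) f"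
proof -
  have BC: "(\<Union>r. block_elts r) \<subseteq> C" using block_elts_C by blast
  let ?H = "\<Union>r. monomials r"
  \<comment> \<open>Expressions equal, in the cyclotomic algebra, to combinations of homogeneous
    monomials of any degrees; all words are shown to lie in it.\<close>
  define U where "U = {f \<in> C. \<exists>g\<in>kspan FA ?H. \<kappa> f = \<kappa> g}"
  have HC: "?H \<subseteq> C" using monomials_C by blast
  have U_0: "0 \<in> U" using C_0 kspan.zero[of FA ?H] by (auto simp: U_def free_algebra_on_simps(5))
  have U_add: "f + g \<in> U" if fg: "f \<in> U" "g \<in> U" for f g
  proof -
    obtain f' g' where "f' \<in> kspan FA ?H" "\<kappa> f = \<kappa> f'" "g' \<in> kspan FA ?H" "\<kappa> g = \<kappa> g'"
      using fg by (auto simp: U_def)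
    then show ?thesis using fg kspan.add[of f' FA ?H g'] kspan_C[OF HC]
      by (auto simp: U_def \<kappa>_add C_add free_algebra_on_simps(4) intro!: bexI[of _ "f' + g'"])
  qed
  have U_scal: "scal c * f \<in> U" if f: "f \<in> U" for c f
  proof -
    obtain f' where "f' \<in> kspan FA ?H" "\<kappa> f = \<kappa> f'" using f by (auto simp: U_def)
    then show ?thesis using f kspan.smult[of f' FA ?H c] kspan_C[OF HC]
      by (auto simp: U_def \<kappa>_smult C_mult C_scal free_algebra_on_simps(6) intro!: bexI[of _ "scal c * f'"])
  qed
  have U_sum: "sum h S \<in> U" if "\<And>a. a \<in> S \<Longrightarrow> h a \<in> U" for h S
    using that by (induction S rule: infinite_finite_induct) (auto intro: U_0 U_add)
  have U_\<kappa>: "f \<in> U" if "f \<in> C" "g \<in> U" "\<kappa> f = \<kappa> g" for f g using that by (auto simp: U_def)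
  have step: "gen g * f \<in> U" if g: "g \<in> G" and f: "f \<in> ?H" for g f
  proof -
    obtain r where r: "(f, r) \<in> hom_monomials D n \<alpha>" using f by (auto simp: monomials_def)
    have fC: "f \<in> C" using f HC by blast
    have H: "h \<in> U" if "(h, s) \<in> hom_monomials D n \<alpha>" for h s
      using that HC kspan.base[of h ?H FA] by (auto simp: U_def monomials_def)
    have ex: "gen g * f \<in> U" if "\<And>\<nu>. \<nu> \<in> IS \<Longrightarrow> gen g * eg \<nu> * f \<in> U"
    proof (rule U_\<kappa>)
      show "gen g * f \<in> C" by (intro C_mult C_gen g fC)
      show "(\<Sum>\<nu>\<in>IS. gen g * eg \<nu> * f) \<in> U" by (intro U_sum that)
      have "\<kappa> (gen g * f) = \<kappa> (\<Sum>\<nu>\<in>IS. gen g * eg \<nu>) \<otimes>\<^bsub>A\<^esub> \<kappa> f"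
        using \<kappa>_expand[OF C_gen[OF g]] \<kappa>_mult[OF C_gen[OF g] fC] by simp
      also have "\<dots> = \<kappa> (\<Sum>\<nu>\<in>IS. gen g * eg \<nu> * f)"
        using \<kappa>_mult[of "\<Sum>\<nu>\<in>IS. gen g * eg \<nu>" f] fC g
        by (simp add: C_sum C_mult C_gen C_eg sum_distrib_right)
      finally show "\<kappa> (gen g * f) = \<kappa> (\<Sum>\<nu>\<in>IS. gen g * eg \<nu> * f)" .
    qed
    consider \<nu> where "g = GE \<nu>" "\<nu> \<in> IS" | k where "g = GX k" "1 \<le> k" "k \<le> n"
      | l where "g = GT l" "1 \<le> l" "l < n" using g by (auto simp: klr_gens_def)
    then show ?thesis
    proof cases
      case 1
      then show ?thesis using H hom_monomials.e[OF r] by blast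
    next
      case 2
      then show ?thesis using H hom_monomials.x[OF r] ex by blast
    next
      case 3
      then show ?thesis using H hom_monomials.\<tau>[OF r] ex by blast
    qed
  qed
  have stepU: "gen g * f \<in> U" if g: "g \<in> G" and f: "f \<in> U" for g f
  proof -
    obtain f' where f': "f' \<in> kspan FA ?H" "\<kappa> f = \<kappa> f'" using f by (auto simp: U_def)
    have "gen g * f' \<in> U" using f'(1)
      by (induction rule: kspan.induct)
        (auto simp: free_algebra_on_simps(4-6) U_0 distrib_left scal_left intro: U_add U_scal step[OF g])
    then show ?thesis
      using f f' kspan_C[OF HC f'(1)] C_gen[OF g]
      by (intro U_\<kappa>[of "gen g * f" "gen g * f'"]) (auto simp: U_def \<kappa>_mult C_mult)
  qed
  have word: "Poly_Mapping.single (Word w) 1 \<in> U" if "set w \<subseteq> G" for w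
    using that
  proof (induction w)
    case Nil
    have "1 \<in> kspan FA ?H" using hom_monomials.one by (intro kspan.base) (auto simp: monomials_def)
    then show ?case using C_1 by (auto simp: U_def simp flip: zero_free_monoid_def)
  next
    case (Cons g w)
    have "gen g * Poly_Mapping.single (Word w) 1 = Poly_Mapping.single (Word (g # w)) (1 :: 'k)"
      by (simp add: gen_def mult_single plus_free_monoid_def)
    then show ?case using stepU[of g "Poly_Mapping.single (Word w) 1"] Cons by simp
  qed
  assume f: "f \<in> C"
  have "f = (\<Sum>w\<in>Poly_Mapping.keys f. scal (Poly_Mapping.lookup f w) * Poly_Mapping.single w 1)"
    by (rule poly_mapping_eqI)
      (simp add: scal_def mult_single lookup_sum lookup_single when_def in_keys_iff)
  moreover have "(\<Sum>w\<in>Poly_Mapping.keys f. scal (Poly_Mapping.lookup f w) * Poly_Mapping.single w 1) \<in> U"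
  proof (intro U_sum U_scal)
    fix w assume "w \<in> Poly_Mapping.keys f"
    then show "Poly_Mapping.single w 1 \<in> U" using word[of "letters w"] f by (simp add: C_iff)
  qed
  ultimately have "f \<in> U" by simp
  then obtain g where g: "g \<in> kspan FA ?H" "\<kappa> f = \<kappa> g" by (auto simp: U_def)
  have mono: "in_trace_span (\<Union>r. block_elts r) h" if h: "h \<in> ?H" for h
  proof -
    obtain r where "h \<in> monomials r" using h by blast
    then have r: "in_trace_span (block_elts r) h" by (rule monomials_block_elts)
    have "q ` kspan FA (block_elts r) \<subseteq> q ` kspan FA (\<Union>r. block_elts r)"
      by (rule span_subset[OF BC]) (use BC in \<open>blast intro: in_trace_span_base\<close>)
    then show ?thesis using r by (auto simp: in_trace_span_def)
  qed
  have "in_trace_span (\<Union>r. block_elts r) g" using in_trace_span_kspan[OF BC mono g(1)] .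
  then show ?thesis using in_trace_span_q f g(2) q_eq by blast
qed

end

section \<open>Runs of equal letters\<close>

text \<open>A pair (i, [(k, l), ...]) holds consecutive blocks on one letter. Blocks may cut a run
  of equal letters into pieces, whereas the elements of the claim refer to maximal runs; grouping
  mediates between the two.\<close>

definition ungroup1 :: "'i \<times> (nat \<times> nat) list \<Rightarrow> ('i \<times> nat \<times> nat) list" where
  "ungroup1 g = map (\<lambda>(k, l). (fst g, k, l)) (snd g)"

definition ungroup :: "('i \<times> (nat \<times> nat) list) list \<Rightarrow> ('i \<times> nat \<times> nat) list" where
  "ungroup gl = concat (map ungroup1 gl)"

definition group_len :: "'i \<times> (nat \<times> nat) list \<Rightarrow> nat" where
  "group_len g = sum_list (map fst (snd g))"

lemma ungroup_simps: "ungroup [] = []" "ungroup (g # gl) = ungroup1 g @ ungroup gl" "ungroup (gl @ gl') = ungroup gl @ ungroup gl'"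
  by (simp_all add: ungroup_def)

lemma bseq_ungroup1: "bseq (ungroup1 g) = replicate (group_len g) (fst g)"
proof -
  have "bseq (map (\<lambda>(k, l). (i, k, l)) kls) = replicate (sum_list (map fst kls)) i" for i :: 'a and kls :: "(nat \<times> nat) list"
    by (induction kls) (auto simp: replicate_add)
  then show ?thesis by (simp add: ungroup1_def group_len_def)
qed

lemma in_bseq: "(i, k, l) \<in> set bl \<Longrightarrow> 1 \<le> k \<Longrightarrow> i \<in> set (bseq bl)"
  by (induction bl) auto

lemma upt_0_Suc: "[0..<Suc m] = 0 # map Suc [0..<m]"
  by (simp add: upt_conv_Cons map_Suc_upt del: upt_Suc)

lemma belt_concat: "belt x t p (concat bls) =
    prod_list (map (\<lambda>s. belt x t (p + length (bseq (concat (take s bls)))) (bls ! s)) [0..<length bls])"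
proof (induction bls arbitrary: p)
  case (Cons b bls)
  have "map (\<lambda>s. belt x t (p + length (bseq (concat (take s (b # bls))))) ((b # bls) ! s)) [0..<length (b # bls)]
      = belt x t p b # map (\<lambda>s. belt x t (p + length (bseq b) + length (bseq (concat (take s bls)))) (bls ! s)) [0..<length bls]"
    by (simp only: length_Cons upt_0_Suc list.map map_map) (simp add: comp_def add.assoc)
  then show ?case using Cons[of "p + length (bseq b)"] by (simp add: belt_append)
qed simp

lemma belt_nth: "belt x t p bl =
    prod_list (map (\<lambda>s. belt x t (p + length (bseq (take s bl))) [bl ! s]) [0..<length bl])"
proof -
  have c: "concat (map (\<lambda>b. [b]) xs) = xs" for xs :: "('b \<times> nat \<times> nat) list" by (induction xs) auto
  have "map (\<lambda>s. belt x t (p + length (bseq (concat (take s (map (\<lambda>b. [b]) bl))))) (map (\<lambda>b. [b]) bl ! s)) [0..<length bl]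
      = map (\<lambda>s. belt x t (p + length (bseq (take s bl))) [bl ! s]) [0..<length bl]"
    by (intro map_cong) (auto simp: take_map c)
  then show ?thesis using belt_concat[of x t p "map (\<lambda>b. [b]) bl"] by (simp only: c length_map)
qed

lemma group_exists: "\<exists>gl. ungroup gl = bl \<and> distinct_adj (map fst gl) \<and> (\<forall>g\<in>set gl. snd g \<noteq> [])"
proof (induction bl)
  case Nil
  show ?case by (intro exI[of _ "[]"]) (simp add: ungroup_simps)
next
  case (Cons b bl)
  then obtain gl where gl: "ungroup gl = bl" "distinct_adj (map fst gl)" "\<forall>g\<in>set gl. snd g \<noteq> []" by blast
  obtain i k l where b: "b = (i, k, l)" by (cases b)
  show ?case
  proof (cases gl)
    case Nil
    then show ?thesis using gl by (intro exI[of _ "[(i, [(k, l)])]"]) (auto simp: ungroup_simps ungroup1_def b)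
  next
    case (Cons g gl')
    show ?thesis
    proof (cases "fst g = i")
      case True
      then show ?thesis using gl Cons
        by (intro exI[of _ "(i, (k, l) # snd g) # gl'"]) (auto simp: ungroup_simps ungroup1_def b distinct_adj_Cons)
    next
      case False
      then show ?thesis using gl Cons
        by (intro exI[of _ "(i, [(k, l)]) # gl"]) (auto simp: ungroup_simps ungroup1_def b distinct_adj_Cons)
    qed
  qed
qed

lemma runs_replicate:
  assumes b: "b \<ge> 1" and \<nu>: "\<nu> = [] \<or> hd \<nu> \<noteq> i"
  shows "runs (replicate b i @ \<nu>) = (i, b) # runs \<nu>"
proof -
  obtain c where c: "b = Suc c" using b by (cases b) auto
  have t: "takeWhile (\<lambda>j. j = i) \<nu> = []" and d: "dropWhile (\<lambda>j. j = i) \<nu> = \<nu>" using \<nu> by (cases \<nu>; simp)+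
  have "takeWhile (\<lambda>j. j = i) (replicate c i @ \<nu>) = replicate c i"
    "dropWhile (\<lambda>j. j = i) (replicate c i @ \<nu>) = \<nu>" using t d by (induction c) auto
  then show ?thesis by (simp add: c)
qed

lemma runs_ungroup:
  "distinct_adj (map fst gl) \<Longrightarrow> (\<And>g. g \<in> set gl \<Longrightarrow> group_len g \<ge> 1) \<Longrightarrow>
    runs (bseq (ungroup gl)) = map (\<lambda>g. (fst g, group_len g)) gl"
proof (induction gl)
  case (Cons g gl)
  have "bseq (ungroup gl) = [] \<or> hd (bseq (ungroup gl)) \<noteq> fst g"
  proof (cases gl)
    case (Cons g' gl')
    then have "group_len g' \<ge> 1" "fst g' \<noteq> fst g" using Cons.prems by auto
    then show ?thesis using Cons by (cases "group_len g'") (auto simp: ungroup_simps bseq_ungroup1)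
  qed (simp add: ungroup_simps)
  moreover have "distinct_adj (map fst gl)" using Cons.prems by (cases gl) auto
  ultimately show ?case using Cons by (simp add: ungroup_simps bseq_ungroup1 runs_replicate)
qed (simp add: ungroup_simps)

lemma bseq_ungroup: "bseq (ungroup gl) = concat (map (\<lambda>g. replicate (group_len g) (fst g)) gl)"
  by (induction gl) (simp_all add: ungroup_simps bseq_ungroup1)

context
  fixes gl :: "('i \<times> (nat \<times> nat) list) list" and \<nu> :: "'i list"
  assumes runs: "runs \<nu> = map (\<lambda>g. (fst g, group_len g)) gl"
begin

lemma bseq_ungroup_runs: "bseq (ungroup gl) = \<nu>"
  using concat_runs[of \<nu>] by (simp add: runs bseq_ungroup comp_def)

lemma nblocks_eq: "nblocks \<nu> = length gl"
  by (simp add: nblocks_def runs)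

lemma block_val_eq: "s < length gl \<Longrightarrow> block_val \<nu> (Suc s) = fst (gl ! s)"
  and block_len_eq: "s < length gl \<Longrightarrow> block_len \<nu> (Suc s) = group_len (gl ! s)"
  by (simp_all add: block_val_def block_len_def runs)

lemma block_end_eq: "s \<le> length gl \<Longrightarrow> block_end \<nu> s = length (bseq (ungroup (take s gl)))"
proof (induction s)
  case (Suc s)
  have "block_end \<nu> (Suc s) = block_end \<nu> s + block_len \<nu> (Suc s)" by (simp add: block_end_def)
  then show ?case using Suc by (simp add: block_len_eq take_Suc_conv_app_nth ungroup_simps bseq_ungroup1)
qed (simp add: block_end_def ungroup_simps)

lemma split_block: "\<nu> = bseq (ungroup (take s gl)) @ bseq (ungroup (drop s gl))"
  using bseq_ungroup_runs append_take_drop_id[of s gl] by (metis bseq_simps(3) ungroup_simps(3))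

lemma split_block': "s < length gl \<Longrightarrow>
    \<nu> = bseq (ungroup (take s gl)) @ bseq (ungroup1 (gl ! s)) @ bseq (ungroup (drop (Suc s) gl))"
  using split_block[of s] by (simp add: Cons_nth_drop_Suc[symmetric] ungroup_simps)

lemma take_block: "s \<le> length gl \<Longrightarrow> take (block_end \<nu> s) \<nu> = bseq (ungroup (take s gl))"
  using split_block[of s] block_end_eq[of s] by (metis append_eq_conv_conj)

lemma block_end_le: "s \<le> length gl \<Longrightarrow> block_end \<nu> s \<le> length \<nu>"
  using split_block[of s] block_end_eq[of s] by (metis le_add1 length_append)

end

text \<open>The only way to fill a run of b letters in top degree: single letters with exponents m -
  1, m - 3, ..., until one letter is left or the remaining m equals the remaining length, and then
  one last block. As a_ii = 2, each letter lowers m by 2.\<close>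

fun top_blocks :: "nat \<Rightarrow> int \<Rightarrow> (nat \<times> nat) list" where
  "top_blocks 0 m = []"
| "top_blocks (Suc b) m = (if b = 0 \<or> m = int (Suc b) then [(Suc b, nat (m - int (Suc b)))]
    else (1, nat (m - 1)) # top_blocks b (m - 2))"

fun tight_group :: "int \<Rightarrow> (nat \<times> nat) list \<Rightarrow> bool" where
  "tight_group m [] \<longleftrightarrow> True"
| "tight_group m ((k, l) # r) \<longleftrightarrow> 1 \<le> k \<and> int l = m - int k \<and> (k = 1 \<or> l = 0) \<and> tight_group (m - 2 * int k) r"

text \<open>A block with k > 1 has l = 0 and therefore m = k. It leaves the value -k, in which no
  further block fits.\<close>

lemma tight_group_unique:
  "tight_group m kls \<Longrightarrow> kls \<noteq> [] \<Longrightarrow> 1 \<le> sum_list (map fst kls) \<and> int (sum_list (map fst kls)) \<le> m \<and>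
    kls = top_blocks (sum_list (map fst kls)) m"
proof (induction m kls rule: tight_group.induct)
  case (2 m k l r)
  show ?case
  proof (cases "r = []")
    case True
    obtain c where "k = Suc c" using 2 by (cases k) auto
    then show ?thesis using 2 True by auto
  next
    case False
    define b where "b = sum_list (map fst r)"
    have IH: "1 \<le> b" "int b \<le> m - 2 * int k" "r = top_blocks b (m - 2 * int k)" using 2 False by (auto simp: b_def)
    have l: "1 \<le> k" "int l = m - int k" "k = 1 \<or> l = 0" using 2 by auto
    then have k: "k = 1" using IH by linarith
    have "sum_list (map fst ((k, l) # r)) = Suc b" by (simp add: k b_def)
    moreover have "top_blocks (Suc b) m = (k, l) # r" using IH l k by simp
    ultimately show ?thesis using IH k by simp
  qed
qed simp

lemma top_blocks_tight: "1 \<le> b \<Longrightarrow> int b \<le> m \<Longrightarrow> tight_group m (top_blocks b m) \<and> sum_list (map fst (top_blocks b m)) = b \<and> top_blocks b m \<noteq> []"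
proof (induction b m rule: top_blocks.induct)
  case (2 b m)
  show ?case
  proof (cases "b = 0 \<or> m = int (Suc b)")
    case True
    then show ?thesis using 2 by auto
  next
    case False
    then have "tight_group (m - 2) (top_blocks b (m - 2)) \<and> sum_list (map fst (top_blocks b (m - 2))) = b"
      using 2 by auto
    then show ?thesis using False 2 by simp
  qed
qed simp

lemma stairs_0: "stairs c l 0 = 1"
  by (simp add: stairs_def)

lemma stairs_Suc: "stairs c l (Suc p) = xg (Suc c) ^ nat (l - 1) * stairs (Suc c) (l - 2) p"
proof -
  have "[1..<Suc p + 1] = 1 # map Suc [1..<p + 1]" by (simp add: upt_conv_Cons map_Suc_upt del: upt_Suc)
  moreover have "nat (l - 2 * int (Suc j) + 1) = nat (l - 2 - 2 * int j + 1)" for j by (rule arg_cong) simp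
  ultimately show ?thesis unfolding stairs_def by (simp only: list.map map_map prod_list.Cons comp_def) simp
qed

text \<open>After j single letters m - 2j meets the remaining length b - j exactly at j = m - b; for
  m \<ge> 2b - 1 this does not happen before the last letter. The case m = b is included, with an
  empty staircase.\<close>

lemma belt_top_blocks: "1 \<le> b \<Longrightarrow> int b \<le> m \<Longrightarrow> (belt xg \<tau>g c (ungroup1 (i, top_blocks b m)) :: ('i, 'k::field) klr_free) =
    (if m \<ge> 2 * int b - 1 then stairs c m b
     else stairs c m (nat (m - int b)) * e_int (c + nat (m - int b) + 1) (c + b))"
proof (induction b m arbitrary: c rule: top_blocks.induct)
  case (2 b m)
  have e1: "e_prod xg \<tau>g a a = (1 :: ('i, 'k) klr_free)" for a by (simp add: e_prod_def)
  have ee: "e_int u v = (e_prod xg \<tau>g u v :: ('i, 'k) klr_free)" for u v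
    by (simp add: e_int_def e_prod_def \<tau>w_def tw_prod_def)
  show ?case
  proof (cases "b = 0 \<or> m = int (Suc b)")
    case True
    show ?thesis
    proof (cases "b = 0")
      case True
      then show ?thesis using 2 by (simp add: ungroup1_def e1 stairs_Suc stairs_0)
    next
      case False
      then show ?thesis using True by (simp add: ungroup1_def stairs_0 ee)
    qed
  next
    case False
    then have b: "1 \<le> b" "int b \<le> m - 2" using 2 by auto
    have n: "nat (m - int (Suc b)) = Suc (nat (m - 2 - int b))" using b by linarith
    have "(belt xg \<tau>g c (ungroup1 (i, top_blocks (Suc b) m)) :: ('i, 'k) klr_free) = xg (Suc c) ^ nat (m - 1) * belt xg \<tau>g (Suc c) (ungroup1 (i, top_blocks b (m - 2)))"
      using False by (simp add: ungroup1_def e1)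
    also have "(belt xg \<tau>g (Suc c) (ungroup1 (i, top_blocks b (m - 2))) :: ('i, 'k) klr_free) =
      (if m - 2 \<ge> 2 * int b - 1 then stairs (Suc c) (m - 2) b
       else stairs (Suc c) (m - 2) (nat (m - 2 - int b)) * e_int (Suc c + nat (m - 2 - int b) + 1) (Suc c + b))"
      using 2(1)[OF False b, of "Suc c"] .
    also have "xg (Suc c) ^ nat (m - 1) * \<dots> = (if m \<ge> 2 * int (Suc b) - 1 then stairs c m (Suc b)
     else stairs c m (nat (m - int (Suc b))) * e_int (c + nat (m - int (Suc b)) + 1) (c + Suc b))"
      unfolding n stairs_Suc by (simp add: mult.assoc)
    finally show ?thesis .
  qed
qed simp

context klr_rel
begin

text \<open>Equality case of the degree bound: \<open>l \<le> \<ell> - k \<le> k (\<ell> - k)\<close> with \<open>\<ell> = ell \<theta> i\<close>.\<close>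

fun tight :: "'i list \<Rightarrow> ('i \<times> nat \<times> nat) list \<Rightarrow> bool" where
  "tight \<theta> [] \<longleftrightarrow> True"
| "tight \<theta> ((i, k, l) # bl) \<longleftrightarrow>
    int l = ell \<theta> i - int k \<and> (k = 1 \<or> l = 0) \<and> tight (\<theta> @ replicate k i) bl"

lemma tight_append: "tight \<theta> (bl @ bl') \<longleftrightarrow> tight \<theta> bl \<and> tight (\<theta> @ bseq bl) bl'"
  by (induction \<theta> bl rule: tight.induct) auto

lemma ell_replicate: "i \<in> I \<Longrightarrow> ell (\<theta> @ replicate k i) i = ell \<theta> i - 2 * int k"
  by (simp add: ell_def ca_diag sum_list_replicate)

lemma valid_tight_ungroup1:
  "i \<in> I \<Longrightarrow> valid \<theta> (ungroup1 (i, kls)) \<and> tight \<theta> (ungroup1 (i, kls)) \<longleftrightarrow> tight_group (ell \<theta> i) kls"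
proof (induction kls arbitrary: \<theta>)
  case (Cons kl kls)
  obtain k l where kl: "kl = (k, l)" by (cases kl)
  have "valid (\<theta> @ replicate k i) (ungroup1 (i, kls)) \<and> tight (\<theta> @ replicate k i) (ungroup1 (i, kls))
      \<longleftrightarrow> tight_group (ell \<theta> i - 2 * int k) kls" using Cons ell_replicate by simp
  then show ?case using Cons.prems by (auto simp: ungroup1_def kl)
qed (simp add: ungroup1_def)

text \<open>Each block is bounded by \<open>ell\<close> at its own start, which is the value at the
  start of the run minus twice the letters in between. So l stays below the initial value, and the
  lengths add up to at most that value.\<close>

lemma valid_ungroup1_bounds:
  "valid \<theta> (ungroup1 (i, kls)) \<Longrightarrow> kls \<noteq> [] \<Longrightarrow>
    i \<in> I \<and> (\<forall>(k, l)\<in>set kls. 1 \<le> k \<and> int l < ell \<theta> i) \<and> 1 \<le> group_len (i, kls) \<and> int (group_len (i, kls)) \<le> ell \<theta> i"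
proof (induction kls arbitrary: \<theta>)
  case (Cons kl kls)
  obtain k l where kl: "kl = (k, l)" by (cases kl)
  have v: "i \<in> I" "1 \<le> k" "int l + int k \<le> ell \<theta> i" "valid (\<theta> @ replicate k i) (ungroup1 (i, kls))"
    using Cons.prems by (auto simp: ungroup1_def kl)
  show ?case
  proof (cases "kls = []")
    case True
    then show ?thesis using v by (simp add: kl group_len_def)
  next
    case False
    have "(\<forall>(k, l)\<in>set kls. 1 \<le> k \<and> int l < ell \<theta> i - 2 * int k') \<longrightarrow> (\<forall>(k, l)\<in>set kls. 1 \<le> k \<and> int l < ell \<theta> i)"
      for k' by fastforce
    then show ?thesis using Cons.IH[OF v(4) False] v ell_replicate[OF v(1), of \<theta> k]
      by (auto simp: kl group_len_def)
  qed
qed simp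

lemma valid_ungroup: "valid \<theta> (ungroup gl) \<longleftrightarrow> (\<forall>s<length gl. valid (\<theta> @ bseq (ungroup (take s gl))) (ungroup1 (gl ! s)))"
  by (induction gl arbitrary: \<theta>) (simp_all add: ungroup_simps valid_append All_less_Suc2)

lemma tight_ungroup: "tight \<theta> (ungroup gl) \<longleftrightarrow> (\<forall>s<length gl. tight (\<theta> @ bseq (ungroup (take s gl))) (ungroup1 (gl ! s)))"
  by (induction gl arbitrary: \<theta>) (simp_all add: ungroup_simps tight_append All_less_Suc2)

lemma belt_e: "(\<And>i k l. (i, k, l) \<in> set bl \<Longrightarrow> 1 \<le> k) \<Longrightarrow> \<nu> = \<theta> @ bseq bl @ \<rho> \<Longrightarrow> length \<nu> = n \<Longrightarrow>
    belt x t (length \<theta>) bl * e \<nu> = e \<nu> * belt x t (length \<theta>) bl"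
  using hm_e[OF hm_belt[of bl \<theta> \<rho>], of "[]"] by simp

lemma belt_Alg: "belt x t p bl \<in> Alg"
proof (induction bl arbitrary: p)
  case (Cons b bl)
  then show ?case by (cases b) (auto intro!: Alg_mult Alg_pow Alg_x Alg_e_prod)
qed (simp add: Alg_1)

lemma belt_comm:
  "(\<And>i k l. (i, k, l) \<in> set bl \<Longrightarrow> 1 \<le> k) \<Longrightarrow>
   (\<And>j. p < j \<Longrightarrow> j < p + length (bseq bl) \<Longrightarrow> w * t j = t j * w) \<Longrightarrow>
   (\<And>j. p < j \<Longrightarrow> j \<le> p + length (bseq bl) \<Longrightarrow> w * x j = x j * w) \<Longrightarrow> w * belt x t p bl = belt x t p bl * w"
proof (induction bl arbitrary: p)
  case (Cons b bl)
  obtain i k l where b: "b = (i, k, l)" by (cases b)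
  then have k: "1 \<le> k" using Cons.prems(1) by auto
  have "w * belt x t (p + k) bl = belt x t (p + k) bl * w"
    by (rule Cons.IH) (use Cons.prems b in auto)
  moreover have "w * e_prod x t (p + 1) (p + k) = e_prod x t (p + 1) (p + k) * w"
    using Cons.prems(2,3) by (intro e_prod_comm) (auto simp: b)
  moreover have "w * x (p + k) ^ l = x (p + k) ^ l * w"
    using Cons.prems(3)[of "p + k"] k by (intro comm_power) (auto simp: b)
  ultimately show ?case by (simp add: b comm_times)
qed simp

abbreviation merged :: "'i \<times> (nat \<times> nat) list \<Rightarrow> 'i \<times> nat \<times> nat" where
  "merged g \<equiv> (fst g, group_len g, 0)"

text \<open>Runs are merged from left to right. The prefix and the suffix commute with the run in
  the middle, so their product is the Y of \<open>merge_block\<close>.\<close>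

lemma merge_groups:
  "(\<And>i k l. (i, k, l) \<in> set (pre @ ungroup gl) \<Longrightarrow> i \<in> I \<and> 1 \<le> k) \<Longrightarrow> (\<And>i k l. (i, k, l) \<in> set (ungroup gl) \<Longrightarrow> l = 0) \<Longrightarrow>
   (\<And>g. g \<in> set gl \<Longrightarrow> snd g \<noteq> []) \<Longrightarrow>
   \<nu> = bseq pre @ bseq (ungroup gl) \<Longrightarrow> length \<nu> = n \<Longrightarrow>
   \<exists>c. belt x t 0 (pre @ ungroup gl) * e \<nu> - sc c * (belt x t 0 (pre @ map merged gl) * e \<nu>) \<in> lsp CC"
proof (induction gl arbitrary: pre)
  case Nil
  show ?case by (intro exI[of _ 1]) (simp add: sc_1 lsp_0 ungroup_simps)
next
  case (Cons g gl)
  obtain i kls where g: "g = (i, kls)" by (cases g)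
  let ?k = "group_len g" and ?\<theta> = "bseq pre" and ?\<rho> = "bseq (ungroup gl)"
  let ?p = "length ?\<theta>"
  have pos: "\<And>i k l. (i, k, l) \<in> set pre \<Longrightarrow> 1 \<le> k" "\<And>i k l. (i, k, l) \<in> set (ungroup1 g) \<Longrightarrow> 1 \<le> k"
    "\<And>i k l. (i, k, l) \<in> set (ungroup gl) \<Longrightarrow> 1 \<le> k"
    using Cons.prems(1) by (fastforce simp: ungroup_simps)+
  have kls: "kls \<noteq> []" using Cons.prems(3)[of g] by (simp add: g)
  have kpos: "1 \<le> k \<and> i \<in> I \<and> l = 0" if "(k, l) \<in> set kls" for k l
  proof -
    have m: "(i, k, l) \<in> set (ungroup (g # gl))" using that by (force simp: ungroup_simps ungroup1_def g)
    show ?thesis using Cons.prems(1)[of i k l] Cons.prems(2)[OF m] m by simp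
  qed
  then have iI: "i \<in> I" using kls by (cases kls) auto
  have klr_cl: "1 \<le> ?k" using kls kpos[of "fst (hd kls)" "snd (hd kls)"] by (cases kls) (auto simp: group_len_def g)
  have \<nu>: "\<nu> = ?\<theta> @ replicate ?k i @ ?\<rho>" using Cons.prems(4) by (simp add: ungroup_simps bseq_ungroup1 g)
  have ln: "?p + ?k + length ?\<rho> = n" using Cons.prems(5) unfolding \<nu> by simp
  let ?A = "belt x t 0 pre" and ?B = "belt x t (?p + ?k) (ungroup gl)"
  have AB: "?A * ?B \<in> Alg" by (intro Alg_mult belt_Alg)
  have Ae: "?A * e \<nu> = e \<nu> * ?A"
    using belt_e[of pre \<nu> "[]" "replicate ?k i @ ?\<rho>"] pos(1) Cons.prems(5) \<nu> by simp
  have Be: "?B * e \<nu> = e \<nu> * ?B"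
    using belt_e[of "ungroup gl" \<nu> "?\<theta> @ replicate ?k i" "[]"] pos(3) Cons.prems(5) \<nu> by simp
  have ABe: "?A * ?B * e \<nu> = e \<nu> * (?A * ?B)" by (rule comm_times[symmetric]) (simp_all add: Ae Be)
  have Bx: "x j * ?B = ?B * x j" if "j \<le> ?p + ?k" for j
    using pos(3) that by (intro belt_comm) (auto simp: x_x t_x_far)
  have Bt: "t j * ?B = ?B * t j" if "j < ?p + ?k" for j
    using pos(3) that by (intro belt_comm) (auto simp: t_x_far t_t_far)
  have Ax: "x j * ?A = ?A * x j" if "?p < j" for j
    using pos(1) that by (intro belt_comm) (auto simp: x_x t_x_far)
  have At: "t j * ?A = ?A * t j" if "?p < j" for j
    using pos(1) that by (intro belt_comm) (auto simp: t_x_far t_t_far[symmetric])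
  have ABx: "?A * ?B * x j = x j * (?A * ?B)" if "Suc ?p \<le> j" "j \<le> ?p + ?k" for j
    using that Ax[of j] Bx[of j] by (intro comm_times[symmetric]) auto
  have ABt: "?A * ?B * t j = t j * (?A * ?B)" if "Suc ?p \<le> j" "j < ?p + ?k" for j
    using that At[of j] Bt[of j] by (intro comm_times[symmetric]) auto
  have midB: "belt x t ?p bl * ?B = ?B * belt x t ?p bl"
    if "\<And>i k l. (i, k, l) \<in> set bl \<Longrightarrow> 1 \<le> k" "length (bseq bl) = ?k" for bl
    by (rule belt_comm[of bl ?p ?B, symmetric]) (use that Bx Bt in auto)
  let ?ws = "map (\<lambda>s. belt x t (?p + length (bseq (take s (ungroup1 g)))) [ungroup1 g ! s]) [0..<length (ungroup1 g)]"
  have ws: "\<exists>a b. w = e_prod x t a b \<and> Suc ?p \<le> a \<and> a \<le> b \<and> b \<le> ?p + ?k" if w: "w \<in> set ?ws" for w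
  proof -
    obtain s where s: "s < length (ungroup1 g)" "w = belt x t (?p + length (bseq (take s (ungroup1 g)))) [ungroup1 g ! s]"
      using w by auto
    obtain j k l where jkl: "ungroup1 g ! s = (j, k, l)" by (cases "ungroup1 g ! s")
    then have "(j, k, l) \<in> set (ungroup1 g)" using s by (metis nth_mem)
    then have "(k, l) \<in> set kls" by (auto simp: ungroup1_def g)
    then have kl: "1 \<le> k" "l = 0" using kpos by auto
    have "bseq (ungroup1 g) = bseq (take s (ungroup1 g)) @ bseq [ungroup1 g ! s] @ bseq (drop (Suc s) (ungroup1 g))"
      using id_take_nth_drop[OF s(1)] by (metis append_Cons append_Nil bseq_simps(3))
    from arg_cong[OF this, of length] have "length (bseq (take s (ungroup1 g))) + k \<le> ?k"
      by (simp add: bseq_ungroup1 jkl)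
    then show ?thesis using s(2) kl
      by (intro exI[of _ "Suc (?p + length (bseq (take s (ungroup1 g))))"] exI[of _ "?p + length (bseq (take s (ungroup1 g))) + k"])
        (simp add: jkl)
  qed
  have f: "e \<nu> = e (?\<theta> @ replicate ?k i @ ?\<rho>)" using \<nu> by simp
  obtain c where c: "?A * ?B * prod_list ?ws * e \<nu> - sc c * (?A * ?B * e_prod x t (Suc ?p) (?p + ?k) * e \<nu>) \<in> lsp CC"
    using merge_block[OF iI klr_cl ln f AB ABe ABx ABt ws] by blast
  have 1: "?A * ?B * prod_list ?ws = belt x t 0 (pre @ ungroup (g # gl))"
  proof -
    have "?A * ?B * prod_list ?ws = ?A * (?B * belt x t ?p (ungroup1 g))" by (simp only: belt_nth[of x t ?p] mult.assoc)
    also have "\<dots> = ?A * (belt x t ?p (ungroup1 g) * ?B)" by (subst midB) (use pos(2) in \<open>auto simp: bseq_ungroup1\<close>)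
    finally show ?thesis by (simp add: ungroup_simps belt_append bseq_ungroup1)
  qed
  have 2: "?A * ?B * e_prod x t (Suc ?p) (?p + ?k) = belt x t 0 ((pre @ [merged g]) @ ungroup gl)"
  proof -
    have "?A * ?B * e_prod x t (Suc ?p) (?p + ?k) = ?A * (?B * belt x t ?p [merged g])" by (simp add: mult.assoc)
    also have "\<dots> = ?A * (belt x t ?p [merged g] * ?B)" by (subst midB) (use klr_cl in auto)
    finally show ?thesis by (simp add: belt_append mult.assoc)
  qed
  have "\<exists>c. belt x t 0 ((pre @ [merged g]) @ ungroup gl) * e \<nu> - sc c * (belt x t 0 ((pre @ [merged g]) @ map merged gl) * e \<nu>) \<in> lsp CC"
  proof (rule Cons.IH)
    show "j \<in> I \<and> 1 \<le> k" if "(j, k, l) \<in> set ((pre @ [merged g]) @ ungroup gl)" for j k l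
      using that Cons.prems(1)[of j k l] iI klr_cl by (auto simp: ungroup_simps g)
    show "l = 0" if "(j, k, l) \<in> set (ungroup gl)" for j k l
      using that Cons.prems(2)[of j k l] by (simp add: ungroup_simps)
    show "snd g' \<noteq> []" if "g' \<in> set gl" for g' using that Cons.prems(3) by simp
    show "\<nu> = bseq (pre @ [merged g]) @ bseq (ungroup gl)" using \<nu> by (simp add: g)
  qed (fact Cons.prems(5))
  then obtain d where d: "belt x t 0 ((pre @ [merged g]) @ ungroup gl) * e \<nu> - sc d * (belt x t 0 ((pre @ [merged g]) @ map merged gl) * e \<nu>) \<in> lsp CC"
    by blast
  let ?X = "belt x t 0 (pre @ ungroup (g # gl)) * e \<nu>" and ?Y = "belt x t 0 ((pre @ [merged g]) @ ungroup gl) * e \<nu>"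
    and ?Z = "belt x t 0 ((pre @ [merged g]) @ map merged gl) * e \<nu>"
  have "?X - sc c * ?Y + sc c * (?Y - sc d * ?Z) \<in> lsp CC"
    using c d unfolding 1 2 by (intro lsp_add lsp_sc)
  moreover have "?X - sc c * ?Y + sc c * (?Y - sc d * ?Z) = ?X - sc (c * d) * ?Z"
    by (simp add: right_diff_distrib sc_mult mult.assoc)
  ultimately have "?X - sc (c * d) * ?Z \<in> lsp CC" by (simp only:)
  then show ?case by (intro exI[of _ "c * d"]) simp
qed

end

context cyc_setup
begin

section \<open>The degree bound\<close>

lemma coroot_add: "i \<in> idx D \<Longrightarrow> coroot D i (y + z) = coroot D i y + coroot D i z"
  using coroot_Pvee[of i] by (simp add: Pvee_def module_hom_iff)

lemma coroot_0: "i \<in> idx D \<Longrightarrow> coroot D i 0 = 0"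
  using coroot_add[of i 0 0] by simp

lemma coroot_diff: "i \<in> idx D \<Longrightarrow> coroot D i (y - z) = coroot D i y - coroot D i z"
  using coroot_add[of i "y - z" z] by simp

abbreviation rsum where "rsum \<theta> \<equiv> \<Sum>i\<leftarrow>\<theta>. sroot D i"

lemma coroot_rsum: "i \<in> idx D \<Longrightarrow> set \<theta> \<subseteq> idx D \<Longrightarrow> coroot D i (rsum \<theta>) = (\<Sum>j\<leftarrow>\<theta>. cartan D i j)"
  by (induction \<theta>) (simp_all add: coroot_0 coroot_add coroot_root)

lemma K_ell: "i \<in> idx D \<Longrightarrow> set \<theta> \<subseteq> idx D \<Longrightarrow> K.ell \<theta> i = coroot D i (\<Lambda> - rsum \<theta>)"
  using \<Lambda> by (simp add: K.ell_def coroot_diff coroot_rsum Pplus_def)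

definition dt where "dt \<theta> = d_top D \<Lambda> (rsum \<theta>)"

text \<open>For \<beta> the sum of the roots of \<theta>, 2 (\<alpha>_i, \<Lambda> - \<beta>) =
  \<ell> (\<alpha>_i, \<alpha>_i); the -1 is the square of the new root.\<close>

lemma dt_snoc: "i \<in> idx D \<Longrightarrow> set \<theta> \<subseteq> idx D \<Longrightarrow> dt (\<theta> @ [i]) = dt \<theta> + of_int (K.ell \<theta> i - 1) * dg i i"
  using coroot_pform[of i \<Lambda>] coroot_pform[of i "rsum \<theta>"] pform_sym[of "rsum \<theta>" "sroot D i"]
  by (simp add: dt_def d_top_def K_ell coroot_diff pform_add_left pform_add_right algebra_simps)

lemma dt_replicate: "i \<in> idx D \<Longrightarrow> set \<theta> \<subseteq> idx D \<Longrightarrow>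
    dt (\<theta> @ replicate k i) = dt \<theta> + of_int (int k * (K.ell \<theta> i - int k)) * dg i i"
proof (induction k arbitrary: \<theta>)
  case (Suc k)
  have IH: "dt ((\<theta> @ [i]) @ replicate k i) = dt (\<theta> @ [i]) + of_int (int k * (K.ell (\<theta> @ [i]) i - int k)) * dg i i"
    using Suc.prems by (intro Suc.IH) auto
  have "dt (\<theta> @ replicate (Suc k) i) = dt ((\<theta> @ [i]) @ replicate k i)" by simp
  also have "\<dots> = dt \<theta> + of_int (K.ell \<theta> i - 1) * dg i i + of_int (int k * (K.ell \<theta> i - 2 - int k)) * dg i i"
    unfolding IH using Suc.prems K.ell_replicate[of i \<theta> 1] by (simp add: dt_snoc)
  also have "\<dots> = dt \<theta> + of_int (int (Suc k) * (K.ell \<theta> i - int (Suc k))) * dg i i"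
    by (simp add: algebra_simps)
  finally show ?case .
qed simp

text \<open>For one block l \<le> m \<le> k m, where m = \<ell> - k \<ge> 0, with equality
  throughout if and only if l = m and k = 1 or l = 0. The bounds add up along the sequence, so
  equality of the totals forces it in every block.\<close>

lemma bdeg_tight:
  "K.valid \<theta> bl \<Longrightarrow> set \<theta> \<subseteq> idx D \<Longrightarrow> K.bdeg bl \<le> dt (\<theta> @ bseq bl) - dt \<theta> \<and>
    (K.bdeg bl = dt (\<theta> @ bseq bl) - dt \<theta> \<longleftrightarrow> K.tight \<theta> bl)"
proof (induction \<theta> bl rule: K.valid.induct)
  case (2 \<theta> i k l bl)
  define m where "m = K.ell \<theta> i - int k"
  have v: "i \<in> idx D" "1 \<le> k" "int l \<le> m" "K.valid (\<theta> @ replicate k i) bl" using 2(2) by (auto simp: m_def)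
  have s: "set (\<theta> @ replicate k i) \<subseteq> idx D" using v 2(3) by (auto dest: in_set_replicate[THEN iffD1])
  note IH = 2(1)[OF v(4) s]
  have d: "dt (\<theta> @ replicate k i) = dt \<theta> + of_int (int k * m) * dg i i"
    using dt_replicate[OF v(1) 2(3)] by (simp add: m_def)
  have m0: "0 \<le> m" using v by linarith
  have km: "m \<le> int k * m" using mult_right_mono[of 1 "int k" m] v m0 by simp
  then have le: "int l \<le> int k * m" using v by linarith
  have eq: "int l = int k * m \<longleftrightarrow> int l = m \<and> (k = 1 \<or> l = 0)"
  proof
    assume a: "int l = int k * m"
    then have "int l = m" "int k * m = m" using km v by linarith+
    then show "int l = m \<and> (k = 1 \<or> l = 0)" by auto
  qed auto
  have b: "K.bdeg ((i, k, l) # bl) = of_int (int l) * dg i i + K.bdeg bl" by (simp add: K.bdeg_def)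
  have g: "dg i i > 0" by (rule dg_pos[OF v(1)])
  have le': "rat_of_int (int l) * dg i i \<le> of_int (int k * m) * dg i i"
    using g le by (simp only: mult_le_cancel_right of_int_le_iff) simp
  have eq': "rat_of_int (int l) * dg i i = of_int (int k * m) * dg i i \<longleftrightarrow> int l = int k * m"
    using g by (simp only: mult_cancel_right of_int_eq_iff) simp
  have "K.bdeg ((i, k, l) # bl) = dt (\<theta> @ bseq ((i, k, l) # bl)) - dt \<theta> \<longleftrightarrow>
      rat_of_int (int l) * dg i i = of_int (int k * m) * dg i i \<and>
      K.bdeg bl = dt ((\<theta> @ replicate k i) @ bseq bl) - dt (\<theta> @ replicate k i)"
    using b d IH le' by (simp only: append_assoc bseq_simps) linarith
  also have "\<dots> \<longleftrightarrow> K.tight \<theta> ((i, k, l) # bl)" unfolding eq' eq using IH by (simp add: m_def)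
  finally show ?case using b d IH le' by simp
qed (simp add: K.bdeg_def)

lemma sum_entries: "c \<le> length \<nu> \<Longrightarrow> (\<Sum>s=1..c. sroot D (entry \<nu> s)) = rsum (take c \<nu>)"
proof (induction c)
  case (Suc c)
  then show ?case by (simp add: take_Suc_conv_app_nth add.commute)
qed simp

lemma ell_eq:
  assumes r: "runs \<nu> = map (\<lambda>g. (fst g, group_len g)) gl" and \<nu>: "set \<nu> \<subseteq> idx D" and s: "s < length gl"
    and pos: "1 \<le> group_len (gl ! s)"
  shows "Defs.ell D \<Lambda> \<nu> (Suc s) = K.ell (bseq (ungroup (take s gl))) (fst (gl ! s))"
proof -
  have "fst (gl ! s) \<in> set \<nu>" using split_block'[OF r s] pos by (metis UnCI bseq_ungroup1 in_set_replicate not_one_le_zero set_append)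
  moreover have "set (bseq (ungroup (take s gl))) \<subseteq> set \<nu>" using split_block'[OF r s] by (metis Un_upper1 set_append)
  ultimately show ?thesis
    using \<nu> s block_val_eq[OF r s] take_block[OF r, of s] sum_entries[of "block_end \<nu> s" \<nu>] block_end_le[OF r, of s]
    by (subst K_ell) (auto simp: Defs.ell_def)
qed

lemma IS_len: "\<nu> \<in> IS \<Longrightarrow> length \<nu> = n" and IS_idx: "\<nu> \<in> IS \<Longrightarrow> set \<nu> \<subseteq> idx D"
  and IS_rsum: "\<nu> \<in> IS \<Longrightarrow> rsum \<nu> = \<alpha>"
  by (auto simp: Iseq_def)

text \<open>Every factor brings its own e(\<nu>). These commute with the blocks and collapse into
  one.\<close>

lemma block_product:
  assumes \<nu>: "\<nu> \<in> IS" and r: "runs \<nu> = map (\<lambda>g. (fst g, group_len g)) gl"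
    and pos: "\<And>i k l. (i, k, l) \<in> set (ungroup gl) \<Longrightarrow> 1 \<le> k"
    and h: "\<And>s. s < length gl \<Longrightarrow> h (Suc s) \<in> C \<and>
      act (h (Suc s)) = belt x t (length (bseq (ungroup (take s gl)))) (ungroup1 (gl ! s)) * e \<nu>"
  shows "prod_list (map h [1..<nblocks \<nu> + 1]) \<in> C"
    and "\<kappa> (prod_list (map h [1..<nblocks \<nu> + 1])) = \<kappa> (belt xg \<tau>g 0 (ungroup gl) * eg \<nu>)"
proof -
  let ?js = "[0..<length gl]"
  have m: "map h [1..<nblocks \<nu> + 1] = map (\<lambda>s. h (Suc s)) ?js"
    unfolding nblocks_eq[OF r] by (simp add: map_Suc_upt[symmetric] comp_def del: upt_Suc)
  show C1: "prod_list (map h [1..<nblocks \<nu> + 1]) \<in> C"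
    unfolding m by (intro C_prod_list) (use h in auto)
  have len: "length (bseq (ungroup gl)) = n" using bseq_ungroup_runs[OF r] IS_len[OF \<nu>] by simp
  have C2: "belt xg \<tau>g 0 (ungroup gl) * eg \<nu> \<in> C" using pos len by (intro C_mult C_belt C_eg \<nu>) auto
  show "\<kappa> (prod_list (map h [1..<nblocks \<nu> + 1])) = \<kappa> (belt xg \<tau>g 0 (ungroup gl) * eg \<nu>)"
  \<comment> \<open>For n = 0 the left side is 1 and the right side is e([]). They agree in the
    cyclotomic algebra but not under \<open>act\<close>.\<close>
  proof (cases "gl = []")
    case True
    then have \<nu>0: "\<nu> = []" using bseq_ungroup_runs[OF r] by (simp add: ungroup_simps)
    then have "n = 0" using IS_len[OF \<nu>] by simp
    then have "IS = {[]}" using \<nu> \<nu>0 by (auto simp: Iseq_def)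
    then show ?thesis using \<kappa>_expand[OF C_1] \<nu>0 unfolding m by (simp add: True ungroup_simps)
  next
    case False
    let ?g = "\<lambda>s. belt x t (length (bseq (ungroup (take s gl)))) (ungroup1 (gl ! s))"
    let ?h = "\<lambda>s. act (h (Suc s))"
    have ge: "?g s * e \<nu> = e \<nu> * ?g s" if "s < length gl" for s
    proof (rule K.belt_e[OF _ split_block'[OF r that] IS_len[OF \<nu>]])
      fix i k l assume a: "(i, k, l) \<in> set (ungroup1 (gl ! s))"
      have "(i, k, l) \<in> set (ungroup gl)" unfolding ungroup_def using a nth_mem[OF that] by auto
      then show "1 \<le> k" by (rule pos)
    qed
    have hf: "?h s * e \<nu> = ?g s * e \<nu>" if "s < length gl" for s
      using h[OF that] by (simp add: mult.assoc e_e)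
    have "prod_list (map ?h ?js) * e \<nu> = prod_list (map ?g ?js) * e \<nu>"
      by (rule prod_list_absorb) (use ge hf in \<open>auto simp: e_e\<close>)
    moreover have "prod_list (map ?h ?js) * e \<nu> = prod_list (map ?h ?js)"
    proof -
      obtain p where p: "length gl = Suc p" using False by (cases "length gl") auto
      have "?h p * e \<nu> = ?h p" using h[of p] p by (simp add: mult.assoc e_e)
      then show ?thesis by (simp add: p mult.assoc)
    qed
    moreover have "belt x t 0 (ungroup gl) = prod_list (map ?g ?js)"
    proof -
      have "map (\<lambda>s. belt x t (0 + length (bseq (concat (take s (map ungroup1 gl))))) (map ungroup1 gl ! s)) [0..<length (map ungroup1 gl)]
          = map ?g ?js" by (intro map_cong) (auto simp: take_map ungroup_def)
      then show ?thesis unfolding ungroup_def by (subst belt_concat) (simp only:)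
    qed
    ultimately have "act (prod_list (map (\<lambda>s. h (Suc s)) ?js)) = act (belt xg \<tau>g 0 (ungroup gl) * eg \<nu>)"
      by (simp add: act_prod_list FI.act_mult act_belt comp_def flip: e_def)
    then show ?thesis using act_eq_\<kappa>[OF C1 C2] unfolding m by simp
  qed
qed

definition PD where "PD = {\<nu> \<in> IS. piecewise_dominant D \<Lambda> \<nu>}"

lemma PD_iff:
  assumes r: "runs \<nu> = map (\<lambda>g. (fst g, group_len g)) gl" and \<nu>: "\<nu> \<in> IS"
    and pos: "\<And>g. g \<in> set gl \<Longrightarrow> 1 \<le> group_len g"
  shows "\<nu> \<in> PD \<longleftrightarrow> (\<forall>s<length gl. int (group_len (gl ! s)) \<le> K.ell (bseq (ungroup (take s gl))) (fst (gl ! s)))"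
proof -
  have "(\<forall>t\<in>{1..length gl}. P t) \<longleftrightarrow> (\<forall>s<length gl. P (Suc s))" for P
    by (metis Suc_le_eq atLeastAtMost_iff le_add1 not0_implies_Suc not_one_le_zero plus_1_eq_Suc)
  then show ?thesis
    using \<nu> ell_eq[OF r IS_idx[OF \<nu>] _ pos] block_len_eq[OF r] nblocks_eq[OF r]
    by (auto simp: PD_def piecewise_dominant_def)
qed

text \<open>This is where piecewise dominance comes from: the bounds on the blocks of a run bound
  the length of the run by \<open>valid_ungroup1_bounds\<close>.\<close>

lemma valid_groups:
  assumes v: "K.valid [] bl" and bl: "bseq bl \<in> IS"
  obtains gl where "ungroup gl = bl" "runs (bseq bl) = map (\<lambda>g. (fst g, group_len g)) gl"
    "\<And>g. g \<in> set gl \<Longrightarrow> snd g \<noteq> [] \<and> 1 \<le> group_len g" "bseq bl \<in> PD"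
    "\<And>s. s < length gl \<Longrightarrow> K.valid (bseq (ungroup (take s gl))) (ungroup1 (gl ! s))"
proof -
  obtain gl where gl: "ungroup gl = bl" "distinct_adj (map fst gl)" "\<forall>g\<in>set gl. snd g \<noteq> []"
    using group_exists by blast
  have val: "K.valid (bseq (ungroup (take s gl))) (ungroup1 (gl ! s))" if "s < length gl" for s
    using v that unfolding gl(1)[symmetric] K.valid_ungroup by simp
  have bd: "1 \<le> group_len (gl ! s) \<and> int (group_len (gl ! s)) \<le> K.ell (bseq (ungroup (take s gl))) (fst (gl ! s))"
    if "s < length gl" for s
    using K.valid_ungroup1_bounds[of "bseq (ungroup (take s gl))" "fst (gl ! s)" "snd (gl ! s)"] val[OF that] gl(3) that by simp
  have pos: "1 \<le> group_len g" if "g \<in> set gl" for g using that bd by (metis in_set_conv_nth)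
  have r: "runs (bseq bl) = map (\<lambda>g. (fst g, group_len g)) gl" using runs_ungroup[OF gl(2) pos] gl(1) by simp
  have "bseq bl \<in> PD" using PD_iff[OF r bl pos] bd by simp
  then show ?thesis using that[OF gl(1) r] gl(3) pos val by blast
qed

section \<open>The spanning set of the whole cocenter\<close>

lemma increasing_le:
  fixes a :: "nat \<Rightarrow> nat"
  assumes a: "\<And>j. 1 \<le> j \<Longrightarrow> j \<le> d \<Longrightarrow> a j < a (j + 1)" and "1 \<le> i" and "i \<le> j" and "j \<le> d + 1"
  shows "a i \<le> a j"
  using assms(3,4)
proof (induction rule: dec_induct)
  case (step j)
  then have "a j < a (j + 1)" using \<open>1 \<le> i\<close> by (intro a) auto
  then show ?case using step by simp
qed simp

definition R_elts where "R_elts = {a | a \<nu>. \<nu> \<in> PD \<and> a \<in> R_set D \<Lambda> \<nu>}"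

text \<open>Each run taken as one block, which makes the lemmas on grouped blocks available for a
  bare sequence.\<close>

lemma trivial_groups:
  obtains gl where "runs \<nu> = map (\<lambda>g. (fst g, group_len g)) gl" "gl = map (\<lambda>(i, b). (i, [(b, 0)])) (runs \<nu>)"
proof -
  have "runs \<nu> = map (\<lambda>g. (fst g, group_len g)) (map (\<lambda>(i, b). (i, [(b, 0)])) (runs \<nu>))"
    by (simp add: comp_def case_prod_unfold group_len_def)
  then show ?thesis using that by blast
qed

lemma R_block_C:
  assumes \<nu>: "\<nu> \<in> IS" and u: "u \<in> {1..nblocks \<nu>}" and a: "f \<in> R_block D \<Lambda> \<nu> u"
  shows "f \<in> C"
proof -
  obtain d a l where f: "f = prod_list (map (\<lambda>j. e_int (a j) (a (j + 1) - 1) * xg (a (j + 1) - 1) ^ l j) [1..<d + 1]) * eg \<nu>"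
    and d: "1 \<le> d" "a 1 = block_end \<nu> (u - 1) + 1" "a (d + 1) = block_end \<nu> u + 1" "\<forall>j\<in>{1..d}. a j < a (j + 1)"
    using a unfolding R_block_def by blast
  obtain gl where r: "runs \<nu> = map (\<lambda>g. (fst g, group_len g)) gl" using trivial_groups by blast
  have n: "block_end \<nu> u \<le> n" using block_end_le[OF r, of u] u nblocks_eq[OF r] IS_len[OF \<nu>] by simp
  have "e_int (a j) (a (j + 1) - 1) * xg (a (j + 1) - 1) ^ l j \<in> C" if j: "j \<in> {1..d}" for j
  proof -
    have "a 1 \<le> a j" by (rule increasing_le[of d]) (use j d(4) in auto)
    moreover have "a (j + 1) \<le> a (d + 1)" by (rule increasing_le[of d]) (use j d(4) in auto)
    moreover have "a j < a (j + 1)" using j d(4) by auto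
    ultimately have "1 \<le> a j" "1 \<le> a (j + 1) - 1" "a (j + 1) - 1 \<le> n" using d n by linarith+
    then show ?thesis unfolding e_int_eq by (intro C_mult C_e_prod C_pow C_xg)
  qed
  then show ?thesis unfolding f by (intro C_mult C_prod_list C_eg \<nu>) auto
qed

lemma R_elts_C: "R_elts \<subseteq> C"
proof
  fix f assume "f \<in> R_elts"
  then obtain \<nu> r where f: "f = prod_list (map r [1..<nblocks \<nu> + 1])" "\<nu> \<in> PD"
    "\<forall>u\<in>{1..nblocks \<nu>}. r u \<in> R_block D \<Lambda> \<nu> u" unfolding R_elts_def R_set_def by blast
  have "r u \<in> C" if "u \<in> {1..nblocks \<nu>}" for u
    by (rule R_block_C[OF _ that]) (use f that in \<open>auto simp: PD_def\<close>)
  then show "f \<in> C" unfolding f(1) by (intro C_prod_list) auto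
qed

lemma belt_R_block:
  assumes r: "runs \<nu> = map (\<lambda>g. (fst g, group_len g)) gl" and \<nu>: "\<nu> \<in> IS" and s: "s < length gl"
    and ne: "snd (gl ! s) \<noteq> []" and v: "K.valid (bseq (ungroup (take s gl))) (ungroup1 (gl ! s))"
  shows "belt xg \<tau>g (block_end \<nu> s) (ungroup1 (gl ! s)) * eg \<nu> \<in> R_block D \<Lambda> \<nu> (Suc s)"
proof -
  let ?fl = "ungroup1 (gl ! s)" and ?c = "block_end \<nu> s"
  \<comment> \<open>First positions of the blocks, counted from 1; the value at d + 1 is the
    position after the run.\<close>
  define a where "a j = ?c + length (bseq (take (j - 1) ?fl)) + 1" for j
  define l where "l j = snd (snd (?fl ! (j - 1)))" for j
  let ?d = "length ?fl"
  have bd: "\<forall>(k, l)\<in>set (snd (gl ! s)). 1 \<le> k \<and> int l < K.ell (bseq (ungroup (take s gl))) (fst (gl ! s))"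
    "1 \<le> group_len (gl ! s)"
    using K.valid_ungroup1_bounds[of "bseq (ungroup (take s gl))" "fst (gl ! s)" "snd (gl ! s)"] v ne by auto
  have el: "Defs.ell D \<Lambda> \<nu> (Suc s) = K.ell (bseq (ungroup (take s gl))) (fst (gl ! s))"
    by (rule ell_eq[OF r IS_idx[OF \<nu>] s bd(2)])
  have aS: "a (Suc p + 1) = ?c + length (bseq (take p ?fl)) + fst (snd (?fl ! p)) + 1" if "p < ?d" for p
    using that by (cases "?fl ! p") (simp add: a_def take_Suc_conv_app_nth)
  have fl: "1 \<le> fst (snd (?fl ! p)) \<and> int (snd (snd (?fl ! p))) < Defs.ell D \<Lambda> \<nu> (Suc s)" if "p < ?d" for p
  proof -
    have "?fl ! p = (\<lambda>(k, l). (fst (gl ! s), k, l)) (snd (gl ! s) ! p)" "snd (gl ! s) ! p \<in> set (snd (gl ! s))"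
      using that by (simp_all add: ungroup1_def)
    moreover obtain k' l' where "snd (gl ! s) ! p = (k', l')" by (cases "snd (gl ! s) ! p")
    ultimately show ?thesis using bspec[OF bd(1), of "(k', l')"] el by simp
  qed
  have d1: "1 \<le> ?d" using ne by (cases "snd (gl ! s)") (auto simp: ungroup1_def)
  have "(belt xg \<tau>g ?c ?fl :: ('i, 'k) klr_free) = prod_list (map (\<lambda>p. belt xg \<tau>g (?c + length (bseq (take p ?fl))) [?fl ! p]) [0..<?d])"
    by (rule belt_nth)
  also have "\<dots> = prod_list (map (\<lambda>p. e_int (a (Suc p)) (a (Suc p + 1) - 1) * xg (a (Suc p + 1) - 1) ^ l (Suc p)) [0..<?d])"
  proof (intro arg_cong[of _ _ prod_list] map_cong refl)
    fix p assume "p \<in> set [0..<?d]"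
    then have p: "p < ?d" by simp
    show "(belt xg \<tau>g (?c + length (bseq (take p ?fl))) [?fl ! p] :: ('i, 'k) klr_free)
        = e_int (a (Suc p)) (a (Suc p + 1) - 1) * xg (a (Suc p + 1) - 1) ^ l (Suc p)"
      unfolding aS[OF p] e_int_eq by (cases "?fl ! p") (simp add: a_def l_def)
  qed
  also have "\<dots> = prod_list (map (\<lambda>j. e_int (a j) (a (j + 1) - 1) * xg (a (j + 1) - 1) ^ l j) [1..<?d + 1])"
    by (simp add: map_Suc_upt[symmetric] comp_def del: upt_Suc)
  finally have eq: "(belt xg \<tau>g ?c ?fl :: ('i, 'k) klr_free)
      = prod_list (map (\<lambda>j. e_int (a j) (a (j + 1) - 1) * xg (a (j + 1) - 1) ^ l j) [1..<?d + 1])" .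
  have "a 1 = block_end \<nu> (Suc s - 1) + 1" by (simp add: a_def)
  moreover have "a (?d + 1) = block_end \<nu> (Suc s) + 1"
    using block_end_eq[OF r, of s] block_end_eq[OF r, of "Suc s"] s
    by (simp add: a_def take_Suc_conv_app_nth ungroup_simps)
  moreover have "\<forall>j\<in>{1..?d}. a j < a (j + 1)"
  proof
    fix j assume "j \<in> {1..?d}"
    then obtain p where p: "j = Suc p" "p < ?d" by (cases j) auto
    then show "a j < a (j + 1)" using aS[OF p(2)] fl[OF p(2)] by (simp add: a_def)
  qed
  moreover have "\<forall>j\<in>{1..?d}. int (l j) < Defs.ell D \<Lambda> \<nu> (Suc s)"
  proof
    fix j assume "j \<in> {1..?d}"
    then obtain p where p: "j = Suc p" "p < ?d" by (cases j) auto
    then show "int (l j) < Defs.ell D \<Lambda> \<nu> (Suc s)" using fl[OF p(2)] by (simp add: l_def)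
  qed
  ultimately show ?thesis unfolding R_block_def eq using d1 by blast
qed

lemma ungroup1_C:
  assumes r: "runs \<nu> = map (\<lambda>g. (fst g, group_len g)) gl" and \<nu>: "\<nu> \<in> IS" and s: "s < length gl"
    and pos: "\<And>i k l. (i, k, l) \<in> set (ungroup gl) \<Longrightarrow> 1 \<le> k"
  shows "belt xg \<tau>g (block_end \<nu> s) (ungroup1 (gl ! s)) * eg \<nu> \<in> C"
proof (intro C_mult C_belt C_eg \<nu>)
  show "block_end \<nu> s + length (bseq (ungroup1 (gl ! s))) \<le> n"
    using block_end_le[OF r, of "Suc s"] IS_len[OF \<nu>] s block_end_eq[OF r, of s] block_end_eq[OF r, of "Suc s"]
    by (simp add: take_Suc_conv_app_nth ungroup_simps)
  fix i k l assume a: "(i, k, l) \<in> set (ungroup1 (gl ! s))"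
  have "(i, k, l) \<in> set (ungroup gl)" unfolding ungroup_def using a nth_mem[OF s] by auto
  then show "1 \<le> k" by (rule pos)
qed

lemma block_elts_R: "f \<in> block_elts r \<Longrightarrow> in_trace_span R_elts f"
proof -
  assume f: "f \<in> block_elts r"
  then obtain bl where bl: "f = belt xg \<tau>g 0 bl * eg (bseq bl)" "K.valid [] bl" "bseq bl \<in> IS"
    by (auto simp: block_elts_def)
  obtain gl where gl: "ungroup gl = bl" "runs (bseq bl) = map (\<lambda>g. (fst g, group_len g)) gl"
    "\<And>g. g \<in> set gl \<Longrightarrow> snd g \<noteq> [] \<and> 1 \<le> group_len g" "bseq bl \<in> PD"
    "\<And>s. s < length gl \<Longrightarrow> K.valid (bseq (ungroup (take s gl))) (ungroup1 (gl ! s))"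
    using valid_groups[OF bl(2,3)] by blast
  let ?\<nu> = "bseq bl"
  define h :: "nat \<Rightarrow> ('i, 'k) klr_free" where "h u = belt xg \<tau>g (block_end ?\<nu> (u - 1)) (ungroup1 (gl ! (u - 1))) * eg ?\<nu>" for u
  have pos: "1 \<le> k" if "(i, k, l) \<in> set (ungroup gl)" for i k l using that bl(2) K.valid_pos gl(1) by blast
  have hs: "h (Suc s) \<in> C \<and> act (h (Suc s)) = belt x t (length (bseq (ungroup (take s gl)))) (ungroup1 (gl ! s)) * e ?\<nu>"
    if "s < length gl" for s
    using ungroup1_C[OF gl(2) bl(3) that pos] block_end_eq[OF gl(2), of s] that
    by (simp add: h_def FI.act_mult act_belt flip: e_def)
  let ?a = "prod_list (map h [1..<nblocks ?\<nu> + 1])"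
  have "h u \<in> R_block D \<Lambda> ?\<nu> u" if "u \<in> {1..nblocks ?\<nu>}" for u
    using belt_R_block[OF gl(2) bl(3), of "u - 1"] gl(3) gl(5)[of "u - 1"] that nblocks_eq[OF gl(2)]
    by (cases u) (auto simp: h_def)
  then have "?a \<in> R_set D \<Lambda> ?\<nu>" unfolding R_set_def by blast
  then have "?a \<in> R_elts" unfolding R_elts_def using gl(4) by blast
  moreover have "\<kappa> ?a = \<kappa> f" using block_product(2)[OF bl(3) gl(2) pos hs] bl(1) gl(1) by simp
  moreover have "f \<in> C" using f block_elts_C by blast
  ultimately show ?thesis by (intro in_trace_span_q[OF in_trace_span_base[OF R_elts_C], of ?a] q_eq) simp_all
qed

section \<open>The top degree\<close>

definition Z_elts where "Z_elts = Z_elt D \<Lambda> ` PD"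

lemma Z_elt_belt:
  assumes r: "runs \<nu> = map (\<lambda>g. (fst g, group_len g)) gl" and \<nu>: "\<nu> \<in> PD"
    and pos: "\<And>g. g \<in> set gl \<Longrightarrow> 1 \<le> group_len g" and posf: "\<And>i k l. (i, k, l) \<in> set (ungroup gl) \<Longrightarrow> 1 \<le> k"
    and z: "\<And>s. s < length gl \<Longrightarrow> snd (gl ! s) = top_blocks (group_len (gl ! s)) (Defs.ell D \<Lambda> \<nu> (Suc s))"
  shows "Z_elt D \<Lambda> \<nu> \<in> C" and "\<kappa> (Z_elt D \<Lambda> \<nu>) = \<kappa> (belt xg \<tau>g 0 (ungroup gl) * eg \<nu>)"
proof -
  have \<nu>I: "\<nu> \<in> IS" using \<nu> by (simp add: PD_def)
  have Z: "Z_block D \<Lambda> \<nu> (Suc s) = belt xg \<tau>g (block_end \<nu> s) (ungroup1 (gl ! s)) * eg \<nu>" if s: "s < length gl" for s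
  proof -
    let ?b = "group_len (gl ! s)" and ?l = "Defs.ell D \<Lambda> \<nu> (Suc s)" and ?c = "block_end \<nu> s"
    have b: "1 \<le> ?b" using pos s by simp
    have bl: "int ?b \<le> ?l"
      using PD_iff[OF r \<nu>I pos] \<nu> s ell_eq[OF r IS_idx[OF \<nu>I] s b] by simp
    have c': "block_end \<nu> (Suc s) = ?c + ?b"
      using s block_len_eq[OF r s] by (simp add: block_end_def)
    have g: "gl ! s = (fst (gl ! s), top_blocks ?b ?l)" using z[OF s] by (metis prod.collapse)
    have "(belt xg \<tau>g ?c (ungroup1 (gl ! s)) :: ('i, 'k) klr_free) = (if ?l \<ge> 2 * int ?b - 1 then stairs ?c ?l ?b
     else stairs ?c ?l (nat (?l - int ?b)) * e_int (?c + nat (?l - int ?b) + 1) (?c + ?b))"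
      using belt_top_blocks[OF b bl, of ?c "fst (gl ! s)"] by (subst g)
    \<comment> \<open>The index \<ell> + 2c - c' of \<open>Z_block\<close>, with c' = c + b.\<close>
    moreover have "nat (?l + 2 * int ?c - int (?c + ?b)) = ?c + nat (?l - int ?b)" using bl by linarith
    moreover have "?l = int ?b" if "\<not> ?l > int ?b" using that bl by linarith
    ultimately show ?thesis
      unfolding Z_block_def Let_def c' block_len_eq[OF r s] diff_Suc_1 by (auto simp: stairs_0)
  qed
  have h: "Z_block D \<Lambda> \<nu> (Suc s) \<in> C \<and>
      act (Z_block D \<Lambda> \<nu> (Suc s)) = belt x t (length (bseq (ungroup (take s gl)))) (ungroup1 (gl ! s)) * e \<nu>"
    if "s < length gl" for s
    using ungroup1_C[OF r \<nu>I that posf] block_end_eq[OF r, of s] that Z[OF that]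
    by (simp add: FI.act_mult act_belt flip: e_def)
  show "Z_elt D \<Lambda> \<nu> \<in> C" "\<kappa> (Z_elt D \<Lambda> \<nu>) = \<kappa> (belt xg \<tau>g 0 (ungroup gl) * eg \<nu>)"
    unfolding Z_elt_def using block_product[OF \<nu>I r posf h] by auto
qed

lemma dt_IS: "\<nu> \<in> IS \<Longrightarrow> dt ([] @ \<nu>) - dt [] = d_top D \<Lambda> \<alpha>"
  using pform_0[of \<Lambda>] pform_0[of 0] by (simp add: dt_def IS_rsum d_top_def)

text \<open>Every piecewise dominant sequence admits \<open>top_blocks\<close> in each run, since
  the run length is at most \<ell>. Hence its Z really has top degree.\<close>

lemma PD_groups:
  assumes \<nu>: "\<nu> \<in> PD"
  obtains gl where "runs \<nu> = map (\<lambda>g. (fst g, group_len g)) gl" "\<And>g. g \<in> set gl \<Longrightarrow> 1 \<le> group_len g"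
    "K.valid [] (ungroup gl)" "K.tight [] (ungroup gl)"
    "\<And>s. s < length gl \<Longrightarrow> snd (gl ! s) = top_blocks (group_len (gl ! s)) (Defs.ell D \<Lambda> \<nu> (Suc s))"
proof -
  have \<nu>I: "\<nu> \<in> IS" using \<nu> by (simp add: PD_def)
  define gl where "gl = map (\<lambda>s. (fst (runs \<nu> ! s), top_blocks (snd (runs \<nu> ! s)) (Defs.ell D \<Lambda> \<nu> (Suc s)))) [0..<length (runs \<nu>)]"
  have b: "1 \<le> snd (runs \<nu> ! s)" if "s < length (runs \<nu>)" for s
    using runs_pos[of "fst (runs \<nu> ! s)" "snd (runs \<nu> ! s)" \<nu>] that by simp
  have el: "int (snd (runs \<nu> ! s)) \<le> Defs.ell D \<Lambda> \<nu> (Suc s)" if "s < length (runs \<nu>)" for s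
  proof -
    have "Suc s \<in> {1..nblocks \<nu>}" using that by (simp add: nblocks_def)
    then have "int (block_len \<nu> (Suc s)) \<le> Defs.ell D \<Lambda> \<nu> (Suc s)"
      using \<nu> unfolding PD_def piecewise_dominant_def by blast
    then show ?thesis by (simp add: block_len_def)
  qed
  have gs: "group_len (gl ! s) = snd (runs \<nu> ! s)" "fst (gl ! s) = fst (runs \<nu> ! s)"
    "snd (gl ! s) = top_blocks (snd (runs \<nu> ! s)) (Defs.ell D \<Lambda> \<nu> (Suc s))" if "s < length (runs \<nu>)" for s
    using that top_blocks_tight[OF b el] by (simp_all add: gl_def group_len_def)
  have len: "length gl = length (runs \<nu>)" by (simp add: gl_def)
  have r: "runs \<nu> = map (\<lambda>g. (fst g, group_len g)) gl"
    by (rule nth_equalityI) (simp_all add: len gs)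
  have pos: "1 \<le> group_len g" if "g \<in> set gl" for g
    using that b gs(1) len by (metis in_set_conv_nth)
  have vt: "K.valid (bseq (ungroup (take s gl))) (ungroup1 (gl ! s)) \<and> K.tight (bseq (ungroup (take s gl))) (ungroup1 (gl ! s))"
    if s: "s < length gl" for s
  proof -
    have s': "s < length (runs \<nu>)" using s len by simp
    have "fst (gl ! s) \<in> set \<nu>"
      using split_block'[OF r s] pos[of "gl ! s"] s
      by (metis UnCI bseq_ungroup1 in_set_replicate not_one_le_zero nth_mem set_append)
    then have i: "fst (gl ! s) \<in> idx D" using IS_idx[OF \<nu>I] by blast
    have "tight_group (K.ell (bseq (ungroup (take s gl))) (fst (gl ! s))) (snd (gl ! s))"
      using top_blocks_tight[OF b[OF s'] el[OF s']] gs[OF s'] ell_eq[OF r IS_idx[OF \<nu>I] s] pos[of "gl ! s"] s by simp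
    then show ?thesis using K.valid_tight_ungroup1[OF i, of "bseq (ungroup (take s gl))" "snd (gl ! s)"] by simp
  qed
  show ?thesis
  proof (rule that[OF r pos])
    show "K.valid [] (ungroup gl)" "K.tight [] (ungroup gl)" using vt by (simp_all add: K.valid_ungroup K.tight_ungroup)
    show "snd (gl ! s) = top_blocks (group_len (gl ! s)) (Defs.ell D \<Lambda> \<nu> (Suc s))" if "s < length gl" for s
      using gs[of s] that len by simp
  qed
qed

lemma Z_elt_component: "\<nu> \<in> PD \<Longrightarrow> in_trace_span (block_elts (d_top D \<Lambda> \<alpha>)) (Z_elt D \<Lambda> \<nu>)" and Z_C: "\<nu> \<in> PD \<Longrightarrow> Z_elt D \<Lambda> \<nu> \<in> C"
proof -
  assume \<nu>: "\<nu> \<in> PD"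
  then have \<nu>I: "\<nu> \<in> IS" by (simp add: PD_def)
  obtain gl where gl: "runs \<nu> = map (\<lambda>g. (fst g, group_len g)) gl" "\<And>g. g \<in> set gl \<Longrightarrow> 1 \<le> group_len g"
    "K.valid [] (ungroup gl)" "K.tight [] (ungroup gl)"
    "\<And>s. s < length gl \<Longrightarrow> snd (gl ! s) = top_blocks (group_len (gl ! s)) (Defs.ell D \<Lambda> \<nu> (Suc s))"
    using PD_groups[OF \<nu>] by blast
  note Z = Z_elt_belt[OF gl(1) \<nu> gl(2) K.valid_pos[OF gl(3)] gl(5)]
  show "Z_elt D \<Lambda> \<nu> \<in> C" by (rule Z(1))
  have bs: "bseq (ungroup gl) = \<nu>" by (rule bseq_ungroup_runs[OF gl(1)])
  have "K.bdeg (ungroup gl) = d_top D \<Lambda> \<alpha>"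
    using bdeg_tight[OF gl(3)] gl(4) dt_IS[OF \<nu>I] bs by simp
  then have "belt xg \<tau>g 0 (ungroup gl) * eg \<nu> \<in> block_elts (d_top D \<Lambda> \<alpha>)"
    unfolding block_elts_def using gl(3) bs \<nu>I by blast
  then show "in_trace_span (block_elts (d_top D \<Lambda> \<alpha>)) (Z_elt D \<Lambda> \<nu>)"
    using Z by (intro in_trace_span_q[OF in_trace_span_base[OF block_elts_C], of "belt xg \<tau>g 0 (ungroup gl) * eg \<nu>"] q_eq)
qed

text \<open>In top degree \<open>bdeg_tight\<close> leaves only tight blocks, and by
  \<open>tight_group_unique\<close> these are determined by the sequence.\<close>

lemma block_elts_Z: "f \<in> block_elts (d_top D \<Lambda> \<alpha>) \<Longrightarrow> in_trace_span Z_elts f"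
proof -
  assume f: "f \<in> block_elts (d_top D \<Lambda> \<alpha>)"
  then obtain bl where bl: "f = belt xg \<tau>g 0 bl * eg (bseq bl)" "K.valid [] bl" "bseq bl \<in> IS"
    "K.bdeg bl = d_top D \<Lambda> \<alpha>" by (auto simp: block_elts_def)
  obtain gl where gl: "ungroup gl = bl" "runs (bseq bl) = map (\<lambda>g. (fst g, group_len g)) gl"
    "\<And>g. g \<in> set gl \<Longrightarrow> snd g \<noteq> [] \<and> 1 \<le> group_len g" "bseq bl \<in> PD"
    "\<And>s. s < length gl \<Longrightarrow> K.valid (bseq (ungroup (take s gl))) (ungroup1 (gl ! s))"
    using valid_groups[OF bl(2,3)] by blast
  have "K.tight [] (ungroup gl)" using bdeg_tight[OF bl(2)] bl(4) dt_IS[OF bl(3)] gl(1) by simp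
  then have tg: "K.tight (bseq (ungroup (take s gl))) (ungroup1 (gl ! s))" if "s < length gl" for s
    using that unfolding K.tight_ungroup by simp
  have z: "snd (gl ! s) = top_blocks (group_len (gl ! s)) (Defs.ell D \<Lambda> (bseq bl) (Suc s))" if s: "s < length gl" for s
  proof -
    have ne: "snd (gl ! s) \<noteq> []" "1 \<le> group_len (gl ! s)" using gl(3) s by auto
    have i: "fst (gl ! s) \<in> idx D"
      using K.valid_ungroup1_bounds[of _ "fst (gl ! s)" "snd (gl ! s)"] gl(5)[OF s] ne(1) by auto
    have "tight_group (K.ell (bseq (ungroup (take s gl))) (fst (gl ! s))) (snd (gl ! s))"
      using K.valid_tight_ungroup1[OF i, of "bseq (ungroup (take s gl))" "snd (gl ! s)"] gl(5)[OF s] tg[OF s] by simp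
    from tight_group_unique[OF this ne(1)] show ?thesis
      using ell_eq[OF gl(2) IS_idx[OF bl(3)] s ne(2)] by (simp add: group_len_def)
  qed
  have "\<kappa> (Z_elt D \<Lambda> (bseq bl)) = \<kappa> f"
    using Z_elt_belt(2)[OF gl(2,4) _ _ z] gl(3) K.valid_pos[of "[]" "ungroup gl"] bl(1,2) gl(1) by auto
  moreover have "Z_elts \<subseteq> C" using Z_C by (auto simp: Z_elts_def)
  moreover have "Z_elt D \<Lambda> (bseq bl) \<in> Z_elts" using gl(4) by (simp add: Z_elts_def)
  moreover have "f \<in> C" using f block_elts_C by blast
  ultimately show ?thesis by (intro in_trace_span_q[OF in_trace_span_base, of Z_elts "Z_elt D \<Lambda> (bseq bl)"] q_eq) simp_all
qed

section \<open>Degree zero\<close>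

definition e_minus_elts where "e_minus_elts = e_minus ` PD"

lemma e_minus_belt: "(e_minus \<nu> :: ('i, 'k) klr_free) = belt xg \<tau>g 0 (map (\<lambda>(i, b). (i, b, 0)) (runs \<nu>)) * eg \<nu>"
proof -
  obtain gl where r: "runs \<nu> = map (\<lambda>g. (fst g, group_len g)) gl" and gl: "gl = map (\<lambda>(i, b). (i, [(b, 0)])) (runs \<nu>)"
    using trivial_groups by blast
  have fl: "ungroup (take s gl) = take s (map (\<lambda>(i, b). (i, b, 0)) (runs \<nu>))" for s
    by (simp add: ungroup_def gl take_map comp_def case_prod_unfold ungroup1_def concat_map_singleton)
  let ?bl = "map (\<lambda>(i, b). (i, b, 0)) (runs \<nu>)"
  have len: "length ?bl = nblocks \<nu>" by (simp add: nblocks_def)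
  have "(map (\<lambda>u. e_int (block_end \<nu> (u - 1) + 1) (block_end \<nu> u)) [1..<nblocks \<nu> + 1] :: ('i, 'k) klr_free list)
      = map (\<lambda>s. e_int (block_end \<nu> s + 1) (block_end \<nu> (Suc s))) [0..<nblocks \<nu>]"
    by (simp add: map_Suc_upt[symmetric] comp_def del: upt_Suc)
  also have "\<dots> = map (\<lambda>s. belt xg \<tau>g (0 + length (bseq (take s ?bl))) [?bl ! s]) [0..<length ?bl]"
  proof (rule map_cong)
    fix s assume "s \<in> set [0..<length ?bl]"
    then have s: "s < length (runs \<nu>)" by simp
    then have s': "s < length gl" by (simp add: gl)
    have c: "block_end \<nu> (Suc s) = block_end \<nu> s + snd (runs \<nu> ! s)"
      by (simp add: block_end_def block_len_def)
    show "(e_int (block_end \<nu> s + 1) (block_end \<nu> (Suc s)) :: ('i, 'k) klr_free) = belt xg \<tau>g (0 + length (bseq (take s ?bl))) [?bl ! s]"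
      using block_end_eq[OF r, of s] s s' fl[of s] unfolding c e_int_eq
      by (simp add: case_prod_unfold)
  qed (simp add: nblocks_def)
  finally have eq: "(map (\<lambda>u. e_int (block_end \<nu> (u - 1) + 1) (block_end \<nu> u)) [1..<nblocks \<nu> + 1] :: ('i, 'k) klr_free list)
      = map (\<lambda>s. belt xg \<tau>g (0 + length (bseq (take s ?bl))) [?bl ! s]) [0..<length ?bl]" .
  have "prod_list (map (\<lambda>u. e_int (block_end \<nu> (u - 1) + 1) (block_end \<nu> u)) [1..<nblocks \<nu> + 1] :: ('i, 'k) klr_free list)
      = belt xg \<tau>g 0 ?bl" by (rule trans[OF arg_cong[OF eq, of prod_list] belt_nth[symmetric]])
  then show ?thesis unfolding e_minus_def by (rule arg_cong)
qed

lemma e_minus_C: "\<nu> \<in> IS \<Longrightarrow> e_minus \<nu> \<in> C"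
proof -
  assume \<nu>: "\<nu> \<in> IS"
  have "bseq (map (\<lambda>(i, b). (i, b, 0)) (runs \<nu>)) = \<nu>"
    using concat_runs[of \<nu>] by (simp add: bseq_def comp_def case_prod_unfold)
  then show ?thesis unfolding e_minus_belt using runs_pos IS_len[OF \<nu>]
    by (intro C_mult C_belt C_eg \<nu>) auto
qed

lemma e_minus_elts_C: "e_minus_elts \<subseteq> C"
  using e_minus_C by (auto simp: e_minus_elts_def PD_def)

text \<open>For blocks that are whole runs with l = 0, the condition l + k \<le> \<ell> is piecewise
  dominance itself.\<close>

lemma e_minus_block_elts: "\<nu> \<in> PD \<Longrightarrow> e_minus \<nu> \<in> block_elts 0"
proof -
  assume \<nu>: "\<nu> \<in> PD"
  then have \<nu>I: "\<nu> \<in> IS" by (simp add: PD_def)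
  obtain gl where r: "runs \<nu> = map (\<lambda>g. (fst g, group_len g)) gl" and gl: "gl = map (\<lambda>(i, b). (i, [(b, 0)])) (runs \<nu>)"
    using trivial_groups by blast
  have fl: "ungroup gl = map (\<lambda>(i, b). (i, b, 0)) (runs \<nu>)"
    by (simp add: ungroup_def gl comp_def case_prod_unfold ungroup1_def concat_map_singleton)
  have bs: "bseq (ungroup gl) = \<nu>" by (rule bseq_ungroup_runs[OF r])
  have pos: "1 \<le> group_len g" if "g \<in> set gl" for g using that runs_pos by (auto simp: gl group_len_def)
  have "K.valid (bseq (ungroup (take s gl))) (ungroup1 (gl ! s))" if s: "s < length gl" for s
  proof -
    have g: "ungroup1 (gl ! s) = [(fst (gl ! s), group_len (gl ! s), 0)]" using s by (simp add: gl ungroup1_def group_len_def case_prod_unfold)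
    have "fst (gl ! s) \<in> set \<nu>"
      using split_block'[OF r s] pos[of "gl ! s"] s
      by (metis UnCI bseq_ungroup1 in_set_replicate not_one_le_zero nth_mem set_append)
    then have i: "fst (gl ! s) \<in> idx D" using IS_idx[OF \<nu>I] by blast
    show ?thesis unfolding g using PD_iff[OF r \<nu>I pos] \<nu> s i pos[of "gl ! s"] by simp
  qed
  then have "K.valid [] (ungroup gl)" by (simp add: K.valid_ungroup)
  moreover have "K.bdeg (ungroup gl) = 0" unfolding fl K.bdeg_def by (simp add: comp_def case_prod_unfold)
  ultimately show ?thesis unfolding e_minus_belt block_elts_def fl[symmetric] using bs \<nu>I by blast
qed

lemma bdeg_0: "K.valid \<theta> bl \<Longrightarrow> 0 \<le> K.bdeg bl \<and> (K.bdeg bl = 0 \<longrightarrow> (\<forall>(i, k, l)\<in>set bl. l = 0))"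
proof (induction \<theta> bl rule: K.valid.induct)
  case (2 \<theta> i k l bl)
  have g: "dg i i > 0" using 2 by (intro dg_pos) auto
  have IH: "0 \<le> K.bdeg bl" "K.bdeg bl = 0 \<longrightarrow> (\<forall>(i, k, l)\<in>set bl. l = 0)" using 2 by auto
  have b: "K.bdeg ((i, k, l) # bl) = of_nat l * dg i i + K.bdeg bl" by (simp add: K.bdeg_def)
  have "0 \<le> rat_of_nat l * dg i i" using g by simp
  moreover have "rat_of_nat l * dg i i = 0 \<longleftrightarrow> l = 0" using g by auto
  ultimately show ?case using IH b by (auto simp: add_nonneg_eq_0_iff)
qed (simp add: K.bdeg_def)

text \<open>In degree 0 no block carries a power, as (\<alpha>_i, \<alpha>_i) > 0. Merging the
  blocks of each run then gives a scalar multiple of \<open>e_minus\<close> modulo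
  commutators.\<close>

lemma block_elts_e_minus: "f \<in> block_elts 0 \<Longrightarrow> in_trace_span e_minus_elts f"
proof -
  assume f: "f \<in> block_elts 0"
  then obtain bl where bl: "f = belt xg \<tau>g 0 bl * eg (bseq bl)" "K.valid [] bl" "bseq bl \<in> IS"
    "K.bdeg bl = 0" by (auto simp: block_elts_def)
  obtain gl where gl: "ungroup gl = bl" "runs (bseq bl) = map (\<lambda>g. (fst g, group_len g)) gl"
    "\<And>g. g \<in> set gl \<Longrightarrow> snd g \<noteq> [] \<and> 1 \<le> group_len g" "bseq bl \<in> PD"
    "\<And>s. s < length gl \<Longrightarrow> K.valid (bseq (ungroup (take s gl))) (ungroup1 (gl ! s))"
    using valid_groups[OF bl(2,3)] by blast
  let ?\<nu> = "bseq bl"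
  have "\<exists>c. belt x t 0 ([] @ ungroup gl) * e ?\<nu> - sc c * (belt x t 0 ([] @ map K.merged gl) * e ?\<nu>) \<in> K.lsp K.CC"
  proof (rule K.merge_groups)
    show "i \<in> idx D \<and> 1 \<le> k" if "(i, k, l) \<in> set ([] @ ungroup gl)" for i k l
    proof -
      have m: "(i, k, l) \<in> set bl" using that gl(1) by simp
      have "1 \<le> k" by (rule K.valid_pos[OF bl(2) m])
      then show ?thesis using in_bseq[OF m] IS_idx[OF bl(3)] by blast
    qed
    show "l = 0" if "(i, k, l) \<in> set (ungroup gl)" for i k l using bdeg_0[OF bl(2)] bl(4) that gl(1) by auto
    show "snd g \<noteq> []" if "g \<in> set gl" for g using gl(3) that by blast
    show "?\<nu> = bseq [] @ bseq (ungroup gl)" using gl(1) by simp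
    show "length ?\<nu> = n" by (rule IS_len[OF bl(3)])
  qed
  then obtain c where c: "belt x t 0 (ungroup gl) * e ?\<nu> - sc c * (belt x t 0 (map K.merged gl) * e ?\<nu>) \<in> K.lsp K.CC" by auto
  have em: "(e_minus ?\<nu> :: ('i, 'k) klr_free) = belt xg \<tau>g 0 (map K.merged gl) * eg ?\<nu>"
    unfolding e_minus_belt gl(2) by (simp add: comp_def)
  have fC: "f \<in> C" using f block_elts_C by blast
  have eC: "e_minus ?\<nu> \<in> C" by (rule e_minus_C[OF bl(3)])
  have "act (f - scal c * e_minus ?\<nu>) \<in> K.lsp K.CC"
    using c by (simp add: act_diff FI.act_mult act_belt bl(1) em gl(1) flip: e_def sc_def)
  then have "act (f - scal c * e_minus ?\<nu>) \<in> K.lsp (K.CC \<union> act ` e_minus_elts)"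
    by (rule K.lsp_mono) (auto intro: K.lsp_base)
  then have "in_trace_span e_minus_elts (f - scal c * e_minus ?\<nu>)"
    by (intro in_trace_span_lsp e_minus_elts_C C_diff fC C_mult C_scal eC)
  moreover have "in_trace_span e_minus_elts (scal c * e_minus ?\<nu>)"
    using gl(4) by (intro in_trace_span_scal e_minus_elts_C in_trace_span_base) (auto simp: e_minus_elts_def)
  ultimately have "in_trace_span e_minus_elts (f - scal c * e_minus ?\<nu> + scal c * e_minus ?\<nu>)" by (rule in_trace_span_add[OF e_minus_elts_C])
  then show ?thesis by simp
qed

lemma Tr_top: "Tr_component D n \<alpha> \<Lambda> (d_top D \<Lambda> \<alpha>) = kspan (cocenter A) (q ` Z_elts)"
proof -
  have ZC: "Z_elts \<subseteq> C" using Z_C by (auto simp: Z_elts_def)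
  have "q ` kspan FA (block_elts (d_top D \<Lambda> \<alpha>)) = q ` kspan FA Z_elts"
    by (intro equalityI span_subset[OF ZC block_elts_Z] span_subset[OF block_elts_C]) (auto simp: Z_elts_def Z_elt_component)
  then show ?thesis using kspan_image(3)[OF ZC] Tr_component_block_elts by simp
qed

lemma Tr_zero: "Tr_component D n \<alpha> \<Lambda> 0 = kspan (cocenter A) (q ` e_minus_elts)"
proof -
  have "q ` kspan FA (block_elts 0) = q ` kspan FA e_minus_elts"
    by (intro equalityI span_subset[OF e_minus_elts_C block_elts_e_minus] span_subset[OF block_elts_C in_trace_span_base[OF block_elts_C]])
      (auto simp: e_minus_elts_def e_minus_block_elts)
  then show ?thesis using kspan_image(3)[OF e_minus_elts_C] Tr_component_block_elts by simp
qed

lemma Tr_carrier: "carrier (cocenter A) = kspan (cocenter A) (q ` R_elts)"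
proof -
  have BC: "(\<Union>r. block_elts r) \<subseteq> C" using block_elts_C by blast
  have "in_trace_span R_elts f" if "f \<in> C" for f
  proof -
    have "q ` kspan FA (\<Union>r. block_elts r) \<subseteq> q ` kspan FA R_elts" by (intro span_subset[OF R_elts_C]) (auto intro: block_elts_R)
    then show ?thesis using carrier_block_elts[OF that] by (auto simp: in_trace_span_def)
  qed
  then have "q ` C \<subseteq> q ` kspan FA R_elts" by (auto simp: in_trace_span_def)
  moreover have "q ` kspan FA R_elts \<subseteq> q ` C" using kspan_C[OF R_elts_C] by blast
  ultimately show ?thesis using kspan_image(3)[OF R_elts_C] q_carrier by simp
qed

end

theorem theorem1p2:
  fixes D :: "('i, 'p::ab_group_add, 'k::field) klr_datum"
    and n :: nat and \<alpha> \<Lambda> :: 'p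
  assumes "klr_datum D" and "\<Lambda> \<in> Pplus D" and "\<alpha> \<in> Qplus D n"
  defines "A \<equiv> cyc_klr D n \<alpha> \<Lambda>"
  defines "PD \<equiv> {\<nu> \<in> Iseq D n \<alpha>. piecewise_dominant D \<Lambda> \<nu>}"
  shows "Tr_component D n \<alpha> \<Lambda> (d_top D \<Lambda> \<alpha>) =
           kspan (cocenter A) {trace_class A (cyc_class D n \<alpha> \<Lambda> (Z_elt D \<Lambda> \<nu>)) | \<nu>. \<nu> \<in> PD} \<and>
         Tr_component D n \<alpha> \<Lambda> 0 =
           kspan (cocenter A) {trace_class A (cyc_class D n \<alpha> \<Lambda> (e_minus \<nu>)) | \<nu>. \<nu> \<in> PD} \<and>
         carrier (cocenter A) =
           kspan (cocenter A)
             {trace_class A (cyc_class D n \<alpha> \<Lambda> a) | a \<nu>. \<nu> \<in> PD \<and> a \<in> R_set D \<Lambda> \<nu>}"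
proof -
  interpret S: cyc_setup D n \<alpha> \<Lambda> by unfold_locales (fact assms(1,2))+
  have PD: "S.PD = PD" by (simp add: S.PD_def PD_def)
  have "{trace_class A (cyc_class D n \<alpha> \<Lambda> (Z_elt D \<Lambda> \<nu>)) | \<nu>. \<nu> \<in> PD} = S.q ` S.Z_elts"
    "{trace_class A (cyc_class D n \<alpha> \<Lambda> (e_minus \<nu>)) | \<nu>. \<nu> \<in> PD} = S.q ` S.e_minus_elts"
    "{trace_class A (cyc_class D n \<alpha> \<Lambda> a) | a \<nu>. \<nu> \<in> PD \<and> a \<in> R_set D \<Lambda> \<nu>} = S.q ` S.R_elts"
    by (auto simp: S.Z_elts_def S.e_minus_elts_def S.R_elts_def PD S.q_def A_def)
  then show ?thesis using S.Tr_top S.Tr_zero S.Tr_carrier by (simp add: A_def)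
qed

end
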